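(* Let $G$ be a tame $\ell_c$-group, $K\subset G$ a compact open subgroup, $\rho\in\widehat{K}$, and $A=\mathcal{H}(G,\rho)$. Let $\mathscr{V}(K,\rho)=\{\pi\in\widehat{G}\mid \operatorname{Hom}_K(\pi|_K,\rho)\neq 0\}$, with the subspace topology from the Fell topology on $\widehat{G}$, and let $\widehat{A}$ be the space of left primitive ideals of $A$ with the Jacobson topology. Then the bijection $\mathscr{V}(K,\rho)\to\widehat{A}$ induced by taking $\rho$-invariants, $\pi\mapsto\operatorname{Ann}_A(\operatorname{Hom}_K(\rho,\pi|_K))$, is a homeomorphism.
   Context: An $\ell$-group is a Hausdorff, locally compact, totally disconnected topological group. An $\ell_c$-group is an $\ell$-group which is a filtered union of its compact open subgroups (every element lies in a compact open subgroup, and any two compact open subgroups are contained in a third). A complex representation $(\pi,V)$ of an $\ell$-group $G$ is smooth if every vector of $V$ has open stabilizer in $G$; it is admissible if in addition $V^K$ is finite-dimensional for every compact open subgroup $K \subset G$. An $\ell$-group is tame if all its irreducible smooth representations are admissible. $\widehat{G}$ is the set of isomorphism classes of irreducible smooth representations of $G$ (similarly $\widehat{K}$). Fell topology on $\widehat{G}$: for a smooth representation $V$ let $V^{\vee}$ be its smooth dual (the vectors of the linear dual $V^*$ with open stabilizer). For $(\pi,V)\in\widehat{G}$, vectors $v_1,\dots,v_n\in V$, $\xi_1,\dots,\xi_n\in V^{\vee}$, a compact subset $B\subset G$ and $\epsilon>0$, let $\mathscr{U}(\pi,v_j,\xi_j,B,\epsilon)$ be the set of $(\sigma,X)\in\widehat{G}$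 for which there exist $w_1,\dots,w_n\in X$ and $\zeta_1,\dots,\zeta_n\in X^{\vee}$ with $|\langle \xi_j,\pi(g)v_j\rangle-\langle\zeta_j,\sigma(g)w_j\rangle|<\epsilon$ for all $1\le j\le n$ and $g\in B$. These sets form a basis of neighborhoods of $\pi$ in the Fell topology. Fix a Haar measure on $G$. For $(\rho,W)\in\widehat{K}$ (necessarily finite-dimensional), $\mathcal{H}(G,\rho)$ is the unital algebra, under convolution $(f_1*f_2)(x)=\int_G f_1(g)f_2(g^{-1}x)\,dg$, of compactly supported locally constant functions $f:G\to\operatorname{End}_{\mathbb{C}}(W^{\vee})$ satisfying $f(k_1gk_2)=\rho^{\vee}(k_1)\circ f(g)\circ\rho^{\vee}(k_2)$ for $k_1,k_2\in K$, $g\in G$. For a smooth representation $(\pi,M)$ of $G$, the space of $\rho$-invariants $\operatorname{Hom}_K(\rho,M|_K)$ is a left $\mathcal{H}(G,\rho)$-module via $(f\cdot\varphi)(w)=\int_G\pi(g)\,\varphi(f(g)^{\vee}w)\,dg$, where $f(g)^{\vee}\in\operatorname{End}_{\mathbb{C}}(W)$ is the transpose of $f(g)$. For a unital associative ring $A$, a left primitive ideal is the annihilator of a simple left $A$-module, and $\widehat{A}$ is the set of these. The Jacobson (hull-kernel) topology on $\widehat{A}$: the closure of $S\subset\widehat{A}$ is the set of primitive ideals containing $J_S=\bigcap_{I\in S}I$. *)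

theory Defs
  imports "HOL-Analysis.Analysis" "HOL-Algebra.Module" "HOL-Algebra.Coset"
    "HOL-Library.Function_Algebras"
begin

section \<open>Complex vector spaces\<close>

class complex_vector = real_vector +
  fixes scaleC :: "complex \<Rightarrow> 'a \<Rightarrow> 'a"  (infixr \<open>*\<^sub>C\<close> 75)
  assumes scaleC_add_right: "c *\<^sub>C (x + y) = c *\<^sub>C x + c *\<^sub>C y"
    and scaleC_add_left: "(c + d) *\<^sub>C x = c *\<^sub>C x + d *\<^sub>C x"
    and scaleC_scaleC: "c *\<^sub>C d *\<^sub>C x = (c * d) *\<^sub>C x"
    and scaleC_one: "1 *\<^sub>C x = x"
    and scaleR_scaleC: "r *\<^sub>R x = complex_of_real r *\<^sub>C x"

global_interpretation complex_vector:
  vector_space "scaleC :: complex \<Rightarrow> 'a \<Rightarrow> 'a::complex_vector"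
  defines csubspace = complex_vector.subspace
    and cspan = complex_vector.span
    and cdependent = complex_vector.dependent
    and crepresentation = complex_vector.representation
  by standard (simp_all add: scaleC_add_right scaleC_add_left scaleC_scaleC scaleC_one)

instantiation complex :: complex_vector
begin
definition "scaleC_complex = ((*) :: complex \<Rightarrow> complex \<Rightarrow> complex)"
instance
  by standard (simp_all add: scaleC_complex_def algebra_simps scaleR_conv_of_real)
end

instantiation "fun" :: (type, real_vector) real_vector
begin
definition "scaleR_fun r f = (\<lambda>x. r *\<^sub>R f x)"
instance
  by standard (simp_all add: scaleR_fun_def fun_eq_iff algebra_simps)
end

instantiation "fun" :: (type, complex_vector) complex_vector
begin
definition "scaleC_fun c f = (\<lambda>x. c *\<^sub>C f x)"
instance
  by standard
    (simp_all add: scaleC_fun_def scaleR_fun_def fun_eq_iff scaleC_add_right scaleC_add_left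
      scaleC_scaleC scaleC_one scaleR_scaleC)
end

text \<open>Linear maps between subspaces; they vanish outside the domain, so that two of them are equal
  iff they agree on \<open>V\<close>, and they form a subspace of the function type.\<close>

definition lin_maps :: "'v::complex_vector set \<Rightarrow> 'w::complex_vector set \<Rightarrow> ('v \<Rightarrow> 'w) set" where
  "lin_maps V W = {\<phi>. (\<forall>x\<in>V. \<phi> x \<in> W) \<and> (\<forall>x. x \<notin> V \<longrightarrow> \<phi> x = 0) \<and>
     (\<forall>x\<in>V. \<forall>y\<in>V. \<phi> (x + y) = \<phi> x + \<phi> y) \<and> (\<forall>c. \<forall>x\<in>V. \<phi> (c *\<^sub>C x) = c *\<^sub>C \<phi> x)}"

section \<open>Totally disconnected groups\<close>

definition topological_group :: "('g, 'b) monoid_scheme \<Rightarrow> 'g topology \<Rightarrow> bool" where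
  "topological_group G T \<longleftrightarrow> group G \<and> topspace T = carrier G \<and>
     continuous_map (prod_topology T T) T (\<lambda>(x, y). x \<otimes>\<^bsub>G\<^esub> y) \<and>
     continuous_map T T (\<lambda>x. inv\<^bsub>G\<^esub> x)"

definition l_group :: "('g, 'b) monoid_scheme \<Rightarrow> 'g topology \<Rightarrow> bool" where
  "l_group G T \<longleftrightarrow> topological_group G T \<and> Hausdorff_space T \<and> locally_compact_space T \<and>
     (\<forall>S. connectedin T S \<longrightarrow> (\<exists>x. S \<subseteq> {x}))"

definition compact_open_subgroup :: "('g, 'b) monoid_scheme \<Rightarrow> 'g topology \<Rightarrow> 'g set \<Rightarrow> bool" where
  "compact_open_subgroup G T K \<longleftrightarrow> subgroup K G \<and> compactin T K \<and> openin T K"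

definition lc_group :: "('g, 'b) monoid_scheme \<Rightarrow> 'g topology \<Rightarrow> bool" where
  "lc_group G T \<longleftrightarrow> l_group G T \<and>
     (\<forall>x\<in>carrier G. \<exists>K. compact_open_subgroup G T K \<and> x \<in> K) \<and>
     (\<forall>K1 K2. compact_open_subgroup G T K1 \<and> compact_open_subgroup G T K2 \<longrightarrow>
        (\<exists>K3. compact_open_subgroup G T K3 \<and> K1 \<subseteq> K3 \<and> K2 \<subseteq> K3))"

section \<open>Smooth representations\<close>

text \<open>The representation space is a complex subspace of the ambient type \<open>'v\<close>; only the action of
  elements of the group on that subspace is meaningful.\<close>

record ('g, 'v) rep = "'v partial_object" +
  act :: "'g \<Rightarrow> 'v \<Rightarrow> 'v"

definition representation ::
    "('g, 'b) monoid_scheme \<Rightarrow> ('g, 'v::complex_vector) rep \<Rightarrow> bool" where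
  "representation G \<pi> \<longleftrightarrow> csubspace (carrier \<pi>) \<and>
     (\<forall>g\<in>carrier G. \<forall>x\<in>carrier \<pi>. act \<pi> g x \<in> carrier \<pi>) \<and>
     (\<forall>g\<in>carrier G. \<forall>x\<in>carrier \<pi>. \<forall>y\<in>carrier \<pi>. act \<pi> g (x + y) = act \<pi> g x + act \<pi> g y) \<and>
     (\<forall>g\<in>carrier G. \<forall>c. \<forall>x\<in>carrier \<pi>. act \<pi> g (c *\<^sub>C x) = c *\<^sub>C act \<pi> g x) \<and>
     (\<forall>x\<in>carrier \<pi>. act \<pi> \<one>\<^bsub>G\<^esub> x = x) \<and>
     (\<forall>g\<in>carrier G. \<forall>h\<in>carrier G. \<forall>x\<in>carrier \<pi>. act \<pi> (g \<otimes>\<^bsub>G\<^esub> h) x = act \<pi> g (act \<pi> h x))"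

definition stabilizer ::
    "('g, 'b) monoid_scheme \<Rightarrow> ('g, 'v) rep \<Rightarrow> 'v \<Rightarrow> 'g set" where
  "stabilizer G \<pi> v = {g \<in> carrier G. act \<pi> g v = v}"

definition smooth_rep ::
    "('g, 'b) monoid_scheme \<Rightarrow> 'g topology \<Rightarrow> ('g, 'v::complex_vector) rep \<Rightarrow> bool" where
  "smooth_rep G T \<pi> \<longleftrightarrow> representation G \<pi> \<and> (\<forall>v\<in>carrier \<pi>. openin T (stabilizer G \<pi> v))"

definition invariant_vectors :: "'g set \<Rightarrow> ('g, 'v) rep \<Rightarrow> 'v set" where
  "invariant_vectors K \<pi> = {v \<in> carrier \<pi>. \<forall>k\<in>K. act \<pi> k v = v}"

definition admissible_rep ::
    "('g, 'b) monoid_scheme \<Rightarrow> 'g topology \<Rightarrow> ('g, 'v::complex_vector) rep \<Rightarrow> bool" where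
  "admissible_rep G T \<pi> \<longleftrightarrow> smooth_rep G T \<pi> \<and>
     (\<forall>K. compact_open_subgroup G T K \<longrightarrow> (\<exists>B. finite B \<and> invariant_vectors K \<pi> \<subseteq> cspan B))"

definition irreducible_rep ::
    "('g, 'b) monoid_scheme \<Rightarrow> ('g, 'v::complex_vector) rep \<Rightarrow> bool" where
  "irreducible_rep G \<pi> \<longleftrightarrow> representation G \<pi> \<and> carrier \<pi> \<noteq> {0} \<and>
     (\<forall>U. csubspace U \<and> U \<subseteq> carrier \<pi> \<and> (\<forall>g\<in>carrier G. \<forall>x\<in>U. act \<pi> g x \<in> U) \<longrightarrow>
        U = {0} \<or> U = carrier \<pi>)"

definition smooth_irrep ::
    "('g, 'b) monoid_scheme \<Rightarrow> 'g topology \<Rightarrow> ('g, 'v::complex_vector) rep \<Rightarrow> bool" where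
  "smooth_irrep G T \<pi> \<longleftrightarrow> smooth_rep G T \<pi> \<and> irreducible_rep G \<pi>"

definition intertwiners ::
    "('g, 'b) monoid_scheme \<Rightarrow> ('g, 'v::complex_vector) rep \<Rightarrow> ('g, 'w::complex_vector) rep \<Rightarrow>
     ('v \<Rightarrow> 'w) set" where
  "intertwiners G \<pi> \<sigma> = {\<phi> \<in> lin_maps (carrier \<pi>) (carrier \<sigma>).
     \<forall>g\<in>carrier G. \<forall>x\<in>carrier \<pi>. \<phi> (act \<pi> g x) = act \<sigma> g (\<phi> x)}"

definition rep_iso ::
    "('g, 'b) monoid_scheme \<Rightarrow> ('g, 'v::complex_vector) rep \<Rightarrow> ('g, 'w::complex_vector) rep \<Rightarrow>
     bool" where
  "rep_iso G \<pi> \<sigma> \<longleftrightarrow> (\<exists>\<phi>\<in>intertwiners G \<pi> \<sigma>. bij_betw \<phi> (carrier \<pi>) (carrier \<sigma>))"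

text \<open>The linear dual with \<open>\<langle>g\<xi>, v\<rangle> = \<langle>\<xi>, g\<^sup>-\<^sup>1v\<rangle>\<close>, and the smooth dual inside it.\<close>

definition dual_rep ::
    "('g, 'b) monoid_scheme \<Rightarrow> ('g, 'v::complex_vector) rep \<Rightarrow> ('g, 'v \<Rightarrow> complex) rep" where
  "dual_rep G \<pi> = \<lparr>carrier = lin_maps (carrier \<pi>) UNIV,
     act = (\<lambda>g \<xi> v. if v \<in> carrier \<pi> then \<xi> (act \<pi> (inv\<^bsub>G\<^esub> g) v) else 0)\<rparr>"

definition smooth_dual ::
    "('g, 'b) monoid_scheme \<Rightarrow> 'g topology \<Rightarrow> ('g, 'v::complex_vector) rep \<Rightarrow>
     ('g, 'v \<Rightarrow> complex) rep" where
  "smooth_dual G T \<pi> = \<lparr>carrier =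
      {\<xi> \<in> carrier (dual_rep G \<pi>). openin T (stabilizer G (dual_rep G \<pi>) \<xi>)},
     act = act (dual_rep G \<pi>)\<rparr>"

section \<open>The set of irreducible smooth representations and the Fell topology\<close>

text \<open>An irreducible smooth representation is spanned by one orbit, so its dimension is at most the
  cardinality of the group. It therefore has an isomorphic copy on a subspace of
  \<open>'g \<Rightarrow> complex\<close> (lemma \<open>smooth_irrep_universe\<close> below), and isomorphism classes can be taken
  there without losing any.\<close>

definition irreps ::
    "('g, 'b) monoid_scheme \<Rightarrow> 'g topology \<Rightarrow> ('g, 'g \<Rightarrow> complex) rep set" where
  "irreps G T = {\<pi>. smooth_irrep G T \<pi>}"

definition irrep_classes ::
    "('g, 'b) monoid_scheme \<Rightarrow> 'g topology \<Rightarrow> ('g, 'g \<Rightarrow> complex) rep set set" where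
  "irrep_classes G T = irreps G T // {(\<pi>, \<sigma>) \<in> irreps G T \<times> irreps G T. rep_iso G \<pi> \<sigma>}"

definition tame :: "('g, 'b) monoid_scheme \<Rightarrow> 'g topology \<Rightarrow> bool" where
  "tame G T \<longleftrightarrow> (\<forall>\<pi>\<in>irreps G T. admissible_rep G T \<pi>)"

lemma rep_iso_trans:
  assumes "rep_iso G \<pi> \<sigma>" "rep_iso G \<sigma> \<tau>"
    and "representation G \<pi>"
  shows "rep_iso G \<pi> \<tau>"
proof -
  obtain \<phi> where f: "\<phi> \<in> intertwiners G \<pi> \<sigma>" "bij_betw \<phi> (carrier \<pi>) (carrier \<sigma>)"
    using assms(1) by (auto simp: rep_iso_def)
  obtain \<psi> where p: "\<psi> \<in> intertwiners G \<sigma> \<tau>" "bij_betw \<psi> (carrier \<sigma>) (carrier \<tau>)"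
    using assms(2) by (auto simp: rep_iso_def)
  define \<omega> where "\<omega> = (\<lambda>x. if x \<in> carrier \<pi> then \<psi> (\<phi> x) else 0)"
  have "bij_betw \<omega> (carrier \<pi>) (carrier \<tau>)"
    using bij_betw_trans[OF f(2) p(2)] by (rule bij_betw_cong[THEN iffD1, rotated]) (simp add: \<omega>_def)
  moreover have "csubspace (carrier \<pi>)" using assms(3) by (simp add: representation_def)
  then have "\<omega> \<in> intertwiners G \<pi> \<tau>"
    using f(1) p(1) assms(3) unfolding intertwiners_def lin_maps_def \<omega>_def representation_def
    by (auto simp: complex_vector.subspace_add complex_vector.subspace_scale)
  ultimately show ?thesis by (auto simp: rep_iso_def)
qed

lemma rep_iso_refl:
  assumes "representation G \<pi>"
  shows "rep_iso G \<pi> \<pi>"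
proof -
  have "(\<lambda>x. if x \<in> carrier \<pi> then x else 0) \<in> intertwiners G \<pi> \<pi>"
    using assms unfolding intertwiners_def lin_maps_def representation_def
    by (auto simp: complex_vector.subspace_add complex_vector.subspace_scale)
  moreover have "bij_betw (\<lambda>x. if x \<in> carrier \<pi> then x else 0) (carrier \<pi>) (carrier \<pi>)"
    by (auto simp: bij_betw_def inj_on_def)
  ultimately show ?thesis by (auto simp: rep_iso_def)
qed

lemma rep_iso_sym:
  assumes "rep_iso G \<pi> \<sigma>" "representation G \<pi>" "representation G \<sigma>"
  shows "rep_iso G \<sigma> \<pi>"
proof -
  obtain \<phi> where f: "\<phi> \<in> intertwiners G \<pi> \<sigma>" and b: "bij_betw \<phi> (carrier \<pi>) (carrier \<sigma>)"
    using assms(1) by (auto simp: rep_iso_def)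
  define \<psi> where "\<psi> = (\<lambda>y. if y \<in> carrier \<sigma> then inv_into (carrier \<pi>) \<phi> y else 0)"
  have bp: "bij_betw \<psi> (carrier \<sigma>) (carrier \<pi>)"
    using bij_betw_inv_into[OF b] by (rule bij_betw_cong[THEN iffD1, rotated]) (simp add: \<psi>_def)
  have in1: "\<psi> y \<in> carrier \<pi>" and in2: "\<phi> (\<psi> y) = y" if "y \<in> carrier \<sigma>" for y
    using that b bp by (auto simp: \<psi>_def bij_betw_def f_inv_into_f)
  have eq: "\<psi> y = x" if "x \<in> carrier \<pi>" "y \<in> carrier \<sigma>" "\<phi> x = y" for x y
    using that b by (auto simp: \<psi>_def bij_betw_def)
  have z: "\<psi> y = 0" if "y \<notin> carrier \<sigma>" for y using that by (simp add: \<psi>_def)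
  have s: "csubspace (carrier \<pi>)" "csubspace (carrier \<sigma>)"
    using assms(2,3) by (auto simp: representation_def)
  have "\<psi> (x + y) = \<psi> x + \<psi> y" if "x \<in> carrier \<sigma>" "y \<in> carrier \<sigma>" for x y
    using f s that
    by (intro eq) (simp_all add: in1 in2 intertwiners_def lin_maps_def complex_vector.subspace_add)
  moreover have "\<psi> (c *\<^sub>C x) = c *\<^sub>C \<psi> x" if "x \<in> carrier \<sigma>" for c x
    using f s that
    by (intro eq) (simp_all add: in1 in2 intertwiners_def lin_maps_def complex_vector.subspace_scale)
  moreover have "\<psi> (act \<sigma> g x) = act \<pi> g (\<psi> x)" if "g \<in> carrier G" "x \<in> carrier \<sigma>" for g x
    using f assms(2,3) that
    by (intro eq) (simp_all add: in1 in2 intertwiners_def representation_def)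
  ultimately have "\<psi> \<in> intertwiners G \<sigma> \<pi>"
    using in1 z by (simp add: intertwiners_def lin_maps_def)
  with bp show ?thesis by (auto simp: rep_iso_def)
qed

lemma equiv_rep_iso: "equiv (irreps G T) {(\<pi>, \<sigma>) \<in> irreps G T \<times> irreps G T. rep_iso G \<pi> \<sigma>}"
proof -
  have "representation G \<pi>" if "\<pi> \<in> irreps G T" for \<pi>
    using that by (simp add: irreps_def smooth_irrep_def smooth_rep_def)
  then show ?thesis
    by (intro equivI refl_onI symI transI) (auto intro: rep_iso_refl rep_iso_sym rep_iso_trans)
qed

lemma rep_transport:
  fixes \<pi> :: "('g, 'v::complex_vector) rep" and \<Phi> :: "'v \<Rightarrow> 'w::complex_vector"
  assumes irr: "smooth_irrep G T \<pi>"
    and lin: "\<Phi> \<in> lin_maps (carrier \<pi>) UNIV" and inj: "inj_on \<Phi> (carrier \<pi>)"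
  shows "\<exists>\<sigma> :: ('g, 'w) rep. smooth_irrep G T \<sigma> \<and> rep_iso G \<pi> \<sigma>"
proof -
  let ?V = "carrier \<pi>"
  let ?inv = "inv_into ?V \<Phi>"
  define \<sigma> :: "('g, 'w) rep" where
    "\<sigma> = \<lparr>carrier = \<Phi> ` ?V, act = (\<lambda>g y. \<Phi> (act \<pi> g (?inv y)))\<rparr>"
  have rep: "representation G \<pi>" and sm: "\<forall>v\<in>?V. openin T (stabilizer G \<pi> v)"
    and ne: "?V \<noteq> {0}"
    and irr_sub: "\<And>U. \<lbrakk>csubspace U; U \<subseteq> ?V; \<forall>g\<in>carrier G. \<forall>x\<in>U. act \<pi> g x \<in> U\<rbrakk> \<Longrightarrow> U = {0} \<or> U = ?V"
    using irr by (auto simp: smooth_irrep_def smooth_rep_def irreducible_rep_def)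
  have s: "csubspace ?V" and cl: "\<And>g x. g \<in> carrier G \<Longrightarrow> x \<in> ?V \<Longrightarrow> act \<pi> g x \<in> ?V"
    using rep by (auto simp: representation_def)
  have add: "\<Phi> (x + y) = \<Phi> x + \<Phi> y" if "x \<in> ?V" "y \<in> ?V" for x y
    using lin that by (simp add: lin_maps_def)
  have scale: "\<Phi> (c *\<^sub>C x) = c *\<^sub>C \<Phi> x" if "x \<in> ?V" for c x
    using lin that by (simp add: lin_maps_def)
  have z0: "0 \<in> ?V" using s by (rule complex_vector.subspace_0)
  have zero: "\<Phi> 0 = 0" using scale[OF z0, of 0] by simp
  have i: "?inv (\<Phi> x) = x" if "x \<in> ?V" for x using inj that by simp
  have cs: "carrier \<sigma> = \<Phi> ` ?V" by (simp add: \<sigma>_def)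
  have act: "act \<sigma> g (\<Phi> x) = \<Phi> (act \<pi> g x)" if "x \<in> ?V" for g x
    using that by (simp add: \<sigma>_def i)
  have sub: "csubspace (\<Phi> ` ?V)"
    unfolding complex_vector.subspace_def
  proof (intro conjI ballI allI)
    show "0 \<in> \<Phi> ` ?V" using z0 zero by (metis imageI)
    show "x + y \<in> \<Phi> ` ?V" if "x \<in> \<Phi> ` ?V" "y \<in> \<Phi> ` ?V" for x y
      using that add complex_vector.subspace_add[OF s] by (metis (no_types, lifting) imageE imageI)
    show "c *\<^sub>C x \<in> \<Phi> ` ?V" if "x \<in> \<Phi> ` ?V" for x c
      using that scale complex_vector.subspace_scale[OF s] by (metis (no_types, lifting) imageE imageI)
  qed
  have r1: "act \<sigma> g (x + y) = act \<sigma> g x + act \<sigma> g y"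
    if g: "g \<in> carrier G" and xy: "x \<in> \<Phi> ` ?V" "y \<in> \<Phi> ` ?V" for g x y
  proof -
    obtain a b where ab: "a \<in> ?V" "b \<in> ?V" "x = \<Phi> a" "y = \<Phi> b" using xy by blast
    have "act \<sigma> g (x + y) = \<Phi> (act \<pi> g (a + b))"
      using ab by (simp add: add[symmetric] act complex_vector.subspace_add[OF s])
    also have "\<dots> = \<Phi> (act \<pi> g a + act \<pi> g b)" using rep g ab by (simp add: representation_def)
    finally show ?thesis using ab g by (simp add: add act cl)
  qed
  have r2: "act \<sigma> g (c *\<^sub>C x) = c *\<^sub>C act \<sigma> g x"
    if g: "g \<in> carrier G" and xy: "x \<in> \<Phi> ` ?V" for g c x
  proof -
    obtain a where ab: "a \<in> ?V" "x = \<Phi> a" using xy by blast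
    have "act \<sigma> g (c *\<^sub>C x) = \<Phi> (act \<pi> g (c *\<^sub>C a))"
      using ab by (simp add: scale[symmetric] act complex_vector.subspace_scale[OF s])
    also have "\<dots> = \<Phi> (c *\<^sub>C act \<pi> g a)" using rep g ab by (simp add: representation_def)
    finally show ?thesis using ab g by (simp add: scale act cl)
  qed
  have reps: "representation G \<sigma>"
    unfolding representation_def cs
    using sub r1 r2 rep by (auto simp: act cl representation_def)
  have stab: "stabilizer G \<sigma> (\<Phi> v) = stabilizer G \<pi> v" if "v \<in> ?V" for v
    using that inj by (auto simp: stabilizer_def act cl inj_on_eq_iff)
  have smooth: "smooth_rep G T \<sigma>"
    using reps sm stab by (auto simp: smooth_rep_def cs)
  have "carrier \<sigma> \<noteq> {0}"
  proof
    assume "carrier \<sigma> = {0}"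
    then have "\<Phi> x = \<Phi> 0" if "x \<in> ?V" for x using that zero by (auto simp: cs)
    then have "x = 0" if "x \<in> ?V" for x using inj_onD[OF inj _ that z0] that by blast
    then have "?V = {0}" using z0 by blast
    with ne show False ..
  qed
  moreover have "U = {0} \<or> U = carrier \<sigma>"
    if U: "csubspace U" "U \<subseteq> carrier \<sigma>" "\<forall>g\<in>carrier G. \<forall>x\<in>U. act \<sigma> g x \<in> U" for U
  proof -
    let ?U = "{x \<in> ?V. \<Phi> x \<in> U}"
    have img: "U = \<Phi> ` ?U" using U(2) by (auto simp: cs)
    have "csubspace ?U"
      unfolding complex_vector.subspace_def
      using s U(1) by (auto simp: zero add scale complex_vector.subspace_0 complex_vector.subspace_add
          complex_vector.subspace_scale)
    moreover have "\<forall>g\<in>carrier G. \<forall>x\<in>?U. act \<pi> g x \<in> ?U"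
      using U(3) by (auto simp: cl act[symmetric])
    ultimately have "?U = {0} \<or> ?U = ?V" by (intro irr_sub) auto
    moreover have "U = \<Phi> ` {0}" if "?U = {0}" using img unfolding that .
    moreover have "U = \<Phi> ` ?V" if "?U = ?V" using img unfolding that .
    ultimately show ?thesis unfolding cs by (auto simp only: zero image_insert image_empty)
  qed
  ultimately have "smooth_irrep G T \<sigma>"
    using reps smooth by (auto simp: smooth_irrep_def irreducible_rep_def)
  moreover have "\<Phi> \<in> intertwiners G \<pi> \<sigma>"
    using lin by (auto simp: intertwiners_def lin_maps_def act cs)
  then have "rep_iso G \<pi> \<sigma>"
    using inj by (auto simp: rep_iso_def bij_betw_def cs)
  ultimately show ?thesis by blast
qed

lemma smooth_irrep_universe:
  fixes \<pi> :: "('g, 'v::complex_vector) rep"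
  assumes G: "group G" and irr: "smooth_irrep G T \<pi>"
  shows "\<exists>\<sigma>\<in>irreps G T. rep_iso G \<pi> \<sigma>"
proof -
  let ?V = "carrier \<pi>"
  have rep: "representation G \<pi>" and ne: "?V \<noteq> {0}"
    and irr_sub: "\<And>U. \<lbrakk>csubspace U; U \<subseteq> ?V; \<forall>g\<in>carrier G. \<forall>x\<in>U. act \<pi> g x \<in> U\<rbrakk> \<Longrightarrow> U = {0} \<or> U = ?V"
    using irr by (auto simp: smooth_irrep_def smooth_rep_def irreducible_rep_def)
  have s: "csubspace ?V" and cl: "\<And>g x. g \<in> carrier G \<Longrightarrow> x \<in> ?V \<Longrightarrow> act \<pi> g x \<in> ?V"
    using rep by (auto simp: representation_def)
  have radd: "act \<pi> g (x + y) = act \<pi> g x + act \<pi> g y" if "g \<in> carrier G" "x \<in> ?V" "y \<in> ?V" for g x y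
    using rep that by (simp add: representation_def)
  have rscale: "act \<pi> g (c *\<^sub>C x) = c *\<^sub>C act \<pi> g x" if "g \<in> carrier G" "x \<in> ?V" for g x c
    using rep that by (simp add: representation_def)
  have rzero: "act \<pi> g 0 = 0" if "g \<in> carrier G" for g
    using rscale[OF that complex_vector.subspace_0[OF s], of 0] by simp
  obtain v where v: "v \<in> ?V" "v \<noteq> 0" using ne complex_vector.subspace_0[OF s] by auto
  define O' where "O' = (\<lambda>g. act \<pi> g v) ` carrier G"
  have OV: "O' \<subseteq> ?V" using v cl by (auto simp: O'_def)
  then have spV: "cspan O' \<subseteq> ?V" using s by (rule complex_vector.span_minimal)
  have st: "x \<in> ?V \<and> act \<pi> g x \<in> cspan O'"
    if g: "g \<in> carrier G" and x: "x \<in> cspan O'" for g x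
    using x
  proof (induction rule: complex_vector.span_induct_alt)
    case base
    then show ?case using g by (simp add: rzero complex_vector.span_zero complex_vector.subspace_0[OF s])
  next
    case (step c y z)
    obtain h where h: "h \<in> carrier G" "y = act \<pi> h v" using step by (auto simp: O'_def)
    have "act \<pi> g y = act \<pi> (g \<otimes>\<^bsub>G\<^esub> h) v"
      using rep g h v by (simp add: representation_def)
    then have gy: "act \<pi> g y \<in> O'"
      using g h group.is_monoid[OF G] by (auto simp: O'_def monoid.m_closed)
    have yz: "y \<in> ?V" "z \<in> ?V" using step OV by auto
    then have "act \<pi> g (c *\<^sub>C y + z) = c *\<^sub>C act \<pi> g y + act \<pi> g z"
      using g by (simp add: radd rscale complex_vector.subspace_scale[OF s])
    then show ?case
      using gy step yz by (simp add: complex_vector.subspace_add[OF s] complex_vector.subspace_scale[OF s]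
          complex_vector.span_add complex_vector.span_scale complex_vector.span_base)
  qed
  have "v \<in> O'"
    using rep v group.is_monoid[OF G] unfolding O'_def representation_def
    by (metis (no_types, lifting) image_eqI monoid.one_closed)
  then have "cspan O' \<noteq> {0}" using v complex_vector.span_base by blast
  then have spO: "cspan O' = ?V"
    using irr_sub[of "cspan O'"] spV st complex_vector.subspace_span by blast
  obtain B where B: "B \<subseteq> O'" "\<not> cdependent B" "O' \<subseteq> cspan B"
    using complex_vector.maximal_independent_subset[of O'] by blast
  have spB: "cspan B = ?V"
    using B spO by (metis complex_vector.span_minimal complex_vector.span_mono
        complex_vector.subspace_span subset_antisym)
  define \<Phi> where "\<Phi> = (\<lambda>x h. crepresentation B x (act \<pi> h v))"
  have "\<Phi> \<in> lin_maps ?V UNIV"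
    unfolding lin_maps_def \<Phi>_def fun_eq_iff
    using B(2) spB complex_vector.representation_add[OF B(2)] complex_vector.representation_scale[OF B(2)]
    by (auto simp: complex_vector.representation_def scaleC_fun_def scaleC_complex_def)
  moreover have "inj_on \<Phi> ?V"
  proof (rule inj_onI)
    fix x y assume xy: "x \<in> ?V" "y \<in> ?V" and eq: "\<Phi> x = \<Phi> y"
    have "crepresentation B x b = crepresentation B y b" for b
    proof (cases "b \<in> B")
      case True
      then obtain h where "b = act \<pi> h v" using B(1) by (auto simp: O'_def)
      then show ?thesis using fun_cong[OF eq, of h] by (simp add: \<Phi>_def)
    next
      case False
      then show ?thesis using complex_vector.representation_ne_zero by metis
    qed
    then have "crepresentation B x = crepresentation B y" by auto
    then show "x = y"
      using complex_vector.sum_nonzero_representation_eq[OF B(2)] xy spB by metis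
  qed
  ultimately show ?thesis
    using rep_transport[OF irr] unfolding irreps_def by blast
qed

definition fell_nbhd ::
    "('g, 'b) monoid_scheme \<Rightarrow> 'g topology \<Rightarrow> ('g, 'g \<Rightarrow> complex) rep \<Rightarrow> nat \<Rightarrow>
     (nat \<Rightarrow> 'g \<Rightarrow> complex) \<Rightarrow> (nat \<Rightarrow> ('g \<Rightarrow> complex) \<Rightarrow> complex) \<Rightarrow> 'g set \<Rightarrow> real \<Rightarrow>
     ('g, 'g \<Rightarrow> complex) rep set set" where
  "fell_nbhd G T \<pi> n v \<xi> B \<epsilon> = {C \<in> irrep_classes G T. \<exists>\<sigma>\<in>C. \<exists>w \<zeta>.
     (\<forall>j<n. w j \<in> carrier \<sigma> \<and> \<zeta> j \<in> carrier (smooth_dual G T \<sigma>)) \<and>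
     (\<forall>j<n. \<forall>g\<in>B. cmod (\<xi> j (act \<pi> g (v j)) - \<zeta> j (act \<sigma> g (w j))) < \<epsilon>)}"

definition fell_open ::
    "('g, 'b) monoid_scheme \<Rightarrow> 'g topology \<Rightarrow> ('g, 'g \<Rightarrow> complex) rep set set \<Rightarrow> bool" where
  "fell_open G T U \<longleftrightarrow> U \<subseteq> irrep_classes G T \<and>
     (\<forall>C\<in>U. \<forall>\<pi>\<in>C. \<exists>n v \<xi> B \<epsilon>.
        (\<forall>j<n. v j \<in> carrier \<pi> \<and> \<xi> j \<in> carrier (smooth_dual G T \<pi>)) \<and>
        compactin T B \<and> \<epsilon> > 0 \<and> fell_nbhd G T \<pi> n v \<xi> B \<epsilon> \<subseteq> U)"

definition fell_topology ::
    "('g, 'b) monoid_scheme \<Rightarrow> 'g topology \<Rightarrow> ('g, 'g \<Rightarrow> complex) rep set topology" where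
  "fell_topology G T = topology (fell_open G T)"

lemma fell_openE:
  assumes "fell_open G T U" "C \<in> U" "\<pi> \<in> C"
  obtains n v \<xi> B \<epsilon>
  where "\<forall>j<n. v j \<in> carrier \<pi> \<and> \<xi> j \<in> carrier (smooth_dual G T \<pi>)"
    "compactin T B" "\<epsilon> > 0" "fell_nbhd G T \<pi> n v \<xi> B \<epsilon> \<subseteq> U"
proof -
  have "\<exists>n v \<xi> B \<epsilon>. (\<forall>j<n. v j \<in> carrier \<pi> \<and> \<xi> j \<in> carrier (smooth_dual G T \<pi>)) \<and>
      compactin T B \<and> \<epsilon> > 0 \<and> fell_nbhd G T \<pi> n v \<xi> B \<epsilon> \<subseteq> U"
    using assms(1) unfolding fell_open_def 
    by (elim conjE) (drule bspec[OF _ assms(2)], drule bspec[OF _ assms(3)], assumption)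
  then show ?thesis by (elim exE conjE) (rule that)
qed

lemma istopology_fell: "istopology (fell_open G T)"
  unfolding istopology_def
proof (intro conjI allI impI)
  fix U U' assume U: "fell_open G T U" and U': "fell_open G T U'"
  show "fell_open G T (U \<inter> U')"
    unfolding fell_open_def
  proof (intro conjI ballI)
    show "U \<inter> U' \<subseteq> irrep_classes G T" using U by (auto simp: fell_open_def)
    fix C \<pi> assume C: "C \<in> U \<inter> U'" and \<pi>: "\<pi> \<in> C"
    obtain n1 v1 \<xi>1 B1 e1 where 1: "\<forall>j<n1. v1 j \<in> carrier \<pi> \<and> \<xi>1 j \<in> carrier (smooth_dual G T \<pi>)"
        "compactin T B1" "e1 > 0" "fell_nbhd G T \<pi> n1 v1 \<xi>1 B1 e1 \<subseteq> U"
      using fell_openE[OF U IntD1[OF C] \<pi>] by metis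
    obtain n2 v2 \<xi>2 B2 e2 where 2: "\<forall>j<n2. v2 j \<in> carrier \<pi> \<and> \<xi>2 j \<in> carrier (smooth_dual G T \<pi>)"
        "compactin T B2" "e2 > 0" "fell_nbhd G T \<pi> n2 v2 \<xi>2 B2 e2 \<subseteq> U'"
      using fell_openE[OF U' IntD2[OF C] \<pi>] by metis
    let ?v = "\<lambda>j. if j < n1 then v1 j else v2 (j - n1)"
    let ?\<xi> = "\<lambda>j. if j < n1 then \<xi>1 j else \<xi>2 (j - n1)"
    let ?N = "fell_nbhd G T \<pi> (n1 + n2) ?v ?\<xi> (B1 \<union> B2) (min e1 e2)"
    have "?N \<subseteq> fell_nbhd G T \<pi> n1 v1 \<xi>1 B1 e1 \<inter> fell_nbhd G T \<pi> n2 v2 \<xi>2 B2 e2"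
    proof
      fix D assume "D \<in> ?N"
      then obtain \<sigma> w \<zeta> where D: "D \<in> irrep_classes G T" "\<sigma> \<in> D"
        and wz: "\<And>j. j < n1 + n2 \<Longrightarrow> w j \<in> carrier \<sigma> \<and> \<zeta> j \<in> carrier (smooth_dual G T \<sigma>)"
        and e: "\<And>j g. j < n1 + n2 \<Longrightarrow> g \<in> B1 \<union> B2 \<Longrightarrow>
          cmod (?\<xi> j (act \<pi> g (?v j)) - \<zeta> j (act \<sigma> g (w j))) < min e1 e2"
        unfolding fell_nbhd_def by blast
      have b1: "cmod (\<xi>1 j (act \<pi> g (v1 j)) - \<zeta> j (act \<sigma> g (w j))) < e1" if "j < n1" "g \<in> B1" for j g
        using e[of j g] that by simp
      have b2: "cmod (\<xi>2 j (act \<pi> g (v2 j)) - \<zeta> (n1 + j) (act \<sigma> g (w (n1 + j)))) < e2"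
        if "j < n2" "g \<in> B2" for j g
        using e[of "n1 + j" g] that by simp
      have "D \<in> fell_nbhd G T \<pi> n1 v1 \<xi>1 B1 e1" "D \<in> fell_nbhd G T \<pi> n2 v2 \<xi>2 B2 e2"
        unfolding fell_nbhd_def mem_Collect_eq
        subgoal using D wz b1 b2 by (intro conjI bexI[of _ \<sigma>] exI[of _ w] exI[of _ \<zeta>]) simp_all
        subgoal using D wz b1 b2 by (intro conjI bexI[of _ \<sigma>] exI[of _ "\<lambda>j. w (n1 + j)"]
              exI[of _ "\<lambda>j. \<zeta> (n1 + j)"]) simp_all
        done
      then show "D \<in> fell_nbhd G T \<pi> n1 v1 \<xi>1 B1 e1 \<inter> fell_nbhd G T \<pi> n2 v2 \<xi>2 B2 e2"
        by simp
    qed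
    then have "?N \<subseteq> U \<inter> U'" using 1(4) 2(4) by blast
    moreover have "\<forall>j<n1 + n2. ?v j \<in> carrier \<pi> \<and> ?\<xi> j \<in> carrier (smooth_dual G T \<pi>)"
      using 1(1) 2(1) by simp
    moreover have "compactin T (B1 \<union> B2)" "min e1 e2 > 0"
      using 1 2 by (auto intro: compactin_Un)
    ultimately show "\<exists>n v \<xi> B \<epsilon>.
        (\<forall>j<n. v j \<in> carrier \<pi> \<and> \<xi> j \<in> carrier (smooth_dual G T \<pi>)) \<and>
        compactin T B \<and> \<epsilon> > 0 \<and> fell_nbhd G T \<pi> n v \<xi> B \<epsilon> \<subseteq> U \<inter> U'"
      by (intro exI conjI)
  qed
next
  fix \<K> assume \<K>: "\<forall>U\<in>\<K>. fell_open G T U"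
  show "fell_open G T (\<Union>\<K>)"
    unfolding fell_open_def
  proof (intro conjI ballI)
    show "\<Union>\<K> \<subseteq> irrep_classes G T" using \<K> by (auto simp: fell_open_def)
    fix C \<pi> assume "C \<in> \<Union>\<K>" and \<pi>: "\<pi> \<in> C"
    then obtain U where U: "U \<in> \<K>" "C \<in> U" by blast
    then obtain n v \<xi> B e where *: "\<forall>j<n. v j \<in> carrier \<pi> \<and> \<xi> j \<in> carrier (smooth_dual G T \<pi>)"
        "compactin T B" "e > 0" "fell_nbhd G T \<pi> n v \<xi> B e \<subseteq> U"
      using fell_openE[OF bspec[OF \<K> U(1)] U(2) \<pi>] by metis
    moreover have "fell_nbhd G T \<pi> n v \<xi> B e \<subseteq> \<Union>\<K>" using *(4) U(1) by blast
    ultimately show "\<exists>n v \<xi> B \<epsilon>.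
        (\<forall>j<n. v j \<in> carrier \<pi> \<and> \<xi> j \<in> carrier (smooth_dual G T \<pi>)) \<and>
        compactin T B \<and> \<epsilon> > 0 \<and> fell_nbhd G T \<pi> n v \<xi> B \<epsilon> \<subseteq> \<Union>\<K>"
      by (intro exI conjI)
  qed
qed

lemma openin_fell: "openin (fell_topology G T) = fell_open G T"
  by (simp add: fell_topology_def istopology_fell)

lemma topspace_fell: "topspace (fell_topology G T) = irrep_classes G T"
proof -
  have "fell_nbhd G T \<pi> 0 v \<xi> {} 1 \<subseteq> irrep_classes G T" for \<pi> v \<xi>
    by (auto simp: fell_nbhd_def)
  then have "fell_open G T (irrep_classes G T)"
    unfolding fell_open_def using compactin_empty[of T] by (metis less_nat_zero_code order_refl zero_less_one)
  then show ?thesis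
    unfolding topspace_def openin_fell by (auto simp: fell_open_def)
qed

text \<open>\<open>\<V>(K, \<rho>)\<close>: the classes of \<open>\<pi>\<close> with \<open>Hom\<^sub>K(\<pi>, \<rho>) \<noteq> 0\<close>.\<close>

definition reps_containing ::
    "('g, 'b) monoid_scheme \<Rightarrow> 'g topology \<Rightarrow> 'g set \<Rightarrow> ('g, 'w::complex_vector) rep \<Rightarrow>
     ('g, 'g \<Rightarrow> complex) rep set set" where
  "reps_containing G T K \<rho> =
     {C \<in> irrep_classes G T. \<exists>\<pi>\<in>C. intertwiners (G\<lparr>carrier := K\<rparr>) \<pi> \<rho> \<noteq> {0}}"

section \<open>The Hecke algebra and its modules\<close>

definition haar_measure ::
    "('g, 'b) monoid_scheme \<Rightarrow> 'g topology \<Rightarrow> 'g measure \<Rightarrow> bool" where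
  "haar_measure G T M \<longleftrightarrow> space M = carrier G \<and> sets M = sigma_sets (carrier G) {U. openin T U} \<and>
     (\<forall>g\<in>carrier G. \<forall>E\<in>sets M. emeasure M (g <#\<^bsub>G\<^esub> E) = emeasure M E) \<and>
     (\<forall>C. compactin T C \<longrightarrow> emeasure M C < \<infinity>) \<and>
     (\<forall>U. openin T U \<and> U \<noteq> {} \<longrightarrow> emeasure M U > 0) \<and>
     (\<forall>E\<in>sets M. emeasure M E = (INF U\<in>{U. openin T U \<and> E \<subseteq> U}. emeasure M U)) \<and>
     (\<forall>U. openin T U \<longrightarrow> emeasure M U = (SUP C\<in>{C. compactin T C \<and> C \<subseteq> U}. emeasure M C))"

abbreviation contragredient ::
    "('g, 'b) monoid_scheme \<Rightarrow> 'g topology \<Rightarrow> 'g set \<Rightarrow> ('g, 'w::complex_vector) rep \<Rightarrow>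
     ('g, 'w \<Rightarrow> complex) rep" where
  "contragredient G T K \<rho> \<equiv> smooth_dual (G\<lparr>carrier := K\<rparr>) (subtopology T K) \<rho>"

text \<open>The integrals below are of compactly supported locally constant functions with values in a
  vector space without topology; such a function takes finitely many values, and
  \<^const>\<open>Bochner_Integration.simple_bochner_integral\<close> is the finite sum of values weighted by the measures of the level sets.
  Elements of the algebra vanish outside the group. The unit is \<open>\<mu>(K)\<^sup>-\<^sup>1 \<rho>\<^sup>\<or>\<close>, supported on \<open>K\<close>.\<close>

definition hecke_algebra ::
    "('g, 'b) monoid_scheme \<Rightarrow> 'g topology \<Rightarrow> 'g measure \<Rightarrow> 'g set \<Rightarrow>
     ('g, 'w::complex_vector) rep \<Rightarrow> ('g \<Rightarrow> ('w \<Rightarrow> complex) \<Rightarrow> 'w \<Rightarrow> complex) ring" where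
  "hecke_algebra G T M K \<rho> = (let \<rho>' = contragredient G T K \<rho>; W' = carrier \<rho>' in
    \<lparr>carrier = {f.
        (\<forall>g\<in>carrier G. f g \<in> lin_maps W' W') \<and> (\<forall>g. g \<notin> carrier G \<longrightarrow> f g = 0) \<and>
        (\<forall>g\<in>carrier G. \<exists>U. openin T U \<and> g \<in> U \<and> (\<forall>h\<in>U. f h = f g)) \<and>
        (\<exists>C. compactin T C \<and> (\<forall>g\<in>carrier G - C. f g = 0)) \<and>
        (\<forall>k1\<in>K. \<forall>k2\<in>K. \<forall>g\<in>carrier G. \<forall>\<xi>\<in>W'.
           f (k1 \<otimes>\<^bsub>G\<^esub> g \<otimes>\<^bsub>G\<^esub> k2) \<xi> = act \<rho>' k1 (f g (act \<rho>' k2 \<xi>)))},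
     mult = (\<lambda>f1 f2 x. if x \<in> carrier G
        then Bochner_Integration.simple_bochner_integral M (\<lambda>g. f1 g \<circ> f2 (inv\<^bsub>G\<^esub> g \<otimes>\<^bsub>G\<^esub> x)) else 0),
     one = (\<lambda>x \<xi>. if x \<in> K \<and> \<xi> \<in> W' then (1 / measure M K) *\<^sub>R act \<rho>' x \<xi> else 0),
     zero = 0,
     add = (+)\<rparr>)"

text \<open>For \<open>A \<in> End(W\<^sup>\<or>)\<close>, the transpose \<open>A\<^sup>\<or> \<in> End(W)\<close> is characterized by
  \<open>\<langle>\<xi>, A\<^sup>\<or>w\<rangle> = \<langle>A\<xi>, w\<rangle>\<close> for all \<open>\<xi> \<in> W\<^sup>\<or>\<close>; here \<open>W\<close> is finite-dimensional.\<close>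

definition transpose_end ::
    "'w::complex_vector set \<Rightarrow> ('w \<Rightarrow> complex) set \<Rightarrow> (('w \<Rightarrow> complex) \<Rightarrow> 'w \<Rightarrow> complex) \<Rightarrow>
     'w \<Rightarrow> 'w" where
  "transpose_end W W' A w = (THE u. u \<in> W \<and> (\<forall>\<xi>\<in>W'. \<xi> u = A \<xi> w))"

text \<open>\<open>Hom\<^sub>K(\<rho>, \<pi>)\<close> as a left module over \<open>hecke_algebra G T M K \<rho>\<close>. The fields \<open>mult\<close> and \<open>one\<close>
  of the record are not used.\<close>

definition rho_invariants ::
    "('g, 'b) monoid_scheme \<Rightarrow> 'g topology \<Rightarrow> 'g measure \<Rightarrow> 'g set \<Rightarrow>
     ('g, 'w::complex_vector) rep \<Rightarrow> ('g, 'v::complex_vector) rep \<Rightarrow>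
     ('g \<Rightarrow> ('w \<Rightarrow> complex) \<Rightarrow> 'w \<Rightarrow> complex, 'w \<Rightarrow> 'v) module" where
  "rho_invariants G T M K \<rho> \<pi> =
    \<lparr>carrier = intertwiners (G\<lparr>carrier := K\<rparr>) \<rho> \<pi>,
     mult = undefined, one = undefined, zero = 0, add = (+),
     smult = (\<lambda>f \<phi> w. if w \<in> carrier \<rho>
       then Bochner_Integration.simple_bochner_integral M (\<lambda>g. act \<pi> g
         (\<phi> (transpose_end (carrier \<rho>) (carrier (contragredient G T K \<rho>)) (f g) w)))
       else 0)\<rparr>"

section \<open>Primitive ideals and the Jacobson topology\<close>

text \<open>The locale \<^locale>\<open>module\<close> of HOL-Algebra requires a commutative ring.\<close>

locale left_module = R?: ring R + M?: abelian_group M for R (structure) and M (structure) +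
  assumes smult_closed:
      "\<lbrakk>a \<in> carrier R; x \<in> carrier M\<rbrakk> \<Longrightarrow> a \<odot>\<^bsub>M\<^esub> x \<in> carrier M"
    and smult_l_distr:
      "\<lbrakk>a \<in> carrier R; b \<in> carrier R; x \<in> carrier M\<rbrakk> \<Longrightarrow>
        (a \<oplus>\<^bsub>R\<^esub> b) \<odot>\<^bsub>M\<^esub> x = a \<odot>\<^bsub>M\<^esub> x \<oplus>\<^bsub>M\<^esub> b \<odot>\<^bsub>M\<^esub> x"
    and smult_r_distr:
      "\<lbrakk>a \<in> carrier R; x \<in> carrier M; y \<in> carrier M\<rbrakk> \<Longrightarrow>
        a \<odot>\<^bsub>M\<^esub> (x \<oplus>\<^bsub>M\<^esub> y) = a \<odot>\<^bsub>M\<^esub> x \<oplus>\<^bsub>M\<^esub> a \<odot>\<^bsub>M\<^esub> y"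
    and smult_assoc:
      "\<lbrakk>a \<in> carrier R; b \<in> carrier R; x \<in> carrier M\<rbrakk> \<Longrightarrow>
        (a \<otimes>\<^bsub>R\<^esub> b) \<odot>\<^bsub>M\<^esub> x = a \<odot>\<^bsub>M\<^esub> (b \<odot>\<^bsub>M\<^esub> x)"
    and smult_one:
      "x \<in> carrier M \<Longrightarrow> \<one>\<^bsub>R\<^esub> \<odot>\<^bsub>M\<^esub> x = x"

definition simple_module :: "('a, 'c) ring_scheme \<Rightarrow> ('a, 'm, 'd) module_scheme \<Rightarrow> bool" where
  "simple_module R M \<longleftrightarrow> left_module R M \<and> carrier M \<noteq> {\<zero>\<^bsub>M\<^esub>} \<and>
     (\<forall>H. submodule H R M \<longrightarrow> H = {\<zero>\<^bsub>M\<^esub>} \<or> H = carrier M)"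

definition annihilator :: "('a, 'c) ring_scheme \<Rightarrow> ('a, 'm, 'd) module_scheme \<Rightarrow> 'a set" where
  "annihilator R M = {a \<in> carrier R. \<forall>x\<in>carrier M. a \<odot>\<^bsub>M\<^esub> x = \<zero>\<^bsub>M\<^esub>}"

text \<open>A simple module is a quotient of the ring, hence has an isomorphic copy whose elements are
  cosets in the ring; so modules on the type \<open>'a set\<close> suffice (lemma \<open>annihilator_primitive\<close>).\<close>

definition primitive_ideals :: "('a, 'c) ring_scheme \<Rightarrow> 'a set set" where
  "primitive_ideals R = {annihilator R M |M :: ('a, 'a set) module. simple_module R M}"

text \<open>The intersection is taken inside the ring, so that \<open>J\<^sub>\<emptyset>\<close> is the whole ring.\<close>

definition hull_kernel :: "('a, 'c) ring_scheme \<Rightarrow> 'a set set \<Rightarrow> 'a set set" where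
  "hull_kernel R S = {I \<in> primitive_ideals R. carrier R \<inter> \<Inter>S \<subseteq> I}"

definition jacobson_topology :: "('a, 'c) ring_scheme \<Rightarrow> 'a set topology" where
  "jacobson_topology R = topology (\<lambda>U. U \<subseteq> primitive_ideals R \<and>
     hull_kernel R (primitive_ideals R - U) = primitive_ideals R - U)"

context left_module
begin

lemma smult_zero_left: "x \<in> carrier M \<Longrightarrow> \<zero>\<^bsub>R\<^esub> \<odot>\<^bsub>M\<^esub> x = \<zero>\<^bsub>M\<^esub>"
  using smult_l_distr[of "\<zero>\<^bsub>R\<^esub>" "\<zero>\<^bsub>R\<^esub>" x] smult_closed[of "\<zero>\<^bsub>R\<^esub>" x]
  by (metis M.add.l_cancel_one R.add.l_one R.zero_closed)

lemma smult_zero_right: "a \<in> carrier R \<Longrightarrow> a \<odot>\<^bsub>M\<^esub> \<zero>\<^bsub>M\<^esub> = \<zero>\<^bsub>M\<^esub>"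
  using smult_r_distr[of a "\<zero>\<^bsub>M\<^esub>" "\<zero>\<^bsub>M\<^esub>"] smult_closed[of a "\<zero>\<^bsub>M\<^esub>"]
  by (metis M.add.l_cancel_one M.add.l_one M.zero_closed)

lemma smult_minus_one:
  assumes "x \<in> carrier M"
  shows "\<ominus>\<^bsub>M\<^esub> x = (\<ominus>\<^bsub>R\<^esub> \<one>\<^bsub>R\<^esub>) \<odot>\<^bsub>M\<^esub> x"
proof -
  have "(\<ominus>\<^bsub>R\<^esub> \<one>\<^bsub>R\<^esub>) \<odot>\<^bsub>M\<^esub> x \<oplus>\<^bsub>M\<^esub> x = ((\<ominus>\<^bsub>R\<^esub> \<one>\<^bsub>R\<^esub>) \<oplus>\<^bsub>R\<^esub> \<one>\<^bsub>R\<^esub>) \<odot>\<^bsub>M\<^esub> x"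
    using assms smult_l_distr[of "\<ominus>\<^bsub>R\<^esub> \<one>\<^bsub>R\<^esub>" "\<one>\<^bsub>R\<^esub>" x] by (simp add: smult_one)
  also have "\<dots> = \<zero>\<^bsub>M\<^esub>" using assms by (simp add: R.l_neg smult_zero_left)
  finally show ?thesis using assms by (simp add: M.minus_equality smult_closed)
qed

lemma submodule_iff:
  "submodule H R M \<longleftrightarrow> H \<subseteq> carrier M \<and> \<zero>\<^bsub>M\<^esub> \<in> H \<and> (\<forall>x\<in>H. \<forall>y\<in>H. x \<oplus>\<^bsub>M\<^esub> y \<in> H) \<and>
     (\<forall>a\<in>carrier R. \<forall>x\<in>H. a \<odot>\<^bsub>M\<^esub> x \<in> H)" (is "?L \<longleftrightarrow> ?R")
proof
  assume ?L
  then interpret H: submodule H R M .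
  show ?R using H.subset H.one_closed H.m_closed H.smult_closed by auto
next
  assume r: ?R
  have "subgroup H (add_monoid M)"
  proof
    show "H \<subseteq> carrier (add_monoid M)" using r by simp
    show "x \<otimes>\<^bsub>add_monoid M\<^esub> y \<in> H" if "x \<in> H" "y \<in> H" for x y using r that by simp
    show "\<one>\<^bsub>add_monoid M\<^esub> \<in> H" using r by simp
    show "inv\<^bsub>add_monoid M\<^esub> x \<in> H" if x: "x \<in> H" for x
    proof -
      have "\<ominus>\<^bsub>M\<^esub> x \<in> H" using r x by (auto simp: smult_minus_one)
      then show ?thesis by (simp add: a_inv_def)
    qed
  qed
  then show ?L using r by (simp add: submodule_def submodule_axioms_def)
qed

end

lemma simple_module_generated:
  assumes s: "simple_module R M" and x: "x \<in> carrier M"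
    and L: "L \<subseteq> carrier R" "\<zero>\<^bsub>R\<^esub> \<in> L" "\<And>a b. a \<in> L \<Longrightarrow> b \<in> L \<Longrightarrow> a \<oplus>\<^bsub>R\<^esub> b \<in> L"
      "\<And>a b. a \<in> carrier R \<Longrightarrow> b \<in> L \<Longrightarrow> a \<otimes>\<^bsub>R\<^esub> b \<in> L"
    and ne: "\<exists>a\<in>L. a \<odot>\<^bsub>M\<^esub> x \<noteq> \<zero>\<^bsub>M\<^esub>"
  shows "(\<lambda>a. a \<odot>\<^bsub>M\<^esub> x) ` L = carrier M"
proof -
  interpret left_module R M using s by (simp add: simple_module_def)
  let ?H = "(\<lambda>a. a \<odot>\<^bsub>M\<^esub> x) ` L"
  have LR: "a \<in> carrier R" if "a \<in> L" for a using L(1) that by blast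
  have "submodule ?H R M"
    unfolding submodule_iff
  proof (intro conjI ballI)
    show "?H \<subseteq> carrier M" using LR x by (auto intro: smult_closed)
    show "\<zero>\<^bsub>M\<^esub> \<in> ?H" using L(2) smult_zero_left[OF x] by (metis imageI)
    show "y \<oplus>\<^bsub>M\<^esub> z \<in> ?H" if yz: "y \<in> ?H" "z \<in> ?H" for y z
    proof -
      obtain a b where ab: "a \<in> L" "b \<in> L" "y = a \<odot>\<^bsub>M\<^esub> x" "z = b \<odot>\<^bsub>M\<^esub> x" using yz by blast
      then have "y \<oplus>\<^bsub>M\<^esub> z = (a \<oplus>\<^bsub>R\<^esub> b) \<odot>\<^bsub>M\<^esub> x" using smult_l_distr[OF LR LR x] by simp
      then show ?thesis using L(3)[OF ab(1,2)] by (rule image_eqI)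
    qed
    show "a \<odot>\<^bsub>M\<^esub> y \<in> ?H" if ay: "a \<in> carrier R" "y \<in> ?H" for a y
    proof -
      obtain b where b: "b \<in> L" "y = b \<odot>\<^bsub>M\<^esub> x" using ay by blast
      then have "a \<odot>\<^bsub>M\<^esub> y = (a \<otimes>\<^bsub>R\<^esub> b) \<odot>\<^bsub>M\<^esub> x" using smult_assoc[OF ay(1) LR x] by simp
      then show ?thesis using L(4)[OF ay(1) b(1)] by (rule image_eqI)
    qed
  qed
  moreover have "?H \<noteq> {\<zero>\<^bsub>M\<^esub>}" using ne by blast
  ultimately show ?thesis using s by (auto simp: simple_module_def)
qed

lemma annihilator_primitive:
  fixes R :: "('a, 'c) ring_scheme" and M :: "('a, 'm, 'd) module_scheme"
  assumes s: "simple_module R M"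
  shows "annihilator R M \<in> primitive_ideals R"
proof -
  interpret left_module R M using s by (simp add: simple_module_def)
  obtain x where x: "x \<in> carrier M" "x \<noteq> \<zero>\<^bsub>M\<^esub>"
    using s M.zero_closed by (auto simp: simple_module_def)
  have gen: "(\<lambda>a. a \<odot>\<^bsub>M\<^esub> x) ` carrier R = carrier M"
    by (rule simple_module_generated[OF s x(1)]) (use x in \<open>auto intro!: bexI[of _ "\<one>\<^bsub>R\<^esub>"] simp: smult_one\<close>)
  define h where "h = (\<lambda>m. {a \<in> carrier R. a \<odot>\<^bsub>M\<^esub> x = m})"
  define k where "k = inv_into (carrier M) h"
  have inj: "inj_on h (carrier M)"
  proof (rule inj_onI)
    fix m n assume m: "m \<in> carrier M" "n \<in> carrier M" "h m = h n"
    obtain a where "a \<in> carrier R" "a \<odot>\<^bsub>M\<^esub> x = m" using m(1) unfolding gen[symmetric] by blast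
    then have "a \<in> h n" using m(3) by (auto simp: h_def)
    then show "m = n" using \<open>a \<odot>\<^bsub>M\<^esub> x = m\<close> by (simp add: h_def)
  qed
  have kh: "k (h m) = m" if "m \<in> carrier M" for m using inj that by (simp add: k_def)
  define N :: "('a, 'a set) module" where
    "N = \<lparr>carrier = h ` carrier M, mult = undefined, one = undefined, zero = h \<zero>\<^bsub>M\<^esub>,
      add = (\<lambda>S S'. h (k S \<oplus>\<^bsub>M\<^esub> k S')), smult = (\<lambda>a S. h (a \<odot>\<^bsub>M\<^esub> k S))\<rparr>"
  have N: "carrier N = h ` carrier M" "\<zero>\<^bsub>N\<^esub> = h \<zero>\<^bsub>M\<^esub>"
    "\<And>m n. m \<in> carrier M \<Longrightarrow> n \<in> carrier M \<Longrightarrow> h m \<oplus>\<^bsub>N\<^esub> h n = h (m \<oplus>\<^bsub>M\<^esub> n)"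
    "\<And>a m. m \<in> carrier M \<Longrightarrow> a \<odot>\<^bsub>N\<^esub> h m = h (a \<odot>\<^bsub>M\<^esub> m)"
    by (simp_all add: N_def kh)
  have "abelian_group N"
  proof (rule abelian_groupI)
    fix y assume "y \<in> carrier N"
    then obtain m where "m \<in> carrier M" "y = h m" by (auto simp: N)
    then show "\<exists>z\<in>carrier N. z \<oplus>\<^bsub>N\<^esub> y = \<zero>\<^bsub>N\<^esub>"
      by (auto simp: N M.l_neg intro!: bexI[of _ "\<ominus>\<^bsub>M\<^esub> m"])
  qed (auto simp: N M.a_ac)
  then interpret N: left_module R N
    by (intro left_module.intro left_module_axioms.intro)
      (auto simp: N smult_closed smult_l_distr smult_r_distr smult_assoc smult_one R.ring_axioms)
  have "carrier N \<noteq> {\<zero>\<^bsub>N\<^esub>}"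
    using x inj M.zero_closed unfolding N by (metis imageI inj_onD singletonD)
  moreover have "H = {\<zero>\<^bsub>N\<^esub>} \<or> H = carrier N" if H: "submodule H R N" for H
  proof -
    let ?H = "{m \<in> carrier M. h m \<in> H}"
    have "submodule ?H R M"
      using H unfolding submodule_iff N.submodule_iff N(2)
      by (auto simp: smult_closed N(3)[symmetric] N(4)[symmetric])
    then have "?H = {\<zero>\<^bsub>M\<^esub>} \<or> ?H = carrier M" using s by (auto simp: simple_module_def)
    moreover have img: "H = h ` ?H" using H unfolding N.submodule_iff N(1) by auto
    moreover have "H = h ` {\<zero>\<^bsub>M\<^esub>}" if "?H = {\<zero>\<^bsub>M\<^esub>}" using img unfolding that .
    moreover have "H = h ` carrier M" if "?H = carrier M" using img unfolding that .
    ultimately show ?thesis unfolding N by (auto simp only: image_insert image_empty)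
  qed
  ultimately have "simple_module R N"
    using N.left_module_axioms by (auto simp: simple_module_def)
  moreover have "annihilator R M = annihilator R N"
    using inj by (auto simp: annihilator_def N smult_closed inj_on_eq_iff)
  ultimately show ?thesis by (auto simp: primitive_ideals_def)
qed

lemma hull_kernel_subset: "hull_kernel R S \<subseteq> primitive_ideals R"
  by (auto simp: hull_kernel_def)

lemma hull_kernel_mono: "S \<subseteq> S' \<Longrightarrow> hull_kernel R S \<subseteq> hull_kernel R S'"
  by (auto simp: hull_kernel_def)

lemma hull_kernel_increasing: "S \<subseteq> primitive_ideals R \<Longrightarrow> S \<subseteq> hull_kernel R S"
  by (auto simp: hull_kernel_def)

lemma hull_kernel_idem: "hull_kernel R (hull_kernel R S) = hull_kernel R S"
  by (auto simp: hull_kernel_def)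

lemma annihilator_ideal:
  assumes "left_module R M" "I = annihilator R M"
  shows "I \<subseteq> carrier R" "\<zero>\<^bsub>R\<^esub> \<in> I" "\<And>a b. a \<in> I \<Longrightarrow> b \<in> I \<Longrightarrow> a \<oplus>\<^bsub>R\<^esub> b \<in> I"
    "\<And>a b. a \<in> carrier R \<Longrightarrow> b \<in> I \<Longrightarrow> a \<otimes>\<^bsub>R\<^esub> b \<in> I"
    "\<And>a b. a \<in> carrier R \<Longrightarrow> b \<in> I \<Longrightarrow> b \<otimes>\<^bsub>R\<^esub> a \<in> I"
proof -
  interpret left_module R M by fact
  show "I \<subseteq> carrier R" "\<zero>\<^bsub>R\<^esub> \<in> I" "\<And>a b. a \<in> I \<Longrightarrow> b \<in> I \<Longrightarrow> a \<oplus>\<^bsub>R\<^esub> b \<in> I"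
    "\<And>a b. a \<in> carrier R \<Longrightarrow> b \<in> I \<Longrightarrow> a \<otimes>\<^bsub>R\<^esub> b \<in> I"
    "\<And>a b. a \<in> carrier R \<Longrightarrow> b \<in> I \<Longrightarrow> b \<otimes>\<^bsub>R\<^esub> a \<in> I"
    unfolding assms(2) annihilator_def
    by (auto simp: smult_zero_left smult_zero_right smult_l_distr smult_assoc smult_closed)
qed

lemma primitive_ideal_ideal:
  assumes "I \<in> primitive_ideals R"
  shows "I \<subseteq> carrier R" "\<zero>\<^bsub>R\<^esub> \<in> I" "\<And>a b. a \<in> I \<Longrightarrow> b \<in> I \<Longrightarrow> a \<oplus>\<^bsub>R\<^esub> b \<in> I"
    "\<And>a b. a \<in> carrier R \<Longrightarrow> b \<in> I \<Longrightarrow> a \<otimes>\<^bsub>R\<^esub> b \<in> I"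
    "\<And>a b. a \<in> carrier R \<Longrightarrow> b \<in> I \<Longrightarrow> b \<otimes>\<^bsub>R\<^esub> a \<in> I"
proof -
  obtain M :: "('a, 'a set) module" where "left_module R M" "I = annihilator R M"
    using assms by (auto simp: primitive_ideals_def simple_module_def)
  note * = annihilator_ideal[OF this]
  show "I \<subseteq> carrier R" "\<zero>\<^bsub>R\<^esub> \<in> I" "\<And>a b. a \<in> I \<Longrightarrow> b \<in> I \<Longrightarrow> a \<oplus>\<^bsub>R\<^esub> b \<in> I"
    "\<And>a b. a \<in> carrier R \<Longrightarrow> b \<in> I \<Longrightarrow> a \<otimes>\<^bsub>R\<^esub> b \<in> I"
    "\<And>a b. a \<in> carrier R \<Longrightarrow> b \<in> I \<Longrightarrow> b \<otimes>\<^bsub>R\<^esub> a \<in> I"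
    using * by blast+
qed

lemma primitive_ideal_prime:
  assumes I: "I \<in> primitive_ideals R" and S: "S \<subseteq> primitive_ideals R" "S' \<subseteq> primitive_ideals R"
    and sub: "carrier R \<inter> \<Inter>(S \<union> S') \<subseteq> I"
  shows "carrier R \<inter> \<Inter>S \<subseteq> I \<or> carrier R \<inter> \<Inter>S' \<subseteq> I"
proof (rule ccontr)
  assume "\<not> ?thesis"
  then obtain a b where a: "a \<in> carrier R" "a \<in> \<Inter>S" "a \<notin> I"
    and b: "b \<in> carrier R" "b \<in> \<Inter>S'" "b \<notin> I" by blast
  obtain M :: "('a, 'a set) module" where s: "simple_module R M" and IM: "I = annihilator R M"
    using I by (auto simp: primitive_ideals_def)
  interpret left_module R M using s by (simp add: simple_module_def)
  obtain m where m: "m \<in> carrier M" "b \<odot>\<^bsub>M\<^esub> m \<noteq> \<zero>\<^bsub>M\<^esub>" using b IM by (auto simp: annihilator_def)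
  obtain n where n: "n \<in> carrier M" "a \<odot>\<^bsub>M\<^esub> n \<noteq> \<zero>\<^bsub>M\<^esub>" using a IM by (auto simp: annihilator_def)
  let ?J = "carrier R \<inter> \<Inter>S'"
  have id: "I' \<in> primitive_ideals R" if "I' \<in> S \<union> S'" for I' using that S by blast
  have "(\<lambda>c. c \<odot>\<^bsub>M\<^esub> m) ` ?J = carrier M"
    by (rule simple_module_generated[OF s m(1)])
      (use b m(2) primitive_ideal_ideal[OF id] in \<open>auto\<close>)
  then obtain c where c: "c \<in> ?J" "c \<odot>\<^bsub>M\<^esub> m = n"
    using n(1) by (metis (no_types, lifting) imageE)
  have "a \<otimes>\<^bsub>R\<^esub> c \<in> I'" if "I' \<in> S \<union> S'" for I'
    using that a c primitive_ideal_ideal(4,5)[OF id[OF that]] by blast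
  then have "a \<otimes>\<^bsub>R\<^esub> c \<in> I" using sub a c by blast
  then have "a \<odot>\<^bsub>M\<^esub> (c \<odot>\<^bsub>M\<^esub> m) = \<zero>\<^bsub>M\<^esub>"
    using a(1) c(1) m(1) smult_assoc[of a c m] by (simp add: IM annihilator_def)
  with c n show False by simp
qed

lemma hull_kernel_Un:
  assumes "S \<subseteq> primitive_ideals R" "S' \<subseteq> primitive_ideals R"
  shows "hull_kernel R (S \<union> S') = hull_kernel R S \<union> hull_kernel R S'"
proof
  show "hull_kernel R (S \<union> S') \<subseteq> hull_kernel R S \<union> hull_kernel R S'"
  proof
    fix I assume "I \<in> hull_kernel R (S \<union> S')"
    then have I: "I \<in> primitive_ideals R" "carrier R \<inter> \<Inter>(S \<union> S') \<subseteq> I"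
      unfolding hull_kernel_def mem_Collect_eq by simp_all
    show "I \<in> hull_kernel R S \<union> hull_kernel R S'"
      using primitive_ideal_prime[OF I(1) assms I(2)] I(1)
      unfolding hull_kernel_def mem_Collect_eq Un_iff by meson
  qed
  show "hull_kernel R S \<union> hull_kernel R S' \<subseteq> hull_kernel R (S \<union> S')"
    by (simp add: hull_kernel_mono)
qed

lemma hull_kernel_empty: "hull_kernel R {} = {}"
proof -
  have False if I: "I \<in> primitive_ideals R" and c: "carrier R \<subseteq> I" for I
  proof -
    obtain M :: "('a, 'a set) module" where s: "simple_module R M" and IM: "I = annihilator R M"
      using I by (auto simp: primitive_ideals_def)
    interpret left_module R M using s by (simp add: simple_module_def)
    have "x = \<zero>\<^bsub>M\<^esub>" if "x \<in> carrier M" for x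
      using c that smult_one[OF that] R.one_closed by (auto simp: IM annihilator_def)
    then have "carrier M = {\<zero>\<^bsub>M\<^esub>}" using M.zero_closed by blast
    with s show False by (simp add: simple_module_def)
  qed
  then show ?thesis by (auto simp: hull_kernel_def)
qed

lemma istopology_jacobson:
  "istopology (\<lambda>U. U \<subseteq> primitive_ideals R \<and>
     hull_kernel R (primitive_ideals R - U) = primitive_ideals R - U)"
  unfolding istopology_def
proof (intro conjI allI impI)
  let ?P = "primitive_ideals R"
  fix U U' assume U: "U \<subseteq> ?P \<and> hull_kernel R (?P - U) = ?P - U"
    and U': "U' \<subseteq> ?P \<and> hull_kernel R (?P - U') = ?P - U'"
  show "U \<inter> U' \<subseteq> ?P" using U by blast
  have "?P - U \<inter> U' = (?P - U) \<union> (?P - U')" by blast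
  then show "hull_kernel R (?P - U \<inter> U') = ?P - U \<inter> U'"
    using U U' by (simp add: hull_kernel_Un)
next
  let ?P = "primitive_ideals R"
  fix \<K> assume \<K>: "\<forall>U\<in>\<K>. U \<subseteq> ?P \<and> hull_kernel R (?P - U) = ?P - U"
  then show "\<Union>\<K> \<subseteq> ?P" by blast
  have "hull_kernel R (?P - \<Union>\<K>) \<subseteq> ?P - U" if "U \<in> \<K>" for U
    using \<K> that hull_kernel_mono[of "?P - \<Union>\<K>" "?P - U" R] by auto
  then have "hull_kernel R (?P - \<Union>\<K>) \<subseteq> ?P - \<Union>\<K>"
    using hull_kernel_subset by blast
  then show "hull_kernel R (?P - \<Union>\<K>) = ?P - \<Union>\<K>"
    using hull_kernel_increasing[of "?P - \<Union>\<K>" R] by blast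
qed

lemma openin_jacobson:
  "openin (jacobson_topology R) U \<longleftrightarrow> U \<subseteq> primitive_ideals R \<and>
     hull_kernel R (primitive_ideals R - U) = primitive_ideals R - U"
  by (simp add: jacobson_topology_def istopology_jacobson)

lemma topspace_jacobson: "topspace (jacobson_topology R) = primitive_ideals R"
proof -
  have "openin (jacobson_topology R) (primitive_ideals R)"
    by (simp add: openin_jacobson hull_kernel_empty)
  then show ?thesis
    by (metis openin_jacobson openin_subset openin_topspace subset_antisym)
qed

lemma jacobson_closure_of:
  assumes "S \<subseteq> primitive_ideals R"
  shows "jacobson_topology R closure_of S = hull_kernel R S"
proof -
  have closed: "closedin (jacobson_topology R) C \<longleftrightarrow> C \<subseteq> primitive_ideals R \<and> hull_kernel R C = C" for C
    unfolding closedin_def topspace_jacobson openin_jacobson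
    by (auto simp: double_diff)
  show ?thesis
  proof (rule closure_of_unique)
    show "S \<subseteq> hull_kernel R S" using assms by (rule hull_kernel_increasing)
    show "closedin (jacobson_topology R) (hull_kernel R S)"
      by (simp add: closed hull_kernel_subset hull_kernel_idem)
    show "hull_kernel R S \<subseteq> C" if "S \<subseteq> C" "closedin (jacobson_topology R) C" for C
      using that hull_kernel_mono[of S C R] by (simp add: closed)
  qed
qed

end

(* Let P = c-Ind_K^G(rho). Sending f to w |-> (x |-> f(x)^T w) identifies H(G,rho) with
   Hom_K(rho,P), which by Frobenius reciprocity is End_G(P) with reversed multiplication, and
   Hom_K(rho,V) with Hom_G(P,V), the action of f being composition with f. The algebra and module
   axioms become associativity of composition. Since averaging over a compact open subgroup makes
   its representations semisimple, every element of Hom_K(rho,V) lifts through any surjection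
   of G-representations onto V. Hence Hom_K(rho,V) is simple for irreducible V. The quotients of P
   supply an irreducible V for each simple module, and an inclusion of annihilators of two vectors
   forces the kernels of the corresponding maps P -> V, P -> V' to agree. Tameness makes
   Hom_K(rho,V) finite-dimensional, which yields such vectors from an inclusion of annihilators.

   For the topologies: if f does not annihilate pi, some integral of a matrix coefficient of pi
   against a compactly supported function is nonzero, and it stays nonzero for representations
   near pi. Conversely, given finitely many matrix coefficients on a compact set, choose a large
   compact open subgroup L containing that set. By finite-dimensionality the L-span E of a copy of
   rho in pi is L-irreducible, and some f supported in L acts on sigma as zero unless sigma
   contains E; in that case sigma has the same matrix coefficients on L. *)
theory Submission
  imports Defs
begin

section \<open>Linear maps on subspaces\<close>

text \<open>Vectors rather than modules carry the comparison of representations: an inclusion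
  between the annihilators of two vectors lets a map out of \<open>P\<close> factor, while an
  inclusion between annihilators of modules is not directly usable. Tameness bridges the gap, since
  the annihilator of a finite-dimensional module is that of finitely many vectors. Finite dimension
  has a second effect: the operators of the algebra on Hom_K(\<rho>,\<pi>) are spanned by finitely
  many elements, whose supports fit in one compact open \<open>L\<close>. Functions supported in
  \<open>L\<close> then generate as much as the full algebra does, which is the source of the
  irreducibility of the \<open>L\<close>-span. Value spaces have no topology, so an integral is a
  finite sum over level sets and is interchanged with other operations by linearity; changes of
  variable are left translations. A Fell neighbourhood lets the vectors of \<sigma> vary
  independently for each j. Non-annihilation is therefore tested on \<open>K\<close>-maps made from
  an arbitrary vector of \<sigma>, by averaging rank one maps.\<close>

lemma lin_mapsD:
  assumes "\<phi> \<in> lin_maps V W"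
  shows "x \<in> V \<Longrightarrow> \<phi> x \<in> W" "x \<notin> V \<Longrightarrow> \<phi> x = 0"
    "x \<in> V \<Longrightarrow> y \<in> V \<Longrightarrow> \<phi> (x + y) = \<phi> x + \<phi> y" "x \<in> V \<Longrightarrow> \<phi> (c *\<^sub>C x) = c *\<^sub>C \<phi> x"
  using assms by (auto simp: lin_maps_def)

lemma lin_mapsI:
  assumes "\<And>x. x \<in> V \<Longrightarrow> \<phi> x \<in> W" "\<And>x. x \<notin> V \<Longrightarrow> \<phi> x = 0"
    "\<And>x y. x \<in> V \<Longrightarrow> y \<in> V \<Longrightarrow> \<phi> (x + y) = \<phi> x + \<phi> y" "\<And>c x. x \<in> V \<Longrightarrow> \<phi> (c *\<^sub>C x) = c *\<^sub>C \<phi> x"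
  shows "\<phi> \<in> lin_maps V W"
  using assms by (auto simp: lin_maps_def)

lemma lin_maps_zero: "csubspace V \<Longrightarrow> \<phi> \<in> lin_maps V W \<Longrightarrow> \<phi> 0 = 0"
  using lin_mapsD(4)[of \<phi> V W 0 0] complex_vector.subspace_0[of V] by simp

lemma lin_maps_sum:
  assumes "csubspace V" "\<phi> \<in> lin_maps V W" "\<And>i. i \<in> I \<Longrightarrow> f i \<in> V"
  shows "\<phi> (\<Sum>i\<in>I. f i) = (\<Sum>i\<in>I. \<phi> (f i))"
  using assms(3)
proof (induction I rule: infinite_finite_induct)
  case (insert i I)
  then show ?case
    using lin_mapsD(3)[OF assms(2)] by (simp add: complex_vector.subspace_sum[OF assms(1)])
qed (simp_all add: lin_maps_zero[OF assms(1,2)])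

lemma lin_maps_diff:
  assumes "csubspace V" "\<phi> \<in> lin_maps V W" "x \<in> V" "y \<in> V"
  shows "\<phi> (x - y) = \<phi> x - \<phi> y"
proof -
  have "\<phi> (x - y + y) = \<phi> (x - y) + \<phi> y"
    using assms by (intro lin_mapsD(3)[OF assms(2)]) (simp_all add: complex_vector.subspace_diff)
  then show ?thesis by simp
qed

lemma zero_lin_maps: "csubspace W \<Longrightarrow> 0 \<in> lin_maps V W"
  by (simp add: lin_maps_def complex_vector.subspace_0)

lemma csubspace_lin_maps: "csubspace W \<Longrightarrow> csubspace (lin_maps V W)"
  unfolding complex_vector.subspace_def lin_maps_def
  by (auto simp: scaleC_fun_def scaleC_add_right mult.commute scaleC_scaleC)

lemma csubspace_scaleR: "csubspace S \<Longrightarrow> x \<in> S \<Longrightarrow> r *\<^sub>R x \<in> S"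
  by (simp add: scaleR_scaleC complex_vector.subspace_scale)

text \<open>A member of \<open>lin_maps\<close> is cut off to 0 outside \<open>V\<close>, so it need
  not be linear on the whole type. Extending it from a basis of \<open>V\<close> makes the existence
  theorems for one-sided inverses of global linear maps applicable.\<close>

lemma lin_maps_extend_global:
  fixes \<phi> :: "'v::complex_vector \<Rightarrow> 'w::complex_vector"
  assumes V: "csubspace V" and \<phi>: "\<phi> \<in> lin_maps V W"
  obtains \<psi> where "Vector_Spaces.linear (*\<^sub>C) (*\<^sub>C) \<psi>" "\<And>x. x \<in> V \<Longrightarrow> \<psi> x = \<phi> x"
proof -
  interpret p: vector_space_pair "(*\<^sub>C) :: complex \<Rightarrow> 'v \<Rightarrow> 'v" "(*\<^sub>C) :: complex \<Rightarrow> 'w \<Rightarrow> 'w" ..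
  obtain B where B: "B \<subseteq> V" "\<not> cdependent B" "V \<subseteq> cspan B"
    using complex_vector.maximal_independent_subset[of V] by blast
  obtain \<psi> where \<psi>: "Vector_Spaces.linear (*\<^sub>C) (*\<^sub>C) \<psi>" "\<forall>x\<in>B. \<psi> x = \<phi> x"
    using p.linear_independent_extend[of B \<phi>] B(2) by (auto simp: cdependent_def)
  interpret l: Vector_Spaces.linear "(*\<^sub>C)" "(*\<^sub>C)" \<psi> by fact
  have "\<psi> x = \<phi> x" if "x \<in> V" for x
  proof -
    have "x \<in> cspan B" using that B by blast
    then have "x \<in> V \<and> \<psi> x = \<phi> x"
    proof (induction rule: complex_vector.span_induct_alt)
      case base
      then show ?case using V lin_maps_zero[OF V \<phi>] by (simp add: complex_vector.subspace_0)
    next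
      case (step c x y)
      then show ?case
        using B(1) \<psi>(2) lin_mapsD(3,4)[OF \<phi>]
        by (auto simp: l.add l.scale complex_vector.subspace_add[OF V] complex_vector.subspace_scale[OF V] subset_iff)
    qed
    then show ?thesis ..
  qed
  with \<psi>(1) that show ?thesis by blast
qed

lemma lin_right_inverse:
  fixes \<phi> :: "'v::complex_vector \<Rightarrow> 'w::complex_vector"
  assumes V: "csubspace V" and W: "csubspace W" and \<phi>: "\<phi> \<in> lin_maps V W" and onto: "W \<subseteq> \<phi> ` V"
  obtains s where "s \<in> lin_maps W V" "\<And>y. y \<in> W \<Longrightarrow> \<phi> (s y) = y"
proof -
  interpret p: vector_space_pair "(*\<^sub>C) :: complex \<Rightarrow> 'v \<Rightarrow> 'v" "(*\<^sub>C) :: complex \<Rightarrow> 'w \<Rightarrow> 'w" ..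
  obtain \<psi> where \<psi>: "Vector_Spaces.linear (*\<^sub>C) (*\<^sub>C) \<psi>" "\<And>x. x \<in> V \<Longrightarrow> \<psi> x = \<phi> x"
    using lin_maps_extend_global[OF V \<phi>] by metis
  have "\<psi> ` V = \<phi> ` V" using \<psi>(2) by (auto intro!: image_cong)
  then obtain g where g: "range g \<subseteq> V" "Vector_Spaces.linear (*\<^sub>C) (*\<^sub>C) g" "\<forall>v\<in>\<phi> ` V. \<psi> (g v) = v"
    using p.linear_exists_right_inverse_on[OF \<psi>(1), of V] V by (auto simp: csubspace_def)
  interpret g: Vector_Spaces.linear "(*\<^sub>C)" "(*\<^sub>C)" g by fact
  show ?thesis
  proof (rule that[of "\<lambda>y. if y \<in> W then g y else 0"])
    show "(\<lambda>y. if y \<in> W then g y else 0) \<in> lin_maps W V"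
      using g(1) by (intro lin_mapsI)
        (auto simp: g.add g.scale complex_vector.subspace_add[OF W] complex_vector.subspace_scale[OF W])
    show "\<phi> (if y \<in> W then g y else 0) = y" if y: "y \<in> W" for y
    proof -
      have "g y \<in> V" using g(1) by blast
      moreover have "\<psi> (g y) = y" using g(3) onto y by blast
      ultimately show ?thesis using \<psi>(2)[of "g y"] y by simp
    qed
  qed
qed

lemma lin_left_inverse:
  fixes \<phi> :: "'v::complex_vector \<Rightarrow> 'w::complex_vector"
  assumes V: "csubspace V" and W: "csubspace W" and \<phi>: "\<phi> \<in> lin_maps V W" and inj: "inj_on \<phi> V"
  obtains s where "s \<in> lin_maps W V" "\<And>x. x \<in> V \<Longrightarrow> s (\<phi> x) = x"
proof -
  interpret p: vector_space_pair "(*\<^sub>C) :: complex \<Rightarrow> 'v \<Rightarrow> 'v" "(*\<^sub>C) :: complex \<Rightarrow> 'w \<Rightarrow> 'w" ..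
  obtain \<psi> where \<psi>: "Vector_Spaces.linear (*\<^sub>C) (*\<^sub>C) \<psi>" "\<And>x. x \<in> V \<Longrightarrow> \<psi> x = \<phi> x"
    using lin_maps_extend_global[OF V \<phi>] by metis
  have "inj_on \<psi> V" using inj \<psi>(2) by (simp add: inj_on_def)
  then obtain g where g: "range g \<subseteq> V" "Vector_Spaces.linear (*\<^sub>C) (*\<^sub>C) g" "\<forall>v\<in>V. g (\<psi> v) = v"
    using p.linear_exists_left_inverse_on[OF \<psi>(1), of V] V by (auto simp: csubspace_def)
  interpret g: Vector_Spaces.linear "(*\<^sub>C)" "(*\<^sub>C)" g by fact
  show ?thesis
  proof (rule that[of "\<lambda>y. if y \<in> W then g y else 0"])
    show "(\<lambda>y. if y \<in> W then g y else 0) \<in> lin_maps W V"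
      using g(1) by (intro lin_mapsI)
        (auto simp: g.add g.scale complex_vector.subspace_add[OF W] complex_vector.subspace_scale[OF W])
    show "(if \<phi> x \<in> W then g (\<phi> x) else 0) = x" if "x \<in> V" for x
      using that g(3) \<psi>(2)[OF that] lin_mapsD(1)[OF \<phi> that] by auto
  qed
qed

lemma lin_projection:
  assumes "csubspace V" "csubspace D" "D \<subseteq> V"
  obtains q where "q \<in> lin_maps V D" "\<And>x. x \<in> D \<Longrightarrow> q x = x"
proof -
  let ?i = "\<lambda>x. if x \<in> D then x else 0"
  have i: "?i \<in> lin_maps D V"
    using assms by (intro lin_mapsI) (auto simp: complex_vector.subspace_add complex_vector.subspace_scale)
  have "inj_on ?i D" by (auto simp: inj_on_def)
  from lin_left_inverse[OF assms(2,1) i this] obtain s where s: "s \<in> lin_maps V D" "\<And>x. x \<in> D \<Longrightarrow> s (?i x) = x"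
    by blast
  then have "s x = x" if "x \<in> D" for x using s(2)[OF that] that by simp
  then show ?thesis using that s(1) by blast
qed

text \<open>The functional is a left inverse of the injective map
  \<open>\<lambda>c. c *\<^sub>C v\<close>.\<close>

lemma exists_functional:
  assumes V: "csubspace V" and v: "v \<in> V" "v \<noteq> 0"
  obtains \<xi> :: "'v::complex_vector \<Rightarrow> complex" where "\<xi> \<in> lin_maps V UNIV" "\<xi> v = 1"
proof -
  let ?f = "\<lambda>c::complex. c *\<^sub>C v"
  have f: "?f \<in> lin_maps UNIV V"
    using complex_vector.subspace_scale[OF V v(1)]
    by (intro lin_mapsI) (simp_all only: scaleC_add_left scaleC_scaleC scaleC_complex_def UNIV_I simp_thms)
  have "inj_on ?f UNIV" using v(2) by (intro inj_onI) simp
  from lin_left_inverse[OF complex_vector.subspace_UNIV V f this]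
  obtain s where s: "s \<in> lin_maps V UNIV" "\<And>c. s (c *\<^sub>C v) = c"
    by (metis UNIV_I)
  show ?thesis using that[OF s(1)] s(2)[of 1] by (simp add: scaleC_one)
qed

lemma sum_apply_fun: "(\<Sum>i\<in>I. f i) x = (\<Sum>i\<in>I. f i x :: 'b::comm_monoid_add)"
  by (induction I rule: infinite_finite_induct) simp_all

section \<open>Finite-dimensional subspaces\<close>

definition finite_dim :: "'v::complex_vector set \<Rightarrow> bool" where
  "finite_dim V \<longleftrightarrow> (\<exists>B. finite B \<and> V \<subseteq> cspan B)"

lemma finite_dim_basis:
  assumes "csubspace V" "finite_dim V"
  obtains B where "finite B" "B \<subseteq> V" "\<not> cdependent B" "cspan B = V"
proof -
  obtain C where C: "finite C" "V \<subseteq> cspan C" using assms(2) by (auto simp: finite_dim_def)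
  obtain B where B: "B \<subseteq> V" "\<not> cdependent B" "V \<subseteq> cspan B"
    using complex_vector.maximal_independent_subset[of V] by blast
  have "finite B" using complex_vector.independent_span_bound[OF C(1) B(2)] B(1) C(2) by blast
  moreover have "cspan B = V" using B assms(1) by (metis complex_vector.span_minimal subset_antisym)
  ultimately show ?thesis using that B by blast
qed

lemma finite_dim_mono: "finite_dim V \<Longrightarrow> U \<subseteq> V \<Longrightarrow> finite_dim U"
  by (auto simp: finite_dim_def)

lemma finite_dim_lin_maps:
  fixes V :: "'v::complex_vector set" and W :: "'w::complex_vector set"
  assumes V: "csubspace V" "finite_dim V" and W: "csubspace W" "finite_dim W"
  shows "finite_dim (lin_maps V W)"
proof -
  obtain B where B: "finite B" "B \<subseteq> V" "\<not> cdependent B" "cspan B = V" by (rule finite_dim_basis[OF V])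
  obtain C where C: "finite C" "C \<subseteq> W" "\<not> cdependent C" "cspan C = W" by (rule finite_dim_basis[OF W])
  \<comment> \<open>The matrix units of the two bases, cut off to 0 outside
    \<open>V\<close>.\<close>
  define E :: "'v \<times> 'w \<Rightarrow> 'v \<Rightarrow> 'w" where "E = (\<lambda>(b, c) x. if x \<in> V then crepresentation B x b *\<^sub>C c else 0)"
  have "\<phi> \<in> cspan (E ` (B \<times> C))" if \<phi>: "\<phi> \<in> lin_maps V W" for \<phi>
  proof -
    have "\<phi> = (\<Sum>(b,c)\<in>B \<times> C. crepresentation C (\<phi> b) c *\<^sub>C E (b, c))"
    proof
      fix x
      have ev: "(\<Sum>(b,c)\<in>B \<times> C. crepresentation C (\<phi> b) c *\<^sub>C E (b, c)) x =
         (\<Sum>b\<in>B. \<Sum>c\<in>C. crepresentation C (\<phi> b) c *\<^sub>C E (b, c) x)"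
        by (simp add: sum.cartesian_product[symmetric] sum_apply_fun scaleC_fun_def)
      show "\<phi> x = (\<Sum>(b,c)\<in>B \<times> C. crepresentation C (\<phi> b) c *\<^sub>C E (b, c)) x"
      proof (cases "x \<in> V")
        case True
        have "\<phi> x = \<phi> (\<Sum>b\<in>B. crepresentation B x b *\<^sub>C b)"
          using complex_vector.sum_representation_eq[OF B(3) _ B(1)] True B(4) by simp
        also have "\<dots> = (\<Sum>b\<in>B. crepresentation B x b *\<^sub>C \<phi> b)"
          using B(2) by (subst lin_maps_sum[OF V(1) \<phi>])
            (auto simp: complex_vector.subspace_scale[OF V(1)] lin_mapsD(4)[OF \<phi>] subset_iff intro!: sum.cong)
        also have "\<dots> = (\<Sum>b\<in>B. crepresentation B x b *\<^sub>C (\<Sum>c\<in>C. crepresentation C (\<phi> b) c *\<^sub>C c))"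
          using B(2) lin_mapsD(1)[OF \<phi>] C(4)
          by (intro sum.cong refl, subst complex_vector.sum_representation_eq[OF C(3) _ C(1)]) auto
        finally show ?thesis
          unfolding ev using True
          by (simp add: E_def complex_vector.scale_sum_right mult.commute)
      qed (simp only: ev, simp add: E_def lin_mapsD(2)[OF \<phi>])
    qed
    also have "\<dots> \<in> cspan (E ` (B \<times> C))"
      by (intro complex_vector.span_sum) (auto intro: complex_vector.span_scale[OF complex_vector.span_base])
    finally show ?thesis .
  qed
  then show ?thesis using B(1) C(1) unfolding finite_dim_def
    by (intro exI[of _ "E ` (B \<times> C)"]) auto
qed

text \<open>The spanning set is chosen among the values of \<open>\<Phi>\<close>, so it can be
  pulled back to arguments. With \<open>\<Phi>\<close> sending an algebra element to its operator,
  this yields finitely many algebra elements whose operators span.\<close>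

lemma finite_dim_image_spanned:
  fixes \<Phi> :: "'a \<Rightarrow> 'v::complex_vector"
  assumes "finite_dim (\<Phi> ` A)"
  obtains S where "finite S" "S \<subseteq> A" "\<Phi> ` A \<subseteq> cspan (\<Phi> ` S)"
proof -
  obtain C where C: "finite C" "\<Phi> ` A \<subseteq> cspan C" using assms by (auto simp: finite_dim_def)
  obtain B where B: "B \<subseteq> \<Phi> ` A" "\<not> cdependent B" "\<Phi> ` A \<subseteq> cspan B"
    using complex_vector.maximal_independent_subset[of "\<Phi> ` A"] by blast
  have "finite B" using complex_vector.independent_span_bound[OF C(1) B(2)] B(1) C(2) by blast
  then obtain S where "finite S" "S \<subseteq> A" "B = \<Phi> ` S" using finite_subset_image[OF _ B(1)] by blast
  then show ?thesis using that B(3) by blast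
qed

section \<open>Locally constant functions\<close>

definition locally_constant :: "'g topology \<Rightarrow> ('g \<Rightarrow> 'a) \<Rightarrow> bool" where
  "locally_constant T f \<longleftrightarrow> (\<forall>g\<in>topspace T. \<exists>U. openin T U \<and> g \<in> U \<and> (\<forall>h\<in>U. f h = f g))"

lemma locally_constant_const: "locally_constant T (\<lambda>g. c)"
  unfolding locally_constant_def by blast

text \<open>Near \<open>g\<close> the inner function is frozen at the single value
  \<open>f g\<close>, and the open set belonging to that value is used; no uniformity in
  \<open>y\<close> is asked. Smoothness supplies just this: \<open>act \<pi> g v\<close> is locally
  constant in \<open>g\<close> for each separate vector \<open>v\<close>.\<close>

lemma locally_constant_bind:
  assumes f: "locally_constant T f" and S: "\<And>g. g \<in> topspace T \<Longrightarrow> f g \<in> S"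
    and F: "\<And>y. y \<in> S \<Longrightarrow> locally_constant T (\<lambda>g. F g y)"
  shows "locally_constant T (\<lambda>g. F g (f g))"
  unfolding locally_constant_def
proof
  fix g assume g: "g \<in> topspace T"
  obtain U where U: "openin T U" "g \<in> U" "\<forall>h\<in>U. f h = f g"
    using f g unfolding locally_constant_def by meson
  obtain U' where U': "openin T U'" "g \<in> U'" "\<forall>h\<in>U'. F h (f g) = F g (f g)"
    using F[OF S[OF g]] g unfolding locally_constant_def by meson
  have "F h (f h) = F g (f g)" if "h \<in> U \<inter> U'" for h
    using that U(3) U'(3) by (metis IntD1 IntD2)
  then show "\<exists>U. openin T U \<and> g \<in> U \<and> (\<forall>h\<in>U. F h (f h) = F g (f g))"
    using U(2) U'(2) openin_Int[OF U(1) U'(1)] by blast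
qed

lemma locally_constant_comp: "locally_constant T f \<Longrightarrow> locally_constant T (\<lambda>g. H (f g))"
  by (rule locally_constant_bind[where F = "\<lambda>g y. H y" and S = UNIV]) (auto intro: locally_constant_const)

lemma locally_constant_comp2:
  "locally_constant T f \<Longrightarrow> locally_constant T f' \<Longrightarrow> locally_constant T (\<lambda>g. H (f g) (f' g))"
  by (rule locally_constant_bind[where F = "\<lambda>g y. H y (f' g)" and S = UNIV]) (auto intro: locally_constant_comp)

lemma locally_constant_vimage:
  assumes f: "locally_constant T f" and c: "continuous_map T' T c"
  shows "locally_constant T' (\<lambda>g. f (c g))"
  unfolding locally_constant_def
proof
  fix g assume g: "g \<in> topspace T'"
  then have "c g \<in> topspace T" using c by (auto simp: continuous_map_def)
  then obtain U where U: "openin T U" "c g \<in> U" "\<forall>h\<in>U. f h = f (c g)"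
    using f unfolding locally_constant_def by meson
  show "\<exists>U. openin T' U \<and> g \<in> U \<and> (\<forall>h\<in>U. f (c h) = f (c g))"
    using openin_continuous_map_preimage[OF c U(1)] U(2,3) g
    by (intro exI[of _ "{x \<in> topspace T'. c x \<in> U}"]) blast
qed

lemma locally_constant_cong:
  assumes "locally_constant T f" "\<And>g. g \<in> topspace T \<Longrightarrow> f g = f' g"
  shows "locally_constant T f'"
  using assms openin_subset[of T] unfolding locally_constant_def by (metis subsetD)

lemma locally_constant_openin_level:
  assumes "locally_constant T f"
  shows "openin T {g \<in> topspace T. P (f g)}"
proof (subst openin_subopen, intro ballI)
  fix g assume g: "g \<in> {g \<in> topspace T. P (f g)}"
  then obtain U where U: "openin T U" "g \<in> U" "\<forall>h\<in>U. f h = f g"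
    using assms unfolding locally_constant_def by blast
  have "h \<in> {g \<in> topspace T. P (f g)}" if "h \<in> U" for h
    using that g U(3) openin_subset[OF U(1)] by (metis (mono_tags) mem_Collect_eq subsetD)
  then show "\<exists>U. openin T U \<and> g \<in> U \<and> U \<subseteq> {g \<in> topspace T. P (f g)}"
    using U(1,2) by blast
qed

text \<open>The level sets over the values taken on \<open>C\<close> form an open cover of
  \<open>C\<close>; a finite subcover leaves finitely many values.\<close>

lemma locally_constant_finite_image:
  assumes f: "locally_constant T f" and C: "compactin T C"
  shows "finite (f ` C)"
proof -
  have CT: "C \<subseteq> topspace T" using C by (rule compactin_subset_topspace)
  let ?U = "(\<lambda>y. {g \<in> topspace T. f g = y}) ` f ` C"
  have "openin T A" if "A \<in> ?U" for A
    using that locally_constant_openin_level[OF f, of "\<lambda>z. z = _"] by (elim imageE) simp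
  moreover have "C \<subseteq> \<Union>?U" using CT by fast
  ultimately have "\<exists>F. finite F \<and> F \<subseteq> ?U \<and> C \<subseteq> \<Union>F"
    by (rule compactinD[OF C])
  then obtain F where F: "finite F" "F \<subseteq> ?U" "C \<subseteq> \<Union>F" by blast
  then obtain Y where Y: "finite Y" "F = (\<lambda>y. {g \<in> topspace T. f g = y}) ` Y"
    using finite_subset_image[OF F(1,2)] by blast
  have "f ` C \<subseteq> Y" using F(3) unfolding Y(2) by auto
  then show ?thesis using Y(1) finite_subset by blast
qed

lemma locally_constant_extend:
  assumes f: "locally_constant (subtopology T L) f" and L: "openin T L" "closedin T L"
  shows "locally_constant T (\<lambda>g. if g \<in> L then f g else c)"
  unfolding locally_constant_def
proof
  fix g assume g: "g \<in> topspace T"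
  show "\<exists>U. openin T U \<and> g \<in> U \<and> (\<forall>h\<in>U. (if h \<in> L then f h else c) = (if g \<in> L then f g else c))"
  proof (cases "g \<in> L")
    case True
    then obtain U where U: "openin (subtopology T L) U" "g \<in> U" "\<forall>h\<in>U. f h = f g"
      using f g unfolding locally_constant_def by (metis IntI topspace_subtopology)
    then have "openin T U" "U \<subseteq> L" using openin_open_subtopology[OF L(1), of U] by auto
    then show ?thesis using U(2,3) True by (metis subsetD)
  next
    case False
    then show ?thesis using L g by (intro exI[of _ "topspace T - L"]) auto
  qed
qed

section \<open>Topological groups and smooth representations\<close>

lemma topological_groupD:
  assumes "topological_group G T"
  shows "group G" "topspace T = carrier G"
    "h \<in> carrier G \<Longrightarrow> continuous_map T T (\<lambda>x. h \<otimes>\<^bsub>G\<^esub> x)"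
    "h \<in> carrier G \<Longrightarrow> continuous_map T T (\<lambda>x. x \<otimes>\<^bsub>G\<^esub> h)"
    "continuous_map T T (\<lambda>x. inv\<^bsub>G\<^esub> x)"
proof -
  have m: "continuous_map (prod_topology T T) T (\<lambda>(x, y). x \<otimes>\<^bsub>G\<^esub> y)"
    using assms by (simp add: topological_group_def)
  show t: "group G" "topspace T = carrier G" "continuous_map T T (\<lambda>x. inv\<^bsub>G\<^esub> x)"
    using assms by (simp_all add: topological_group_def)
  show "continuous_map T T (\<lambda>x. h \<otimes>\<^bsub>G\<^esub> x)" "continuous_map T T (\<lambda>x. x \<otimes>\<^bsub>G\<^esub> h)" if h: "h \<in> carrier G"
  proof -
    have "continuous_map T (prod_topology T T) (\<lambda>x. (h, x))" "continuous_map T (prod_topology T T) (\<lambda>x. (x, h))"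
      using h t(2) by (simp_all add: continuous_map_pairedI)
    from this[THEN continuous_map_compose, OF m]
    show "continuous_map T T (\<lambda>x. h \<otimes>\<^bsub>G\<^esub> x)" "continuous_map T T (\<lambda>x. x \<otimes>\<^bsub>G\<^esub> h)"
      by (simp_all add: o_def)
  qed
qed

lemma topological_group_subgroup:
  assumes G: "topological_group G T" and L: "subgroup L G"
  shows "topological_group (G\<lparr>carrier := L\<rparr>) (subtopology T L)"
proof -
  interpret group G using G by (simp add: topological_group_def)
  interpret L: subgroup L G by fact
  have top: "topspace (subtopology T L) = L"
    using topological_groupD(2)[OF G] L.subset by auto
  have m: "continuous_map (prod_topology T T) T (\<lambda>(x, y). x \<otimes>\<^bsub>G\<^esub> y)"
    using G by (simp add: topological_group_def)
  have "continuous_map (prod_topology (subtopology T L) (subtopology T L)) (subtopology T L) (\<lambda>(x, y). x \<otimes>\<^bsub>G\<^esub> y)"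
    unfolding subtopology_Times[symmetric] continuous_map_in_subtopology
    using continuous_map_from_subtopology[OF m, of "L \<times> L"] by auto
  moreover have "continuous_map (subtopology T L) (subtopology T L) (\<lambda>x. inv\<^bsub>G\<^esub> x)"
    unfolding continuous_map_in_subtopology
    using continuous_map_from_subtopology[OF topological_groupD(5)[OF G], of L] top by auto
  then have "continuous_map (subtopology T L) (subtopology T L) (\<lambda>x. inv\<^bsub>G\<lparr>carrier := L\<rparr>\<^esub> x)"
    by (rule continuous_map_eq) (simp add: top m_inv_consistent[OF L])
  ultimately show ?thesis
    using L.subgroup_is_group[OF is_group] top by (simp add: topological_group_def)
qed

text \<open>Left translates of \<open>U\<close> inside \<open>H\<close> are neighbourhoods of the
  points of \<open>H\<close>. Openness of a stabilizer thereby reduces to exhibiting one nonempty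
  open subset.\<close>

lemma openin_subgroup:
  assumes G: "topological_group G T" and H: "subgroup H G" and U: "openin T U" "u \<in> U" "U \<subseteq> H"
  shows "openin T H"
proof (subst openin_subopen, intro ballI)
  fix h assume h: "h \<in> H"
  interpret group G using G by (simp add: topological_group_def)
  interpret H: subgroup H G by fact
  have u: "u \<in> H" using U by blast
  \<comment> \<open>Left multiplication by this element carries \<open>h\<close> to
    \<open>u\<close>.\<close>
  let ?a = "u \<otimes>\<^bsub>G\<^esub> inv\<^bsub>G\<^esub> h"
  let ?N = "{x \<in> topspace T. ?a \<otimes>\<^bsub>G\<^esub> x \<in> U}"
  have a: "?a \<in> H" using h u by simp
  have "openin T ?N"
    using topological_groupD(3)[OF G H.mem_carrier[OF a]] U(1) by (rule openin_continuous_map_preimage)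
  moreover have "h \<in> ?N" using h u U(2) by (simp add: topological_groupD(2)[OF G] m_assoc)
  moreover have "x \<in> H" if x: "x \<in> ?N" for x
  proof -
    have xc: "x \<in> carrier G" using x topological_groupD(2)[OF G] by simp
    have "x = inv\<^bsub>G\<^esub> ?a \<otimes>\<^bsub>G\<^esub> (?a \<otimes>\<^bsub>G\<^esub> x)"
      using xc H.mem_carrier[OF a] by (simp only: m_assoc[symmetric] inv_closed m_closed l_inv l_one)
    moreover have "inv\<^bsub>G\<^esub> ?a \<otimes>\<^bsub>G\<^esub> (?a \<otimes>\<^bsub>G\<^esub> x) \<in> H"
      by (rule H.m_closed[OF H.m_inv_closed[OF a]]) (use x U(3) in blast)
    ultimately show ?thesis by simp
  qed
  ultimately show "\<exists>N. openin T N \<and> h \<in> N \<and> N \<subseteq> H" by blast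
qed

lemma representationD:
  assumes "representation G \<pi>"
  shows "csubspace (carrier \<pi>)" "g \<in> carrier G \<Longrightarrow> x \<in> carrier \<pi> \<Longrightarrow> act \<pi> g x \<in> carrier \<pi>"
    "g \<in> carrier G \<Longrightarrow> x \<in> carrier \<pi> \<Longrightarrow> y \<in> carrier \<pi> \<Longrightarrow> act \<pi> g (x + y) = act \<pi> g x + act \<pi> g y"
    "g \<in> carrier G \<Longrightarrow> x \<in> carrier \<pi> \<Longrightarrow> act \<pi> g (c *\<^sub>C x) = c *\<^sub>C act \<pi> g x"
    "x \<in> carrier \<pi> \<Longrightarrow> act \<pi> \<one>\<^bsub>G\<^esub> x = x"
    "g \<in> carrier G \<Longrightarrow> h \<in> carrier G \<Longrightarrow> x \<in> carrier \<pi> \<Longrightarrow> act \<pi> (g \<otimes>\<^bsub>G\<^esub> h) x = act \<pi> g (act \<pi> h x)"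
  using assms by (auto simp: representation_def)

lemma representation_act_zero: "representation G \<pi> \<Longrightarrow> g \<in> carrier G \<Longrightarrow> act \<pi> g 0 = 0"
  using representationD(4)[of G \<pi> g 0 0] complex_vector.subspace_0[OF representationD(1), of G \<pi>] by simp

lemma representation_inv_act:
  assumes "representation G \<pi>" "group G" "g \<in> carrier G" "x \<in> carrier \<pi>"
  shows "act \<pi> (inv\<^bsub>G\<^esub> g) (act \<pi> g x) = x" "act \<pi> g (act \<pi> (inv\<^bsub>G\<^esub> g) x) = x"
proof -
  interpret group G by fact
  show "act \<pi> (inv\<^bsub>G\<^esub> g) (act \<pi> g x) = x" "act \<pi> g (act \<pi> (inv\<^bsub>G\<^esub> g) x) = x"
    using representationD(5,6)[OF assms(1)] assms(3,4) by (metis inv_closed l_inv r_inv)+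
qed

lemma smooth_repD: "smooth_rep G T \<pi> \<Longrightarrow> representation G \<pi>"
  "smooth_rep G T \<pi> \<Longrightarrow> v \<in> carrier \<pi> \<Longrightarrow> openin T (stabilizer G \<pi> v)"
  by (auto simp: smooth_rep_def)

lemma stabilizer_subgroup:
  assumes "representation G \<pi>" "group G" "v \<in> carrier \<pi>"
  shows "subgroup (stabilizer G \<pi> v) G"
proof -
  interpret group G by fact
  show ?thesis
  proof
    show "inv\<^bsub>G\<^esub> x \<in> stabilizer G \<pi> v" if "x \<in> stabilizer G \<pi> v" for x
      using that representation_inv_act(1)[OF assms(1,2), of x v] assms(3)
      by (auto simp: stabilizer_def)
  qed (use assms representationD[OF assms(1)] in \<open>auto simp: stabilizer_def\<close>)
qed

text \<open>The action on \<open>v\<close> is constant on \<open>g\<close> times the stabilizer of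
  \<open>v\<close>, an open coset.\<close>

lemma smooth_act_locally_constant:
  assumes G: "topological_group G T" and \<pi>: "smooth_rep G T \<pi>" and v: "v \<in> carrier \<pi>"
  shows "locally_constant T (\<lambda>g. act \<pi> g v)"
  unfolding locally_constant_def
proof
  fix g assume "g \<in> topspace T"
  then have g: "g \<in> carrier G" by (simp add: topological_groupD(2)[OF G])
  interpret group G using G by (simp add: topological_group_def)
  let ?U = "{x \<in> topspace T. inv\<^bsub>G\<^esub> g \<otimes>\<^bsub>G\<^esub> x \<in> stabilizer G \<pi> v}"
  have "openin T ?U"
    using topological_groupD(3)[OF G inv_closed[OF g]] smooth_repD(2)[OF \<pi> v]
    by (rule openin_continuous_map_preimage)
  moreover have "g \<in> ?U"
    using g v representationD(5)[OF smooth_repD(1)[OF \<pi>] v] by (simp add: topological_groupD(2)[OF G] stabilizer_def)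
  moreover have "act \<pi> h v = act \<pi> g v" if "h \<in> ?U" for h
  proof -
    have h: "h \<in> carrier G" using that by (simp add: topological_groupD(2)[OF G])
    have "act \<pi> h v = act \<pi> (g \<otimes>\<^bsub>G\<^esub> (inv\<^bsub>G\<^esub> g \<otimes>\<^bsub>G\<^esub> h)) v" using g h by (simp add: m_assoc[symmetric])
    also have "\<dots> = act \<pi> g (act \<pi> (inv\<^bsub>G\<^esub> g \<otimes>\<^bsub>G\<^esub> h) v)"
      using g h v representationD(6)[OF smooth_repD(1)[OF \<pi>]] by simp
    finally show ?thesis using that by (simp add: stabilizer_def)
  qed
  ultimately show "\<exists>U. openin T U \<and> g \<in> U \<and> (\<forall>h\<in>U. act \<pi> h v = act \<pi> g v)" by blast
qed

lemma smooth_rep_restrict: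
  assumes G: "topological_group G T" and \<pi>: "smooth_rep G T \<pi>" and L: "subgroup L G"
    and E: "csubspace E" "E \<subseteq> carrier \<pi>" "\<And>g x. g \<in> L \<Longrightarrow> x \<in> E \<Longrightarrow> act \<pi> g x \<in> E"
  shows "smooth_rep (G\<lparr>carrier := L\<rparr>) (subtopology T L) (\<pi>\<lparr>carrier := E\<rparr>)"
proof -
  have LG: "L \<subseteq> carrier G" using L by (rule subgroup.subset)
  have "stabilizer (G\<lparr>carrier := L\<rparr>) (\<pi>\<lparr>carrier := E\<rparr>) v = stabilizer G \<pi> v \<inter> L" for v
    using LG by (auto simp: stabilizer_def)
  moreover have "representation (G\<lparr>carrier := L\<rparr>) (\<pi>\<lparr>carrier := E\<rparr>)"
    using smooth_repD(1)[OF \<pi>] E LG unfolding representation_def by (simp add: subset_iff)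
  ultimately show ?thesis
    using openin_subtopology_Int[OF smooth_repD(2)[OF \<pi> subsetD[OF E(2)]]] by (simp add: smooth_rep_def)
qed

text \<open>Unlike in \<open>lin_maps\<close>, nothing is asked off \<open>S\<close>. Group actions,
  evaluation at a point and the integral itself are linear on a subspace without being cut off
  outside it, and all of them are to be interchanged with integrals.\<close>

definition clinear_on :: "'v::complex_vector set \<Rightarrow> ('v \<Rightarrow> 'w::complex_vector) \<Rightarrow> bool" where
  "clinear_on S f \<longleftrightarrow> (\<forall>x\<in>S. \<forall>y\<in>S. f (x + y) = f x + f y) \<and> (\<forall>c. \<forall>x\<in>S. f (c *\<^sub>C x) = c *\<^sub>C f x)"

lemma clinear_on_lin_maps: "\<phi> \<in> lin_maps V W \<Longrightarrow> clinear_on V \<phi>"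
  by (auto simp: clinear_on_def lin_maps_def)

lemma clinear_on_act: "representation G \<pi> \<Longrightarrow> g \<in> carrier G \<Longrightarrow> clinear_on (carrier \<pi>) (act \<pi> g)"
  by (auto simp: clinear_on_def representation_def)

lemma clinear_on_apply: "clinear_on S (\<lambda>f. f x)"
  by (simp add: clinear_on_def scaleC_fun_def)

lemma clinear_on_sum:
  assumes S: "csubspace S" and f: "clinear_on S f" and x: "\<And>i. i \<in> I \<Longrightarrow> x i \<in> S"
  shows "f (\<Sum>i\<in>I. x i) = (\<Sum>i\<in>I. f (x i))"
  using x
proof (induction I rule: infinite_finite_induct)
  case (insert i I)
  then show ?case
    using f by (simp add: clinear_on_def complex_vector.subspace_sum[OF S])
next
  case empty
  have "f (0 *\<^sub>C 0) = 0 *\<^sub>C f 0" using f complex_vector.subspace_0[OF S] unfolding clinear_on_def by blast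
  then show ?case by simp
next
  case (infinite I)
  have "f (0 *\<^sub>C 0) = 0 *\<^sub>C f 0" using f complex_vector.subspace_0[OF S] unfolding clinear_on_def by blast
  then show ?case using infinite by simp
qed

section \<open>Integration of locally constant functions with compact support\<close>

locale haar_l_group =
  fixes G (structure) and T :: "'g topology" and M :: "'g measure"
  assumes l_group: "l_group G T" and haar: "haar_measure G T M"
begin

lemma topological: "topological_group G T" and hausdorff: "Hausdorff_space T"
  using l_group by (simp_all add: l_group_def)

sublocale group G
  using topological by (rule topological_groupD(1))

lemma top: "topspace T = carrier G"
  using topological by (rule topological_groupD(2))

lemmas haar_unfolded = haar[unfolded haar_measure_def]

lemma space_M: "space M = carrier G"
  by (rule haar_unfolded[THEN conjunct1])

lemma emeasure_translate: "g \<in> carrier G \<Longrightarrow> E \<in> sets M \<Longrightarrow> emeasure M (g <# E) = emeasure M E"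
  by (rule haar_unfolded[THEN conjunct2, THEN conjunct2, THEN conjunct1, rule_format])

lemma emeasure_compact: "compactin T C \<Longrightarrow> emeasure M C < \<infinity>"
  by (rule haar_unfolded[THEN conjunct2, THEN conjunct2, THEN conjunct2, THEN conjunct1, rule_format])

lemma emeasure_open: "openin T U \<Longrightarrow> U \<noteq> {} \<Longrightarrow> emeasure M U > 0"
  using haar_unfolded[THEN conjunct2, THEN conjunct2, THEN conjunct2, THEN conjunct2, THEN conjunct1] by blast

lemma sets_open: "openin T U \<Longrightarrow> U \<in> sets M"
  using haar_unfolded[THEN conjunct2, THEN conjunct1] by (simp add: sigma_sets.Basic)

lemma sets_compact: assumes "compactin T C" shows "C \<in> sets M"
proof -
  have "closedin T C" using compactin_imp_closedin[OF hausdorff assms] .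
  then have "C \<subseteq> carrier G" "carrier G - C \<in> sets M"
    using sets_open top by (auto simp: closedin_def)
  then show ?thesis using sets.compl_sets[of "carrier G - C" M] by (simp add: space_M double_diff)
qed

text \<open>For complex values these are the test functions of Bruhat and Schwartz on the group.
  Only a zero is asked of the value type, so that functions and operators are allowed as
  values.\<close>

definition cc :: "('g \<Rightarrow> 'v::zero) \<Rightarrow> bool" where
  "cc f \<longleftrightarrow> locally_constant T f \<and> (\<exists>C. compactin T C \<and> (\<forall>g\<in>carrier G - C. f g = 0))"

abbreviation integral :: "('g \<Rightarrow> 'v::real_vector) \<Rightarrow> 'v" where
  "integral \<equiv> Bochner_Integration.simple_bochner_integral M"

text \<open>Compact support and local constancy leave finitely many values, and the level sets are
  open, hence measurable.\<close>

lemma cc_integrable: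
  assumes "cc f"
  shows "Bochner_Integration.simple_bochner_integrable M f"
proof (rule Bochner_Integration.simple_bochner_integrable.intros)
  obtain C where C: "compactin T C" "\<And>g. g \<in> carrier G \<Longrightarrow> g \<notin> C \<Longrightarrow> f g = 0"
    and f: "locally_constant T f" using assms by (auto simp: cc_def)
  have level: "{x \<in> carrier G. P (f x)} \<in> sets M" for P
    using sets_open[OF locally_constant_openin_level[OF f, of P]] by (simp add: top)
  have "f ` space M \<subseteq> insert 0 (f ` C)" using C(2) by (auto simp: space_M)
  then have "finite (f ` space M)"
    using locally_constant_finite_image[OF f C(1)] by (meson finite_insert finite_subset)
  moreover have "f -` {y} \<inter> space M = {x \<in> carrier G. f x = y}" for y by (auto simp: space_M)
  ultimately show "simple_function M f" using level by (auto simp: simple_function_def)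
  have "{y \<in> space M. f y \<noteq> 0} \<subseteq> C" using C(2) by (auto simp: space_M)
  then have "emeasure M {y \<in> space M. f y \<noteq> 0} \<le> emeasure M C"
    by (rule emeasure_mono) (rule sets_compact[OF C(1)])
  then show "emeasure M {y \<in> space M. f y \<noteq> 0} \<noteq> \<infinity>" using emeasure_compact[OF C(1)] by auto
qed

lemma cc_simple:
  fixes f :: "'g \<Rightarrow> 'v::real_vector"
  shows "cc f \<Longrightarrow> simple_function M f"
  using cc_integrable[of f] by (simp add: Bochner_Integration.simple_bochner_integrable.simps)

lemma integral_cong: "(\<And>g. g \<in> carrier G \<Longrightarrow> f g = f' g) \<Longrightarrow> integral f = integral f'"
  unfolding Bochner_Integration.simple_bochner_integral_def space_M
  by (intro sum.cong image_cong arg_cong2[where f = "(*\<^sub>R)"] arg_cong[where f = "measure M"]) auto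

lemma cc_cong: "cc f \<Longrightarrow> (\<And>g. g \<in> carrier G \<Longrightarrow> f g = f' g) \<Longrightarrow> cc f'"
  unfolding cc_def using locally_constant_cong[of T f f'] top by (metis DiffD1)

lemma cc_comp: "cc f \<Longrightarrow> H 0 = 0 \<Longrightarrow> cc (\<lambda>g. H (f g))"
  unfolding cc_def by (metis locally_constant_comp)

lemma cc_bind:
  assumes "cc f" "\<And>g. g \<in> carrier G \<Longrightarrow> f g \<in> S"
    "\<And>y. y \<in> S \<Longrightarrow> locally_constant T (\<lambda>g. F g y)" "\<And>g. g \<in> carrier G \<Longrightarrow> F g 0 = 0"
  shows "cc (\<lambda>g. F g (f g))"
proof -
  obtain C where C: "compactin T C" "\<And>g. g \<in> carrier G - C \<Longrightarrow> f g = 0" and f: "locally_constant T f"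
    using assms(1) by (auto simp: cc_def)
  have "locally_constant T (\<lambda>g. F g (f g))"
    by (rule locally_constant_bind[OF f, of S]) (auto simp: top assms)
  moreover have "\<forall>g\<in>carrier G - C. F g (f g) = 0" using C(2) assms(4) by simp
  ultimately show ?thesis using C(1) by (auto simp: cc_def)
qed

lemma cc_add:
  fixes f f' :: "'g \<Rightarrow> 'v::monoid_add"
  assumes "cc f" "cc f'" shows "cc (\<lambda>g. f g + f' g)"
proof -
  obtain C C' where "compactin T C" "\<forall>g\<in>carrier G - C. f g = 0" "compactin T C'" "\<forall>g\<in>carrier G - C'. f' g = 0"
    using assms by (auto simp: cc_def)
  then show ?thesis
    using assms locally_constant_comp2[of T f f' "(+)"] compactin_Un[of T C C']
    unfolding cc_def by (intro conjI exI[of _ "C \<union> C'"]) auto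
qed

lemma cc_zero: "cc (\<lambda>g. 0)"
  unfolding cc_def using locally_constant_const[of T 0] compactin_empty[of T] by auto

lemma cc_sum: "(\<And>i. i \<in> I \<Longrightarrow> cc (f i)) \<Longrightarrow> cc (\<lambda>g. \<Sum>i\<in>I. f i g :: 'v::comm_monoid_add)"
  by (induction I rule: infinite_finite_induct) (simp_all add: cc_zero cc_add)

lemma compactin_translate:
  assumes "h \<in> carrier G" "compactin T C"
  shows "compactin T ((\<lambda>x. h \<otimes> x) ` C)"
  using image_compactin[OF assms(2) topological_groupD(3)[OF topological assms(1)]] .

lemma cc_translate:
  assumes "cc f" and h: "h \<in> carrier G"
  shows "cc (\<lambda>g. f (h \<otimes> g))"
proof -
  obtain C where C: "compactin T C" "\<And>g. g \<in> carrier G \<Longrightarrow> g \<notin> C \<Longrightarrow> f g = 0"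
    and f: "locally_constant T f" using assms by (auto simp: cc_def)
  have "f (h \<otimes> g) = 0" if "g \<in> carrier G - (\<lambda>x. inv h \<otimes> x) ` C" for g
  proof (rule C(2))
    show "h \<otimes> g \<notin> C"
    proof
      assume "h \<otimes> g \<in> C"
      then have "inv h \<otimes> (h \<otimes> g) \<in> (\<lambda>x. inv h \<otimes> x) ` C" by (rule imageI)
      then show False using that h by (simp add: m_assoc[symmetric])
    qed
  qed (use that h in simp)
  then show ?thesis
    using locally_constant_vimage[OF f topological_groupD(3)[OF topological h]]
      compactin_translate[OF inv_closed[OF h] C(1)] unfolding cc_def by blast
qed

lemma cc_extend:
  assumes "compactin T L" "openin T L" "locally_constant (subtopology T L) f"
  shows "cc (\<lambda>g. if g \<in> L then f g else 0)"
  using locally_constant_extend[OF assms(3,2) compactin_imp_closedin[OF hausdorff assms(1)], of 0] assms(1)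
  unfolding cc_def by (intro conjI exI[of _ L]) auto

lemma integral_add:
  "cc f \<Longrightarrow> cc f' \<Longrightarrow> integral (\<lambda>g. f g + f' g) = integral f + integral f'"
  by (rule Bochner_Integration.simple_bochner_integral_add) (auto intro: cc_integrable)

lemma integral_mem:
  assumes "csubspace S" "\<And>g. g \<in> carrier G \<Longrightarrow> f g \<in> S"
  shows "integral f \<in> S"
  unfolding Bochner_Integration.simple_bochner_integral_def space_M using assms
  by (intro complex_vector.subspace_sum) (auto intro: csubspace_scaleR)

text \<open>A non-injective \<open>\<phi>\<close> merges level sets of \<open>f\<close>. The
  partition formula nevertheless sums the integral of the composite over the values of
  \<open>f\<close>, where linearity of \<open>\<phi>\<close> on a finite sum suffices. Most
  interchanges of an integral with a linear operation below rest on this.\<close>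

lemma integral_clinear:
  assumes f: "cc f" "\<And>g. g \<in> carrier G \<Longrightarrow> f g \<in> S" and S: "csubspace S" and \<phi>: "clinear_on S \<phi>"
  shows "integral (\<lambda>g. \<phi> (f g)) = \<phi> (integral f)"
proof -
  have \<phi>0: "\<phi> 0 = 0"
    using \<phi> complex_vector.subspace_0[OF S] unfolding clinear_on_def by (metis complex_vector.scale_zero_left)
  have "integral (\<lambda>g. \<phi> (f g)) = (\<Sum>y\<in>f ` space M. measure M {x\<in>space M. f x = y} *\<^sub>R \<phi> y)"
    by (rule Bochner_Integration.simple_bochner_integral_partition)
      (auto intro: cc_integrable cc_comp[where H = \<phi>] f cc_simple \<phi>0)
  also have "\<dots> = \<phi> (integral f)"
    unfolding Bochner_Integration.simple_bochner_integral_def using \<phi> f(2)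
    by (subst clinear_on_sum[OF S \<phi>]) (auto simp: space_M clinear_on_def scaleR_scaleC complex_vector.subspace_scale[OF S] intro!: sum.cong)
  finally show ?thesis .
qed

lemma integral_scale: "cc f \<Longrightarrow> integral (\<lambda>g. c *\<^sub>C f g) = c *\<^sub>C integral f"
  by (rule integral_clinear[where S = UNIV])
    (auto simp: clinear_on_def complex_vector.subspace_UNIV complex_vector.scale_right_distrib complex_vector.scale_left_commute)

lemma integral_apply:
  fixes f :: "'g \<Rightarrow> 'x \<Rightarrow> 'v::complex_vector"
  shows "cc f \<Longrightarrow> integral f x = integral (\<lambda>g. f g x)"
  by (rule integral_clinear[where S = UNIV and \<phi> = "\<lambda>f. f x", symmetric])
    (simp_all add: complex_vector.subspace_UNIV clinear_on_apply)

lemma integral_zero: "integral (\<lambda>g. 0) = 0"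
  unfolding Bochner_Integration.simple_bochner_integral_def by (intro sum.neutral) auto

lemma integral_sum:
  "(\<And>i. i \<in> I \<Longrightarrow> cc (f i)) \<Longrightarrow> integral (\<lambda>g. \<Sum>i\<in>I. f i g) = (\<Sum>i\<in>I. integral (f i))"
  by (induction I rule: infinite_finite_induct) (simp_all add: integral_zero integral_add cc_sum)

text \<open>Translation by \<open>h\<close> carries the level sets of the translated function onto
  those of \<open>f\<close>, so by left invariance the finite sums agree term by term.\<close>

lemma integral_translate:
  assumes f: "cc f" and h: "h \<in> carrier G"
  shows "integral (\<lambda>g. f (h \<otimes> g)) = integral f"
proof -
  have hG: "(\<lambda>g. h \<otimes> g) ` carrier G = carrier G" using h surj_const_mult by blast
  have img: "(\<lambda>g. f (h \<otimes> g)) ` carrier G = f ` carrier G"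
    using hG by (metis image_image)
  have "measure M {g \<in> carrier G. f (h \<otimes> g) = y} = measure M {g \<in> carrier G. f g = y}" for y
  proof -
    let ?E = "{g \<in> carrier G. f (h \<otimes> g) = y}"
    have "?E \<in> sets M"
      using sets_open[OF locally_constant_openin_level[of T "\<lambda>g. f (h \<otimes> g)" "\<lambda>z. z = y"]] cc_translate[OF f h]
      by (simp add: top cc_def)
    moreover have "h <# ?E = {g \<in> carrier G. f g = y}"
    proof (intro equalityI subsetI)
      fix g assume "g \<in> {g \<in> carrier G. f g = y}"
      then have "inv h \<otimes> g \<in> ?E" "g = h \<otimes> (inv h \<otimes> g)" using h by (simp_all add: m_assoc[symmetric])
      then show "g \<in> h <# ?E" unfolding l_coset_def by blast
    qed (use h in \<open>auto simp: l_coset_def\<close>)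
    ultimately show ?thesis using emeasure_translate[OF h, of ?E] by (simp add: measure_def)
  qed
  then show ?thesis unfolding Bochner_Integration.simple_bochner_integral_def space_M img by simp
qed

lemma integral_indicator:
  assumes "compactin T L" "openin T L"
  shows "integral (\<lambda>g. if g \<in> L then c else 0) = measure M L *\<^sub>R c"
proof -
  have LG: "L \<subseteq> carrier G" using openin_subset[OF assms(2)] top by simp
  let ?f = "\<lambda>g. if g \<in> L then c else 0"
  have empty: "{x \<in> carrier G. ?f x = y} = {}" if "y \<notin> ?f ` carrier G" for y
    using that by blast
  \<comment> \<open>The set of values may be a proper subset of \<open>{c, 0}\<close>; a value that
    is not taken has an empty level set.\<close>
  have "integral ?f = (\<Sum>y\<in>{c, 0}. measure M {x\<in>carrier G. ?f x = y} *\<^sub>R y)"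
    unfolding Bochner_Integration.simple_bochner_integral_def space_M
  proof (rule sum.mono_neutral_left)
    show "\<forall>i\<in>{c, 0} - ?f ` carrier G. measure M {x \<in> carrier G. ?f x = i} *\<^sub>R i = 0"
      using empty by (metis (no_types, lifting) DiffD2 measure_empty scaleR_zero_left)
  qed auto
  also have "\<dots> = measure M L *\<^sub>R c"
  proof (cases "c = 0")
    case False
    then have "{x\<in>carrier G. ?f x = c} = L" using LG by auto
    then show ?thesis using False by simp
  qed simp
  finally show ?thesis .
qed

lemma measure_pos: "compactin T L \<Longrightarrow> openin T L \<Longrightarrow> L \<noteq> {} \<Longrightarrow> measure M L > 0"
  using emeasure_open[of L] emeasure_compact[of L] by (simp add: measure_def enn2real_positive_iff)

lemma csubspace_cc: "csubspace {f :: 'g \<Rightarrow> 'v::complex_vector. cc f}"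
  unfolding complex_vector.subspace_def
  using cc_zero cc_add cc_comp[where H = "\<lambda>x. _ *\<^sub>C x"]
  by (auto simp: zero_fun_def plus_fun_def scaleC_fun_def)

lemma clinear_on_integral: "clinear_on {f :: 'g \<Rightarrow> 'v::complex_vector. cc f} integral"
  by (simp add: clinear_on_def integral_add integral_scale plus_fun_def scaleC_fun_def)

text \<open>Fubini: \<^term>\<open>integral\<close> commutes with linear maps, and is itself a linear map on the space of
  locally constant functions with compact support; apply this to the function-valued integrand \<open>F\<close>.\<close>

lemma integral_swap:
  fixes F :: "'g \<Rightarrow> 'g \<Rightarrow> 'v::complex_vector"
  assumes F: "cc F" "\<And>g. g \<in> carrier G \<Longrightarrow> cc (F g)"
  shows "integral (\<lambda>g. integral (F g)) = integral (\<lambda>h. integral (\<lambda>g. F g h))"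
proof -
  have "integral (\<lambda>g. integral (F g)) = integral (integral F)"
    by (rule integral_clinear[OF F(1) _ csubspace_cc clinear_on_integral]) (simp add: F(2))
  also have "integral F = (\<lambda>h. integral (\<lambda>g. F g h))"
    using integral_apply[OF F(1)] by (intro ext)
  finally show ?thesis .
qed

end

section \<open>Intertwiners and averaging over compact open subgroups\<close>

lemma intertwinersD:
  assumes "\<phi> \<in> intertwiners G \<pi> \<sigma>"
  shows "\<phi> \<in> lin_maps (carrier \<pi>) (carrier \<sigma>)"
    "g \<in> carrier G \<Longrightarrow> x \<in> carrier \<pi> \<Longrightarrow> \<phi> (act \<pi> g x) = act \<sigma> g (\<phi> x)"
  using assms by (auto simp: intertwiners_def)

lemma intertwiners_mem: "\<phi> \<in> intertwiners G \<pi> \<sigma> \<Longrightarrow> x \<in> carrier \<pi> \<Longrightarrow> \<phi> x \<in> carrier \<sigma>"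
  by (rule lin_mapsD(1)[OF intertwinersD(1)])

lemma intertwinersI:
  "\<phi> \<in> lin_maps (carrier \<pi>) (carrier \<sigma>) \<Longrightarrow>
   (\<And>g x. g \<in> carrier G \<Longrightarrow> x \<in> carrier \<pi> \<Longrightarrow> \<phi> (act \<pi> g x) = act \<sigma> g (\<phi> x)) \<Longrightarrow> \<phi> \<in> intertwiners G \<pi> \<sigma>"
  by (auto simp: intertwiners_def)

lemma intertwiners_subgroup: "L \<subseteq> carrier G \<Longrightarrow> intertwiners G \<pi> \<sigma> \<subseteq> intertwiners (G\<lparr>carrier := L\<rparr>) \<pi> \<sigma>"
  by (auto simp: intertwiners_def)

lemma csubspace_intertwiners:
  assumes "representation G \<sigma>"
  shows "csubspace (intertwiners G \<pi> \<sigma>)"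
proof -
  note s = representationD(1)[OF assms]
  note l = csubspace_lin_maps[OF s, of "carrier \<pi>"]
  show ?thesis
    unfolding complex_vector.subspace_def
  proof (intro conjI ballI allI)
    show "0 \<in> intertwiners G \<pi> \<sigma>"
      using complex_vector.subspace_0[OF l] representation_act_zero[OF assms] by (auto simp: intertwiners_def)
    show "\<phi> + \<psi> \<in> intertwiners G \<pi> \<sigma>" if "\<phi> \<in> intertwiners G \<pi> \<sigma>" "\<psi> \<in> intertwiners G \<pi> \<sigma>" for \<phi> \<psi>
      using that complex_vector.subspace_add[OF l] representationD(3)[OF assms]
      by (auto simp: intertwiners_def lin_mapsD(1))
    show "c *\<^sub>C \<phi> \<in> intertwiners G \<pi> \<sigma>" if "\<phi> \<in> intertwiners G \<pi> \<sigma>" for c \<phi>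
      using that complex_vector.subspace_scale[OF l] representationD(4)[OF assms]
      by (auto simp: intertwiners_def lin_mapsD(1) scaleC_fun_def)
  qed
qed

lemma lin_maps_comp:
  assumes "\<phi> \<in> lin_maps U V" "\<psi> \<in> lin_maps V W"  "csubspace V"
  shows "(\<lambda>x. \<psi> (\<phi> x)) \<in> lin_maps U W"
  using lin_mapsD[OF assms(1)] lin_mapsD[OF assms(2)] lin_maps_zero[OF assms(3,2)]
  by (intro lin_mapsI) auto

lemma intertwiners_comp:
  assumes "\<phi> \<in> intertwiners G \<pi> \<sigma>" "\<psi> \<in> intertwiners G \<sigma> \<tau>" "representation G \<sigma>"
  shows "(\<lambda>x. \<psi> (\<phi> x)) \<in> intertwiners G \<pi> \<tau>"
  using lin_maps_comp[OF intertwinersD(1)[OF assms(1)] intertwinersD(1)[OF assms(2)] representationD(1)[OF assms(3)]]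
    intertwinersD(2)[OF assms(1)] intertwinersD(2)[OF assms(2)] intertwiners_mem[OF assms(1)]
  by (intro intertwinersI) auto

lemma intertwiner_nonzero:
  assumes "\<phi> \<in> intertwiners G \<pi> \<sigma>"
  shows "\<phi> \<noteq> 0 \<longleftrightarrow> (\<exists>x\<in>carrier \<pi>. \<phi> x \<noteq> 0)"
  using lin_mapsD(2)[OF intertwinersD(1)[OF assms]] by (auto simp: fun_eq_iff)

section \<open>Kernels, images and Schur's lemma\<close>

lemma irreducible_repD:
  assumes "irreducible_rep G \<pi>"
  shows "representation G \<pi>" "carrier \<pi> \<noteq> {0}"
    "csubspace U \<Longrightarrow> U \<subseteq> carrier \<pi> \<Longrightarrow> (\<And>g x. g \<in> carrier G \<Longrightarrow> x \<in> U \<Longrightarrow> act \<pi> g x \<in> U) \<Longrightarrow> U = {0} \<or> U = carrier \<pi>"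
  using assms by (auto simp: irreducible_rep_def)

lemma csubspace_kernel:
  "csubspace V \<Longrightarrow> \<phi> \<in> lin_maps V W \<Longrightarrow> csubspace {x \<in> V. \<phi> x = 0}"
  unfolding complex_vector.subspace_def
  using lin_maps_zero[of V \<phi> W] lin_mapsD(3,4)[of \<phi> V W] by (simp add: complex_vector.subspace_def)

lemma csubspace_image:
  assumes "csubspace V" "\<phi> \<in> lin_maps V W" "csubspace U" "U \<subseteq> V"
  shows "csubspace (\<phi> ` U)"
  unfolding complex_vector.subspace_def
proof (intro conjI ballI allI)
  show "0 \<in> \<phi> ` U"
    using lin_maps_zero[OF assms(1,2)] complex_vector.subspace_0[OF assms(3)] by (metis imageI)
  show "x + y \<in> \<phi> ` U" if xy: "x \<in> \<phi> ` U" "y \<in> \<phi> ` U" for x y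
  proof -
    obtain a b where "a \<in> U" "b \<in> U" "x = \<phi> a" "y = \<phi> b" using xy by blast
    then show ?thesis
      using lin_mapsD(3)[OF assms(2), of a b] complex_vector.subspace_add[OF assms(3), of a b] assms(4)
      by (metis imageI subsetD)
  qed
  show "c *\<^sub>C x \<in> \<phi> ` U" if x: "x \<in> \<phi> ` U" for c x
  proof -
    obtain a where "a \<in> U" "x = \<phi> a" using x by blast
    then show ?thesis
      using lin_mapsD(4)[OF assms(2), of a c] complex_vector.subspace_scale[OF assms(3), of a c] assms(4)
      by (metis imageI subsetD)
  qed
qed

lemma irreducible_injective:
  assumes \<pi>: "irreducible_rep G \<pi>" and \<sigma>: "representation G \<sigma>" and \<phi>: "\<phi> \<in> intertwiners G \<pi> \<sigma>" "\<phi> \<noteq> 0"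
  shows "inj_on \<phi> (carrier \<pi>)"
proof (rule inj_onI)
  note rep = irreducible_repD(1)[OF \<pi>]
  note s = representationD(1)[OF rep] and lin = intertwinersD(1)[OF \<phi>(1)]
  let ?D = "{x \<in> carrier \<pi>. \<phi> x = 0}"
  have "?D = {0} \<or> ?D = carrier \<pi>"
    by (rule irreducible_repD(3)[OF \<pi> csubspace_kernel[OF s lin]])
      (auto simp: intertwinersD(2)[OF \<phi>(1)] representationD(2)[OF rep] representation_act_zero[OF \<sigma>])
  then have D: "?D = {0}" using \<phi> intertwiner_nonzero by fastforce
  fix x y assume xy: "x \<in> carrier \<pi>" "y \<in> carrier \<pi>" "\<phi> x = \<phi> y"
  then have "x - y \<in> ?D" by (simp add: lin_maps_diff[OF s lin] complex_vector.subspace_diff[OF s])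
  then show "x = y" using D by simp
qed

lemma irreducible_surjective:
  assumes \<sigma>: "irreducible_rep G \<sigma>" and \<pi>: "representation G \<pi>" and \<phi>: "\<phi> \<in> intertwiners G \<pi> \<sigma>" "\<phi> \<noteq> 0"
  shows "\<phi> ` carrier \<pi> = carrier \<sigma>"
proof -
  note s = representationD(1)[OF \<pi>] and lin = intertwinersD(1)[OF \<phi>(1)]
  have "\<phi> ` carrier \<pi> = {0} \<or> \<phi> ` carrier \<pi> = carrier \<sigma>"
  proof (rule irreducible_repD(3)[OF \<sigma> csubspace_image[OF s lin s order_refl]])
    show "act \<sigma> g x \<in> \<phi> ` carrier \<pi>" if "g \<in> carrier G" "x \<in> \<phi> ` carrier \<pi>" for g x
      using that intertwinersD(2)[OF \<phi>(1)] representationD(2)[OF \<pi>] by (metis (no_types, lifting) imageE imageI)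
  qed (use intertwiners_mem[OF \<phi>(1)] in auto)
  then show ?thesis using \<phi> intertwiner_nonzero by fastforce
qed

section \<open>The smooth dual\<close>

lemma dual_rep_representation:
  assumes \<pi>: "representation G \<pi>" and G: "group G"
  shows "representation G (dual_rep G \<pi>)"
proof -
  interpret group G by fact
  note s = representationD(1)[OF \<pi>]
  have "act \<pi> (inv\<^bsub>G\<^esub> (g \<otimes>\<^bsub>G\<^esub> h)) x = act \<pi> (inv\<^bsub>G\<^esub> h) (act \<pi> (inv\<^bsub>G\<^esub> g) x)"
    if "g \<in> carrier G" "h \<in> carrier G" "x \<in> carrier \<pi>" for g h x
    using that representationD(6)[OF \<pi>] by (simp add: inv_mult_group)
  moreover have "\<xi> (c *\<^sub>C x) = c * \<xi> x" if "\<xi> \<in> lin_maps (carrier \<pi>) UNIV" "x \<in> carrier \<pi>" for \<xi> :: "_ \<Rightarrow> complex" and c x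
    using lin_mapsD(4)[OF that] by (simp add: scaleC_complex_def)
  moreover have "(\<lambda>v. if v \<in> carrier \<pi> then \<xi> (act \<pi> (inv\<^bsub>G\<^esub> g) v) else 0) \<in> lin_maps (carrier \<pi>) UNIV"
    if "\<xi> \<in> lin_maps (carrier \<pi>) UNIV" "g \<in> carrier G" for \<xi> :: "_ \<Rightarrow> complex" and g
    using lin_mapsD[OF that(1)] that(2) representationD[OF \<pi>]
    by (intro lin_mapsI) (auto simp: complex_vector.subspace_add[OF s] complex_vector.subspace_scale[OF s])
  ultimately show ?thesis
    using csubspace_lin_maps[OF complex_vector.subspace_UNIV, of "carrier \<pi>"] lin_mapsD(2) representationD(2,5)[OF \<pi>]
    unfolding representation_def dual_rep_def
    by (auto simp: fun_eq_iff scaleC_fun_def)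
qed

text \<open>The stabilizer of \<open>\<xi>\<close> in the linear dual is a subgroup, so an open
  neighbourhood \<open>U\<close> of the identity that fixes \<open>\<xi>\<close> makes it
  open.\<close>

lemma smooth_dualI:
  assumes G: "topological_group G T" and \<pi>: "representation G \<pi>" and \<xi>: "\<xi> \<in> lin_maps (carrier \<pi>) UNIV"
    and U: "openin T U" "\<one>\<^bsub>G\<^esub> \<in> U" "U \<subseteq> carrier G"
    and inv: "\<And>g v. g \<in> U \<Longrightarrow> v \<in> carrier \<pi> \<Longrightarrow> \<xi> (act \<pi> (inv\<^bsub>G\<^esub> g) v) = \<xi> v"
  shows "\<xi> \<in> carrier (smooth_dual G T \<pi>)"
proof -
  note gr = topological_groupD(1)[OF G]
  have \<xi>': "\<xi> \<in> carrier (dual_rep G \<pi>)" using \<xi> by (simp add: dual_rep_def)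
  have "U \<subseteq> stabilizer G (dual_rep G \<pi>) \<xi>"
    using U(3) inv lin_mapsD(2)[OF \<xi>] by (auto simp: stabilizer_def dual_rep_def fun_eq_iff)
  then have "openin T (stabilizer G (dual_rep G \<pi>) \<xi>)"
    by (rule openin_subgroup[OF G stabilizer_subgroup[OF dual_rep_representation[OF \<pi> gr] gr \<xi>'] U(1,2)])
  then show ?thesis using \<xi>' by (simp add: smooth_dual_def)
qed

text \<open>The stabilizers of a finite basis meet in an open set that fixes every vector, hence
  every functional.\<close>

lemma smooth_dual_finite_dim:
  assumes G: "topological_group G T" and \<pi>: "smooth_rep G T \<pi>" and fd: "finite_dim (carrier \<pi>)"
  shows "carrier (smooth_dual G T \<pi>) = lin_maps (carrier \<pi>) UNIV"
proof
  show "carrier (smooth_dual G T \<pi>) \<subseteq> lin_maps (carrier \<pi>) UNIV" by (auto simp: smooth_dual_def dual_rep_def)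
  note rep = smooth_repD(1)[OF \<pi>] and gr = topological_groupD(1)[OF G]
  note s = representationD(1)[OF rep]
  interpret group G by fact
  obtain B where B: "finite B" "B \<subseteq> carrier \<pi>" "\<not> cdependent B" "cspan B = carrier \<pi>"
    using finite_dim_basis[OF s fd] by metis
  let ?U = "topspace T \<inter> \<Inter>(stabilizer G \<pi> ` B)"
  have U: "openin T ?U"
    using B(1,2) smooth_repD(2)[OF \<pi>] by (induction B) (auto simp: Int_left_commute[of "topspace T"] intro: openin_Int)
  have sub: "?U \<subseteq> carrier G" using topological_groupD(2)[OF G] by auto
  have one: "\<one>\<^bsub>G\<^esub> \<in> ?U"
    using B(2) representationD(5)[OF rep] topological_groupD(2)[OF G] by (auto simp: stabilizer_def)
  have fixed: "act \<pi> g v = v" if g: "g \<in> ?U" and v: "v \<in> carrier \<pi>" for g v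
  proof -
    have "v \<in> cspan B" using v B by simp
    then have "v \<in> carrier \<pi> \<and> act \<pi> g v = v"
    proof (induction rule: complex_vector.span_induct_alt)
      case base
      then show ?case using representation_act_zero[OF rep] complex_vector.subspace_0[OF s] g sub by blast
    next
      case (step c x y)
      then have "x \<in> carrier \<pi>" "act \<pi> g x = x" using g B(2) by (auto simp: stabilizer_def)
      then show ?case
        using step g sub representationD(3,4)[OF rep]
        by (simp add: complex_vector.subspace_add[OF s] complex_vector.subspace_scale[OF s] subset_iff)
    qed
    then show ?thesis ..
  qed
  show "lin_maps (carrier \<pi>) UNIV \<subseteq> carrier (smooth_dual G T \<pi>)"
  proof
    fix \<xi> :: "_ \<Rightarrow> complex" assume \<xi>: "\<xi> \<in> lin_maps (carrier \<pi>) UNIV"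
    show "\<xi> \<in> carrier (smooth_dual G T \<pi>)"
    proof (rule smooth_dualI[OF G rep \<xi> U one sub])
      fix g v assume "g \<in> ?U" and v: "v \<in> carrier \<pi>"
      then have "act \<pi> g v = v" "g \<in> carrier G" using fixed sub by blast+
      then show "\<xi> (act \<pi> (inv\<^bsub>G\<^esub> g) v) = \<xi> v" using representation_inv_act(1)[OF rep gr _ v] by metis
    qed
  qed
qed

text \<open>The orbit of a vector is the image of a compact set under a locally constant map, hence
  finite, and its span is invariant.\<close>

lemma compact_irreducible_finite_dim:
  assumes G: "topological_group G T" and c: "compactin T (carrier G)" and \<pi>: "smooth_irrep G T \<pi>"
  shows "finite_dim (carrier \<pi>)"
proof -
  have sm: "smooth_rep G T \<pi>" and irr: "irreducible_rep G \<pi>" using \<pi> by (auto simp: smooth_irrep_def)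
  note rep = smooth_repD(1)[OF sm] and gr = topological_groupD(1)[OF G]
  note s = representationD(1)[OF rep]
  interpret group G by fact
  obtain v where v: "v \<in> carrier \<pi>" "v \<noteq> 0"
    using irreducible_repD(2)[OF irr] complex_vector.subspace_0[OF s] by blast
  let ?O = "(\<lambda>g. act \<pi> g v) ` carrier G"
  have fin: "finite ?O" by (rule locally_constant_finite_image[OF smooth_act_locally_constant[OF G sm v(1)] c])
  have OV: "?O \<subseteq> carrier \<pi>" using v representationD(2)[OF rep] by blast
  have sp: "cspan ?O \<subseteq> carrier \<pi>" using OV s by (rule complex_vector.span_minimal)
  have "x \<in> carrier \<pi> \<and> act \<pi> g x \<in> cspan ?O" if g: "g \<in> carrier G" and x: "x \<in> cspan ?O" for g x
    using x
  proof (induction rule: complex_vector.span_induct_alt)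
    case base
    then show ?case using representation_act_zero[OF rep g]
      by (simp add: complex_vector.span_zero complex_vector.subspace_0[OF s])
  next
    case (step c x y)
    then obtain h where h: "h \<in> carrier G" "x = act \<pi> h v" by blast
    have gx: "act \<pi> g x \<in> ?O" using representationD(6)[OF rep g h(1) v(1)] g h by (metis image_eqI m_closed)
    have xy: "x \<in> carrier \<pi>" "y \<in> carrier \<pi>" using step OV by auto
    then have "act \<pi> g (c *\<^sub>C x + y) = c *\<^sub>C act \<pi> g x + act \<pi> g y"
      using g by (simp add: representationD(3,4)[OF rep] complex_vector.subspace_scale[OF s])
    moreover have "c *\<^sub>C x + y \<in> carrier \<pi>"
      using xy by (intro complex_vector.subspace_add[OF s] complex_vector.subspace_scale[OF s])
    moreover have "c *\<^sub>C act \<pi> g x + act \<pi> g y \<in> cspan ?O"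
      by (rule complex_vector.span_add[OF complex_vector.span_scale[OF complex_vector.span_base[OF gx]]]) (use step in blast)
    ultimately show ?case by simp
  qed
  moreover have "v \<in> ?O" using representationD(5)[OF rep v(1)] by (metis image_eqI one_closed)
  then have "v \<in> cspan ?O" by (rule complex_vector.span_base)
  then have "cspan ?O \<noteq> {0}" using v(2) by auto
  ultimately have "cspan ?O = carrier \<pi>"
    using irreducible_repD(3)[OF irr complex_vector.subspace_span sp] by metis
  then show ?thesis using fin by (auto simp: finite_dim_def)
qed

section \<open>Averaging over a compact open subgroup\<close>

context haar_l_group
begin

lemma compact_open_subgroupD:
  assumes "compact_open_subgroup G T L"
  shows "subgroup L G" "compactin T L" "openin T L" "L \<subseteq> carrier G" "\<one> \<in> L"
    "topological_group (G\<lparr>carrier := L\<rparr>) (subtopology T L)" "measure M L > 0"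
    "x \<in> L \<Longrightarrow> y \<in> L \<Longrightarrow> x \<otimes> y \<in> L" "x \<in> L \<Longrightarrow> inv x \<in> L"
proof -
  show L: "subgroup L G" "compactin T L" "openin T L" using assms by (auto simp: compact_open_subgroup_def)
  interpret L: subgroup L G by fact
  show "L \<subseteq> carrier G" "\<one> \<in> L" "x \<in> L \<Longrightarrow> y \<in> L \<Longrightarrow> x \<otimes> y \<in> L" "x \<in> L \<Longrightarrow> inv x \<in> L" by auto
  show "topological_group (G\<lparr>carrier := L\<rparr>) (subtopology T L)"
    by (rule topological_group_subgroup[OF topological L(1)])
  show "measure M L > 0" using measure_pos[OF L(2,3)] L.one_closed by blast
qed

text \<open>The operator that sends \<open>s\<close> to the integral over \<open>L\<close> of
  \<sigma>(g) s \<pi>(g)^-1, left unnormalized: on maps that already commute with \<open>L\<close>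
  it is multiplication by the volume of \<open>L\<close>. Cutting the integrand off outside
  \<open>L\<close> makes this an integral over the whole group, to which left translation
  applies.\<close>

definition average ::
    "'g set \<Rightarrow> ('g, 'v::complex_vector) rep \<Rightarrow> ('g, 'w::complex_vector) rep \<Rightarrow> ('v \<Rightarrow> 'w) \<Rightarrow> 'v \<Rightarrow> 'w" where
  "average L \<pi> \<sigma> s v = (if v \<in> carrier \<pi>
     then integral (\<lambda>g. if g \<in> L then act \<sigma> g (s (act \<pi> (inv g) v)) else 0) else 0)"

abbreviation smooth_on :: "'g set \<Rightarrow> ('g, 'v::complex_vector) rep \<Rightarrow> bool" where
  "smooth_on L \<equiv> smooth_rep (G\<lparr>carrier := L\<rparr>) (subtopology T L)"

abbreviation hom_on :: "'g set \<Rightarrow> ('g, 'v::complex_vector) rep \<Rightarrow> ('g, 'w::complex_vector) rep \<Rightarrow> ('v \<Rightarrow> 'w) set" where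
  "hom_on L \<equiv> intertwiners (G\<lparr>carrier := L\<rparr>)"

context
  fixes L assumes L: "compact_open_subgroup G T L"
begin

lemma smooth_onD:
  assumes "smooth_on L \<pi>"
  shows "representation (G\<lparr>carrier := L\<rparr>) \<pi>" "csubspace (carrier \<pi>)"
    "g \<in> L \<Longrightarrow> x \<in> carrier \<pi> \<Longrightarrow> act \<pi> g x \<in> carrier \<pi>"
    "x \<in> carrier \<pi> \<Longrightarrow> act \<pi> \<one> x = x"
    "g \<in> L \<Longrightarrow> h \<in> L \<Longrightarrow> x \<in> carrier \<pi> \<Longrightarrow> act \<pi> (g \<otimes> h) x = act \<pi> g (act \<pi> h x)"
    "g \<in> L \<Longrightarrow> clinear_on (carrier \<pi>) (act \<pi> g)"
    "g \<in> L \<Longrightarrow> x \<in> carrier \<pi> \<Longrightarrow> act \<pi> (inv g) (act \<pi> g x) = x"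
    "g \<in> L \<Longrightarrow> x \<in> carrier \<pi> \<Longrightarrow> act \<pi> g (act \<pi> (inv g) x) = x"
    "g \<in> L \<Longrightarrow> act \<pi> g 0 = 0"
proof -
  show rep: "representation (G\<lparr>carrier := L\<rparr>) \<pi>" by (rule smooth_repD(1)[OF assms])
  note D = compact_open_subgroupD[OF L]
  note m = m_inv_consistent[OF D(1)]
  show "csubspace (carrier \<pi>)"
    "g \<in> L \<Longrightarrow> x \<in> carrier \<pi> \<Longrightarrow> act \<pi> g x \<in> carrier \<pi>"
    "x \<in> carrier \<pi> \<Longrightarrow> act \<pi> \<one> x = x"
    "g \<in> L \<Longrightarrow> h \<in> L \<Longrightarrow> x \<in> carrier \<pi> \<Longrightarrow> act \<pi> (g \<otimes> h) x = act \<pi> g (act \<pi> h x)"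
    "g \<in> L \<Longrightarrow> clinear_on (carrier \<pi>) (act \<pi> g)"
    "g \<in> L \<Longrightarrow> x \<in> carrier \<pi> \<Longrightarrow> act \<pi> (inv g) (act \<pi> g x) = x"
    "g \<in> L \<Longrightarrow> x \<in> carrier \<pi> \<Longrightarrow> act \<pi> g (act \<pi> (inv g) x) = x"
    "g \<in> L \<Longrightarrow> act \<pi> g 0 = 0"
    using representationD[OF rep] clinear_on_act[OF rep] representation_act_zero[OF rep]
      representation_inv_act[OF rep topological_groupD(1)[OF D(6)]]
    by (simp_all add: m)
qed

lemma smooth_on_locally_constant:
  assumes "smooth_on L \<pi>" "v \<in> carrier \<pi>"
  shows "locally_constant (subtopology T L) (\<lambda>g. act \<pi> g v)"
    "locally_constant (subtopology T L) (\<lambda>g. act \<pi> (inv g) v)"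
proof -
  note D = compact_open_subgroupD[OF L]
  show 1: "locally_constant (subtopology T L) (\<lambda>g. act \<pi> g v)"
    by (rule smooth_act_locally_constant[OF D(6) assms])
  show "locally_constant (subtopology T L) (\<lambda>g. act \<pi> (inv g) v)"
    by (rule locally_constant_cong[OF locally_constant_vimage[OF 1 topological_groupD(5)[OF D(6)]]])
      (simp add: m_inv_consistent[OF D(1)])
qed

lemma average_cc:
  assumes \<pi>: "smooth_on L \<pi>" and \<sigma>: "smooth_on L \<sigma>"
    and s: "\<And>x. x \<in> carrier \<pi> \<Longrightarrow> s x \<in> carrier \<sigma>" and v: "v \<in> carrier \<pi>"
  shows "cc (\<lambda>g. if g \<in> L then act \<sigma> g (s (act \<pi> (inv g) v)) else 0)"
proof (rule cc_extend)
  note D = compact_open_subgroupD[OF L]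
  show "compactin T L" "openin T L" by (fact D)+
  show "locally_constant (subtopology T L) (\<lambda>g. act \<sigma> g (s (act \<pi> (inv g) v)))"
    by (rule locally_constant_bind[where S = "carrier \<sigma>" and f = "\<lambda>g. s (act \<pi> (inv g) v)" and F = "act \<sigma>"])
      (auto intro: locally_constant_comp smooth_on_locally_constant[OF \<pi> v] smooth_on_locally_constant[OF \<sigma>]
        s smooth_onD(3)[OF \<pi> _ v] D(9))
qed

lemma average_apply:
  "v \<in> carrier \<pi> \<Longrightarrow> average L \<pi> \<sigma> s v = integral (\<lambda>g. if g \<in> L then act \<sigma> g (s (act \<pi> (inv g) v)) else 0)"
  by (simp add: average_def)

lemma average_intertwiner:
  assumes \<pi>: "smooth_on L \<pi>" and \<sigma>: "smooth_on L \<sigma>" and s: "s \<in> lin_maps (carrier \<pi>) (carrier \<sigma>)"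
  shows "average L \<pi> \<sigma> s \<in> hom_on L \<pi> \<sigma>"
proof (rule intertwinersI)
  note D = compact_open_subgroupD[OF L]
  note sD = lin_mapsD[OF s]
  note S = smooth_onD(2)[OF \<sigma>]
  let ?F = "\<lambda>v g. if g \<in> L then act \<sigma> g (s (act \<pi> (inv g) v)) else 0"
  have F: "cc (?F v)" if "v \<in> carrier \<pi>" for v using average_cc[OF \<pi> \<sigma> sD(1) that] .
  have mem: "?F v g \<in> carrier \<sigma>" if "v \<in> carrier \<pi>" for v g
    using that by (simp add: sD(1) smooth_onD(3)[OF \<pi>] smooth_onD(3)[OF \<sigma>] D(9) complex_vector.subspace_0[OF S])
  have add: "?F (x + y) = (\<lambda>g. ?F x g + ?F y g)" if "x \<in> carrier \<pi>" "y \<in> carrier \<pi>" for x y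
    using that sD(1,3) smooth_onD(3,6)[OF \<pi>] smooth_onD(3,6)[OF \<sigma>] D(9) by (auto simp: fun_eq_iff clinear_on_def)
  have scale: "?F (c *\<^sub>C x) = (\<lambda>g. c *\<^sub>C ?F x g)" if "x \<in> carrier \<pi>" for x c
    using that sD(1,4) smooth_onD(3,6)[OF \<pi>] smooth_onD(3,6)[OF \<sigma>] D(9) by (auto simp: fun_eq_iff clinear_on_def)
  show "average L \<pi> \<sigma> s \<in> lin_maps (carrier \<pi>) (carrier \<sigma>)"
  proof (rule lin_mapsI)
    show "average L \<pi> \<sigma> s x \<in> carrier \<sigma>" if "x \<in> carrier \<pi>" for x
      unfolding average_apply[OF that] using mem[OF that] by (intro integral_mem[OF S])
    show "average L \<pi> \<sigma> s x = 0" if "x \<notin> carrier \<pi>" for x using that by (simp add: average_def)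
    show "average L \<pi> \<sigma> s (x + y) = average L \<pi> \<sigma> s x + average L \<pi> \<sigma> s y"
      if "x \<in> carrier \<pi>" "y \<in> carrier \<pi>" for x y
      using that by (simp add: average_apply complex_vector.subspace_add[OF smooth_onD(2)[OF \<pi>]] add integral_add F
          del: if_distrib)
    show "average L \<pi> \<sigma> s (c *\<^sub>C x) = c *\<^sub>C average L \<pi> \<sigma> s x" if "x \<in> carrier \<pi>" for x c
      unfolding average_apply[OF that] average_apply[OF complex_vector.subspace_scale[OF smooth_onD(2)[OF \<pi>] that]]
        scale[OF that] by (rule integral_scale[OF F[OF that]])
  qed
  fix h x assume h: "h \<in> carrier (G\<lparr>carrier := L\<rparr>)" and x: "x \<in> carrier \<pi>"
  then have hL: "h \<in> L" and hG: "h \<in> carrier G" using D(4) by auto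
  note hx = smooth_onD(3)[OF \<pi> hL x]
  \<comment> \<open>The identity behind the change of variable: (h g)^-1 h = g^-1, and left
    translation by \<open>h\<close> preserves both \<open>L\<close> and its complement.\<close>
  have eq: "?F (act \<pi> h x) (h \<otimes> g) = act \<sigma> h (?F x g)" if g: "g \<in> carrier G" for g
  proof (cases "g \<in> L")
    case True
    have "act \<pi> (inv (h \<otimes> g)) (act \<pi> h x) = act \<pi> (inv g) (act \<pi> (inv h) (act \<pi> h x))"
      using True hL hG g hx D(9) smooth_onD(5)[OF \<pi>, of "inv g" "inv h"] by (simp add: inv_mult_group)
    then show ?thesis using True hL D(8,9) x
      by (simp add: smooth_onD(7)[OF \<pi>] smooth_onD(5)[OF \<sigma>] sD(1) smooth_onD(3)[OF \<pi>])
  next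
    case False
    have "h \<otimes> g \<notin> L"
    proof
      assume "h \<otimes> g \<in> L"
      then have "inv h \<otimes> (h \<otimes> g) \<in> L" using D(8,9) hL by blast
      then show False using False hG g by (simp add: m_assoc[symmetric])
    qed
    then show ?thesis using False by (simp add: smooth_onD(9)[OF \<sigma> hL])
  qed
  have "average L \<pi> \<sigma> s (act \<pi> h x) = integral (?F (act \<pi> h x))" by (rule average_apply[OF hx])
  also have "\<dots> = integral (\<lambda>g. ?F (act \<pi> h x) (h \<otimes> g))" by (rule integral_translate[OF F[OF hx] hG, symmetric])
  also have "\<dots> = integral (\<lambda>g. act \<sigma> h (?F x g))" by (rule integral_cong) (rule eq)
  also have "\<dots> = act \<sigma> h (integral (?F x))"
    by (rule integral_clinear[OF F[OF x] mem[OF x] S smooth_onD(6)[OF \<sigma> hL]])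
  finally show "average L \<pi> \<sigma> s (act \<pi> h x) = act \<sigma> h (average L \<pi> \<sigma> s x)" by (simp only: average_apply[OF x])
qed

lemma average_post:
  assumes \<pi>: "smooth_on L \<pi>" and \<sigma>: "smooth_on L \<sigma>" and s: "s \<in> lin_maps (carrier \<pi>) (carrier \<sigma>)"
    and \<theta>: "\<theta> \<in> hom_on L \<sigma> \<tau>" and v: "v \<in> carrier \<pi>"
  shows "\<theta> (average L \<pi> \<sigma> s v) = average L \<pi> \<tau> (\<lambda>x. \<theta> (s x)) v"
proof -
  note D = compact_open_subgroupD[OF L]
  note lin = intertwinersD(1)[OF \<theta>]
  let ?F = "\<lambda>g. if g \<in> L then act \<sigma> g (s (act \<pi> (inv g) v)) else 0"
  have mem: "s (act \<pi> (inv g) v) \<in> carrier \<sigma>" if "g \<in> L" for g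
    using lin_mapsD(1)[OF s] smooth_onD(3)[OF \<pi> D(9)[OF that] v] by blast
  have "\<theta> (average L \<pi> \<sigma> s v) = integral (\<lambda>g. \<theta> (?F g))"
    unfolding average_apply[OF v]
    by (rule integral_clinear[OF average_cc[OF \<pi> \<sigma> lin_mapsD(1)[OF s] v] _ smooth_onD(2)[OF \<sigma>] clinear_on_lin_maps[OF lin], symmetric])
      (simp_all add: mem smooth_onD(3)[OF \<sigma>] complex_vector.subspace_0[OF smooth_onD(2)[OF \<sigma>]])
  also have "\<dots> = average L \<pi> \<tau> (\<lambda>x. \<theta> (s x)) v"
    unfolding average_apply[OF v] using intertwinersD(2)[OF \<theta>] mem lin_maps_zero[OF smooth_onD(2)[OF \<sigma>] lin]
    by (intro integral_cong) simp
  finally show ?thesis .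
qed

lemma average_pre:
  assumes \<eta>: "\<eta> \<in> hom_on L \<pi>' \<pi>" and \<pi>': "smooth_on L \<pi>'" and v: "v \<in> carrier \<pi>'"
  shows "average L \<pi> \<sigma> s (\<eta> v) = average L \<pi>' \<sigma> (\<lambda>x. s (\<eta> x)) v"
  unfolding average_apply[OF v] average_apply[OF intertwiners_mem[OF \<eta> v]]
  using intertwinersD(2)[OF \<eta>] compact_open_subgroupD(9)[OF L] v by (intro integral_cong) simp

lemma average_id:
  assumes \<pi>: "smooth_on L \<pi>" and s: "\<And>x. x \<in> carrier \<pi> \<Longrightarrow> s x = x" and v: "v \<in> carrier \<pi>"
  shows "average L \<pi> \<pi> s v = measure M L *\<^sub>R v"
proof -
  note D = compact_open_subgroupD[OF L]
  have "average L \<pi> \<pi> s v = integral (\<lambda>g. if g \<in> L then v else 0)"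
    unfolding average_apply[OF v] using smooth_onD(3)[OF \<pi> D(9) v]
    by (intro integral_cong) (simp add: s smooth_onD(8)[OF \<pi> _ v])
  then show ?thesis using integral_indicator[OF D(2,3)] by simp
qed

lemma average_scaled:
  assumes \<pi>: "smooth_on L \<pi>" and \<sigma>: "smooth_on L \<sigma>" and s: "s \<in> lin_maps (carrier \<pi>) (carrier \<sigma>)"
  shows "complex_of_real (1 / measure M L) *\<^sub>C average L \<pi> \<sigma> s \<in> hom_on L \<pi> \<sigma>"
  by (intro complex_vector.subspace_scale[OF csubspace_intertwiners] smooth_onD(1)[OF \<sigma>] average_intertwiner[OF assms])

text \<open>Maschke's argument: a linear section exists, averaging commutes with composition by the
  \<open>L\<close>-map \<open>\<theta>\<close>, and the average of the identity is the volume of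
  \<open>L\<close>, which is divided out.\<close>

lemma hom_on_right_inverse:
  assumes \<sigma>: "smooth_on L \<sigma>" and \<tau>: "smooth_on L \<tau>" and \<theta>: "\<theta> \<in> hom_on L \<sigma> \<tau>" and onto: "carrier \<tau> \<subseteq> \<theta> ` carrier \<sigma>"
  obtains s where "s \<in> hom_on L \<tau> \<sigma>" "\<And>y. y \<in> carrier \<tau> \<Longrightarrow> \<theta> (s y) = y"
proof -
  note lin = intertwinersD(1)[OF \<theta>]
  note pos = compact_open_subgroupD(7)[OF L]
  obtain s where s: "s \<in> lin_maps (carrier \<tau>) (carrier \<sigma>)" "\<And>y. y \<in> carrier \<tau> \<Longrightarrow> \<theta> (s y) = y"
    using lin_right_inverse[OF smooth_onD(2)[OF \<sigma>] smooth_onD(2)[OF \<tau>] lin onto] by metis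
  show ?thesis
  proof (rule that[OF average_scaled[OF \<tau> \<sigma> s(1)]])
    fix y assume y: "y \<in> carrier \<tau>"
    have "\<theta> ((complex_of_real (1 / measure M L) *\<^sub>C average L \<tau> \<sigma> s) y) =
       complex_of_real (1 / measure M L) *\<^sub>C \<theta> (average L \<tau> \<sigma> s y)"
      unfolding scaleC_fun_def by (rule lin_mapsD(4)[OF lin intertwiners_mem[OF average_intertwiner[OF \<tau> \<sigma> s(1)] y]])
    also have "\<theta> (average L \<tau> \<sigma> s y) = measure M L *\<^sub>R y"
      unfolding average_post[OF \<tau> \<sigma> s(1) \<theta> y] by (rule average_id[OF \<tau> s(2) y])
    finally show "\<theta> ((complex_of_real (1 / measure M L) *\<^sub>C average L \<tau> \<sigma> s) y) = y"
      using pos by (simp add: scaleR_scaleC scaleC_scaleC scaleC_one flip: of_real_mult)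
  qed
qed

text \<open>The counterpart for retractions: here \<open>\<eta>\<close> passes through the average
  on the source side.\<close>

lemma hom_on_left_inverse:
  assumes \<sigma>: "smooth_on L \<sigma>" and \<tau>: "smooth_on L \<tau>" and \<eta>: "\<eta> \<in> hom_on L \<sigma> \<tau>" and inj: "inj_on \<eta> (carrier \<sigma>)"
  obtains s where "s \<in> hom_on L \<tau> \<sigma>" "\<And>x. x \<in> carrier \<sigma> \<Longrightarrow> s (\<eta> x) = x"
proof -
  note lin = intertwinersD(1)[OF \<eta>]
  note pos = compact_open_subgroupD(7)[OF L]
  obtain s where s: "s \<in> lin_maps (carrier \<tau>) (carrier \<sigma>)" "\<And>x. x \<in> carrier \<sigma> \<Longrightarrow> s (\<eta> x) = x"
    using lin_left_inverse[OF smooth_onD(2)[OF \<sigma>] smooth_onD(2)[OF \<tau>] lin inj] by metis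
  show ?thesis
  proof (rule that[OF average_scaled[OF \<tau> \<sigma> s(1)]])
    fix x assume x: "x \<in> carrier \<sigma>"
    have "average L \<tau> \<sigma> s (\<eta> x) = measure M L *\<^sub>R x"
      unfolding average_pre[OF \<eta> \<sigma> x] by (rule average_id[OF \<sigma> s(2) x])
    then show "(complex_of_real (1 / measure M L) *\<^sub>C average L \<tau> \<sigma> s) (\<eta> x) = x"
      using pos by (simp add: scaleC_fun_def scaleR_scaleC scaleC_scaleC scaleC_one flip: of_real_mult)
  qed
qed

end

lemma smooth_on_restrict:
  assumes "smooth_rep G T \<pi>" "compact_open_subgroup G T L"
  shows "smooth_on L \<pi>"
proof -
  note D = compact_open_subgroupD[OF assms(2)] and rep = smooth_repD(1)[OF assms(1)]
  have "smooth_on L (\<pi>\<lparr>carrier := carrier \<pi>\<rparr>)"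
    using representationD(1,2)[OF rep] D(4)
    by (intro smooth_rep_restrict[OF topological assms(1) D(1)]) auto
  then show ?thesis by simp
qed

text \<open>As \<open>K\<close> is closed under inverses, the condition is symmetric in
  \<open>x\<close> and \<open>y\<close>. So \<open>x\<close> ranges over a left coset of
  \<open>K\<close>, and left invariance gives its volume.\<close>

lemma integral_coset:
  assumes K: "compact_open_subgroup G T K" and y: "y \<in> carrier G"
  shows "integral (\<lambda>x. if inv x \<otimes> y \<in> K then c else 0) = measure M K *\<^sub>R c"
proof -
  note D = compact_open_subgroupD[OF K]
  have cc: "cc (\<lambda>x. if x \<in> K then c else 0)" by (rule cc_extend[OF D(2,3) locally_constant_const])
  have "inv x \<otimes> y \<in> K \<longleftrightarrow> inv y \<otimes> x \<in> K" if x: "x \<in> carrier G" for x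
    using D(9)[of "inv x \<otimes> y"] D(9)[of "inv y \<otimes> x"] x y by (auto simp: inv_mult_group)
  then have "integral (\<lambda>x. if inv x \<otimes> y \<in> K then c else 0) = integral (\<lambda>x. if inv y \<otimes> x \<in> K then c else 0)"
    by (intro integral_cong) simp
  also have "\<dots> = integral (\<lambda>x. if x \<in> K then c else 0)" by (rule integral_translate[OF cc inv_closed[OF y]])
  finally show ?thesis using integral_indicator[OF D(2,3)] by simp
qed

text \<open>The stabilizer is closed as well as open, its complement being a union of level sets of
  a locally constant map; intersecting with \<open>L\<close> supplies compactness.\<close>

lemma compact_open_stabilizer:
  assumes L: "compact_open_subgroup G T L" and \<pi>: "smooth_rep G T \<pi>" and v: "v \<in> carrier \<pi>"
  shows "compact_open_subgroup G T (L \<inter> stabilizer G \<pi> v)"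
proof -
  note D = compact_open_subgroupD[OF L]
  have eq: "stabilizer G \<pi> v = topspace T - {g \<in> topspace T. act \<pi> g v \<noteq> v}" by (auto simp: stabilizer_def top)
  have "openin T {g \<in> topspace T. act \<pi> g v \<noteq> v}"
    by (rule locally_constant_openin_level[OF smooth_act_locally_constant[OF topological \<pi> v]])
  then have "closedin T (stabilizer G \<pi> v)" unfolding eq by blast
  then have "compactin T (L \<inter> stabilizer G \<pi> v)" using D(2) compact_Int_closedin by blast
  moreover have "subgroup (L \<inter> stabilizer G \<pi> v) G"
    by (rule subgroups_Inter_pair[OF D(1) stabilizer_subgroup[OF smooth_repD(1)[OF \<pi>] is_group v]])
  ultimately show ?thesis
    using D(3) smooth_repD(2)[OF \<pi> v] by (auto simp: compact_open_subgroup_def)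
qed

text \<open>A linear functional with value 1 at \<open>v\<close> is averaged over a compact open
  group that fixes \<open>v\<close>. Invariance makes the average smooth, and its value at
  \<open>v\<close> is the volume of that group.\<close>

lemma smooth_dual_separates:
  fixes \<pi> :: "('g, 'v::complex_vector) rep"
  assumes L: "compact_open_subgroup G T L" and \<pi>: "smooth_rep G T \<pi>" and v: "v \<in> carrier \<pi>" "v \<noteq> 0"
  obtains \<xi> where "\<xi> \<in> carrier (smooth_dual G T \<pi>)" "\<xi> v \<noteq> 0"
proof -
  note rep = smooth_repD(1)[OF \<pi>]
  let ?U = "L \<inter> stabilizer G \<pi> v"
  have U: "compact_open_subgroup G T ?U" by (rule compact_open_stabilizer[OF L \<pi> v(1)])
  note D = compact_open_subgroupD[OF U]
  obtain \<xi> where \<xi>: "\<xi> \<in> lin_maps (carrier \<pi>) (UNIV :: complex set)" "\<xi> v = 1"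
    using exists_functional[OF representationD(1)[OF rep] v] by metis
  \<comment> \<open>The trivial representation: equivariant maps into it are the invariant
    functionals.\<close>
  define tr :: "('g, complex) rep" where "tr = \<lparr>carrier = UNIV, act = \<lambda>g x. x\<rparr>"
  have "stabilizer (G\<lparr>carrier := ?U\<rparr>) tr x = topspace (subtopology T ?U)" for x
    using topological_groupD(2)[OF D(6)] by (auto simp: stabilizer_def tr_def)
  then have "openin (subtopology T ?U) (stabilizer (G\<lparr>carrier := ?U\<rparr>) tr x)" for x by (simp only: openin_topspace)
  moreover have "representation (G\<lparr>carrier := ?U\<rparr>) tr"
    by (simp add: representation_def tr_def complex_vector.subspace_UNIV)
  ultimately have tr: "smooth_on ?U tr" by (simp add: smooth_rep_def)
  have av: "average ?U \<pi> tr \<xi> \<in> hom_on ?U \<pi> tr"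
    using \<xi>(1) by (intro average_intertwiner[OF U smooth_on_restrict[OF \<pi> U] tr]) (simp add: tr_def)
  have "average ?U \<pi> tr \<xi> \<in> carrier (smooth_dual G T \<pi>)"
  proof (rule smooth_dualI[OF topological rep _ D(3,5,4)])
    show "average ?U \<pi> tr \<xi> \<in> lin_maps (carrier \<pi>) UNIV" using intertwinersD(1)[OF av] by (simp add: tr_def)
    show "average ?U \<pi> tr \<xi> (act \<pi> (inv g) u) = average ?U \<pi> tr \<xi> u" if "g \<in> ?U" "u \<in> carrier \<pi>" for g u
      using intertwinersD(2)[OF av, of "inv g" u] that D(9)[OF that(1)] by (simp add: tr_def)
  qed
  moreover have "average ?U \<pi> tr \<xi> v = integral (\<lambda>g. if g \<in> ?U then 1 else 0)"
    unfolding average_apply[OF U v(1)] using D(9) \<xi>(2)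
    by (intro integral_cong) (auto simp: tr_def stabilizer_def)
  then have "average ?U \<pi> tr \<xi> v = measure M ?U *\<^sub>R 1" using integral_indicator[OF D(2,3)] by simp
  ultimately show ?thesis using that D(7) by auto
qed

end

lemma finite_dim_coordinates:
  fixes V :: "'v::complex_vector set"
  assumes "csubspace V" "finite_dim V"
  obtains B and coord :: "'v \<Rightarrow> 'v \<Rightarrow> complex" where "finite B" "B \<subseteq> V"
    "\<And>b. b \<in> B \<Longrightarrow> coord b \<in> lin_maps V UNIV" "\<And>v. v \<in> V \<Longrightarrow> (\<Sum>b\<in>B. coord b v *\<^sub>C b) = v"
proof -
  obtain B where B: "finite B" "B \<subseteq> V" "\<not> cdependent B" "cspan B = V"
    using finite_dim_basis[OF assms] by metis
  show ?thesis
  proof (rule that[OF B(1,2), of "\<lambda>b v. if v \<in> V then crepresentation B v b else 0"])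
    show "(\<lambda>v. if v \<in> V then crepresentation B v b else 0) \<in> lin_maps V UNIV" for b
      using complex_vector.representation_add[OF B(3)] complex_vector.representation_scale[OF B(3)] B(4)
      by (intro lin_mapsI) (auto simp: complex_vector.subspace_add[OF assms(1)] complex_vector.subspace_scale[OF assms(1)] scaleC_complex_def)
    show "(\<Sum>b\<in>B. (if v \<in> V then crepresentation B v b else 0) *\<^sub>C b) = v" if "v \<in> V" for v
      using that complex_vector.sum_representation_eq[OF B(3) _ B(1)] B(4) by simp
  qed
qed

section \<open>The compactly induced representation\<close>

locale hecke_setting = haar_l_group G T M for G (structure) and T :: "'g topology" and M :: "'g measure" +
  fixes K :: "'g set" and \<rho> :: "('g, 'w::complex_vector) rep"
  assumes K: "compact_open_subgroup G T K"
    and \<rho>: "smooth_irrep (G\<lparr>carrier := K\<rparr>) (subtopology T K) \<rho>"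
begin

abbreviation "W \<equiv> carrier \<rho>"
abbreviation "W' \<equiv> carrier (contragredient G T K \<rho>)"
abbreviation "\<H> \<equiv> hecke_algebra G T M K \<rho>"
abbreviation "\<mu>K \<equiv> complex_of_real (1 / measure M K)"

lemmas KD = compact_open_subgroupD[OF K]

lemma \<rho>_smooth: "smooth_on K \<rho>" and \<rho>_irr: "irreducible_rep (G\<lparr>carrier := K\<rparr>) \<rho>"
  using \<rho> by (auto simp: smooth_irrep_def)

lemmas \<rho>D = smooth_onD[OF K \<rho>_smooth]

lemma KG: "k \<in> K \<Longrightarrow> k \<in> carrier G"
  using KD(4) by blast

lemma W_finite_dim: "finite_dim W"
proof (rule compact_irreducible_finite_dim[OF KD(6) _ \<rho>])
  show "compactin (subtopology T K) (carrier (G\<lparr>carrier := K\<rparr>))"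
    using KD(2) by (simp add: compactin_subtopology)
qed

lemma W'_eq: "W' = lin_maps W UNIV"
  by (rule smooth_dual_finite_dim[OF KD(6) \<rho>_smooth W_finite_dim])

lemma W_eqI:
  assumes "u \<in> W" "v \<in> W" "\<And>\<xi>. \<xi> \<in> W' \<Longrightarrow> \<xi> u = \<xi> v"
  shows "u = v"
proof (rule ccontr)
  assume ne: "u \<noteq> v"
  have "u - v \<in> W" using assms(1,2) by (rule complex_vector.subspace_diff[OF \<rho>D(2)])
  then obtain \<xi> where \<xi>: "\<xi> \<in> W'" "\<xi> (u - v) = 1"
    using exists_functional[OF \<rho>D(2), of "u - v"] ne unfolding W'_eq by auto
  then show False
    using lin_maps_diff[OF \<rho>D(2) \<xi>(1)[unfolded W'_eq] assms(1,2)] assms(3)[OF \<xi>(1)] by simp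
qed

text \<open>A basis with its dual basis, in the form of resolutions of the identity of
  \<open>W\<close> and of \<open>W'\<close>; these explicit coordinates replace independence in what
  follows.\<close>

lemma W'_mem_cspan:
  obtains B and coord :: "'w \<Rightarrow> 'w \<Rightarrow> complex" where "finite B" "B \<subseteq> W"
    "\<And>b. b \<in> B \<Longrightarrow> coord b \<in> W'" "\<And>v. v \<in> W \<Longrightarrow> (\<Sum>b\<in>B. coord b v *\<^sub>C b) = v"
    "\<And>\<xi>. \<xi> \<in> W' \<Longrightarrow> (\<Sum>b\<in>B. \<xi> b *\<^sub>C coord b) = \<xi>"
proof -
  obtain B and coord :: "'w \<Rightarrow> 'w \<Rightarrow> complex" where B: "finite B" "B \<subseteq> W"
    "\<And>b. b \<in> B \<Longrightarrow> coord b \<in> W'" "\<And>v. v \<in> W \<Longrightarrow> (\<Sum>b\<in>B. coord b v *\<^sub>C b) = v"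
    by (rule finite_dim_coordinates[OF \<rho>D(2) W_finite_dim]) (rule that, simp_all only: W'_eq)
  have "(\<Sum>b\<in>B. \<xi> b *\<^sub>C coord b) = \<xi>" if \<xi>: "\<xi> \<in> W'" for \<xi>
  proof
    fix v
    note lin = \<xi>[unfolded W'_eq]
    show "(\<Sum>b\<in>B. \<xi> b *\<^sub>C coord b) v = \<xi> v"
    proof (cases "v \<in> W")
      case True
      have "\<xi> v = \<xi> (\<Sum>b\<in>B. coord b v *\<^sub>C b)" using B(4)[OF True] by simp
      also have "\<dots> = (\<Sum>b\<in>B. \<xi> (coord b v *\<^sub>C b))"
        using B(2) by (intro lin_maps_sum[OF \<rho>D(2) lin]) (auto intro: complex_vector.subspace_scale[OF \<rho>D(2)])
      also have "\<dots> = (\<Sum>b\<in>B. \<xi> b *\<^sub>C coord b) v"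
        using B(2) by (simp add: sum_apply_fun scaleC_fun_def scaleC_complex_def lin_mapsD(4)[OF lin] subset_iff mult.commute)
      finally show ?thesis ..
    next
      case False
      then show ?thesis using B(3) lin_mapsD(2)[OF lin]
        by (auto simp: sum_apply_fun scaleC_fun_def scaleC_complex_def W'_eq lin_maps_def intro!: sum.neutral)
    qed
  qed
  from that[OF B this] show ?thesis .
qed

text \<open>Gives the definite description its meaning: the dual basis allows the transposed matrix
  to be written down, and \<open>W'\<close> separates the points of \<open>W\<close>.\<close>

lemma transpose_end:
  assumes A: "A \<in> lin_maps W' W'" and w: "w \<in> W"
  shows "transpose_end W W' A w \<in> W" "\<xi> \<in> W' \<Longrightarrow> \<xi> (transpose_end W W' A w) = A \<xi> w"
proof -
  obtain B and coord :: "'w \<Rightarrow> 'w \<Rightarrow> complex" where B: "finite B" "B \<subseteq> W"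
    "\<And>b. b \<in> B \<Longrightarrow> coord b \<in> W'" "\<And>\<xi>. \<xi> \<in> W' \<Longrightarrow> (\<Sum>b\<in>B. \<xi> b *\<^sub>C coord b) = \<xi>"
    by (rule W'_mem_cspan) (rule that)
  define u where "u = (\<Sum>b\<in>B. A (coord b) w *\<^sub>C b)"
  have s': "csubspace W'" unfolding W'_eq by (rule csubspace_lin_maps[OF complex_vector.subspace_UNIV])
  have u: "u \<in> W" unfolding u_def using B(2)
    by (intro complex_vector.subspace_sum[OF \<rho>D(2)] complex_vector.subspace_scale[OF \<rho>D(2)]) auto
  have ux: "\<xi> u = A \<xi> w" if \<xi>: "\<xi> \<in> W'" for \<xi>
  proof -
    note lin = \<xi>[unfolded W'_eq]
    have "A \<xi> = A (\<Sum>b\<in>B. \<xi> b *\<^sub>C coord b)" using B(4)[OF \<xi>] by simp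
    also have "\<dots> = (\<Sum>b\<in>B. \<xi> b *\<^sub>C A (coord b))"
      using B(3) by (subst lin_maps_sum[OF s' A]) (auto simp: complex_vector.subspace_scale[OF s'] lin_mapsD(4)[OF A])
    finally have "A \<xi> w = (\<Sum>b\<in>B. \<xi> b * A (coord b) w)"
      by (simp add: sum_apply_fun scaleC_fun_def scaleC_complex_def)
    also have "\<dots> = (\<Sum>b\<in>B. \<xi> (A (coord b) w *\<^sub>C b))"
      using B(2) by (intro sum.cong) (auto simp: lin_mapsD(4)[OF lin] scaleC_complex_def)
    also have "\<dots> = \<xi> u" unfolding u_def
      using B(2) by (intro lin_maps_sum[OF \<rho>D(2) lin, symmetric]) (auto intro: complex_vector.subspace_scale[OF \<rho>D(2)])
    finally show ?thesis ..
  qed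
  have eq: "transpose_end W W' A w = u"
    unfolding transpose_end_def
  proof (rule the_equality)
    show "v = u" if "v \<in> W \<and> (\<forall>\<xi>\<in>W'. \<xi> v = A \<xi> w)" for v
      by (rule W_eqI) (use that u ux in simp_all)
  qed (use u ux in blast)
  show "transpose_end W W' A w \<in> W" unfolding eq by (fact u)
  show "\<xi> \<in> W' \<Longrightarrow> \<xi> (transpose_end W W' A w) = A \<xi> w" unfolding eq by (rule ux)
qed

text \<open>The compact induction of \<open>\<rho>\<close>. Its elements are right \<open>K\<close>-equivariant and extended by \<open>0\<close>
  outside the group; local constancy is automatic.\<close>

definition cind :: "('g, 'g \<Rightarrow> 'w) rep" where
  "cind = \<lparr>carrier = {p. (\<forall>x. x \<notin> carrier G \<longrightarrow> p x = 0) \<and> (\<forall>x\<in>carrier G. p x \<in> W) \<and>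
      (\<forall>x\<in>carrier G. \<forall>k\<in>K. p (x \<otimes> k) = act \<rho> (inv k) (p x)) \<and>
      (\<exists>C. compactin T C \<and> (\<forall>x\<in>carrier G - C. p x = 0))},
    act = (\<lambda>g p x. if x \<in> carrier G then p (inv g \<otimes> x) else 0)\<rparr>"

lemma act_cind: "x \<in> carrier G \<Longrightarrow> act cind g p x = p (inv g \<otimes> x)"
  "x \<notin> carrier G \<Longrightarrow> act cind g p x = 0"
  by (simp_all add: cind_def)

text \<open>The function is constant on \<open>x\<close> times the stabilizer of \<open>p x\<close>
  in \<open>K\<close>, and that stabilizer is open in \<open>K\<close>, hence in the group.\<close>

lemma cind_locally_constant:
  assumes W: "\<And>x. x \<in> carrier G \<Longrightarrow> p x \<in> W"
    and eq: "\<And>x k. x \<in> carrier G \<Longrightarrow> k \<in> K \<Longrightarrow> p (x \<otimes> k) = act \<rho> (inv k) (p x)"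
  shows "locally_constant T p"
  unfolding locally_constant_def
proof
  fix x assume "x \<in> topspace T"
  then have x: "x \<in> carrier G" by (simp add: top)
  let ?S = "stabilizer (G\<lparr>carrier := K\<rparr>) \<rho> (p x)"
  have SK: "?S \<subseteq> K" by (auto simp: stabilizer_def)
  have "openin (subtopology T K) ?S" by (rule smooth_repD(2)[OF \<rho>_smooth W[OF x]])
  then have S: "openin T ?S" using openin_open_subtopology[OF KD(3)] by blast
  let ?U = "{y \<in> topspace T. inv x \<otimes> y \<in> ?S}"
  have "openin T ?U"
    by (rule openin_continuous_map_preimage[OF topological_groupD(3)[OF topological inv_closed[OF x]] S])
  moreover have "x \<in> ?U" using x W[OF x] \<rho>D(4) KD(5) by (simp add: stabilizer_def top)
  moreover have "p y = p x" if y: "y \<in> ?U" for y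
  proof -
    have yG: "y \<in> carrier G" and k: "inv x \<otimes> y \<in> K" "act \<rho> (inv x \<otimes> y) (p x) = p x"
      using y top by (auto simp: stabilizer_def)
    have "p y = p (x \<otimes> (inv x \<otimes> y))" using x yG by (simp add: m_assoc[symmetric])
    also have "\<dots> = act \<rho> (inv (inv x \<otimes> y)) (p x)" by (rule eq[OF x k(1)])
    also have "\<dots> = p x" using \<rho>D(7)[OF k(1) W[OF x]] k(2) by simp
    finally show ?thesis .
  qed
  ultimately show "\<exists>U. openin T U \<and> x \<in> U \<and> (\<forall>y\<in>U. p y = p x)" by blast
qed

lemma cindD:
  assumes "p \<in> carrier cind"
  shows "x \<notin> carrier G \<Longrightarrow> p x = 0" "x \<in> carrier G \<Longrightarrow> p x \<in> W"
    "x \<in> carrier G \<Longrightarrow> k \<in> K \<Longrightarrow> p (x \<otimes> k) = act \<rho> (inv k) (p x)"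
    "\<exists>C. compactin T C \<and> (\<forall>x\<in>carrier G - C. p x = 0)" "cc p"
proof -
  show 1: "x \<notin> carrier G \<Longrightarrow> p x = 0" "\<And>x. x \<in> carrier G \<Longrightarrow> p x \<in> W"
    "\<And>x k. x \<in> carrier G \<Longrightarrow> k \<in> K \<Longrightarrow> p (x \<otimes> k) = act \<rho> (inv k) (p x)"
    "\<exists>C. compactin T C \<and> (\<forall>x\<in>carrier G - C. p x = 0)"
    using assms by (auto simp: cind_def)
  show "cc p" using cind_locally_constant[of p] 1 by (simp add: cc_def)
qed

lemma cindI:
  assumes "\<And>x. x \<notin> carrier G \<Longrightarrow> p x = 0" "\<And>x. x \<in> carrier G \<Longrightarrow> p x \<in> W"
    "\<And>x k. x \<in> carrier G \<Longrightarrow> k \<in> K \<Longrightarrow> p (x \<otimes> k) = act \<rho> (inv k) (p x)" "cc p"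
  shows "p \<in> carrier cind"
  using assms by (auto simp: cind_def cc_def)

lemma cind_representation: "representation G cind"
proof -
  note s = \<rho>D(2) and c = \<rho>D(6)[unfolded clinear_on_def]
  have "csubspace (carrier cind)"
    unfolding complex_vector.subspace_def
  proof (intro conjI ballI allI)
    show "0 \<in> carrier cind"
      by (rule cindI) (use complex_vector.subspace_0[OF s] \<rho>D(9) KD(9) cc_zero in \<open>auto simp: zero_fun_def\<close>)
    show "p + q \<in> carrier cind" if p: "p \<in> carrier cind" and q: "q \<in> carrier cind" for p q
    proof (rule cindI)
      show "cc (p + q)" using cc_add[OF cindD(5)[OF p] cindD(5)[OF q]] by (simp add: plus_fun_def)
    qed (use cindD[OF p] cindD[OF q] c KD(9) complex_vector.subspace_add[OF s] in auto)
    show "z *\<^sub>C p \<in> carrier cind" if p: "p \<in> carrier cind" for z p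
    proof (rule cindI)
      show "cc (z *\<^sub>C p)" using cc_comp[OF cindD(5)[OF p], of "\<lambda>x. z *\<^sub>C x"] by (simp add: scaleC_fun_def)
    qed (use cindD[OF p] c KD(9) complex_vector.subspace_scale[OF s] in \<open>auto simp: scaleC_fun_def\<close>)
  qed
  moreover have "act cind g p \<in> carrier cind" if g: "g \<in> carrier G" and p: "p \<in> carrier cind" for g p
  proof (rule cindI)
    show "cc (act cind g p)"
      by (rule cc_cong[OF cc_translate[OF cindD(5)[OF p] inv_closed[OF g]]]) (simp add: act_cind)
  qed (use g cindD[OF p] KG in \<open>auto simp: act_cind m_assoc[symmetric]\<close>)
  ultimately show ?thesis
    unfolding representation_def
    by (auto simp: fun_eq_iff cind_def scaleC_fun_def inv_mult_group m_assoc)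
qed

lemmas cindR = representationD[OF cind_representation]

text \<open>The factor \<open>\<mu>K\<close> compensates the volume of \<open>K\<close> in later
  integrals: \<open>cind_unit\<close> becomes the element of Hom_K(\<rho>, cind) that corresponds to
  the unit of the algebra, and the Frobenius extension of \<open>\<phi>\<close> gives back
  \<open>\<phi>\<close> on it without a constant.\<close>

definition cind_unit :: "'w \<Rightarrow> 'g \<Rightarrow> 'w" where
  "cind_unit w = (\<lambda>x. if w \<in> W \<and> x \<in> K then \<mu>K *\<^sub>C act \<rho> (inv x) w else 0)"

lemma cind_unit_mem: "cind_unit w \<in> carrier cind"
proof (rule cindI)
  note s = \<rho>D(2)
  show "x \<notin> carrier G \<Longrightarrow> cind_unit w x = 0" for x using KD(4) by (auto simp: cind_unit_def)
  show "x \<in> carrier G \<Longrightarrow> cind_unit w x \<in> W" for x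
    by (auto simp: cind_unit_def complex_vector.subspace_0[OF s] KD(9) \<rho>D(3) intro!: complex_vector.subspace_scale[OF s])
  show eq: "cind_unit w (x \<otimes> k) = act \<rho> (inv k) (cind_unit w x)" if x: "x \<in> carrier G" and k: "k \<in> K" for x k
  proof (cases "x \<in> K \<and> w \<in> W")
    case True
    then show ?thesis using k KD(8,9) \<rho>D(5)[of "inv k" "inv x" w] \<rho>D(6)[of "inv k"] \<rho>D(3)
      by (simp add: cind_unit_def inv_mult_group KG clinear_on_def)
  next
    case False
    have "x \<otimes> k \<notin> K" if "w \<in> W"
    proof
      assume "x \<otimes> k \<in> K"
      then have "x \<otimes> k \<otimes> inv k \<in> K" using KD(8,9) k by blast
      then show False using False that x KG[OF k] by (simp add: m_assoc)
    qed
    then show ?thesis using False \<rho>D(9) KD(9) k by (auto simp: cind_unit_def)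
  qed
  have "locally_constant T (cind_unit w)"
    by (rule cind_locally_constant)
      (use eq in \<open>auto simp: cind_unit_def complex_vector.subspace_0[OF s] KD(9) \<rho>D(3) intro!: complex_vector.subspace_scale[OF s]\<close>)
  then show "cc (cind_unit w)" unfolding cc_def using KD(2) by (auto simp: cind_unit_def)
qed

lemma cind_unit_hom: "cind_unit \<in> hom_on K \<rho> cind"
proof (intro intertwinersI lin_mapsI)
  note s = \<rho>D(2) and c = \<rho>D(6)[unfolded clinear_on_def]
  show "cind_unit x = 0" if "x \<notin> W" for x using that by (simp add: cind_unit_def fun_eq_iff)
  show "cind_unit (x + y) = cind_unit x + cind_unit y" if "x \<in> W" "y \<in> W" for x y
    using that c KD(9) by (auto simp: cind_unit_def fun_eq_iff complex_vector.subspace_add[OF s] scaleC_add_right)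
  show "cind_unit (z *\<^sub>C x) = z *\<^sub>C cind_unit x" if "x \<in> W" for x z
    using that c KD(9)
    by (auto simp: cind_unit_def fun_eq_iff scaleC_fun_def complex_vector.subspace_scale[OF s] complex_vector.scale_left_commute)
  show "cind_unit (act \<rho> k x) = act cind k (cind_unit x)" if "k \<in> carrier (G\<lparr>carrier := K\<rparr>)" and x: "x \<in> W" for k x
  proof
    have k: "k \<in> K" using that by simp
    fix y
    show "cind_unit (act \<rho> k x) y = act cind k (cind_unit x) y"
    proof (cases "y \<in> carrier G")
      case True
      have "inv k \<otimes> y \<in> K \<longleftrightarrow> y \<in> K"
      proof
        assume "inv k \<otimes> y \<in> K"
        then have "k \<otimes> (inv k \<otimes> y) \<in> K" using KD(8) k by blast
        then show "y \<in> K" using True KG[OF k] by (simp add: m_assoc[symmetric])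
      qed (use k KD(8,9) in auto)
      then show ?thesis using True k x KD(9) \<rho>D(3) \<rho>D(5)[of "inv y" k x]
        by (auto simp: cind_unit_def act_cind inv_mult_group KG)
    next
      case False
      then show ?thesis using KG by (auto simp: cind_unit_def act_cind)
    qed
  qed
qed (rule cind_unit_mem)

text \<open>Replacing \<open>x\<close> by \<open>x \<otimes> k\<close> brings in the action of
  \<open>k\<close> from the translation and that of its inverse from the value of \<open>p\<close>.
  The two cancel, so the integrand is constant on the open cosets of \<open>K\<close>.\<close>

lemma cind_unit_translate_cc:
  assumes p: "p \<in> carrier cind"
  shows "cc (\<lambda>x. act cind x (cind_unit (p x)))"
proof -
  let ?F = "\<lambda>x. act cind x (cind_unit (p x))"
  have const: "?F (x \<otimes> k) = ?F x" if x: "x \<in> carrier G" and k: "k \<in> K" for x k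
  proof -
    have "cind_unit (p (x \<otimes> k)) = act cind (inv k) (cind_unit (p x))"
      using cindD(2,3)[OF p] x k KD(9) intertwinersD(2)[OF cind_unit_hom] by simp
    then show ?thesis
      using x KG[OF k] cindR(6)[of "x \<otimes> k" "inv k" "cind_unit (p x)"] cind_unit_mem by (simp add: m_assoc)
  qed
  have "locally_constant T ?F"
    unfolding locally_constant_def
  proof
    fix x assume "x \<in> topspace T"
    then have x: "x \<in> carrier G" by (simp add: top)
    let ?U = "{y \<in> topspace T. inv x \<otimes> y \<in> K}"
    have "openin T ?U"
      by (rule openin_continuous_map_preimage[OF topological_groupD(3)[OF topological inv_closed[OF x]] KD(3)])
    moreover have "x \<in> ?U" using x KD(5) by (simp add: top)
    moreover have "?F y = ?F x" if y: "y \<in> ?U" for y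
    proof -
      have "y \<in> carrier G" "inv x \<otimes> y \<in> K" using y top by auto
      then show ?thesis using const[OF x, of "inv x \<otimes> y"] x by (simp add: m_assoc[symmetric])
    qed
    ultimately show "\<exists>U. openin T U \<and> x \<in> U \<and> (\<forall>y\<in>U. ?F y = ?F x)" by blast
  qed
  moreover obtain C where "compactin T C" "\<forall>x\<in>carrier G - C. p x = 0" using cindD(4)[OF p] by blast
  moreover have "?F x = 0" if "x \<in> carrier G" "p x = 0" for x
    using that lin_maps_zero[OF \<rho>D(2) intertwinersD(1)[OF cind_unit_hom]] representation_act_zero[OF cind_representation]
    by simp
  ultimately show ?thesis unfolding cc_def by blast
qed

text \<open>At a point \<open>y\<close> only those \<open>x\<close> with
  \<open>inv x \<otimes> y \<in> K\<close> contribute, with constant value \<open>\<mu>K\<close>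
  times \<open>p y\<close>; they form a coset whose volume cancels the factor. Thus
  \<open>cind_unit\<close> generates \<open>cind\<close>.\<close>

lemma cind_reconstruct:
  assumes p: "p \<in> carrier cind"
  shows "integral (\<lambda>x. act cind x (cind_unit (p x))) = p"
proof
  fix y
  show "integral (\<lambda>x. act cind x (cind_unit (p x))) y = p y"
  proof (cases "y \<in> carrier G")
    case False
    then show ?thesis
      unfolding integral_apply[OF cind_unit_translate_cc[OF p]] by (simp add: act_cind cindD(1)[OF p] integral_zero)
  next
    case y: True
    let ?c = "\<mu>K *\<^sub>C p y"
    let ?f = "\<lambda>x. if inv x \<otimes> y \<in> K then ?c else 0"
    have eq: "act cind x (cind_unit (p x)) y = ?f x" if x: "x \<in> carrier G" for x
    proof (cases "inv x \<otimes> y \<in> K")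
      case True
      have "p y = p (x \<otimes> (inv x \<otimes> y))" using x y by (simp add: m_assoc[symmetric])
      then show ?thesis using True x y cindD(2,3)[OF p x] by (simp add: act_cind cind_unit_def)
    qed (use x y in \<open>simp add: act_cind cind_unit_def\<close>)
    have "integral (\<lambda>x. act cind x (cind_unit (p x))) y = integral ?f"
      unfolding integral_apply[OF cind_unit_translate_cc[OF p]] by (rule integral_cong) (rule eq)
    also have "\<dots> = measure M K *\<^sub>R ?c" by (rule integral_coset[OF K y])
    also have "\<dots> = p y" using KD(7) by (simp add: scaleR_scaleC scaleC_scaleC scaleC_one flip: of_real_mult)
    finally show ?thesis .
  qed
qed

text \<open>The vectors with open stabilizer form a subspace containing the translates of \<^term>\<open>cind_unit w\<close>,
  and every vector is an integral of such translates.\<close>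

lemma cind_smooth: "smooth_rep G T cind"
proof -
  let ?S = "{p \<in> carrier cind. openin T (stabilizer G cind p)}"
  note sub = stabilizer_subgroup[OF cind_representation is_group]
  have S: "csubspace ?S"
    unfolding complex_vector.subspace_def
  proof (intro conjI ballI allI)
    have "stabilizer G cind 0 = topspace T"
      using representation_act_zero[OF cind_representation] by (auto simp: stabilizer_def top)
    then show "0 \<in> ?S" using complex_vector.subspace_0[OF cindR(1)] by simp
    show "p + q \<in> ?S" if p: "p \<in> ?S" and q: "q \<in> ?S" for p q
    proof -
      have pq: "p + q \<in> carrier cind" using p q complex_vector.subspace_add[OF cindR(1)] by simp
      have "openin T (stabilizer G cind p \<inter> stabilizer G cind q)" using p q by (intro openin_Int) auto
      moreover have "\<one> \<in> stabilizer G cind p \<inter> stabilizer G cind q" using p q cindR(5) by (auto simp: stabilizer_def)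
      moreover have "stabilizer G cind p \<inter> stabilizer G cind q \<subseteq> stabilizer G cind (p + q)"
        using p q cindR(3) by (auto simp: stabilizer_def)
      ultimately have "openin T (stabilizer G cind (p + q))" by (rule openin_subgroup[OF topological sub[OF pq]])
      then show ?thesis using pq by simp
    qed
    show "z *\<^sub>C p \<in> ?S" if p: "p \<in> ?S" for z p
    proof -
      have zp: "z *\<^sub>C p \<in> carrier cind" using p complex_vector.subspace_scale[OF cindR(1)] by simp
      moreover have "\<one> \<in> stabilizer G cind p" using p cindR(5) by (auto simp: stabilizer_def)
      moreover have "stabilizer G cind p \<subseteq> stabilizer G cind (z *\<^sub>C p)" using p cindR(4) by (auto simp: stabilizer_def)
      ultimately have "openin T (stabilizer G cind (z *\<^sub>C p))"
        using p by (intro openin_subgroup[OF topological sub[OF zp]]) auto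
      then show ?thesis using zp by simp
    qed
  qed
  have unit: "cind_unit w \<in> ?S" if w: "w \<in> W" for w
  proof -
    let ?U = "stabilizer (G\<lparr>carrier := K\<rparr>) \<rho> w"
    have "openin (subtopology T K) ?U" by (rule smooth_repD(2)[OF \<rho>_smooth w])
    then have "openin T ?U" using openin_open_subtopology[OF KD(3)] by blast
    moreover have "\<one> \<in> ?U" using \<rho>D(4)[OF w] KD(5) by (simp add: stabilizer_def)
    moreover have "?U \<subseteq> stabilizer G cind (cind_unit w)"
      using intertwinersD(2)[OF cind_unit_hom _ w, symmetric] KG by (auto simp: stabilizer_def)
    ultimately have "openin T (stabilizer G cind (cind_unit w))"
      by (rule openin_subgroup[OF topological sub[OF cind_unit_mem]])
    then show ?thesis using cind_unit_mem by simp
  qed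
  have translate: "act cind x p \<in> ?S" if x: "x \<in> carrier G" and p: "p \<in> ?S" for x p
  proof -
    have xp: "act cind x p \<in> carrier cind" using x p cindR(2) by simp
    have c: "continuous_map T T (\<lambda>g. inv x \<otimes> (g \<otimes> x))"
      using continuous_map_compose[OF topological_groupD(4)[OF topological x] topological_groupD(3)[OF topological inv_closed[OF x]]]
      by (simp add: o_def)
    have pst: "openin T (stabilizer G cind p)" using p by simp
    let ?U = "{g \<in> topspace T. inv x \<otimes> (g \<otimes> x) \<in> stabilizer G cind p}"
    have "openin T ?U" using openin_continuous_map_preimage[OF c pst] .
    moreover have "\<one> \<in> ?U" using x p cindR(5) by (simp add: stabilizer_def top)
    moreover have "g \<in> stabilizer G cind (act cind x p)" if g: "g \<in> ?U" for g
    proof -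
      have gG: "g \<in> carrier G" and st: "act cind (inv x \<otimes> (g \<otimes> x)) p = p" using g by (auto simp: stabilizer_def top)
      have pc: "p \<in> carrier cind" using p by simp
      have "act cind g (act cind x p) = act cind (x \<otimes> (inv x \<otimes> (g \<otimes> x))) p"
        using gG x by (simp add: cindR(6)[OF gG x pc, symmetric] m_assoc[symmetric])
      also have "\<dots> = act cind x p" using cindR(6)[OF x _ pc, of "inv x \<otimes> (g \<otimes> x)"] gG x st by simp
      finally show ?thesis using gG by (simp add: stabilizer_def)
    qed
    then have "?U \<subseteq> stabilizer G cind (act cind x p)" by blast
    ultimately have "openin T (stabilizer G cind (act cind x p))" by (rule openin_subgroup[OF topological sub[OF xp]])
    then show ?thesis using xp by simp
  qed
  have "p \<in> ?S" if p: "p \<in> carrier cind" for p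
  proof -
    have "integral (\<lambda>x. act cind x (cind_unit (p x))) \<in> ?S"
      using translate unit cindD(2)[OF p] by (intro integral_mem[OF S]) blast
    then show ?thesis unfolding cind_reconstruct[OF p] .
  qed
  then show ?thesis using cind_representation by (auto simp: smooth_rep_def)
qed

section \<open>Frobenius reciprocity\<close>

text \<open>The \<open>G\<close>-map from the compact induction that extends a \<open>K\<close>-map \<open>\<phi>\<close> defined on \<open>\<rho>\<close>.\<close>

definition frob :: "('g, 'v::complex_vector) rep \<Rightarrow> ('w \<Rightarrow> 'v) \<Rightarrow> ('g \<Rightarrow> 'w) \<Rightarrow> 'v" where
  "frob \<pi> \<phi> p = (if p \<in> carrier cind then integral (\<lambda>g. act \<pi> g (\<phi> (p g))) else 0)"

lemma frob_cc:
  assumes \<pi>: "smooth_rep G T \<pi>" and \<phi>: "\<phi> \<in> hom_on K \<rho> \<pi>" and p: "p \<in> carrier cind"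
  shows "cc (\<lambda>g. act \<pi> g (\<phi> (p g)))"
proof (rule cc_bind[where f = "\<lambda>g. \<phi> (p g)" and F = "act \<pi>" and S = "carrier \<pi>"])
  show "cc (\<lambda>g. \<phi> (p g))"
    by (rule cc_comp[where H = \<phi>, OF cindD(5)[OF p] lin_maps_zero[OF \<rho>D(2) intertwinersD(1)[OF \<phi>]]])
  show "\<phi> (p g) \<in> carrier \<pi>" if "g \<in> carrier G" for g
    using intertwiners_mem[OF \<phi>] cindD(2)[OF p that] by blast
qed (auto intro: smooth_act_locally_constant[OF topological \<pi>] representation_act_zero[OF smooth_repD(1)[OF \<pi>]])

lemma frob_intertwiner:
  assumes \<pi>: "smooth_rep G T \<pi>" and \<phi>: "\<phi> \<in> hom_on K \<rho> \<pi>"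
  shows "frob \<pi> \<phi> \<in> intertwiners G cind \<pi>"
proof (intro intertwinersI lin_mapsI)
  note R = representationD[OF smooth_repD(1)[OF \<pi>]]
  note lin = intertwinersD(1)[OF \<phi>]
  have mem: "act \<pi> g (\<phi> (p g)) \<in> carrier \<pi>" if "p \<in> carrier cind" "g \<in> carrier G" for p g
    using that R(2) lin_mapsD(1)[OF lin] cindD(2) by blast
  show "frob \<pi> \<phi> p \<in> carrier \<pi>" if "p \<in> carrier cind" for p
    using that mem by (auto simp: frob_def intro!: integral_mem[OF R(1)])
  show "frob \<pi> \<phi> p = 0" if "p \<notin> carrier cind" for p using that by (simp add: frob_def)
  show "frob \<pi> \<phi> (p + q) = frob \<pi> \<phi> p + frob \<pi> \<phi> q" if p: "p \<in> carrier cind" and q: "q \<in> carrier cind" for p q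
  proof -
    have "integral (\<lambda>g. act \<pi> g (\<phi> ((p + q) g))) = integral (\<lambda>g. act \<pi> g (\<phi> (p g)) + act \<pi> g (\<phi> (q g)))"
      using cindD(2)[OF p] cindD(2)[OF q] lin_mapsD[OF lin] R by (intro integral_cong) simp
    then show ?thesis
      using p q complex_vector.subspace_add[OF cindR(1) p q] integral_add[OF frob_cc[OF \<pi> \<phi> p] frob_cc[OF \<pi> \<phi> q]]
      by (simp add: frob_def)
  qed
  show "frob \<pi> \<phi> (c *\<^sub>C p) = c *\<^sub>C frob \<pi> \<phi> p" if p: "p \<in> carrier cind" for c p
  proof -
    have "integral (\<lambda>g. act \<pi> g (\<phi> ((c *\<^sub>C p) g))) = integral (\<lambda>g. c *\<^sub>C act \<pi> g (\<phi> (p g)))"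
      using cindD(2)[OF p] lin_mapsD[OF lin] R by (intro integral_cong) (simp add: scaleC_fun_def)
    then show ?thesis
      using p complex_vector.subspace_scale[OF cindR(1) p] integral_scale[OF frob_cc[OF \<pi> \<phi> p]]
      by (simp add: frob_def)
  qed
  show "frob \<pi> \<phi> (act cind h p) = act \<pi> h (frob \<pi> \<phi> p)" if h: "h \<in> carrier G" and p: "p \<in> carrier cind" for h p
  proof -
    note hp = cindR(2)[OF h p]
    let ?F = "\<lambda>p g. act \<pi> g (\<phi> (p g))"
    \<comment> \<open>The translate of \<open>p\<close> by \<open>h\<close>, evaluated at
      \<open>h \<otimes> g\<close>, is \<open>p g\<close>; the remaining action of \<open>h\<close>
      can be taken out of the integral.\<close>
    have eq: "?F (act cind h p) (h \<otimes> g) = act \<pi> h (?F p g)" if g: "g \<in> carrier G" for g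
      using g h lin_mapsD(1)[OF lin cindD(2)[OF p g]] by (simp add: act_cind m_assoc[symmetric] R(6))
    have "frob \<pi> \<phi> (act cind h p) = integral (\<lambda>g. ?F (act cind h p) (h \<otimes> g))"
      using hp integral_translate[OF frob_cc[OF \<pi> \<phi> hp] h] by (simp add: frob_def)
    also have "\<dots> = integral (\<lambda>g. act \<pi> h (?F p g))" by (rule integral_cong) (rule eq)
    also have "\<dots> = act \<pi> h (integral (?F p))"
      by (rule integral_clinear[OF frob_cc[OF \<pi> \<phi> p] mem[OF p] R(1) clinear_on_act[OF smooth_repD(1)[OF \<pi>] h]])
    finally show ?thesis using p by (simp add: frob_def)
  qed
qed

text \<open>On \<open>K\<close> equivariance makes the integrand constant. Since
  \<open>cind_unit\<close> generates \<open>cind\<close>, this determines the extension of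
  \<open>\<phi>\<close> and amounts to Frobenius reciprocity.\<close>

lemma frob_unit:
  assumes \<pi>: "smooth_rep G T \<pi>" and \<phi>: "\<phi> \<in> hom_on K \<rho> \<pi>" and w: "w \<in> W"
  shows "frob \<pi> \<phi> (cind_unit w) = \<phi> w"
proof -
  note R = representationD[OF smooth_repD(1)[OF \<pi>]]
  note lin = intertwinersD(1)[OF \<phi>]
  have mem: "act \<rho> (inv g) w \<in> W" if "g \<in> K" for g by (rule \<rho>D(3)[OF KD(9)[OF that] w])
  have "act \<pi> g (\<phi> (cind_unit w g)) = (if g \<in> K then \<mu>K *\<^sub>C \<phi> w else 0)" if g: "g \<in> carrier G" for g
  proof (cases "g \<in> K")
    case True
    have "act \<pi> g (\<phi> (cind_unit w g)) = \<mu>K *\<^sub>C act \<pi> g (\<phi> (act \<rho> (inv g) w))"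
      using True w mem[OF True] lin_mapsD[OF lin] R(4)[OF g] by (simp add: cind_unit_def)
    also have "act \<pi> g (\<phi> (act \<rho> (inv g) w)) = \<phi> (act \<rho> g (act \<rho> (inv g) w))"
      using True mem[OF True] intertwinersD(2)[OF \<phi>] by simp
    finally show ?thesis using True w by (simp add: \<rho>D(8))
  qed (use g lin_maps_zero[OF \<rho>D(2) lin] representation_act_zero[OF smooth_repD(1)[OF \<pi>]] in \<open>simp add: cind_unit_def\<close>)
  then have "frob \<pi> \<phi> (cind_unit w) = integral (\<lambda>g. if g \<in> K then \<mu>K *\<^sub>C \<phi> w else 0)"
    using cind_unit_mem by (auto simp: frob_def intro: integral_cong)
  also have "\<dots> = measure M K *\<^sub>R (\<mu>K *\<^sub>C \<phi> w)" by (rule integral_indicator[OF KD(2,3)])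
  finally show ?thesis using KD(7) by (simp add: scaleR_scaleC scaleC_scaleC scaleC_one flip: of_real_mult)
qed

text \<open>When \<open>\<theta>\<close> is itself a Frobenius extension, this is the associativity
  law of the algebra and of its modules.\<close>

lemma frob_natural:
  assumes \<pi>: "smooth_rep G T \<pi>" and \<phi>: "\<phi> \<in> hom_on K \<rho> \<pi>" and \<theta>: "\<theta> \<in> intertwiners G \<pi> \<sigma>" and p: "p \<in> carrier cind"
  shows "\<theta> (frob \<pi> \<phi> p) = frob \<sigma> (\<lambda>w. \<theta> (\<phi> w)) p"
proof -
  note R = representationD[OF smooth_repD(1)[OF \<pi>]]
  have \<phi>p: "\<phi> (p g) \<in> carrier \<pi>" if "g \<in> carrier G" for g
    using intertwiners_mem[OF \<phi>] cindD(2)[OF p that] by blast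
  have "\<theta> (frob \<pi> \<phi> p) = integral (\<lambda>g. \<theta> (act \<pi> g (\<phi> (p g))))"
    using p integral_clinear[OF frob_cc[OF \<pi> \<phi> p] _ R(1) clinear_on_lin_maps[OF intertwinersD(1)[OF \<theta>]]] R(2) \<phi>p
    by (simp add: frob_def)
  also have "\<dots> = frob \<sigma> (\<lambda>w. \<theta> (\<phi> w)) p"
    using p intertwinersD(2)[OF \<theta>] \<phi>p by (auto simp: frob_def intro!: integral_cong)
  finally show ?thesis .
qed

lemma frob_cind_unit: "p \<in> carrier cind \<Longrightarrow> frob cind cind_unit p = p"
  using cind_reconstruct by (simp add: frob_def)

end

text \<open>Induction on \<open>F\<close>. If the elements killing the smaller set already
  annihilate \<open>N'\<close>, the new vector \<open>n\<close> is dropped. Otherwise some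
  \<open>j\<close> kills the smaller set but not a certain \<open>m\<close> in \<open>N'\<close>.
  Such a \<open>j\<close> cannot kill \<open>n\<close>, and the images of \<open>n\<close> and
  \<open>m\<close> under \<open>j\<close> are the required vectors: if \<open>a\<close> kills the
  first, then the product of \<open>a\<close> and \<open>j\<close> kills the smaller set together
  with \<open>n\<close>, hence also \<open>m\<close>. For empty \<open>F\<close> the unit would
  annihilate \<open>N'\<close>.\<close>

lemma (in left_module) annihilator_finite_cyclic:
  fixes N' :: "('a, 'm, 'e) module_scheme"
  assumes N': "left_module R N'" "carrier N' \<noteq> {\<zero>\<^bsub>N'\<^esub>}"
    and F: "finite F" "F \<subseteq> carrier M"
    and sub: "{a \<in> carrier R. \<forall>x\<in>F. a \<odot>\<^bsub>M\<^esub> x = \<zero>\<^bsub>M\<^esub>} \<subseteq> annihilator R N'"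
  shows "\<exists>n\<in>carrier M. \<exists>m\<in>carrier N'. n \<noteq> \<zero>\<^bsub>M\<^esub> \<and> m \<noteq> \<zero>\<^bsub>N'\<^esub> \<and>
    (\<forall>a\<in>carrier R. a \<odot>\<^bsub>M\<^esub> n = \<zero>\<^bsub>M\<^esub> \<longrightarrow> a \<odot>\<^bsub>N'\<^esub> m = \<zero>\<^bsub>N'\<^esub>)"
  using F sub
proof (induction F rule: finite_induct)
  interpret N': left_module R N' by fact
  case empty
  then have "\<one>\<^bsub>R\<^esub> \<in> annihilator R N'" using R.one_closed by auto
  then have "x = \<zero>\<^bsub>N'\<^esub>" if "x \<in> carrier N'" for x using that N'.smult_one[OF that] by (simp add: annihilator_def)
  then have "carrier N' = {\<zero>\<^bsub>N'\<^esub>}" using N'.M.zero_closed by blast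
  with N'(2) show ?case by contradiction
next
  interpret N': left_module R N' by fact
  case (insert n F)
  let ?J = "{a \<in> carrier R. \<forall>x\<in>F. a \<odot>\<^bsub>M\<^esub> x = \<zero>\<^bsub>M\<^esub>}"
  show ?case
  proof (cases "?J \<subseteq> annihilator R N'")
    case True
    then show ?thesis using insert by simp
  next
    case False
    then obtain j m where j: "j \<in> carrier R" "\<And>x. x \<in> F \<Longrightarrow> j \<odot>\<^bsub>M\<^esub> x = \<zero>\<^bsub>M\<^esub>"
      and m: "m \<in> carrier N'" "j \<odot>\<^bsub>N'\<^esub> m \<noteq> \<zero>\<^bsub>N'\<^esub>" by (auto simp: annihilator_def)
    have n: "n \<in> carrier M" and FM: "F \<subseteq> carrier M" using insert.prems by auto
    have kill: "b \<odot>\<^bsub>N'\<^esub> m = \<zero>\<^bsub>N'\<^esub>"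
      if "b \<in> carrier R" "\<And>x. x \<in> F \<Longrightarrow> b \<odot>\<^bsub>M\<^esub> x = \<zero>\<^bsub>M\<^esub>" "b \<odot>\<^bsub>M\<^esub> n = \<zero>\<^bsub>M\<^esub>" for b
      using that insert.prems(2) m(1) by (auto simp: annihilator_def)
    have "j \<odot>\<^bsub>M\<^esub> n \<noteq> \<zero>\<^bsub>M\<^esub>" using kill[OF j(1) j(2)] m(2) by blast
    moreover have "a \<odot>\<^bsub>N'\<^esub> (j \<odot>\<^bsub>N'\<^esub> m) = \<zero>\<^bsub>N'\<^esub>"
      if a: "a \<in> carrier R" "a \<odot>\<^bsub>M\<^esub> (j \<odot>\<^bsub>M\<^esub> n) = \<zero>\<^bsub>M\<^esub>" for a
    proof -
      have "(a \<otimes>\<^bsub>R\<^esub> j) \<odot>\<^bsub>N'\<^esub> m = \<zero>\<^bsub>N'\<^esub>"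
      proof (rule kill)
        show "(a \<otimes>\<^bsub>R\<^esub> j) \<odot>\<^bsub>M\<^esub> x = \<zero>\<^bsub>M\<^esub>" if "x \<in> F" for x
          using that FM a(1) j smult_assoc[OF a(1) j(1), of x] smult_zero_right[OF a(1)] by auto
      qed (use a j(1) n in \<open>simp_all add: smult_assoc\<close>)
      then show ?thesis using N'.smult_assoc[OF a(1) j(1) m(1)] by simp
    qed
    ultimately show ?thesis using smult_closed[OF j(1) n] N'.smult_closed[OF j(1) m(1)] m(2) by blast
  qed
qed

context hecke_setting
begin

section \<open>The Hecke algebra as an algebra of intertwiners\<close>

lemma contragredient_act: "k \<in> K \<Longrightarrow> act (contragredient G T K \<rho>) k \<xi> v = (if v \<in> W then \<xi> (act \<rho> (inv k) v) else 0)"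
  by (simp add: smooth_dual_def dual_rep_def m_inv_consistent[OF KD(1)])

lemma W'_csubspace: "csubspace W'"
  unfolding W'_eq by (rule csubspace_lin_maps[OF complex_vector.subspace_UNIV])

lemma contragredient_act_mem:
  assumes k: "k \<in> K" and \<xi>: "\<xi> \<in> W'"
  shows "act (contragredient G T K \<rho>) k \<xi> \<in> W'"
  unfolding W'_eq
proof (rule lin_mapsI)
  note lin = lin_mapsD[OF \<xi>[unfolded W'_eq]]
  note c = \<rho>D(6)[unfolded clinear_on_def] and s = \<rho>D(2)
  show "act (contragredient G T K \<rho>) k \<xi> (x + y) =
     act (contragredient G T K \<rho>) k \<xi> x + act (contragredient G T K \<rho>) k \<xi> y" if "x \<in> W" "y \<in> W" for x y
    using that k KD(9) c lin \<rho>D(3) by (simp add: contragredient_act complex_vector.subspace_add[OF s])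
  show "act (contragredient G T K \<rho>) k \<xi> (z *\<^sub>C x) = z *\<^sub>C act (contragredient G T K \<rho>) k \<xi> x" if "x \<in> W" for z x
    using that k KD(9) c lin \<rho>D(3) by (simp add: contragredient_act complex_vector.subspace_scale[OF s])
qed (simp_all add: contragredient_act[OF k])

lemma heckeD:
  assumes "a \<in> carrier \<H>"
  shows "g \<in> carrier G \<Longrightarrow> a g \<in> lin_maps W' W'" "g \<notin> carrier G \<Longrightarrow> a g = 0" "cc a"
    "k1 \<in> K \<Longrightarrow> k2 \<in> K \<Longrightarrow> g \<in> carrier G \<Longrightarrow> \<xi> \<in> W' \<Longrightarrow>
      a (k1 \<otimes> g \<otimes> k2) \<xi> = act (contragredient G T K \<rho>) k1 (a g (act (contragredient G T K \<rho>) k2 \<xi>))"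
  using assms by (simp_all add: hecke_algebra_def Let_def cc_def locally_constant_def top)

lemma heckeI:
  assumes "\<And>g. g \<in> carrier G \<Longrightarrow> a g \<in> lin_maps W' W'" "\<And>g. g \<notin> carrier G \<Longrightarrow> a g = 0" "cc a"
    "\<And>k1 k2 g \<xi>. k1 \<in> K \<Longrightarrow> k2 \<in> K \<Longrightarrow> g \<in> carrier G \<Longrightarrow> \<xi> \<in> W' \<Longrightarrow>
      a (k1 \<otimes> g \<otimes> k2) \<xi> = act (contragredient G T K \<rho>) k1 (a g (act (contragredient G T K \<rho>) k2 \<xi>))"
  shows "a \<in> carrier \<H>"
  using assms by (simp add: hecke_algebra_def Let_def cc_def locally_constant_def top)

text \<open>The Hecke algebra is identified with \<open>Hom\<^sub>K(\<rho>, cind)\<close>; under this identification its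
  multiplication is composition in reversed order, and its action on \<open>Hom\<^sub>K(\<rho>, \<pi>)\<close> is
  precomposition with \<open>\<phi> \<mapsto> frob \<pi> \<phi>\<close>.\<close>

definition hecke_hom :: "('g \<Rightarrow> ('w \<Rightarrow> complex) \<Rightarrow> 'w \<Rightarrow> complex) \<Rightarrow> 'w \<Rightarrow> 'g \<Rightarrow> 'w" where
  "hecke_hom a w x = (if w \<in> W \<and> x \<in> carrier G then transpose_end W W' (a x) w else 0)"

definition hom_hecke :: "('w \<Rightarrow> 'g \<Rightarrow> 'w) \<Rightarrow> 'g \<Rightarrow> ('w \<Rightarrow> complex) \<Rightarrow> 'w \<Rightarrow> complex" where
  "hom_hecke \<phi> x \<xi> w = (if x \<in> carrier G \<and> \<xi> \<in> W' \<and> w \<in> W then \<xi> (\<phi> w x) else 0)"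

lemma hecke_hom_apply:
  assumes "a \<in> carrier \<H>" "w \<in> W" "x \<in> carrier G"
  shows "hecke_hom a w x \<in> W" "\<xi> \<in> W' \<Longrightarrow> \<xi> (hecke_hom a w x) = a x \<xi> w"
  using transpose_end[OF heckeD(1)[OF assms(1,3)] assms(2)] assms(2,3) by (simp_all add: hecke_hom_def)

lemma W'_apply:
  assumes "\<xi> \<in> W'"
  shows "x \<in> W \<Longrightarrow> y \<in> W \<Longrightarrow> \<xi> (x + y) = \<xi> x + \<xi> y" "x \<in> W \<Longrightarrow> \<xi> (c *\<^sub>C x) = c * \<xi> x"
    "x \<notin> W \<Longrightarrow> \<xi> x = 0" "\<xi> 0 = 0"
  using lin_mapsD[OF assms[unfolded W'_eq]] lin_maps_zero[OF \<rho>D(2) assms[unfolded W'_eq]]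
  by (simp_all add: scaleC_complex_def)

lemma hecke_hom_eqI:
  assumes a: "a \<in> carrier \<H>" and \<phi>: "\<phi> \<in> hom_on K \<rho> cind"
    and eq: "\<And>x \<xi> w. x \<in> carrier G \<Longrightarrow> \<xi> \<in> W' \<Longrightarrow> w \<in> W \<Longrightarrow> \<xi> (\<phi> w x) = a x \<xi> w"
  shows "hecke_hom a = \<phi>"
proof (intro ext)
  fix w x
  note \<phi>m = intertwiners_mem[OF \<phi>]
  show "hecke_hom a w x = \<phi> w x"
  proof (cases "w \<in> W \<and> x \<in> carrier G")
    case True
    then show ?thesis
      using hecke_hom_apply[OF a] eq cindD(2)[OF \<phi>m] by (intro W_eqI) auto
  next
    case False
    have "\<phi> w x = 0"
    proof (cases "w \<in> W")
      case True
      then show ?thesis using False cindD(1)[OF \<phi>m[OF True]] by simp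
    next
      case False
      then show ?thesis using lin_mapsD(2)[OF intertwinersD(1)[OF \<phi>]] by simp
    qed
    moreover have "hecke_hom a w x = 0" unfolding hecke_hom_def using False by (rule if_not_P)
    ultimately show ?thesis by simp
  qed
qed

text \<open>The two sides of bi-equivariance are used separately: right translation by
  \<open>K\<close> is the condition defining \<open>cind\<close>, left translation is
  \<open>K\<close>-equivariance in \<open>w\<close>. The other factor is set to the identity each
  time, and equalities in \<open>W\<close> are tested by pairing with \<open>W'\<close>.\<close>

lemma hecke_hom_hom:
  assumes a: "a \<in> carrier \<H>"
  shows "hecke_hom a \<in> hom_on K \<rho> cind"
proof (intro intertwinersI lin_mapsI)
  note A = hecke_hom_apply[OF a] and s = \<rho>D(2) and lin = lin_mapsD[OF heckeD(1)[OF a]]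
  have aw: "a x \<xi> (u + v) = a x \<xi> u + a x \<xi> v" "a x \<xi> (c *\<^sub>C u) = c * a x \<xi> u"
    if "x \<in> carrier G" "\<xi> \<in> W'" "u \<in> W" "v \<in> W" for x \<xi> u v c
    using W'_apply[OF lin(1)[OF that(1,2)]] that by auto
  have mem: "hecke_hom a w \<in> carrier cind" if w: "w \<in> W" for w
  proof (rule cindI)
    show "hecke_hom a w x = 0" if "x \<notin> carrier G" for x using that by (simp add: hecke_hom_def)
    show "hecke_hom a w x \<in> W" if "x \<in> carrier G" for x by (rule A(1)[OF w that])
    show "hecke_hom a w (x \<otimes> k) = act \<rho> (inv k) (hecke_hom a w x)" if x: "x \<in> carrier G" and k: "k \<in> K" for x k
    proof (rule W_eqI)
      have xk: "x \<otimes> k \<in> carrier G" using x KG[OF k] by simp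
      show "hecke_hom a w (x \<otimes> k) \<in> W" "act \<rho> (inv k) (hecke_hom a w x) \<in> W"
        using A(1)[OF w] xk x \<rho>D(3)[OF KD(9)[OF k]] by auto
      fix \<xi> assume \<xi>: "\<xi> \<in> W'"
      let ?\<eta> = "act (contragredient G T K \<rho>) k \<xi>"
      have \<eta>: "?\<eta> \<in> W'" by (rule contragredient_act_mem[OF k \<xi>])
      have "\<xi> (hecke_hom a w (x \<otimes> k)) = a (\<one> \<otimes> x \<otimes> k) \<xi> w" using A(2)[OF w xk \<xi>] x by simp
      also have "\<dots> = act (contragredient G T K \<rho>) \<one> (a x ?\<eta>) w" by (simp only: heckeD(4)[OF a KD(5) k x \<xi>])
      also have "\<dots> = a x ?\<eta> w" using w by (simp add: contragredient_act[OF KD(5)] \<rho>D(4))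
      also have "\<dots> = ?\<eta> (hecke_hom a w x)" by (rule A(2)[OF w x \<eta>, symmetric])
      also have "\<dots> = \<xi> (act \<rho> (inv k) (hecke_hom a w x))" by (simp add: contragredient_act[OF k] A(1)[OF w x])
      finally show "\<xi> (hecke_hom a w (x \<otimes> k)) = \<xi> (act \<rho> (inv k) (hecke_hom a w x))" .
    qed
    have "cc (\<lambda>x. transpose_end W W' (a x) w)"
    proof (rule cc_comp[OF heckeD(3)[OF a], where H = "\<lambda>A. transpose_end W W' A w"])
      have z: "0 \<in> lin_maps W' W'" by (rule zero_lin_maps[OF W'_csubspace])
      show "transpose_end W W' 0 w = 0"
        by (rule W_eqI) (use transpose_end[OF z w] complex_vector.subspace_0[OF s] in \<open>auto simp: W'_apply\<close>)
    qed
    then show "cc (hecke_hom a w)" by (rule cc_cong) (simp add: hecke_hom_def w)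
  qed
  show "hecke_hom a w \<in> carrier cind" if "w \<in> W" for w by (rule mem[OF that])
  show "hecke_hom a w = 0" if "w \<notin> W" for w using that by (simp add: hecke_hom_def fun_eq_iff)
  show "hecke_hom a (u + v) = hecke_hom a u + hecke_hom a v" if uv: "u \<in> W" "v \<in> W" for u v
  proof
    note uv' = complex_vector.subspace_add[OF s uv]
    show "hecke_hom a (u + v) x = (hecke_hom a u + hecke_hom a v) x" for x
    proof (cases "x \<in> carrier G")
      case True
      then show ?thesis using A[OF uv' True] A[OF uv(1) True] A[OF uv(2) True] aw uv
        by (intro W_eqI) (auto simp: complex_vector.subspace_add[OF s] W'_apply)
    qed (simp add: hecke_hom_def)
  qed
  show "hecke_hom a (c *\<^sub>C u) = c *\<^sub>C hecke_hom a u" if u: "u \<in> W" for c u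
  proof
    note u' = complex_vector.subspace_scale[OF s u]
    show "hecke_hom a (c *\<^sub>C u) x = (c *\<^sub>C hecke_hom a u) x" for x
    proof (cases "x \<in> carrier G")
      case True
      then show ?thesis using A[OF u' True] A[OF u True] aw u
        by (intro W_eqI) (auto simp: complex_vector.subspace_scale[OF s] W'_apply scaleC_fun_def)
    qed (simp add: hecke_hom_def scaleC_fun_def)
  qed
  show "hecke_hom a (act \<rho> k w) = act cind k (hecke_hom a w)" if "k \<in> carrier (G\<lparr>carrier := K\<rparr>)" and w: "w \<in> W" for k w
  proof
    have k: "k \<in> K" using that by simp
    note kw = \<rho>D(3)[OF k w]
    show "hecke_hom a (act \<rho> k w) x = act cind k (hecke_hom a w) x" for x
    proof (cases "x \<in> carrier G")
      case True
      have kx: "inv k \<otimes> x \<in> carrier G" using True KG[OF k] by simp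
      show ?thesis unfolding act_cind(1)[OF True]
      proof (rule W_eqI)
        fix \<xi> assume \<xi>: "\<xi> \<in> W'"
        let ?\<eta> = "act (contragredient G T K \<rho>) \<one> \<xi>"
        have "?\<eta> = \<xi>"
          using W'_apply(3)[OF \<xi>] \<rho>D(4) by (auto simp: fun_eq_iff contragredient_act[OF KD(5)])
        then have "a (inv k \<otimes> x \<otimes> \<one>) \<xi> = act (contragredient G T K \<rho>) (inv k) (a x \<xi>)"
          using heckeD(4)[OF a KD(9)[OF k] KD(5) True \<xi>] by simp
        then have "a (inv k \<otimes> x) \<xi> w = a x \<xi> (act \<rho> k w)"
          using w kx KG[OF k] by (simp add: contragredient_act[OF KD(9)[OF k]])
        then show "\<xi> (hecke_hom a (act \<rho> k w) x) = \<xi> (hecke_hom a w (inv k \<otimes> x))"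
          by (simp add: A(2)[OF kw True \<xi>] A(2)[OF w kx \<xi>])
      qed (use A(1)[OF kw True] A(1)[OF w kx] in auto)
    qed (simp add: act_cind hecke_hom_def)
  qed
qed

lemma hom_hecke_mem:
  assumes \<phi>: "\<phi> \<in> hom_on K \<rho> cind"
  shows "hom_hecke \<phi> \<in> carrier \<H>"
proof (rule heckeI)
  note s = \<rho>D(2) and lin = lin_mapsD[OF intertwinersD(1)[OF \<phi>]]
  have mem: "\<phi> w x \<in> W" if "w \<in> W" "x \<in> carrier G" for w x by (rule cindD(2)[OF lin(1)[OF that(1)] that(2)])
  show "hom_hecke \<phi> g \<in> lin_maps W' W'" if g: "g \<in> carrier G" for g
  proof (rule lin_mapsI)
    show "hom_hecke \<phi> g \<xi> \<in> W'" if "\<xi> \<in> W'" for \<xi>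
      unfolding W'_eq by (rule lin_mapsI)
        (use that g lin mem in \<open>auto simp: hom_hecke_def complex_vector.subspace_add[OF s] complex_vector.subspace_scale[OF s] W'_apply scaleC_fun_def scaleC_complex_def\<close>)
    show "hom_hecke \<phi> g \<xi> = 0" if "\<xi> \<notin> W'" for \<xi> using that by (simp add: hom_hecke_def fun_eq_iff)
    show "hom_hecke \<phi> g (\<xi> + \<eta>) = hom_hecke \<phi> g \<xi> + hom_hecke \<phi> g \<eta>" if "\<xi> \<in> W'" "\<eta> \<in> W'" for \<xi> \<eta>
      using that g complex_vector.subspace_add[OF W'_csubspace that] by (auto simp: fun_eq_iff hom_hecke_def)
    show "hom_hecke \<phi> g (c *\<^sub>C \<xi>) = c *\<^sub>C hom_hecke \<phi> g \<xi>" if "\<xi> \<in> W'" for c \<xi>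
      using that g complex_vector.subspace_scale[OF W'_csubspace that] by (auto simp: fun_eq_iff hom_hecke_def scaleC_fun_def)
  qed
  show "hom_hecke \<phi> g = 0" if "g \<notin> carrier G" for g using that by (simp add: hom_hecke_def fun_eq_iff)
  show "cc (hom_hecke \<phi>)"
  proof -
    obtain B and coord :: "'w \<Rightarrow> 'w \<Rightarrow> complex" where B: "finite B" "B \<subseteq> W"
      "\<And>b. b \<in> B \<Longrightarrow> coord b \<in> W'" "\<And>v. v \<in> W \<Longrightarrow> (\<Sum>b\<in>B. coord b v *\<^sub>C b) = v"
      by (rule W'_mem_cspan) (rule that)
    \<comment> \<open>Local constancy of each \<open>\<phi> w\<close> gives neighbourhoods that
      depend on \<open>w\<close>, and \<open>w\<close> ranges over an infinite set; the expansion in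
      a basis leaves only the finitely many functions \<open>\<phi> b\<close>.\<close>
    let ?f = "\<lambda>x. \<Sum>b\<in>B. (\<lambda>w. coord b w *\<^sub>C \<phi> b x)"
    have "cc ?f"
    proof (rule cc_sum)
      fix b assume b: "b \<in> B"
      show "cc (\<lambda>x w. coord b w *\<^sub>C \<phi> b x)"
        by (rule cc_comp[OF cindD(5)[OF lin(1)], where H = "\<lambda>v w. coord b w *\<^sub>C v"]) (use b B(2) in \<open>auto simp: zero_fun_def\<close>)
    qed
    moreover have "?f x w = \<phi> w x" if w: "w \<in> W" for x w
    proof -
      have "\<phi> w = \<phi> (\<Sum>b\<in>B. coord b w *\<^sub>C b)" using B(4)[OF w] by simp
      also have "\<dots> = (\<Sum>b\<in>B. coord b w *\<^sub>C \<phi> b)"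
        using B(2) by (subst lin_maps_sum[OF s intertwinersD(1)[OF \<phi>]])
          (auto simp: lin(4) intro: complex_vector.subspace_scale[OF s] intro!: sum.cong)
      finally show ?thesis by (simp add: sum_apply_fun scaleC_fun_def)
    qed
    ultimately have "cc (\<lambda>x \<xi> w. if \<xi> \<in> W' \<and> w \<in> W then \<xi> (?f x w) else 0)"
      by (intro cc_comp[where H = "\<lambda>y \<xi> w. if \<xi> \<in> W' \<and> w \<in> W then \<xi> (y w) else 0"]) (auto simp: fun_eq_iff W'_apply)
    then show ?thesis
      by (rule cc_cong) (auto simp: fun_eq_iff hom_hecke_def \<open>\<And>x w. w \<in> W \<Longrightarrow> ?f x w = \<phi> w x\<close>)
  qed
  fix k1 k2 g \<xi> assume k: "k1 \<in> K" "k2 \<in> K" and g: "g \<in> carrier G" and \<xi>: "\<xi> \<in> W'"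
  let ?\<eta> = "act (contragredient G T K \<rho>) k2 \<xi>"
  have \<eta>: "?\<eta> \<in> W'" by (rule contragredient_act_mem[OF k(2) \<xi>])
  show "hom_hecke \<phi> (k1 \<otimes> g \<otimes> k2) \<xi> = act (contragredient G T K \<rho>) k1 (hom_hecke \<phi> g ?\<eta>)"
  proof
    fix w
    show "hom_hecke \<phi> (k1 \<otimes> g \<otimes> k2) \<xi> w = act (contragredient G T K \<rho>) k1 (hom_hecke \<phi> g ?\<eta>) w"
    proof (cases "w \<in> W")
      case w: True
      note kw = \<rho>D(3)[OF KD(9)[OF k(1)] w]
      have kg: "k1 \<otimes> g \<in> carrier G" using g KG[OF k(1)] by simp
      have "\<phi> w (k1 \<otimes> g) = \<phi> (act \<rho> (inv k1) w) g"
        using intertwinersD(2)[OF \<phi> _ w, of "inv k1"] KD(9)[OF k(1)] KG[OF k(1)] g by (simp add: act_cind)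
      then have "\<xi> (\<phi> w (k1 \<otimes> g \<otimes> k2)) = ?\<eta> (\<phi> (act \<rho> (inv k1) w) g)"
        using cindD(3)[OF lin(1)[OF w] kg k(2)] mem[OF kw g] by (simp add: contragredient_act[OF k(2)])
      then show ?thesis using w kw g kg KG[OF k(2)] \<xi> \<eta> by (simp add: hom_hecke_def contragredient_act[OF k(1)])
    qed (simp add: hom_hecke_def contragredient_act[OF k(1)])
  qed
qed

lemma hecke_hom_inverse: "\<phi> \<in> hom_on K \<rho> cind \<Longrightarrow> hecke_hom (hom_hecke \<phi>) = \<phi>"
  by (rule hecke_hom_eqI[OF hom_hecke_mem]) (simp_all add: hom_hecke_def)

lemma hom_hecke_eqI:
  assumes "\<And>x \<xi> w. x \<in> carrier G \<Longrightarrow> \<xi> \<in> W' \<Longrightarrow> w \<in> W \<Longrightarrow> a x \<xi> w = \<xi> (\<phi> w x)"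
    "\<And>x \<xi> w. \<not> (x \<in> carrier G \<and> \<xi> \<in> W' \<and> w \<in> W) \<Longrightarrow> a x \<xi> w = 0"
  shows "a = hom_hecke \<phi>"
  using assms unfolding fun_eq_iff hom_hecke_def by auto

lemma hecke_zero_outside:
  assumes "a \<in> carrier \<H>" "\<not> (x \<in> carrier G \<and> \<xi> \<in> W' \<and> w \<in> W)"
  shows "a x \<xi> w = 0"
proof (cases "x \<in> carrier G")
  case True
  then show ?thesis
    using lin_mapsD(1,2)[OF heckeD(1)[OF assms(1) True]] W'_apply(3) assms(2) by (cases "\<xi> \<in> W'") auto
qed (use heckeD(2)[OF assms(1)] in simp)

lemma hom_hecke_inverse: "a \<in> carrier \<H> \<Longrightarrow> hom_hecke (hecke_hom a) = a"
  by (rule hom_hecke_eqI[symmetric]) (simp_all add: hecke_hom_apply hecke_zero_outside)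

lemma hecke_hom_inj: "a \<in> carrier \<H> \<Longrightarrow> b \<in> carrier \<H> \<Longrightarrow> hecke_hom a = hecke_hom b \<Longrightarrow> a = b"
  using hom_hecke_inverse by metis

lemma hom_csubspace: "smooth_rep G T \<pi> \<Longrightarrow> csubspace (hom_on K \<rho> \<pi>)"
  by (rule csubspace_intertwiners[OF smooth_onD(1)[OF K smooth_on_restrict[OF _ K]]])

lemma hom_comp:
  assumes \<phi>: "\<phi> \<in> hom_on K \<rho> \<pi>" and \<pi>: "smooth_rep G T \<pi>" and \<theta>: "\<theta> \<in> intertwiners G \<pi> \<sigma>"
  shows "(\<lambda>w. \<theta> (\<phi> w)) \<in> hom_on K \<rho> \<sigma>"
proof (rule intertwiners_comp[OF \<phi>])
  show "\<theta> \<in> hom_on K \<pi> \<sigma>" using intertwiners_subgroup[OF KD(4)] \<theta> by blast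
  show "representation (G\<lparr>carrier := K\<rparr>) \<pi>" by (rule smooth_onD(1)[OF K smooth_on_restrict[OF \<pi> K]])
qed

lemmas hom_frob = hom_comp[OF _ cind_smooth frob_intertwiner]

lemma hecke_sel: "\<zero>\<^bsub>\<H>\<^esub> = 0" "a \<oplus>\<^bsub>\<H>\<^esub> b = a + b"
  by (simp_all add: hecke_algebra_def Let_def)

lemma hecke_add:
  assumes a: "a \<in> carrier \<H>" and b: "b \<in> carrier \<H>"
  shows "a \<oplus>\<^bsub>\<H>\<^esub> b \<in> carrier \<H>" "hecke_hom (a \<oplus>\<^bsub>\<H>\<^esub> b) = hecke_hom a + hecke_hom b"
proof -
  have h: "hecke_hom a + hecke_hom b \<in> hom_on K \<rho> cind"
    by (rule complex_vector.subspace_add[OF hom_csubspace[OF cind_smooth] hecke_hom_hom[OF a] hecke_hom_hom[OF b]])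
  have eq: "a \<oplus>\<^bsub>\<H>\<^esub> b = hom_hecke (hecke_hom a + hecke_hom b)"
    unfolding hecke_sel
    by (rule hom_hecke_eqI) (simp_all add: hecke_hom_apply[OF a] hecke_hom_apply[OF b] W'_apply hecke_zero_outside[OF a] hecke_zero_outside[OF b])
  show "a \<oplus>\<^bsub>\<H>\<^esub> b \<in> carrier \<H>" unfolding eq by (rule hom_hecke_mem[OF h])
  show "hecke_hom (a \<oplus>\<^bsub>\<H>\<^esub> b) = hecke_hom a + hecke_hom b" unfolding eq by (rule hecke_hom_inverse[OF h])
qed

lemma hecke_zero: "\<zero>\<^bsub>\<H>\<^esub> \<in> carrier \<H>" "hecke_hom \<zero>\<^bsub>\<H>\<^esub> = 0"
proof -
  have h: "0 \<in> hom_on K \<rho> cind" by (rule complex_vector.subspace_0[OF hom_csubspace[OF cind_smooth]])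
  have eq: "\<zero>\<^bsub>\<H>\<^esub> = hom_hecke 0"
    unfolding hecke_sel by (rule hom_hecke_eqI) (simp_all add: W'_apply)
  show "\<zero>\<^bsub>\<H>\<^esub> \<in> carrier \<H>" unfolding eq by (rule hom_hecke_mem[OF h])
  show "hecke_hom \<zero>\<^bsub>\<H>\<^esub> = 0" unfolding eq by (rule hecke_hom_inverse[OF h])
qed

lemma hecke_one: "\<one>\<^bsub>\<H>\<^esub> \<in> carrier \<H>" "hecke_hom \<one>\<^bsub>\<H>\<^esub> = cind_unit"
proof -
  have "\<one>\<^bsub>\<H>\<^esub> x \<xi> w = (if x \<in> K \<and> \<xi> \<in> W' then (1 / measure M K) *\<^sub>R act (contragredient G T K \<rho>) x \<xi> w else 0)" for x \<xi> w
    by (simp add: hecke_algebra_def Let_def scaleR_fun_def)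
  then have eq: "\<one>\<^bsub>\<H>\<^esub> = hom_hecke cind_unit"
    using KG KD(9) \<rho>D(3)
    by (intro hom_hecke_eqI) (auto simp: cind_unit_def contragredient_act W'_apply scaleR_conv_of_real)
  show "\<one>\<^bsub>\<H>\<^esub> \<in> carrier \<H>" unfolding eq by (rule hom_hecke_mem[OF cind_unit_hom])
  show "hecke_hom \<one>\<^bsub>\<H>\<^esub> = cind_unit" unfolding eq by (rule hecke_hom_inverse[OF cind_unit_hom])
qed

text \<open>Paired with \<xi>, the value of the composite at x is the integral over g of
  \<xi>(b(g^-1 x)^T a(g)^T w), whose integrand equals (a(g) b(g^-1 x) \<xi>)(w): this is the
  convolution. Transposition is the source of the reversed order.\<close>

lemma hecke_mult:
  assumes a: "a \<in> carrier \<H>" and b: "b \<in> carrier \<H>"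
  shows "a \<otimes>\<^bsub>\<H>\<^esub> b \<in> carrier \<H>"
    "hecke_hom (a \<otimes>\<^bsub>\<H>\<^esub> b) = (\<lambda>w. frob cind (hecke_hom b) (hecke_hom a w))"
proof -
  let ?\<phi> = "\<lambda>w. frob cind (hecke_hom b) (hecke_hom a w)"
  note ha = hecke_hom_hom[OF a] and hb = hecke_hom_hom[OF b]
  have h: "?\<phi> \<in> hom_on K \<rho> cind" by (rule hom_frob[OF ha cind_smooth hb])
  have mult: "(a \<otimes>\<^bsub>\<H>\<^esub> b) x = (if x \<in> carrier G then integral (\<lambda>g. a g \<circ> b (inv g \<otimes> x)) else 0)" for x
    by (simp add: hecke_algebra_def Let_def)
  have eq: "a \<otimes>\<^bsub>\<H>\<^esub> b = hom_hecke ?\<phi>"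
  proof (rule hom_hecke_eqI)
    have cc: "cc (\<lambda>g. a g \<circ> b (inv g \<otimes> x))" if x: "x \<in> carrier G" for x
    proof (rule cc_bind[OF heckeD(3)[OF a], where S = UNIV and F = "\<lambda>g y. y \<circ> b (inv g \<otimes> x)"])
      have c: "continuous_map T T (\<lambda>g. inv g \<otimes> x)"
        using continuous_map_compose[OF topological_groupD(5)[OF topological] topological_groupD(4)[OF topological x]]
        by (simp add: o_def)
      have "locally_constant T b" using heckeD(3)[OF b] by (simp add: cc_def)
      from locally_constant_vimage[OF this c]
      show "locally_constant T (\<lambda>g. y \<circ> b (inv g \<otimes> x))" for y by (rule locally_constant_comp)
    qed (simp_all add: fun_eq_iff)
    have ev: "(a \<otimes>\<^bsub>\<H>\<^esub> b) x \<xi> w = integral (\<lambda>g. a g (b (inv g \<otimes> x) \<xi>) w)" if x: "x \<in> carrier G" for x \<xi> w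
      using x integral_apply[OF cc[OF x], of \<xi>] integral_apply[OF cc_comp[OF cc[OF x], of "\<lambda>y. y \<xi>"], of w]
      by (simp add: mult)
    show "(a \<otimes>\<^bsub>\<H>\<^esub> b) x \<xi> w = \<xi> (?\<phi> w x)" if x: "x \<in> carrier G" and \<xi>: "\<xi> \<in> W'" and w: "w \<in> W" for x \<xi> w
    proof -
      note aw = intertwiners_mem[OF ha w]
      let ?F = "\<lambda>g. act cind g (hecke_hom b (hecke_hom a w g))"
      have F: "cc ?F" by (rule frob_cc[OF cind_smooth hb aw])
      have Fx: "cc (\<lambda>g. ?F g x)" by (rule cc_comp[OF F, where H = "\<lambda>q. q x"]) simp
      have mem: "?F g x \<in> W" if g: "g \<in> carrier G" for g
        using cindD(2)[OF cindR(2)[OF g intertwiners_mem[OF hb hecke_hom_apply(1)[OF a w g]]] x] .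
      have "\<xi> (?\<phi> w x) = \<xi> (integral (\<lambda>g. ?F g x))"
        using aw integral_apply[OF F, of x] by (simp add: frob_def)
      also have "\<dots> = integral (\<lambda>g. \<xi> (?F g x))"
        by (rule integral_clinear[OF Fx mem \<rho>D(2) clinear_on_lin_maps[OF \<xi>[unfolded W'_eq]], symmetric])
      also have "\<dots> = integral (\<lambda>g. a g (b (inv g \<otimes> x) \<xi>) w)"
      proof (rule integral_cong)
        fix g assume g: "g \<in> carrier G"
        have gx: "inv g \<otimes> x \<in> carrier G" using g x by simp
        show "\<xi> (?F g x) = a g (b (inv g \<otimes> x) \<xi>) w"
          using hecke_hom_apply(2)[OF b hecke_hom_apply(1)[OF a w g] gx \<xi>]
            hecke_hom_apply(2)[OF a w g lin_mapsD(1)[OF heckeD(1)[OF b gx] \<xi>]] by (simp add: act_cind(1)[OF x])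
      qed
      finally show ?thesis using ev[OF x] by simp
    qed
    show "(a \<otimes>\<^bsub>\<H>\<^esub> b) x \<xi> w = 0" if n: "\<not> (x \<in> carrier G \<and> \<xi> \<in> W' \<and> w \<in> W)" for x \<xi> w
    proof (cases "x \<in> carrier G")
      case True
      have "a g (b (inv g \<otimes> x) \<xi>) w = 0" if g: "g \<in> carrier G" for g
      proof (cases "\<xi> \<in> W'")
        case True
        then show ?thesis using n \<open>x \<in> carrier G\<close> hecke_zero_outside[OF a] by simp
      next
        case False
        have "inv g \<otimes> x \<in> carrier G" using g \<open>x \<in> carrier G\<close> by simp
        then have "b (inv g \<otimes> x) \<xi> = 0" using lin_mapsD(2)[OF heckeD(1)[OF b]] False by blast
        then show ?thesis using lin_maps_zero[OF W'_csubspace heckeD(1)[OF a g]] by simp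
      qed
      then have "integral (\<lambda>g. a g (b (inv g \<otimes> x) \<xi>) w) = integral (\<lambda>g. 0)" by (rule integral_cong)
      then show ?thesis unfolding ev[OF True] integral_zero .
    qed (simp add: mult)
  qed
  show "a \<otimes>\<^bsub>\<H>\<^esub> b \<in> carrier \<H>" unfolding eq by (rule hom_hecke_mem[OF h])
  show "hecke_hom (a \<otimes>\<^bsub>\<H>\<^esub> b) = ?\<phi>" unfolding eq by (rule hecke_hom_inverse[OF h])
qed

end

section \<open>Cyclic vectors of simple modules\<close>

lemma simple_module_cyclic:
  assumes "simple_module R N" "n \<in> carrier N" "n \<noteq> \<zero>\<^bsub>N\<^esub>" "x \<in> carrier N"
  obtains b where "b \<in> carrier R" "b \<odot>\<^bsub>N\<^esub> n = x"
proof -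
  interpret left_module R N using assms(1) by (simp add: simple_module_def)
  have "(\<lambda>a. a \<odot>\<^bsub>N\<^esub> n) ` carrier R = carrier N"
    by (rule simple_module_generated[OF assms(1,2)])
      (use assms(2,3) smult_one[OF assms(2)] in \<open>auto intro!: bexI[of _ "\<one>\<^bsub>R\<^esub>"]\<close>)
  then show ?thesis using that assms(4) by (metis (no_types, lifting) imageE)
qed

text \<open>Every vector is a multiple of \<open>n\<close>, so \<open>a\<close> annihilates
  \<open>N\<close> exactly when all right multiples of \<open>a\<close> kill \<open>n\<close>. The
  annihilator of a simple module is thus determined by that of one nonzero vector.\<close>

lemma annihilator_eq_if_cyclic_eq:
  assumes N: "simple_module R N" "n \<in> carrier N" "n \<noteq> \<zero>\<^bsub>N\<^esub>"
    and N': "simple_module R N'" "n' \<in> carrier N'" "n' \<noteq> \<zero>\<^bsub>N'\<^esub>"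
    and eq: "\<And>a. a \<in> carrier R \<Longrightarrow> a \<odot>\<^bsub>N\<^esub> n = \<zero>\<^bsub>N\<^esub> \<longleftrightarrow> a \<odot>\<^bsub>N'\<^esub> n' = \<zero>\<^bsub>N'\<^esub>"
  shows "annihilator R N = annihilator R N'"
proof -
  interpret N: left_module R N using N(1) by (simp add: simple_module_def)
  interpret N': left_module R N' using N'(1) by (simp add: simple_module_def)
  have "a \<in> annihilator R N \<longleftrightarrow> (\<forall>b\<in>carrier R. (a \<otimes>\<^bsub>R\<^esub> b) \<odot>\<^bsub>N\<^esub> n = \<zero>\<^bsub>N\<^esub>)" if "a \<in> carrier R" for a
    unfolding annihilator_def using that N.smult_assoc[OF that _ N(2)] N.smult_closed[OF _ N(2)]
      simple_module_cyclic[OF N] by (auto; metis)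
  moreover have "a \<in> annihilator R N' \<longleftrightarrow> (\<forall>b\<in>carrier R. (a \<otimes>\<^bsub>R\<^esub> b) \<odot>\<^bsub>N'\<^esub> n' = \<zero>\<^bsub>N'\<^esub>)" if "a \<in> carrier R" for a
    unfolding annihilator_def using that N'.smult_assoc[OF that _ N'(2)] N'.smult_closed[OF _ N'(2)]
      simple_module_cyclic[OF N'] by (auto; metis)
  ultimately have "a \<in> annihilator R N \<longleftrightarrow> a \<in> annihilator R N'" if "a \<in> carrier R" for a
    using that eq by auto
  then show ?thesis by (auto simp: annihilator_def)
qed

section \<open>Ring axioms and the module of invariants\<close>

context hecke_setting
begin

lemma frob_add:
  assumes \<pi>: "smooth_rep G T \<pi>" and \<phi>: "\<phi> \<in> hom_on K \<rho> \<pi>" and \<psi>: "\<psi> \<in> hom_on K \<rho> \<pi>" and p: "p \<in> carrier cind"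
  shows "frob \<pi> (\<phi> + \<psi>) p = frob \<pi> \<phi> p + frob \<pi> \<psi> p"
proof -
  have "integral (\<lambda>g. act \<pi> g ((\<phi> + \<psi>) (p g))) = integral (\<lambda>g. act \<pi> g (\<phi> (p g)) + act \<pi> g (\<psi> (p g)))"
    using cindD(2)[OF p] intertwiners_mem[OF \<phi>] intertwiners_mem[OF \<psi>] representationD(3)[OF smooth_repD(1)[OF \<pi>]]
    by (intro integral_cong) simp
  then show ?thesis using p integral_add[OF frob_cc[OF \<pi> \<phi> p] frob_cc[OF \<pi> \<psi> p]] by (simp add: frob_def)
qed

lemma hom_outside: "\<phi> \<in> hom_on K \<rho> \<pi> \<Longrightarrow> w \<notin> W \<Longrightarrow> \<phi> w = 0"
  by (rule lin_mapsD(2)[OF intertwinersD(1)])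

lemma frob_zero: "smooth_rep G T \<pi> \<Longrightarrow> \<phi> \<in> hom_on K \<rho> \<pi> \<Longrightarrow> frob \<pi> \<phi> 0 = 0"
  by (rule lin_maps_zero[OF cindR(1) intertwinersD(1)[OF frob_intertwiner]])

lemma hecke_hom_mem: "a \<in> carrier \<H> \<Longrightarrow> hecke_hom a w \<in> carrier cind"
  using intertwiners_mem[OF hecke_hom_hom] hom_outside[OF hecke_hom_hom] complex_vector.subspace_0[OF cindR(1)]
  by metis

lemma hecke_ring: "ring \<H>"
proof (rule ringI)
  note inj = hecke_hom_inj
  note F = frob_intertwiner[OF cind_smooth hecke_hom_hom]
  show "abelian_group \<H>"
  proof (rule abelian_groupI)
    show "\<exists>y\<in>carrier \<H>. y \<oplus>\<^bsub>\<H>\<^esub> x = \<zero>\<^bsub>\<H>\<^esub>" if x: "x \<in> carrier \<H>" for x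
    proof
      have h: "- hecke_hom x \<in> hom_on K \<rho> cind"
        by (rule complex_vector.subspace_neg[OF hom_csubspace[OF cind_smooth] hecke_hom_hom[OF x]])
      show "hom_hecke (- hecke_hom x) \<in> carrier \<H>" by (rule hom_hecke_mem[OF h])
      then show "hom_hecke (- hecke_hom x) \<oplus>\<^bsub>\<H>\<^esub> x = \<zero>\<^bsub>\<H>\<^esub>"
        using x by (intro inj hecke_add hecke_zero) (simp_all add: hecke_add hecke_zero hecke_hom_inverse[OF h])
    qed
  qed (auto simp: hecke_add hecke_zero, auto simp: hecke_sel add_ac)
  show "monoid \<H>"
  proof (rule monoidI)
    show "x \<otimes>\<^bsub>\<H>\<^esub> y \<otimes>\<^bsub>\<H>\<^esub> z = x \<otimes>\<^bsub>\<H>\<^esub> (y \<otimes>\<^bsub>\<H>\<^esub> z)"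
      if xyz: "x \<in> carrier \<H>" "y \<in> carrier \<H>" "z \<in> carrier \<H>" for x y z
      by (rule inj) (simp_all add: xyz hecke_mult
        frob_natural[OF cind_smooth hecke_hom_hom[OF xyz(2)] F[OF xyz(3)] hecke_hom_mem[OF xyz(1)]])
    show "\<one>\<^bsub>\<H>\<^esub> \<otimes>\<^bsub>\<H>\<^esub> x = x" if x: "x \<in> carrier \<H>" for x
    proof (rule inj)
      have "frob cind (hecke_hom x) (cind_unit w) = hecke_hom x w" for w
      proof (cases "w \<in> W")
        case False
        then show ?thesis
          using hom_outside[OF cind_unit_hom False] hom_outside[OF hecke_hom_hom[OF x] False]
            frob_zero[OF cind_smooth hecke_hom_hom[OF x]] by simp
      qed (rule frob_unit[OF cind_smooth hecke_hom_hom[OF x]])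
      then show "hecke_hom (\<one>\<^bsub>\<H>\<^esub> \<otimes>\<^bsub>\<H>\<^esub> x) = hecke_hom x" by (simp add: hecke_mult[OF hecke_one(1) x] hecke_one(2))
    qed (simp_all add: x hecke_mult hecke_one)
    show "x \<otimes>\<^bsub>\<H>\<^esub> \<one>\<^bsub>\<H>\<^esub> = x" if x: "x \<in> carrier \<H>" for x
      by (rule inj) (simp_all add: x hecke_mult hecke_one frob_cind_unit hecke_hom_mem)
  qed (simp_all add: hecke_mult hecke_one)
  show "(x \<oplus>\<^bsub>\<H>\<^esub> y) \<otimes>\<^bsub>\<H>\<^esub> z = x \<otimes>\<^bsub>\<H>\<^esub> z \<oplus>\<^bsub>\<H>\<^esub> y \<otimes>\<^bsub>\<H>\<^esub> z"
    if xyz: "x \<in> carrier \<H>" "y \<in> carrier \<H>" "z \<in> carrier \<H>" for x y z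
    by (rule inj) (simp_all add: xyz hecke_mult hecke_add fun_eq_iff
        lin_mapsD(3)[OF intertwinersD(1)[OF F[OF xyz(3)]]] hecke_hom_mem)
  show "z \<otimes>\<^bsub>\<H>\<^esub> (x \<oplus>\<^bsub>\<H>\<^esub> y) = z \<otimes>\<^bsub>\<H>\<^esub> x \<oplus>\<^bsub>\<H>\<^esub> z \<otimes>\<^bsub>\<H>\<^esub> y"
    if xyz: "x \<in> carrier \<H>" "y \<in> carrier \<H>" "z \<in> carrier \<H>" for x y z
    by (rule inj) (simp_all add: xyz hecke_mult hecke_add fun_eq_iff
        frob_add[OF cind_smooth hecke_hom_hom hecke_hom_hom] hecke_hom_mem)
qed

abbreviation "\<N> \<equiv> rho_invariants G T M K \<rho>"

lemma inv_sel: "carrier (\<N> \<pi>) = hom_on K \<rho> \<pi>" "\<zero>\<^bsub>\<N> \<pi>\<^esub> = 0" "\<phi> \<oplus>\<^bsub>\<N> \<pi>\<^esub> \<psi> = \<phi> + \<psi>"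
  by (simp_all add: rho_invariants_def)

lemma inv_smult:
  assumes \<pi>: "smooth_rep G T \<pi>" and \<phi>: "\<phi> \<in> hom_on K \<rho> \<pi>" and a: "a \<in> carrier \<H>"
  shows "a \<odot>\<^bsub>\<N> \<pi>\<^esub> \<phi> = (\<lambda>w. frob \<pi> \<phi> (hecke_hom a w))"
proof
  fix w
  show "(a \<odot>\<^bsub>\<N> \<pi>\<^esub> \<phi>) w = frob \<pi> \<phi> (hecke_hom a w)"
  proof (cases "w \<in> W")
    case True
    then show ?thesis
      using hecke_hom_mem[OF a] by (auto simp: rho_invariants_def frob_def hecke_hom_def intro!: integral_cong)
  next
    case False
    then show ?thesis
      using hom_outside[OF hecke_hom_hom[OF a] False] frob_zero[OF \<pi> \<phi>] by (simp add: rho_invariants_def)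
  qed
qed

lemma inv_left_module:
  fixes \<pi> :: "('g, 'v::complex_vector) rep"
  assumes \<pi>: "smooth_rep G T \<pi>"
  shows "left_module \<H> (\<N> \<pi>)"
proof -
  interpret R: ring \<H> by (rule hecke_ring)
  note S = hom_csubspace[OF \<pi>]
  have "abelian_group (\<N> \<pi>)"
  proof (rule abelian_groupI)
    show "\<exists>y\<in>carrier (\<N> \<pi>). y \<oplus>\<^bsub>\<N> \<pi>\<^esub> x = \<zero>\<^bsub>\<N> \<pi>\<^esub>" if "x \<in> carrier (\<N> \<pi>)" for x
      using that complex_vector.subspace_neg[OF S] by (intro bexI[of _ "- x"]) (simp_all add: inv_sel)
  qed (auto simp: inv_sel add_ac complex_vector.subspace_add[OF S] complex_vector.subspace_0[OF S])
  moreover have "left_module_axioms \<H> (\<N> \<pi>)"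
  proof (rule left_module_axioms.intro)
    note F = frob_intertwiner[OF \<pi>]
    show cl: "a \<odot>\<^bsub>\<N> \<pi>\<^esub> x \<in> carrier (\<N> \<pi>)" if a: "a \<in> carrier \<H>" and x: "x \<in> carrier (\<N> \<pi>)" for a x
      using x hom_frob[OF hecke_hom_hom[OF a] \<pi>] by (simp add: inv_sel inv_smult[OF \<pi> _ a])
    show "(a \<oplus>\<^bsub>\<H>\<^esub> b) \<odot>\<^bsub>\<N> \<pi>\<^esub> x = a \<odot>\<^bsub>\<N> \<pi>\<^esub> x \<oplus>\<^bsub>\<N> \<pi>\<^esub> b \<odot>\<^bsub>\<N> \<pi>\<^esub> x"
      if "a \<in> carrier \<H>" "b \<in> carrier \<H>" "x \<in> carrier (\<N> \<pi>)" for a b x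
      using that by (simp add: inv_sel inv_smult[OF \<pi>] hecke_add fun_eq_iff
          lin_mapsD(3)[OF intertwinersD(1)[OF F]] hecke_hom_mem)
    show "a \<odot>\<^bsub>\<N> \<pi>\<^esub> (x \<oplus>\<^bsub>\<N> \<pi>\<^esub> y) = a \<odot>\<^bsub>\<N> \<pi>\<^esub> x \<oplus>\<^bsub>\<N> \<pi>\<^esub> a \<odot>\<^bsub>\<N> \<pi>\<^esub> y"
      if "a \<in> carrier \<H>" "x \<in> carrier (\<N> \<pi>)" "y \<in> carrier (\<N> \<pi>)" for a x y
      using that complex_vector.subspace_add[OF S, of x y]
      by (simp add: inv_sel inv_smult[OF \<pi>] fun_eq_iff frob_add[OF \<pi>] hecke_hom_mem)
    show "(a \<otimes>\<^bsub>\<H>\<^esub> b) \<odot>\<^bsub>\<N> \<pi>\<^esub> x = a \<odot>\<^bsub>\<N> \<pi>\<^esub> (b \<odot>\<^bsub>\<N> \<pi>\<^esub> x)"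
      if a: "a \<in> carrier \<H>" and b: "b \<in> carrier \<H>" and x': "x \<in> carrier (\<N> \<pi>)" for a b x
    proof -
      have x: "x \<in> hom_on K \<rho> \<pi>" using x' by (simp add: inv_sel)
      note bx = hom_frob[OF hecke_hom_hom[OF b] \<pi> x]
      show ?thesis
        unfolding inv_smult[OF \<pi> x hecke_mult(1)[OF a b]] inv_smult[OF \<pi> x b] inv_smult[OF \<pi> bx a] hecke_mult(2)[OF a b]
        using frob_natural[OF cind_smooth hecke_hom_hom[OF b] F[OF x] hecke_hom_mem[OF a]] by simp
    qed
    show "\<one>\<^bsub>\<H>\<^esub> \<odot>\<^bsub>\<N> \<pi>\<^esub> x = x" if x': "x \<in> carrier (\<N> \<pi>)" for x
    proof
      have x: "x \<in> hom_on K \<rho> \<pi>" using x' by (simp add: inv_sel)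
      fix w
      show "(\<one>\<^bsub>\<H>\<^esub> \<odot>\<^bsub>\<N> \<pi>\<^esub> x) w = x w"
        unfolding inv_smult[OF \<pi> x hecke_one(1)] hecke_one(2)
        using frob_unit[OF \<pi> x] hom_outside[OF cind_unit_hom] hom_outside[OF x] frob_zero[OF \<pi> x] by (cases "w \<in> W") auto
    qed
  qed
  ultimately show ?thesis using R.ring_axioms by (simp add: left_module_def)
qed

text \<open>Frobenius reciprocity turns the search for \<open>a\<close> into lifting
  \<open>\<psi>\<close> through the restriction of \<open>frob \<pi> \<phi>\<close> to
  \<open>D\<close>. Complete reducibility over \<open>K\<close> gives an equivariant section there,
  and \<open>a\<close> corresponds to the section composed with \<open>\<psi>\<close>. The freedom
  in \<open>D\<close> forces the lift into a prescribed subspace: all of \<open>cind\<close> for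
  simplicity of the module, a kernel for the comparison of annihilators.\<close>

lemma hom_lift:
  fixes \<pi> :: "('g, 'v::complex_vector) rep"
  assumes \<pi>: "smooth_rep G T \<pi>" and \<phi>: "\<phi> \<in> hom_on K \<rho> \<pi>" and \<psi>: "\<psi> \<in> hom_on K \<rho> \<pi>"
    and D: "csubspace D" "D \<subseteq> carrier cind" "\<And>k p. k \<in> K \<Longrightarrow> p \<in> D \<Longrightarrow> act cind k p \<in> D"
    and im: "\<And>w. w \<in> W \<Longrightarrow> \<psi> w \<in> frob \<pi> \<phi> ` D"
  obtains a where "a \<in> carrier \<H>" "\<And>w. w \<in> W \<Longrightarrow> hecke_hom a w \<in> D" "a \<odot>\<^bsub>\<N> \<pi>\<^esub> \<phi> = \<psi>"
proof -
  note F = frob_intertwiner[OF \<pi> \<phi>]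
  note lin = intertwinersD(1)[OF F]
  let ?\<theta> = "\<lambda>p. if p \<in> D then frob \<pi> \<phi> p else 0"
  let ?\<sigma> = "cind\<lparr>carrier := D\<rparr>" and ?\<tau> = "\<pi>\<lparr>carrier := frob \<pi> \<phi> ` D\<rparr>"
  have \<sigma>: "smooth_on K ?\<sigma>" by (rule smooth_rep_restrict[OF topological cind_smooth KD(1) D])
  have FDsub: "frob \<pi> \<phi> ` D \<subseteq> carrier \<pi>" using intertwiners_mem[OF F] D(2) by blast
  have FDact: "act \<pi> k v \<in> frob \<pi> \<phi> ` D" if "k \<in> K" "v \<in> frob \<pi> \<phi> ` D" for k v
  proof -
    obtain p where p: "p \<in> D" "v = frob \<pi> \<phi> p" using \<open>v \<in> _\<close> by blast
    then have "act \<pi> k v = frob \<pi> \<phi> (act cind k p)" using intertwinersD(2)[OF F KG[OF that(1)]] D(2) by auto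
    then show ?thesis using D(3)[OF that(1) p(1)] by blast
  qed
  have \<tau>: "smooth_on K ?\<tau>"
    by (rule smooth_rep_restrict[OF topological \<pi> KD(1) csubspace_image[OF cindR(1) lin D(1,2)] FDsub FDact])
  have \<theta>: "?\<theta> \<in> hom_on K ?\<sigma> ?\<tau>"
  proof (intro intertwinersI lin_mapsI)
    fix g x assume "g \<in> carrier (G\<lparr>carrier := K\<rparr>)" "x \<in> carrier ?\<sigma>"
    then show "?\<theta> (act ?\<sigma> g x) = act ?\<tau> g (?\<theta> x)"
      using D(2,3) intertwinersD(2)[OF F, of g x] KG by auto
  qed (use lin_mapsD(3)[OF lin subsetD[OF D(2)] subsetD[OF D(2)]] lin_mapsD(4)[OF lin subsetD[OF D(2)]] in \<open>auto simp: complex_vector.subspace_add[OF D(1)] complex_vector.subspace_scale[OF D(1)]\<close>)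
  obtain s where s: "s \<in> hom_on K ?\<tau> ?\<sigma>" "\<And>y. y \<in> carrier ?\<tau> \<Longrightarrow> ?\<theta> (s y) = y"
    by (rule hom_on_right_inverse[OF K \<sigma> \<tau> \<theta>]) (auto intro: that)
  have \<psi>': "\<psi> \<in> hom_on K \<rho> ?\<tau>"
    using intertwinersD[OF \<psi>] im by (auto simp: intertwiners_def lin_maps_def)
  have \<chi>': "(\<lambda>w. s (\<psi> w)) \<in> hom_on K \<rho> ?\<sigma>" by (rule intertwiners_comp[OF \<psi>' s(1) smooth_onD(1)[OF K \<tau>]])
  then have \<chi>: "(\<lambda>w. s (\<psi> w)) \<in> hom_on K \<rho> cind"
    using D(2) by (auto simp: intertwiners_def lin_maps_def)
  note h = hecke_hom_inverse[OF \<chi>]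
  have sD: "s (\<psi> w) \<in> D" if "w \<in> W" for w using intertwiners_mem[OF \<chi>' that] by simp
  show ?thesis
  proof (rule that[OF hom_hecke_mem[OF \<chi>]])
    show "hecke_hom (hom_hecke (\<lambda>w. s (\<psi> w))) w \<in> D" if "w \<in> W" for w unfolding h by (rule sD[OF that])
    have "frob \<pi> \<phi> (s (\<psi> w)) = \<psi> w" for w
    proof (cases "w \<in> W")
      case True
      then show ?thesis using s(2)[of "\<psi> w"] im[OF True] sD[OF True] by simp
    next
      case False
      then show ?thesis using hom_outside[OF \<psi> False] hom_outside[OF \<chi> False] frob_zero[OF \<pi> \<phi>] by simp
    qed
    then show "hom_hecke (\<lambda>w. s (\<psi> w)) \<odot>\<^bsub>\<N> \<pi>\<^esub> \<phi> = \<psi>"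
      unfolding inv_smult[OF \<pi> \<phi> hom_hecke_mem[OF \<chi>]] h by simp
  qed
qed

lemma frob_nonzero:
  assumes \<pi>: "smooth_rep G T \<pi>" and \<phi>: "\<phi> \<in> hom_on K \<rho> \<pi>" "\<phi> \<noteq> 0"
  shows "frob \<pi> \<phi> \<noteq> 0"
proof
  assume z: "frob \<pi> \<phi> = 0"
  obtain w where "w \<in> W" "\<phi> w \<noteq> 0" using intertwiner_nonzero[OF \<phi>(1)] \<phi>(2) by blast
  then show False using frob_unit[OF \<pi> \<phi>(1), of w] z by simp
qed

lemma smooth_irrepD: "smooth_irrep G T \<pi> \<Longrightarrow> smooth_rep G T \<pi>" "smooth_irrep G T \<pi> \<Longrightarrow> irreducible_rep G \<pi>"
  by (auto simp: smooth_irrep_def)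

lemma frob_onto:
  assumes "smooth_irrep G T \<pi>" "\<phi> \<in> hom_on K \<rho> \<pi>" "\<phi> \<noteq> 0"
  shows "frob \<pi> \<phi> ` carrier cind = carrier \<pi>"
  using assms by (intro irreducible_surjective[OF smooth_irrepD(2) cind_representation frob_intertwiner frob_nonzero] smooth_irrepD)

text \<open>Irreducibility of \<open>\<pi>\<close> makes \<open>frob \<pi> \<phi>\<close> onto for
  every nonzero \<open>\<phi>\<close>, so \<open>hom_lift\<close> with \<open>D\<close> the whole of
  \<open>cind\<close> carries \<open>\<phi>\<close> to any given \<open>\<psi>\<close>.\<close>

lemma inv_simple_module:
  assumes \<pi>: "smooth_irrep G T \<pi>" and ne: "hom_on K \<rho> \<pi> \<noteq> {0}"
  shows "simple_module \<H> (\<N> \<pi>)"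
proof -
  note sm = smooth_irrepD(1)[OF \<pi>]
  interpret left_module \<H> "\<N> \<pi>" by (rule inv_left_module[OF sm])
  have "S = {\<zero>\<^bsub>\<N> \<pi>\<^esub>} \<or> S = carrier (\<N> \<pi>)" if S: "submodule S \<H> (\<N> \<pi>)" for S
  proof (cases "S = {0}")
    case False
    have S': "S \<subseteq> hom_on K \<rho> \<pi>" "0 \<in> S" "\<And>a \<phi>. a \<in> carrier \<H> \<Longrightarrow> \<phi> \<in> S \<Longrightarrow> a \<odot>\<^bsub>\<N> \<pi>\<^esub> \<phi> \<in> S"
      using S unfolding submodule_iff inv_sel by auto
    then obtain \<phi> where \<phi>: "\<phi> \<in> S" "\<phi> \<noteq> 0" using False by blast
    then have \<phi>h: "\<phi> \<in> hom_on K \<rho> \<pi>" using S' by blast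
    have "\<psi> \<in> S" if \<psi>: "\<psi> \<in> hom_on K \<rho> \<pi>" for \<psi>
    proof -
      obtain a where "a \<in> carrier \<H>" "a \<odot>\<^bsub>\<N> \<pi>\<^esub> \<phi> = \<psi>"
        by (rule hom_lift[OF sm \<phi>h \<psi> cindR(1) order_refl])
          (use cindR(2) KG frob_onto[OF \<pi> \<phi>h \<phi>(2)] intertwiners_mem[OF \<psi>] in auto)
      then show ?thesis using S'(3) \<phi>(1) by blast
    qed
    then show ?thesis using S'(1) by (auto simp: inv_sel)
  qed (simp add: inv_sel)
  then show ?thesis using left_module_axioms ne by (simp add: simple_module_def inv_sel)
qed

lemma cyclic_annihilator_le_iso:
  fixes \<pi> :: "('g, 'v::complex_vector) rep" and \<pi>' :: "('g, 'u::complex_vector) rep"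
  assumes \<pi>: "smooth_irrep G T \<pi>" and \<pi>': "smooth_irrep G T \<pi>'"
    and n: "n \<in> hom_on K \<rho> \<pi>" "n \<noteq> 0" and m: "m \<in> hom_on K \<rho> \<pi>'" "m \<noteq> 0"
    and le: "\<And>a. a \<in> carrier \<H> \<Longrightarrow> a \<odot>\<^bsub>\<N> \<pi>\<^esub> n = 0 \<Longrightarrow> a \<odot>\<^bsub>\<N> \<pi>'\<^esub> m = 0"
  shows "rep_iso G \<pi> \<pi>'"
proof -
  note s = smooth_irrepD(1)[OF \<pi>] and s' = smooth_irrepD(1)[OF \<pi>']
  note F = frob_intertwiner[OF s n(1)] and F' = frob_intertwiner[OF s' m(1)]
  note lin = intertwinersD(1)[OF F] and lin' = intertwinersD(1)[OF F']
  \<comment> \<open>If \<open>frob \<pi>' m\<close> did not vanish on the kernel \<open>D\<close> of \<open>frob \<pi> n\<close>, it would map \<open>D\<close> onto \<open>\<pi>'\<close>, so that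
    \<open>m\<close> would lift to some \<open>a\<close> with values in \<open>D\<close>; then \<open>a\<close> kills \<open>n\<close> but fixes \<open>m\<close>.\<close>
  let ?D = "{p \<in> carrier cind. frob \<pi> n p = 0}"
  have D: "csubspace ?D" by (rule csubspace_kernel[OF cindR(1) lin])
  have DG: "act cind g p \<in> ?D" if "g \<in> carrier G" "p \<in> ?D" for g p
    using that cindR(2) intertwinersD(2)[OF F] representation_act_zero[OF smooth_repD(1)[OF s]] by auto
  have ker: "frob \<pi>' m p = 0" if p: "p \<in> ?D" for p
  proof (rule ccontr)
    assume ne: "frob \<pi>' m p \<noteq> 0"
    let ?E = "frob \<pi>' m ` ?D"
    have "?E = {0} \<or> ?E = carrier \<pi>'"
    proof (rule irreducible_repD(3)[OF smooth_irrepD(2)[OF \<pi>'] csubspace_image[OF cindR(1) lin' D]])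
      show "?E \<subseteq> carrier \<pi>'" using intertwiners_mem[OF F'] by blast
      show "act \<pi>' g x \<in> ?E" if g: "g \<in> carrier G" and x: "x \<in> ?E" for g x
      proof -
        obtain q where q: "q \<in> ?D" "x = frob \<pi>' m q" using x by blast
        then have "act \<pi>' g x = frob \<pi>' m (act cind g q)" using intertwinersD(2)[OF F' g] by simp
        then show ?thesis using DG[OF g q(1)] by blast
      qed
    qed auto
    then have E: "?E = carrier \<pi>'" using ne p by blast
    obtain a where a: "a \<in> carrier \<H>" "\<And>w. w \<in> W \<Longrightarrow> hecke_hom a w \<in> ?D" "a \<odot>\<^bsub>\<N> \<pi>'\<^esub> m = m"
    proof (rule hom_lift[OF s' m(1) m(1) D])
      show "m w \<in> frob \<pi>' m ` ?D" if "w \<in> W" for w unfolding E by (rule intertwiners_mem[OF m(1) that])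
      show "act cind k p \<in> ?D" if "k \<in> K" "p \<in> ?D" for k p by (rule DG[OF KG[OF that(1)] that(2)])
    qed (auto intro: that)
    have "frob \<pi> n (hecke_hom a w) = 0" for w
      using a(2)[of w] hom_outside[OF hecke_hom_hom[OF a(1)], of w] frob_zero[OF s n(1)] by (cases "w \<in> W") auto
    then have "a \<odot>\<^bsub>\<N> \<pi>\<^esub> n = 0" by (simp add: inv_smult[OF s n(1) a(1)] zero_fun_def)
    then show False using le[OF a(1)] a(3) m(2) by simp
  qed
  \<comment> \<open>\<open>frob \<pi>' m\<close> vanishes on the kernel of
    \<open>frob \<pi> n\<close>, so the value does not depend on the preimage chosen by
    \<open>inv_into\<close>.\<close>
  define \<theta> where "\<theta> v = (if v \<in> carrier \<pi> then frob \<pi>' m (inv_into (carrier cind) (frob \<pi> n) v) else 0)" for v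
  note onto = frob_onto[OF \<pi> n]
  have \<theta>: "\<theta> (frob \<pi> n p) = frob \<pi>' m p" if p: "p \<in> carrier cind" for p
  proof -
    let ?q = "inv_into (carrier cind) (frob \<pi> n) (frob \<pi> n p)"
    have q: "?q \<in> carrier cind" "frob \<pi> n ?q = frob \<pi> n p"
      by (rule inv_into_into[OF imageI[OF p]], rule f_inv_into_f[OF imageI[OF p]])
    then have "?q - p \<in> ?D"
      using p by (simp add: complex_vector.subspace_diff[OF cindR(1)] lin_maps_diff[OF cindR(1) lin])
    then have "frob \<pi>' m (?q - p) = 0" by (rule ker)
    then have "frob \<pi>' m ?q = frob \<pi>' m p" by (simp add: lin_maps_diff[OF cindR(1) lin' q(1) p])
    then show ?thesis using intertwiners_mem[OF F p] by (simp add: \<theta>_def)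
  qed
  have pre: "\<exists>p\<in>carrier cind. x = frob \<pi> n p" if "x \<in> carrier \<pi>" for x using that onto by blast
  have hom: "\<theta> \<in> intertwiners G \<pi> \<pi>'"
  proof (intro intertwinersI lin_mapsI)
    show "\<theta> x \<in> carrier \<pi>'" if "x \<in> carrier \<pi>" for x using pre[OF that] \<theta> intertwiners_mem[OF F'] by auto
    show "\<theta> x = 0" if "x \<notin> carrier \<pi>" for x using that by (simp add: \<theta>_def)
    show "\<theta> (x + y) = \<theta> x + \<theta> y" if xy: "x \<in> carrier \<pi>" "y \<in> carrier \<pi>" for x y
    proof -
      obtain p q where "p \<in> carrier cind" "x = frob \<pi> n p" "q \<in> carrier cind" "y = frob \<pi> n q" using pre xy by metis
      then show ?thesis
        using \<theta> lin_mapsD(3)[OF lin, of p q] lin_mapsD(3)[OF lin', of p q] complex_vector.subspace_add[OF cindR(1), of p q] by metis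
    qed
    show "\<theta> (c *\<^sub>C x) = c *\<^sub>C \<theta> x" if x: "x \<in> carrier \<pi>" for c x
    proof -
      obtain p where "p \<in> carrier cind" "x = frob \<pi> n p" using pre x by metis
      then show ?thesis
        using \<theta> lin_mapsD(4)[OF lin, of p c] lin_mapsD(4)[OF lin', of p c] complex_vector.subspace_scale[OF cindR(1), of p c] by metis
    qed
    show "\<theta> (act \<pi> g x) = act \<pi>' g (\<theta> x)" if g: "g \<in> carrier G" and x: "x \<in> carrier \<pi>" for g x
    proof -
      obtain p where "p \<in> carrier cind" "x = frob \<pi> n p" using pre x by metis
      then show ?thesis
        using \<theta> intertwinersD(2)[OF F g, of p] intertwinersD(2)[OF F' g, of p] cindR(2)[OF g, of p] by metis
    qed
  qed
  have "\<theta> \<noteq> 0"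
  proof
    assume z: "\<theta> = 0"
    obtain w where w: "w \<in> W" "m w \<noteq> 0" using m intertwiner_nonzero by blast
    then show False using \<theta>[OF cind_unit_mem, of w] frob_unit[OF s' m(1) w(1)] z by simp
  qed
  then have "bij_betw \<theta> (carrier \<pi>) (carrier \<pi>')"
    using irreducible_injective[OF smooth_irrepD(2)[OF \<pi>] smooth_repD(1)[OF s'] hom]
      irreducible_surjective[OF smooth_irrepD(2)[OF \<pi>'] smooth_repD(1)[OF s] hom] by (simp add: bij_betw_def)
  then show ?thesis using hom by (auto simp: rep_iso_def)
qed

text \<open>The finitely many generators \<open>cind_unit b\<close>, with \<open>b\<close> in a
  basis of \<open>W\<close>, are all fixed by one compact open subgroup \<open>U\<close>. As
  \<open>\<phi> b\<close> is the image of \<open>cind_unit b\<close> under a map of group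
  representations, \<open>\<phi>\<close> takes its values in the \<open>U\<close>-invariants, a
  finite-dimensional space by admissibility.\<close>

lemma hom_finite_dim:
  fixes \<pi> :: "('g, 'v::complex_vector) rep"
  assumes \<pi>: "admissible_rep G T \<pi>"
  shows "finite_dim (hom_on K \<rho> \<pi>)"
proof -
  have sm: "smooth_rep G T \<pi>" using \<pi> by (simp add: admissible_rep_def)
  note R = representationD[OF smooth_repD(1)[OF sm]]
  obtain B where B: "finite B" "B \<subseteq> W" "\<not> cdependent B" "cspan B = W"
    using finite_dim_basis[OF \<rho>D(2) W_finite_dim] by metis
  have "\<exists>U. compact_open_subgroup G T U \<and> (\<forall>b\<in>B. U \<subseteq> stabilizer G cind (cind_unit b))"
    using B(1)
  proof (induction B rule: finite_induct)
    case empty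
    then show ?case using K by auto
  next
    case (insert b B)
    then obtain U where U: "compact_open_subgroup G T U" "\<forall>b\<in>B. U \<subseteq> stabilizer G cind (cind_unit b)" by blast
    show ?case
      using compact_open_stabilizer[OF U(1) cind_smooth cind_unit_mem[of b]] U(2) by (intro exI[of _ "U \<inter> stabilizer G cind (cind_unit b)"]) auto
  qed
  then obtain U where U: "compact_open_subgroup G T U" "\<And>b g. b \<in> B \<Longrightarrow> g \<in> U \<Longrightarrow> act cind g (cind_unit b) = cind_unit b"
    unfolding stabilizer_def by blast
  note UG = compact_open_subgroupD(4)[OF U(1)]
  let ?V = "invariant_vectors U \<pi>"
  have V: "csubspace ?V"
    using UG R representation_act_zero[OF smooth_repD(1)[OF sm]]
    unfolding complex_vector.subspace_def invariant_vectors_def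
    by (auto simp: complex_vector.subspace_0[OF R(1)] complex_vector.subspace_add[OF R(1)] complex_vector.subspace_scale[OF R(1)] subset_iff)
  have "finite_dim ?V" using \<pi> U(1) by (auto simp: admissible_rep_def finite_dim_def)
  then have "finite_dim (lin_maps W ?V)" by (intro finite_dim_lin_maps \<rho>D(2) W_finite_dim V)
  moreover have "hom_on K \<rho> \<pi> \<subseteq> lin_maps W ?V"
  proof
    fix \<phi> assume \<phi>: "\<phi> \<in> hom_on K \<rho> \<pi>"
    note lin = lin_mapsD[OF intertwinersD(1)[OF \<phi>]]
    have b: "\<phi> b \<in> ?V" if "b \<in> B" for b
    proof -
      have bW: "b \<in> W" using that B(2) by blast
      have "act \<pi> g (\<phi> b) = \<phi> b" if "g \<in> U" for g
        using intertwinersD(2)[OF frob_intertwiner[OF sm \<phi>] subsetD[OF UG that] cind_unit_mem[of b]]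
          frob_unit[OF sm \<phi> bW] U(2)[OF \<open>b \<in> B\<close> that] by simp
      then show ?thesis using lin(1)[OF bW] by (simp add: invariant_vectors_def)
    qed
    have "\<phi> w \<in> ?V" if w: "w \<in> W" for w
    proof -
      have "w \<in> cspan B" using w B(4) by simp
      then have "w \<in> W \<and> \<phi> w \<in> ?V"
      proof (induction rule: complex_vector.span_induct_alt)
        case base
        then show ?case using lin_maps_zero[OF \<rho>D(2) intertwinersD(1)[OF \<phi>]] complex_vector.subspace_0[OF V]
          by (simp add: complex_vector.subspace_0[OF \<rho>D(2)])
      next
        case (step c x y)
        have xW: "x \<in> W" using step B(2) by blast
        then have cx: "c *\<^sub>C x \<in> W" by (rule complex_vector.subspace_scale[OF \<rho>D(2)])
        have "\<phi> (c *\<^sub>C x + y) = c *\<^sub>C \<phi> x + \<phi> y" using lin(3)[OF cx] lin(4)[OF xW] step by simp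
        moreover have "c *\<^sub>C \<phi> x + \<phi> y \<in> ?V"
          using step b by (intro complex_vector.subspace_add[OF V] complex_vector.subspace_scale[OF V]) auto
        moreover have "c *\<^sub>C x + y \<in> W" using step cx by (intro complex_vector.subspace_add[OF \<rho>D(2)]) auto
        ultimately show ?case by simp
      qed
      then show ?thesis ..
    qed
    then show "\<phi> \<in> lin_maps W ?V" using lin by (intro lin_mapsI) auto
  qed
  ultimately show ?thesis by (rule finite_dim_mono)
qed

text \<open>The module axioms speak of addition only; complex linearity of the action is what allows
  annihilation to be tested on a basis.\<close>

lemma inv_smult_scale:
  fixes \<pi> :: "('g, 'v::complex_vector) rep"
  assumes \<pi>: "smooth_rep G T \<pi>" and \<phi>: "\<phi> \<in> hom_on K \<rho> \<pi>" and a: "a \<in> carrier \<H>"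
  shows "a \<odot>\<^bsub>\<N> \<pi>\<^esub> (c *\<^sub>C \<phi>) = c *\<^sub>C (a \<odot>\<^bsub>\<N> \<pi>\<^esub> \<phi>)"
proof -
  have c\<phi>: "c *\<^sub>C \<phi> \<in> hom_on K \<rho> \<pi>" by (rule complex_vector.subspace_scale[OF hom_csubspace[OF \<pi>] \<phi>])
  have "frob \<pi> (c *\<^sub>C \<phi>) (hecke_hom a w) = c *\<^sub>C frob \<pi> \<phi> (hecke_hom a w)" for w
  proof -
    have "integral (\<lambda>g. act \<pi> g ((c *\<^sub>C \<phi>) (hecke_hom a w g))) = integral (\<lambda>g. c *\<^sub>C act \<pi> g (\<phi> (hecke_hom a w g)))"
      using representationD(4)[OF smooth_repD(1)[OF \<pi>]] intertwiners_mem[OF \<phi>] cindD(2)[OF hecke_hom_mem[OF a]]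
      by (intro integral_cong) (simp add: scaleC_fun_def)
    then show ?thesis
      using integral_scale[OF frob_cc[OF \<pi> \<phi> hecke_hom_mem[OF a]]] hecke_hom_mem[OF a] by (simp add: frob_def)
  qed
  moreover have "(c *\<^sub>C g) w = c *\<^sub>C g w" for g :: "'w \<Rightarrow> 'v" and w by (simp add: scaleC_fun_def)
  ultimately show ?thesis by (intro ext) (simp only: inv_smult[OF \<pi> c\<phi> a] inv_smult[OF \<pi> \<phi> a])
qed

text \<open>By linearity an element that kills a finite basis of Hom_K(\<rho>,\<pi>) annihilates the
  whole module, so the inclusion descends from modules to a pair of vectors. An inclusion of ideals
  thus already forces an isomorphism.\<close>

lemma annihilator_le_iso:
  fixes \<pi> :: "('g, 'v::complex_vector) rep" and \<pi>' :: "('g, 'u::complex_vector) rep"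
  assumes \<pi>: "smooth_irrep G T \<pi>" "admissible_rep G T \<pi>" and \<pi>': "smooth_irrep G T \<pi>'" "hom_on K \<rho> \<pi>' \<noteq> {0}"
    and le: "annihilator \<H> (\<N> \<pi>) \<subseteq> annihilator \<H> (\<N> \<pi>')"
  shows "rep_iso G \<pi> \<pi>'"
proof -
  note s = smooth_irrepD(1)[OF \<pi>(1)]
  interpret N: left_module \<H> "\<N> \<pi>" by (rule inv_left_module[OF s])
  obtain F where F: "finite F" "F \<subseteq> hom_on K \<rho> \<pi>" "\<not> cdependent F" "cspan F = hom_on K \<rho> \<pi>"
    using finite_dim_basis[OF hom_csubspace[OF s] hom_finite_dim[OF \<pi>(2)]] by metis
  have "{a \<in> carrier \<H>. \<forall>x\<in>F. a \<odot>\<^bsub>\<N> \<pi>\<^esub> x = \<zero>\<^bsub>\<N> \<pi>\<^esub>} \<subseteq> annihilator \<H> (\<N> \<pi>)"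
  proof
    fix a assume "a \<in> {a \<in> carrier \<H>. \<forall>x\<in>F. a \<odot>\<^bsub>\<N> \<pi>\<^esub> x = \<zero>\<^bsub>\<N> \<pi>\<^esub>}"
    then have a: "a \<in> carrier \<H>" "\<And>x. x \<in> F \<Longrightarrow> a \<odot>\<^bsub>\<N> \<pi>\<^esub> x = 0" by (auto simp: inv_sel)
    let ?Z = "{x \<in> hom_on K \<rho> \<pi>. a \<odot>\<^bsub>\<N> \<pi>\<^esub> x = 0}"
    have "csubspace ?Z"
      unfolding complex_vector.subspace_def
    proof (intro conjI ballI allI)
      show "0 \<in> ?Z" using N.smult_zero_right[OF a(1)] complex_vector.subspace_0[OF hom_csubspace[OF s]] by (simp add: inv_sel)
      show "x + y \<in> ?Z" if "x \<in> ?Z" "y \<in> ?Z" for x y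
        using that N.smult_r_distr[OF a(1), of x y] complex_vector.subspace_add[OF hom_csubspace[OF s], of x y] by (simp add: inv_sel)
      show "c *\<^sub>C x \<in> ?Z" if "x \<in> ?Z" for c x
        using that complex_vector.subspace_scale[OF hom_csubspace[OF s], of x c] by (simp add: inv_smult_scale[OF s _ a(1)])
    qed
    then have "cspan F \<subseteq> ?Z" using a(2) F(2) by (intro complex_vector.span_minimal) auto
    then show "a \<in> annihilator \<H> (\<N> \<pi>)" using a(1) F(4) by (auto simp: annihilator_def inv_sel)
  qed
  also note le
  finally have sub: "{a \<in> carrier \<H>. \<forall>x\<in>F. a \<odot>\<^bsub>\<N> \<pi>\<^esub> x = \<zero>\<^bsub>\<N> \<pi>\<^esub>} \<subseteq> annihilator \<H> (\<N> \<pi>')" .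
  have "\<exists>n\<in>hom_on K \<rho> \<pi>. \<exists>m\<in>hom_on K \<rho> \<pi>'. n \<noteq> 0 \<and> m \<noteq> 0 \<and>
      (\<forall>a\<in>carrier \<H>. a \<odot>\<^bsub>\<N> \<pi>\<^esub> n = 0 \<longrightarrow> a \<odot>\<^bsub>\<N> \<pi>'\<^esub> m = 0)"
    using N.annihilator_finite_cyclic[OF inv_left_module[OF smooth_irrepD(1)[OF \<pi>'(1)]] _ F(1) _ sub] \<pi>'(2) F(2)
    unfolding inv_sel by blast
  then obtain n m where nm: "n \<in> hom_on K \<rho> \<pi>" "m \<in> hom_on K \<rho> \<pi>'" "n \<noteq> 0" "m \<noteq> 0"
    and ann: "\<forall>a\<in>carrier \<H>. a \<odot>\<^bsub>\<N> \<pi>\<^esub> n = 0 \<longrightarrow> a \<odot>\<^bsub>\<N> \<pi>'\<^esub> m = 0" by blast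
  show ?thesis by (rule cyclic_annihilator_le_iso[OF \<pi>(1) \<pi>'(1) nm(1,3,2,4) ann[rule_format]])
qed

end

context hecke_setting
begin

section \<open>Every primitive ideal comes from an irreducible representation\<close>

text \<open>Averaging the rank one maps \<open>w \<mapsto> \<xi>(w) u\<close> yields enough \<open>K\<close>-maps to span \<open>Hom\<^sub>K(\<rho>, \<pi>)\<close>.\<close>

definition spread :: "('g, 'v::complex_vector) rep \<Rightarrow> ('w \<Rightarrow> complex) \<Rightarrow> 'v \<Rightarrow> 'w \<Rightarrow> 'v" where
  "spread \<pi> \<xi> u = average K \<rho> \<pi> (\<lambda>w. \<xi> w *\<^sub>C u)"

lemma rank_one_lin:
  assumes \<pi>: "smooth_rep G T \<pi>" and \<xi>: "\<xi> \<in> W'" and u: "u \<in> carrier \<pi>"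
  shows "(\<lambda>w. \<xi> w *\<^sub>C u) \<in> lin_maps W (carrier \<pi>)"
  using W'_apply[OF \<xi>] u representationD(1)[OF smooth_repD(1)[OF \<pi>]]
  by (intro lin_mapsI) (auto simp: complex_vector.subspace_scale scaleC_add_left scaleC_scaleC)

lemma spread_hom:
  assumes \<pi>: "smooth_rep G T \<pi>" and \<xi>: "\<xi> \<in> W'" and u: "u \<in> carrier \<pi>"
  shows "spread \<pi> \<xi> u \<in> hom_on K \<rho> \<pi>"
  unfolding spread_def by (rule average_intertwiner[OF K \<rho>_smooth smooth_on_restrict[OF \<pi> K] rank_one_lin[OF assms]])

lemma spread_apply:
  "w \<in> W \<Longrightarrow> spread \<pi> \<xi> u w = integral (\<lambda>g. if g \<in> K then act \<pi> g (\<xi> (act \<rho> (inv g) w) *\<^sub>C u) else 0)"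
  unfolding spread_def by (rule average_apply[OF K])

lemma spread_cc:
  assumes \<pi>: "smooth_rep G T \<pi>" and \<xi>: "\<xi> \<in> W'" and u: "u \<in> carrier \<pi>" and w: "w \<in> W"
  shows "cc (\<lambda>g. if g \<in> K then act \<pi> g (\<xi> (act \<rho> (inv g) w) *\<^sub>C u) else 0)"
  using average_cc[OF K \<rho>_smooth smooth_on_restrict[OF \<pi> K] lin_mapsD(1)[OF rank_one_lin[OF \<pi> \<xi> u]] w] .

lemma spread_natural:
  assumes \<pi>: "smooth_rep G T \<pi>" and \<sigma>: "smooth_rep G T \<sigma>" and \<xi>: "\<xi> \<in> W'" and u: "u \<in> carrier \<pi>"
    and \<theta>: "\<theta> \<in> intertwiners G \<pi> \<sigma>"
  shows "(\<lambda>w. \<theta> (spread \<pi> \<xi> u w)) = spread \<sigma> \<xi> (\<theta> u)"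
proof
  fix w
  note \<theta>u = intertwiners_mem[OF \<theta> u]
  show "\<theta> (spread \<pi> \<xi> u w) = spread \<sigma> \<xi> (\<theta> u) w"
  proof (cases "w \<in> W")
    case True
    have \<theta>K: "\<theta> \<in> hom_on K \<pi> \<sigma>" using intertwiners_subgroup[OF KD(4)] \<theta> by blast
    have "\<theta> (spread \<pi> \<xi> u w) = average K \<rho> \<sigma> (\<lambda>x. \<theta> (\<xi> x *\<^sub>C u)) w"
      unfolding spread_def
      by (rule average_post[OF K \<rho>_smooth smooth_on_restrict[OF \<pi> K] rank_one_lin[OF \<pi> \<xi> u] \<theta>K True])
    then show ?thesis by (simp add: spread_def lin_mapsD(4)[OF intertwinersD(1)[OF \<theta>] u])
  next
    case False
    then show ?thesis
      using hom_outside[OF spread_hom[OF \<pi> \<xi> u] False] hom_outside[OF spread_hom[OF \<sigma> \<xi> \<theta>u] False]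
        lin_maps_zero[OF representationD(1)[OF smooth_repD(1)[OF \<pi>]] intertwinersD(1)[OF \<theta>]] by simp
  qed
qed

lemma spread_add:
  assumes \<pi>: "smooth_rep G T \<pi>" and \<xi>: "\<xi> \<in> W'" and u: "u \<in> carrier \<pi>" and v: "v \<in> carrier \<pi>"
  shows "spread \<pi> \<xi> (u + v) = spread \<pi> \<xi> u + spread \<pi> \<xi> v"
proof
  fix w
  note R = representationD[OF smooth_repD(1)[OF \<pi>]]
  note uv = complex_vector.subspace_add[OF R(1) u v]
  show "spread \<pi> \<xi> (u + v) w = (spread \<pi> \<xi> u + spread \<pi> \<xi> v) w"
  proof (cases "w \<in> W")
    case True
    have "spread \<pi> \<xi> (u + v) w = integral (\<lambda>g. (if g \<in> K then act \<pi> g (\<xi> (act \<rho> (inv g) w) *\<^sub>C u) else 0) +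
        (if g \<in> K then act \<pi> g (\<xi> (act \<rho> (inv g) w) *\<^sub>C v) else 0))"
      unfolding spread_apply[OF True]
      using R(3) u v complex_vector.subspace_scale[OF R(1)] by (intro integral_cong) (simp add: scaleC_add_right)
    also have "\<dots> = spread \<pi> \<xi> u w + spread \<pi> \<xi> v w"
      unfolding spread_apply[OF True] by (rule integral_add[OF spread_cc[OF \<pi> \<xi> u True] spread_cc[OF \<pi> \<xi> v True]])
    finally show ?thesis by simp
  qed (simp add: hom_outside[OF spread_hom[OF \<pi> \<xi>]] u v uv)
qed

lemma spread_scale:
  assumes \<pi>: "smooth_rep G T \<pi>" and \<xi>: "\<xi> \<in> W'" and u: "u \<in> carrier \<pi>"
  shows "spread \<pi> \<xi> (c *\<^sub>C u) = c *\<^sub>C spread \<pi> \<xi> u"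
proof
  fix w
  note R = representationD[OF smooth_repD(1)[OF \<pi>]]
  note cu = complex_vector.subspace_scale[OF R(1) u]
  show "spread \<pi> \<xi> (c *\<^sub>C u) w = (c *\<^sub>C spread \<pi> \<xi> u) w"
  proof (cases "w \<in> W")
    case True
    have "spread \<pi> \<xi> (c *\<^sub>C u) w = integral (\<lambda>g. c *\<^sub>C (if g \<in> K then act \<pi> g (\<xi> (act \<rho> (inv g) w) *\<^sub>C u) else 0))"
      unfolding spread_apply[OF True]
      using R(4) u cu by (intro integral_cong) (simp add: complex_vector.scale_left_commute)
    also have "\<dots> = c *\<^sub>C spread \<pi> \<xi> u w"
      unfolding spread_apply[OF True] by (rule integral_scale[OF spread_cc[OF \<pi> \<xi> u True]])
    finally show ?thesis by (simp add: scaleC_fun_def)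
  qed (simp add: hom_outside[OF spread_hom[OF \<pi> \<xi>]] u cu scaleC_fun_def)
qed

text \<open>The rank one maps \<open>\<lambda>w. coord b w *\<^sub>C \<phi> b\<close> add up to
  \<open>\<phi>\<close>, which already commutes with \<open>K\<close>, so averaging multiplies their
  sum by the volume of \<open>K\<close>.\<close>

lemma spread_sum:
  fixes \<pi> :: "('g, 'v::complex_vector) rep"
  assumes \<pi>: "smooth_rep G T \<pi>" and \<phi>: "\<phi> \<in> hom_on K \<rho> \<pi>"
    and B: "finite B" "B \<subseteq> W" "\<And>b. b \<in> B \<Longrightarrow> coord b \<in> W'" "\<And>v. v \<in> W \<Longrightarrow> (\<Sum>b\<in>B. coord b v *\<^sub>C b) = v"
  shows "(\<Sum>b\<in>B. spread \<pi> (coord b) (\<phi> b)) = measure M K *\<^sub>R \<phi>"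
proof
  fix w
  note R = representationD[OF smooth_repD(1)[OF \<pi>]]
  note lin = intertwinersD(1)[OF \<phi>]
  have \<phi>b: "\<phi> b \<in> carrier \<pi>" if "b \<in> B" for b using intertwiners_mem[OF \<phi>] B(2) that by blast
  show "(\<Sum>b\<in>B. spread \<pi> (coord b) (\<phi> b)) w = (measure M K *\<^sub>R \<phi>) w"
  proof (cases "w \<in> W")
    case True
    let ?F = "\<lambda>b g. if g \<in> K then act \<pi> g (coord b (act \<rho> (inv g) w) *\<^sub>C \<phi> b) else 0"
    have "(\<Sum>b\<in>B. spread \<pi> (coord b) (\<phi> b)) w = (\<Sum>b\<in>B. integral (?F b))"
      by (simp add: sum_apply_fun spread_apply[OF True])
    also have "\<dots> = integral (\<lambda>g. \<Sum>b\<in>B. ?F b g)"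
      by (rule integral_sum[symmetric]) (rule spread_cc[OF \<pi> B(3) \<phi>b True])
    also have "\<dots> = integral (\<lambda>g. if g \<in> K then \<phi> w else 0)"
    proof (rule integral_cong)
      fix g assume gG: "g \<in> carrier G"
      show "(\<Sum>b\<in>B. ?F b g) = (if g \<in> K then \<phi> w else 0)"
      proof (cases "g \<in> K")
        case g: True
        let ?x = "act \<rho> (inv g) w"
        have x: "?x \<in> W" by (rule \<rho>D(3)[OF KD(9)[OF g] True])
        have "(\<Sum>b\<in>B. ?F b g) = act \<pi> g (\<Sum>b\<in>B. coord b ?x *\<^sub>C \<phi> b)"
          using g \<phi>b complex_vector.subspace_scale[OF R(1)]
          by (subst clinear_on_sum[OF R(1) clinear_on_act[OF smooth_repD(1)[OF \<pi>] gG]]) auto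
        also have "(\<Sum>b\<in>B. coord b ?x *\<^sub>C \<phi> b) = \<phi> (\<Sum>b\<in>B. coord b ?x *\<^sub>C b)"
          using B(2) by (subst lin_maps_sum[OF \<rho>D(2) lin])
            (auto simp: lin_mapsD(4)[OF lin] intro: complex_vector.subspace_scale[OF \<rho>D(2)] intro!: sum.cong)
        also have "\<dots> = \<phi> ?x" using B(4)[OF x] by simp
        also have "act \<pi> g (\<phi> ?x) = \<phi> w" using intertwinersD(2)[OF \<phi>, of g ?x] g x True by (simp add: \<rho>D(8))
        finally show ?thesis using g by simp
      qed simp
    qed
    also have "\<dots> = measure M K *\<^sub>R \<phi> w" by (rule integral_indicator[OF KD(2,3)])
    finally show ?thesis by (simp add: scaleR_fun_def)
  next
    case False
    then show ?thesis
      using hom_outside[OF spread_hom[OF \<pi> B(3) \<phi>b]] hom_outside[OF \<phi> False]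
      by (simp add: sum_apply_fun scaleR_fun_def)
  qed
qed

text \<open>\<open>N\<close> is the quotient of the algebra by the left ideal \<open>J\<close> of
  elements killing a nonzero \<open>n\<close>. The representation is the quotient of
  \<open>cind\<close> by a subrepresentation \<open>D\<close> matching \<open>J\<close>, and in it
  the image \<open>m\<close> of \<open>cind_unit\<close> again has annihilator \<open>J\<close>;
  simple modules with such a pair of vectors have the same annihilator.\<close>

lemma primitive_ideal_irreducible:
  assumes I: "I \<in> primitive_ideals \<H>"
  obtains \<pi> :: "('g, 'g \<Rightarrow> 'w) rep"
  where "smooth_irrep G T \<pi>" "hom_on K \<rho> \<pi> \<noteq> {0}" "annihilator \<H> (\<N> \<pi>) = I"
proof -
  obtain N :: "('g \<Rightarrow> ('w \<Rightarrow> complex) \<Rightarrow> 'w \<Rightarrow> complex, ('g \<Rightarrow> ('w \<Rightarrow> complex) \<Rightarrow> 'w \<Rightarrow> complex) set) module"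
    where N: "simple_module \<H> N" and IN: "I = annihilator \<H> N"
    using I by (auto simp: primitive_ideals_def)
  interpret N: left_module \<H> N using N by (simp add: simple_module_def)
  obtain n where n: "n \<in> carrier N" "n \<noteq> \<zero>\<^bsub>N\<^esub>"
    using N N.M.zero_closed by (auto simp: simple_module_def)
  define J where "J = {a \<in> carrier \<H>. a \<odot>\<^bsub>N\<^esub> n = \<zero>\<^bsub>N\<^esub>}"
  define S where "S = hecke_hom ` J"
  have J: "a \<in> carrier \<H>" if "a \<in> J" for a using that by (simp add: J_def)
  have J_mult: "b \<otimes>\<^bsub>\<H>\<^esub> a \<in> J" if "b \<in> carrier \<H>" "a \<in> J" for a b
    using that n(1) by (simp add: J_def N.smult_assoc N.smult_zero_right)
  have S_hom: "\<psi> \<in> hom_on K \<rho> cind" if "\<psi> \<in> S" for \<psi> using that hecke_hom_hom J by (auto simp: S_def)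
  have S_comp: "(\<lambda>w. frob cind \<psi> (\<kappa> w)) \<in> S" if \<psi>: "\<psi> \<in> S" and \<kappa>: "\<kappa> \<in> hom_on K \<rho> cind" for \<psi> \<kappa>
  proof -
    obtain a where a: "a \<in> J" "\<psi> = hecke_hom a" using \<psi> by (auto simp: S_def)
    have "hecke_hom (hom_hecke \<kappa> \<otimes>\<^bsub>\<H>\<^esub> a) = (\<lambda>w. frob cind \<psi> (\<kappa> w))"
      by (simp add: hecke_mult(2)[OF hom_hecke_mem[OF \<kappa>] J[OF a(1)]] hecke_hom_inverse[OF \<kappa>] a(2))
    then show ?thesis using J_mult[OF hom_hecke_mem[OF \<kappa>] a(1)] unfolding S_def by (metis imageI)
  qed
  have S: "csubspace S"
    unfolding complex_vector.subspace_def
  proof (intro conjI ballI allI)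
    have "\<zero>\<^bsub>\<H>\<^esub> \<in> J" using n(1) by (simp add: J_def hecke_zero N.smult_zero_left)
    then show "0 \<in> S" unfolding S_def using hecke_zero(2) by (metis imageI)
    show "x + y \<in> S" if xy: "x \<in> S" "y \<in> S" for x y
    proof -
      obtain a b where ab: "a \<in> J" "b \<in> J" "x = hecke_hom a" "y = hecke_hom b" using xy by (auto simp: S_def)
      have "a \<oplus>\<^bsub>\<H>\<^esub> b \<in> J" using ab n(1) N.M.zero_closed by (simp add: J_def hecke_add(1) N.smult_l_distr)
      moreover have "hecke_hom (a \<oplus>\<^bsub>\<H>\<^esub> b) = x + y" using hecke_add(2)[OF J J] ab by simp
      ultimately show ?thesis unfolding S_def by (metis imageI)
    qed
    show "c *\<^sub>C x \<in> S" if x: "x \<in> S" for c x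
    proof -
      note xh = S_hom[OF x] and H = hom_csubspace[OF cind_smooth]
      \<comment> \<open>\<open>N\<close> is a module over a ring only. Stability of \<open>J\<close>
        under scalars comes from the scalar multiples of \<open>cind_unit\<close>, which correspond
        to elements of the algebra.\<close>
      note u = complex_vector.subspace_scale[OF H cind_unit_hom, of c]
      have "frob cind x ((c *\<^sub>C cind_unit) w) = (c *\<^sub>C x) w" for w
      proof (cases "w \<in> W")
        case True
        have "frob cind x (c *\<^sub>C cind_unit w) = c *\<^sub>C frob cind x (cind_unit w)"
          by (rule lin_mapsD(4)[OF intertwinersD(1)[OF frob_intertwiner[OF cind_smooth xh]] cind_unit_mem])
        then show ?thesis by (simp add: scaleC_fun_def frob_unit[OF cind_smooth xh True])
      next
        case False
        then show ?thesis using hom_outside[OF u False] hom_outside[OF complex_vector.subspace_scale[OF H xh, of c] False]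
            frob_zero[OF cind_smooth xh] by simp
      qed
      then have "(\<lambda>w. frob cind x ((c *\<^sub>C cind_unit) w)) = c *\<^sub>C x" by (rule ext)
      then show ?thesis using S_comp[OF x u] by simp
    qed
  qed
  \<comment> \<open>The largest subrepresentation whose \<open>\<rho>\<close>-invariants are \<open>J\<close>; a smaller one might not be maximal.\<close>
  define D where "D = {p \<in> carrier cind. \<forall>g\<in>carrier G. \<forall>\<xi>\<in>W'. spread cind \<xi> (act cind g p) \<in> S}"
  have Dsub: "D \<subseteq> carrier cind" by (auto simp: D_def)
  have DG: "act cind h p \<in> D" if "h \<in> carrier G" "p \<in> D" for h p
    using that cindR(2) cindR(6)[of _ h p, symmetric] by (auto simp: D_def)
  have D: "csubspace D"
    unfolding complex_vector.subspace_def
  proof (intro conjI ballI allI)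
    have "spread cind \<xi> 0 = 0" if "\<xi> \<in> W'" for \<xi>
      using spread_scale[OF cind_smooth that complex_vector.subspace_0[OF cindR(1)], of 0] by simp
    then show "0 \<in> D"
      using complex_vector.subspace_0[OF S] complex_vector.subspace_0[OF cindR(1)] representation_act_zero[OF cind_representation]
      by (simp add: D_def)
    show "x + y \<in> D" if "x \<in> D" "y \<in> D" for x y
      using that complex_vector.subspace_add[OF S] complex_vector.subspace_add[OF cindR(1)] cindR(2,3)
      by (auto simp: D_def spread_add[OF cind_smooth])
    show "c *\<^sub>C x \<in> D" if "x \<in> D" for c x
      using that complex_vector.subspace_scale[OF S] complex_vector.subspace_scale[OF cindR(1)] cindR(2,4)
      by (auto simp: D_def spread_scale[OF cind_smooth])
  qed
  \<comment> \<open>The \<open>spread\<close> maps made from the values of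
    \<open>hecke_hom b\<close> on a basis add up to a multiple of it, so values in \<open>D\<close>
    put it in \<open>S\<close>. Conversely, \<open>spread\<close> applied to a translated value of
    an element of \<open>S\<close> is a composite with that element, and stays in \<open>S\<close>
    because \<open>J\<close> is a left ideal.\<close>
  have D_J: "(\<forall>w\<in>W. hecke_hom b w \<in> D) \<longleftrightarrow> b \<in> J" if b: "b \<in> carrier \<H>" for b
  proof
    note bh = hecke_hom_hom[OF b]
    assume bD: "\<forall>w\<in>W. hecke_hom b w \<in> D"
    obtain B and coord :: "'w \<Rightarrow> 'w \<Rightarrow> complex" where B: "finite B" "B \<subseteq> W"
      "\<And>b. b \<in> B \<Longrightarrow> coord b \<in> W'" "\<And>v. v \<in> W \<Longrightarrow> (\<Sum>b\<in>B. coord b v *\<^sub>C b) = v"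
      by (rule W'_mem_cspan) (rule that)
    have "spread cind (coord c) (hecke_hom b c) \<in> S" if c: "c \<in> B" for c
    proof -
      have "hecke_hom b c \<in> D" using bD B(2) c by blast
      then have "spread cind (coord c) (act cind \<one> (hecke_hom b c)) \<in> S" using B(3)[OF c] by (auto simp: D_def)
      then show ?thesis by (simp add: cindR(5)[OF hecke_hom_mem[OF b]])
    qed
    then have "(\<Sum>c\<in>B. spread cind (coord c) (hecke_hom b c)) \<in> S" by (rule complex_vector.subspace_sum[OF S])
    also have "(\<Sum>c\<in>B. spread cind (coord c) (hecke_hom b c)) = measure M K *\<^sub>R hecke_hom b"
      by (rule spread_sum[OF cind_smooth bh B])
    finally have "measure M K *\<^sub>R hecke_hom b \<in> S" .
    then have "(1 / measure M K) *\<^sub>R measure M K *\<^sub>R hecke_hom b \<in> S" by (rule csubspace_scaleR[OF S])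
    then have "hecke_hom b \<in> S" using KD(7) by simp
    then obtain a where "a \<in> J" "hecke_hom b = hecke_hom a" by (auto simp: S_def)
    then show "b \<in> J" using hecke_hom_inj[OF b J] by metis
  next
    assume bJ: "b \<in> J"
    note bh = hecke_hom_hom[OF b]
    note F = frob_intertwiner[OF cind_smooth bh]
    show "\<forall>w\<in>W. hecke_hom b w \<in> D"
    proof
      fix w assume w: "w \<in> W"
      have "spread cind \<xi> (act cind g (hecke_hom b w)) \<in> S" if g: "g \<in> carrier G" and \<xi>: "\<xi> \<in> W'" for g \<xi>
      proof -
        note gu = cindR(2)[OF g cind_unit_mem[of w]]
        have "act cind g (hecke_hom b w) = frob cind (hecke_hom b) (act cind g (cind_unit w))"
          using intertwinersD(2)[OF F g cind_unit_mem] frob_unit[OF cind_smooth bh w] by simp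
        then have "spread cind \<xi> (act cind g (hecke_hom b w)) = (\<lambda>v. frob cind (hecke_hom b) (spread cind \<xi> (act cind g (cind_unit w)) v))"
          using spread_natural[OF cind_smooth cind_smooth \<xi> gu F] by simp
        moreover have "hecke_hom b \<in> S" using bJ by (simp add: S_def)
        ultimately show ?thesis using S_comp spread_hom[OF cind_smooth \<xi> gu] by simp
      qed
      then show "hecke_hom b w \<in> D" using hecke_hom_mem[OF b] by (auto simp: D_def)
    qed
  qed
  \<comment> \<open>Carriers are subspaces, so the quotient by \<open>D\<close> is modelled on a
    linear complement, the image of \<open>q\<close>. This complement need not be stable under the
    group, and the action on it is compressed by \<open>q\<close>; stability of \<open>D\<close>,
    the kernel of \<open>q\<close>, makes the result an action.\<close>
  obtain r where r: "r \<in> lin_maps (carrier cind) D" "\<And>p. p \<in> D \<Longrightarrow> r p = p"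
    using lin_projection[OF cindR(1) D Dsub] by metis
  define q where "q p = (if p \<in> carrier cind then p - r p else 0)" for p
  have rD: "r p \<in> D" "r p \<in> carrier cind" if "p \<in> carrier cind" for p using lin_mapsD(1)[OF r(1) that] Dsub by auto
  have q_lin: "q \<in> lin_maps (carrier cind) (carrier cind)"
    using lin_mapsD(3,4)[OF r(1)] rD
    by (intro lin_mapsI) (auto simp: q_def complex_vector.subspace_add[OF cindR(1)] complex_vector.subspace_scale[OF cindR(1)]
        complex_vector.subspace_diff[OF cindR(1)] complex_vector.scale_right_diff_distrib)
  have q_zero: "q p = 0 \<longleftrightarrow> p \<in> D" if p: "p \<in> carrier cind" for p
    using p r(2) rD(1)[OF p] by (auto simp: q_def)
  have q_act: "q (act cind g (q p)) = q (act cind g p)" if g: "g \<in> carrier G" and p: "p \<in> carrier cind" for g p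
  proof -
    have qp: "q p \<in> carrier cind" by (rule lin_mapsD(1)[OF q_lin p])
    have "p - q p \<in> D" using rD(1)[OF p] p by (simp add: q_def)
    then have "act cind g (p - q p) \<in> D" by (rule DG[OF g])
    moreover have "act cind g (p - q p) \<in> carrier cind"
      using g complex_vector.subspace_diff[OF cindR(1) p qp] by (rule cindR(2))
    ultimately have "q (act cind g (p - q p)) = 0" using q_zero by blast
    moreover have "act cind g p = act cind g (p - q p) + act cind g (q p)"
      using cindR(3)[OF g complex_vector.subspace_diff[OF cindR(1) p qp] qp] by simp
    ultimately show ?thesis
      using lin_mapsD(3)[OF q_lin cindR(2)[OF g complex_vector.subspace_diff[OF cindR(1) p qp]] cindR(2)[OF g qp]] by simp
  qed
  define V :: "('g, 'g \<Rightarrow> 'w) rep" where "V = \<lparr>carrier = q ` carrier cind, act = \<lambda>g v. q (act cind g v)\<rparr>"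
  have cV: "carrier V = q ` carrier cind" and actV: "act V g v = q (act cind g v)" for g v by (simp_all add: V_def)
  have Vsub: "csubspace (carrier V)" unfolding cV by (rule csubspace_image[OF cindR(1) q_lin cindR(1) order_refl])
  have actq: "act V g (q p) = q (act cind g p)" if "g \<in> carrier G" "p \<in> carrier cind" for g p
    unfolding actV by (rule q_act[OF that])
  have VP: "v \<in> carrier cind" if "v \<in> carrier V" for v using that lin_mapsD(1)[OF q_lin] by (auto simp: cV)
  have V_rep: "representation G V"
    unfolding representation_def
  proof (intro conjI ballI allI)
    fix g x y c assume g: "g \<in> carrier G" and x: "x \<in> carrier V"
    show "act V g x \<in> carrier V" using cindR(2)[OF g VP[OF x]] by (simp add: actV cV)
    show "act V g (x + y) = act V g x + act V g y" if y: "y \<in> carrier V"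
      unfolding actV using cindR(3)[OF g VP[OF x] VP[OF y]] lin_mapsD(3)[OF q_lin cindR(2)[OF g VP[OF x]] cindR(2)[OF g VP[OF y]]] by simp
    show "act V g (c *\<^sub>C x) = c *\<^sub>C act V g x"
      unfolding actV using cindR(4)[OF g VP[OF x]] lin_mapsD(4)[OF q_lin cindR(2)[OF g VP[OF x]]] by simp
    show "act V (g \<otimes> h) x = act V g (act V h x)" if h: "h \<in> carrier G" for h
      unfolding actV using cindR(6)[OF g h VP[OF x]] q_act[OF g cindR(2)[OF h VP[OF x]]] by simp
  next
    fix x assume "x \<in> carrier V"
    then obtain p where p: "p \<in> carrier cind" "x = q p" by (auto simp: cV)
    then show "act V \<one> x = x" using actq[OF one_closed p(1)] cindR(5)[OF p(1)] by simp
  qed (rule Vsub)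
  have q_hom: "q \<in> intertwiners G cind V"
    using lin_mapsD[OF q_lin] actq by (intro intertwinersI lin_mapsI) (auto simp: cV)
  have V_smooth: "smooth_rep G T V"
    unfolding smooth_rep_def
  proof (intro conjI ballI V_rep)
    fix v assume v: "v \<in> carrier V"
    then obtain p where p: "p \<in> carrier cind" "v = q p" by (auto simp: cV)
    have "stabilizer G cind p \<subseteq> stabilizer G V v" using actq[OF _ p(1)] p(2) by (auto simp: stabilizer_def)
    moreover have "\<one> \<in> stabilizer G cind p" using cindR(5)[OF p(1)] by (simp add: stabilizer_def)
    ultimately show "openin T (stabilizer G V v)"
      using openin_subgroup[OF topological stabilizer_subgroup[OF V_rep is_group v] smooth_repD(2)[OF cind_smooth p(1)]] by blast
  qed
  have one_notin: "\<one>\<^bsub>\<H>\<^esub> \<notin> J" using n by (simp add: J_def N.smult_one)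
  \<comment> \<open>The images of \<open>cind_unit\<close> generate, because
    \<open>cind_reconstruct\<close> writes every vector of \<open>cind\<close> as an integral of
    their translates.\<close>
  have full: "U = carrier V" if U: "csubspace U" "U \<subseteq> carrier V" "\<And>g x. g \<in> carrier G \<Longrightarrow> x \<in> U \<Longrightarrow> act V g x \<in> U"
    and u: "\<And>w. w \<in> W \<Longrightarrow> q (cind_unit w) \<in> U" for U
  proof -
    have "q p \<in> U" if p: "p \<in> carrier cind" for p
    proof -
      have "q p = q (integral (\<lambda>x. act cind x (cind_unit (p x))))" by (simp add: cind_reconstruct[OF p])
      also have "\<dots> = integral (\<lambda>x. q (act cind x (cind_unit (p x))))"
        by (rule integral_clinear[OF cind_unit_translate_cc[OF p] _ cindR(1) clinear_on_lin_maps[OF q_lin], symmetric])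
          (rule cindR(2)[OF _ cind_unit_mem])
      also have "\<dots> \<in> U"
        using U(3)[OF _ u] cindD(2)[OF p] actq[OF _ cind_unit_mem] by (intro integral_mem[OF U(1)]) simp
      finally show ?thesis .
    qed
    then show ?thesis using U(2) by (auto simp: cV)
  qed
  have V_irr: "irreducible_rep G V"
    unfolding irreducible_rep_def
  proof (intro conjI allI impI V_rep)
    show "carrier V \<noteq> {0}"
    proof
      assume "carrier V = {0}"
      then have "q (cind_unit w) = 0" for w using cind_unit_mem by (auto simp: cV)
      then have "\<forall>w\<in>W. hecke_hom \<one>\<^bsub>\<H>\<^esub> w \<in> D" using q_zero[OF cind_unit_mem] by (simp add: hecke_one)
      then show False using D_J[OF hecke_one(1)] one_notin by simp
    qed
    fix U assume U: "csubspace U \<and> U \<subseteq> carrier V \<and> (\<forall>g\<in>carrier G. \<forall>x\<in>U. act V g x \<in> U)"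
    \<comment> \<open>Two cases for the left ideal \<open>J'\<close> of the preimage
      \<open>D'\<close> of \<open>U\<close>. If \<open>J'\<close> moves \<open>n\<close>, simplicity
      of \<open>N\<close> gives \<open>j\<close> in \<open>J'\<close> fixing \<open>n\<close>; then
      1 - j lies in \<open>J\<close>, so 1 lies in \<open>J'\<close> and \<open>U\<close> contains
      the generators. Otherwise \<open>J'\<close> equals \<open>J\<close>, and \<open>U\<close> is 0
      because \<open>D\<close> is the largest subrepresentation with these invariants.\<close>
    define D' where "D' = {p \<in> carrier cind. q p \<in> U}"
    define J' where "J' = {a \<in> carrier \<H>. \<forall>w\<in>W. hecke_hom a w \<in> D'}"
    have D': "csubspace D'"
      using U lin_mapsD(3,4)[OF q_lin] lin_maps_zero[OF cindR(1) q_lin]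
      by (auto simp: D'_def complex_vector.subspace_def[of U] complex_vector.subspace_def[of "Collect _"]
          complex_vector.subspace_0[OF cindR(1)] complex_vector.subspace_add[OF cindR(1)] complex_vector.subspace_scale[OF cindR(1)])
    have D'G: "act cind g p \<in> D'" if "g \<in> carrier G" "p \<in> D'" for g p
      using that U actq cindR(2) unfolding D'_def by (metis (mono_tags, lifting) mem_Collect_eq)
    have DD': "D \<subseteq> D'"
    proof
      fix p assume p: "p \<in> D"
      then have "q p = 0" "p \<in> carrier cind" using Dsub q_zero by auto
      then show "p \<in> D'" using U complex_vector.subspace_0[of U] by (simp add: D'_def)
    qed
    have frobD': "frob cind \<kappa> p \<in> D'" if \<kappa>: "\<kappa> \<in> hom_on K \<rho> cind" "\<And>w. w \<in> W \<Longrightarrow> \<kappa> w \<in> D'" and p: "p \<in> carrier cind" for \<kappa> p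
      using p \<kappa>(2) cindD(2)[OF p] D'G by (auto simp: frob_def intro!: integral_mem[OF D'])
    have J': "J' \<subseteq> carrier \<H>" "J \<subseteq> J'" using D_J J DD' by (auto simp: J'_def)
    show "U = {0} \<or> U = carrier V"
    proof (cases "\<exists>a\<in>J'. a \<odot>\<^bsub>N\<^esub> n \<noteq> \<zero>\<^bsub>N\<^esub>")
      case True
      have "(\<lambda>a. a \<odot>\<^bsub>N\<^esub> n) ` J' = carrier N"
      proof (rule simple_module_generated[OF N n(1) J'(1) _ _ _ True])
        show "\<zero>\<^bsub>\<H>\<^esub> \<in> J'" using complex_vector.subspace_0[OF D'] by (simp add: J'_def hecke_zero)
        show "a \<oplus>\<^bsub>\<H>\<^esub> b \<in> J'" if "a \<in> J'" "b \<in> J'" for a b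
          using that complex_vector.subspace_add[OF D'] by (simp add: J'_def hecke_add)
        show "a \<otimes>\<^bsub>\<H>\<^esub> b \<in> J'" if "a \<in> carrier \<H>" "b \<in> J'" for a b
          using that frobD'[OF hecke_hom_hom] hecke_hom_mem by (simp add: J'_def hecke_mult)
      qed
      then obtain j where j: "j \<in> J'" "j \<odot>\<^bsub>N\<^esub> n = n" using n(1) by (metis (no_types, lifting) imageE)
      have jH: "j \<in> carrier \<H>" using j J'(1) by blast
      have minus: "\<ominus>\<^bsub>\<H>\<^esub> j \<in> carrier \<H>" using jH by simp
      have "(\<one>\<^bsub>\<H>\<^esub> \<oplus>\<^bsub>\<H>\<^esub> \<ominus>\<^bsub>\<H>\<^esub> j) \<odot>\<^bsub>N\<^esub> n \<oplus>\<^bsub>N\<^esub> j \<odot>\<^bsub>N\<^esub> n = n"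
      proof -
        have "(\<one>\<^bsub>\<H>\<^esub> \<oplus>\<^bsub>\<H>\<^esub> \<ominus>\<^bsub>\<H>\<^esub> j) \<oplus>\<^bsub>\<H>\<^esub> j = \<one>\<^bsub>\<H>\<^esub>" using jH minus by (simp add: N.R.a_assoc N.R.l_neg)
        then show ?thesis
          using N.smult_l_distr[OF N.R.a_closed[OF N.R.one_closed minus] jH n(1)] n(1) by (simp add: N.smult_one)
      qed
      then have "(\<one>\<^bsub>\<H>\<^esub> \<oplus>\<^bsub>\<H>\<^esub> \<ominus>\<^bsub>\<H>\<^esub> j) \<odot>\<^bsub>N\<^esub> n = \<zero>\<^bsub>N\<^esub>"
        using j(2) N.M.add.r_cancel_one[OF n(1) N.smult_closed[OF N.R.a_closed[OF N.R.one_closed minus] n(1)]]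
        by simp
      then have "\<one>\<^bsub>\<H>\<^esub> \<oplus>\<^bsub>\<H>\<^esub> \<ominus>\<^bsub>\<H>\<^esub> j \<in> J" using minus by (simp add: J_def)
      then have "\<one>\<^bsub>\<H>\<^esub> \<oplus>\<^bsub>\<H>\<^esub> \<ominus>\<^bsub>\<H>\<^esub> j \<in> J'" using J'(2) by blast
      then have "(\<one>\<^bsub>\<H>\<^esub> \<oplus>\<^bsub>\<H>\<^esub> \<ominus>\<^bsub>\<H>\<^esub> j) \<oplus>\<^bsub>\<H>\<^esub> j \<in> J'"
        using j(1) complex_vector.subspace_add[OF D'] by (simp add: J'_def hecke_add)
      then have "\<one>\<^bsub>\<H>\<^esub> \<in> J'" using jH minus by (simp add: N.R.a_assoc N.R.l_neg)
      then have "q (cind_unit w) \<in> U" if "w \<in> W" for w using that by (simp add: J'_def hecke_one D'_def)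
      then show ?thesis using full U by blast
    next
      case False
      then have JJ': "J' \<subseteq> J" using J'(1) by (auto simp: J_def)
      have "p \<in> D" if p: "p \<in> D'" for p
      proof -
        \<comment> \<open>\<open>D'\<close> is stable under \<open>K\<close>, so a rank one map into
          it keeps its values there after averaging and gives an element of \<open>J'\<close>, hence
          of \<open>J\<close>.\<close>
        have "spread cind \<xi> (act cind g p) \<in> S" if g: "g \<in> carrier G" and \<xi>: "\<xi> \<in> W'" for g \<xi>
        proof -
          have gp: "act cind g p \<in> D'" "act cind g p \<in> carrier cind" using D'G[OF g p] by (auto simp: D'_def)
          note h = spread_hom[OF cind_smooth \<xi> gp(2)]
          have "spread cind \<xi> (act cind g p) w \<in> D'" if w: "w \<in> W" for w
            unfolding spread_apply[OF w] using D'G[OF KG] complex_vector.subspace_scale[OF D' gp(1)] complex_vector.subspace_0[OF D']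
            by (intro integral_mem[OF D']) simp
          then have "hom_hecke (spread cind \<xi> (act cind g p)) \<in> J"
            using JJ' hom_hecke_mem[OF h] by (auto simp: J'_def hecke_hom_inverse[OF h])
          then show ?thesis unfolding S_def using hecke_hom_inverse[OF h] by (metis imageI)
        qed
        then show ?thesis using p by (auto simp: D_def D'_def)
      qed
      then have "u = 0" if u: "u \<in> U" for u
      proof -
        obtain p where p: "p \<in> carrier cind" "u = q p" using u U by (auto simp: cV)
        then have "p \<in> D" using u \<open>\<And>p. p \<in> D' \<Longrightarrow> p \<in> D\<close> by (simp add: D'_def)
        then show ?thesis using p q_zero by simp
      qed
      then show ?thesis using U complex_vector.subspace_0[of U] by blast
    qed
  qed
  have V: "smooth_irrep G T V" using V_smooth V_irr by (simp add: smooth_irrep_def)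
  define m where "m = (\<lambda>w. q (cind_unit w))"
  have m: "m \<in> hom_on K \<rho> V" unfolding m_def by (rule hom_comp[OF cind_unit_hom cind_smooth q_hom])
  have am: "a \<odot>\<^bsub>\<N> V\<^esub> m = 0 \<longleftrightarrow> a \<in> J" if a: "a \<in> carrier \<H>" for a
  proof -
    have "frob V m (hecke_hom a w) = q (hecke_hom a w)" for w
      using frob_natural[OF cind_smooth cind_unit_hom q_hom hecke_hom_mem[OF a]]
      by (simp add: m_def frob_cind_unit[OF hecke_hom_mem[OF a]])
    then have "a \<odot>\<^bsub>\<N> V\<^esub> m = 0 \<longleftrightarrow> (\<forall>w. hecke_hom a w \<in> D)"
      using q_zero[OF hecke_hom_mem[OF a]] by (simp add: inv_smult[OF V_smooth m a] fun_eq_iff)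
    also have "\<dots> \<longleftrightarrow> (\<forall>w\<in>W. hecke_hom a w \<in> D)"
      using hom_outside[OF hecke_hom_hom[OF a]] complex_vector.subspace_0[OF D] by metis
    finally show ?thesis using D_J[OF a] by simp
  qed
  have m0: "m \<noteq> 0"
    using am[OF hecke_one(1)] one_notin left_module.smult_one[OF inv_left_module[OF V_smooth], of m] m by (auto simp: inv_sel)
  then have ne: "hom_on K \<rho> V \<noteq> {0}" using m by blast
  have "annihilator \<H> (\<N> V) = annihilator \<H> N"
  proof (rule annihilator_eq_if_cyclic_eq[OF inv_simple_module[OF V ne] _ _ N n])
    show "a \<odot>\<^bsub>\<N> V\<^esub> m = \<zero>\<^bsub>\<N> V\<^esub> \<longleftrightarrow> a \<odot>\<^bsub>N\<^esub> n = \<zero>\<^bsub>N\<^esub>" if "a \<in> carrier \<H>" for a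
      using am[OF that] that by (simp add: inv_sel J_def)
  qed (use m m0 in \<open>simp_all add: inv_sel\<close>)
  then show ?thesis using that[OF V ne] IN by simp
qed

section \<open>Invariance under isomorphism\<close>

text \<open>Composition with an injective map of representations commutes with the algebra and
  reflects vanishing.\<close>

lemma rep_iso_annihilator_subset:
  fixes \<pi> :: "('g, 'v::complex_vector) rep" and \<sigma> :: "('g, 'u::complex_vector) rep"
  assumes \<pi>: "smooth_rep G T \<pi>" and \<sigma>: "smooth_rep G T \<sigma>" and iso: "rep_iso G \<pi> \<sigma>"
  shows "annihilator \<H> (\<N> \<sigma>) \<subseteq> annihilator \<H> (\<N> \<pi>)" "hom_on K \<rho> \<pi> \<noteq> {0} \<Longrightarrow> hom_on K \<rho> \<sigma> \<noteq> {0}"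
proof -
  obtain \<theta> where \<theta>: "\<theta> \<in> intertwiners G \<pi> \<sigma>" "inj_on \<theta> (carrier \<pi>)"
    using iso by (auto simp: rep_iso_def bij_betw_def)
  note s = representationD(1)[OF smooth_repD(1)[OF \<pi>]]
  have z: "x = 0" if "x \<in> carrier \<pi>" "\<theta> x = 0" for x
    using inj_onD[OF \<theta>(2), of x 0] that complex_vector.subspace_0[OF s] lin_maps_zero[OF s intertwinersD(1)[OF \<theta>(1)]] by simp
  show "annihilator \<H> (\<N> \<sigma>) \<subseteq> annihilator \<H> (\<N> \<pi>)"
  proof
    fix a assume a': "a \<in> annihilator \<H> (\<N> \<sigma>)"
    then have a: "a \<in> carrier \<H>" by (simp add: annihilator_def)
    have "a \<odot>\<^bsub>\<N> \<pi>\<^esub> \<phi> = 0" if \<phi>: "\<phi> \<in> hom_on K \<rho> \<pi>" for \<phi>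
    proof -
      note h = hom_comp[OF \<phi> \<pi> \<theta>(1)]
      have "a \<odot>\<^bsub>\<N> \<sigma>\<^esub> (\<lambda>w. \<theta> (\<phi> w)) = 0" using a' h by (simp add: annihilator_def inv_sel)
      then have "\<theta> (frob \<pi> \<phi> (hecke_hom a w)) = 0" for w
        using frob_natural[OF \<pi> \<phi> \<theta>(1) hecke_hom_mem[OF a]] by (simp add: inv_smult[OF \<sigma> h a] fun_eq_iff)
      then show ?thesis
        using z intertwiners_mem[OF frob_intertwiner[OF \<pi> \<phi>] hecke_hom_mem[OF a]] by (simp add: inv_smult[OF \<pi> \<phi> a] fun_eq_iff)
    qed
    then show "a \<in> annihilator \<H> (\<N> \<pi>)" using a by (simp add: annihilator_def inv_sel)
  qed
  assume "hom_on K \<rho> \<pi> \<noteq> {0}"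
  then obtain \<phi> where \<phi>: "\<phi> \<in> hom_on K \<rho> \<pi>" "\<phi> \<noteq> 0" using complex_vector.subspace_0[OF hom_csubspace[OF \<pi>]] by blast
  obtain w where w: "w \<in> W" "\<phi> w \<noteq> 0" using \<phi> intertwiner_nonzero by blast
  have "(\<lambda>w. \<theta> (\<phi> w)) \<noteq> 0" using z[of "\<phi> w"] w intertwiners_mem[OF \<phi>(1) w(1)] by (metis zero_fun_apply)
  then show "hom_on K \<rho> \<sigma> \<noteq> {0}" using hom_comp[OF \<phi>(1) \<pi> \<theta>(1)] by blast
qed

lemma rep_iso_annihilator:
  fixes \<pi> :: "('g, 'v::complex_vector) rep" and \<sigma> :: "('g, 'u::complex_vector) rep"
  assumes \<pi>: "smooth_rep G T \<pi>" and \<sigma>: "smooth_rep G T \<sigma>" and iso: "rep_iso G \<pi> \<sigma>"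
  shows "annihilator \<H> (\<N> \<pi>) = annihilator \<H> (\<N> \<sigma>)" "hom_on K \<rho> \<pi> \<noteq> {0} \<longleftrightarrow> hom_on K \<rho> \<sigma> \<noteq> {0}"
  using rep_iso_annihilator_subset[OF \<pi> \<sigma> iso]
    rep_iso_annihilator_subset[OF \<sigma> \<pi> rep_iso_sym[OF iso smooth_repD(1)[OF \<pi>] smooth_repD(1)[OF \<sigma>]]]
  by (blast, argo)

text \<open>\<open>reps_containing\<close> is phrased with maps into \<open>\<rho>\<close>, the
  module with maps out of it. Irreducibility of \<open>\<rho>\<close> makes a nonzero map onto or
  injective, respectively, and complete reducibility over \<open>K\<close> then provides an
  equivariant section or retraction.\<close>

lemma hom_to_from:
  fixes \<pi> :: "('g, 'v::complex_vector) rep"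
  assumes \<pi>: "smooth_rep G T \<pi>"
  shows "hom_on K \<pi> \<rho> \<noteq> {0} \<longleftrightarrow> hom_on K \<rho> \<pi> \<noteq> {0}"
proof
  note \<pi>K = smooth_on_restrict[OF \<pi> K]
  obtain w where w: "w \<in> W" "w \<noteq> 0" using irreducible_repD(2)[OF \<rho>_irr] complex_vector.subspace_0[OF \<rho>D(2)] by blast
  assume "hom_on K \<pi> \<rho> \<noteq> {0}"
  then obtain l where l: "l \<in> hom_on K \<pi> \<rho>" "l \<noteq> 0"
    using complex_vector.subspace_0[OF csubspace_intertwiners[OF \<rho>D(1)]] by blast
  have "carrier \<rho> \<subseteq> l ` carrier \<pi>" using irreducible_surjective[OF \<rho>_irr smooth_onD(1)[OF K \<pi>K] l] by simp
  then obtain s where s: "s \<in> hom_on K \<rho> \<pi>" "\<And>y. y \<in> W \<Longrightarrow> l (s y) = y"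
    using hom_on_right_inverse[OF K \<pi>K \<rho>_smooth l(1)] by metis
  have "s \<noteq> 0"
    using s(2)[OF w(1)] w(2) lin_maps_zero[OF smooth_onD(2)[OF K \<pi>K] intertwinersD(1)[OF l(1)]] by (metis zero_fun_apply)
  then show "hom_on K \<rho> \<pi> \<noteq> {0}" using s(1) by blast
next
  note \<pi>K = smooth_on_restrict[OF \<pi> K]
  assume "hom_on K \<rho> \<pi> \<noteq> {0}"
  then obtain l where l: "l \<in> hom_on K \<rho> \<pi>" "l \<noteq> 0"
    using complex_vector.subspace_0[OF hom_csubspace[OF \<pi>]] by blast
  obtain w where w: "w \<in> W" "w \<noteq> 0" using irreducible_repD(2)[OF \<rho>_irr] complex_vector.subspace_0[OF \<rho>D(2)] by blast
  have "inj_on l W" by (rule irreducible_injective[OF \<rho>_irr smooth_onD(1)[OF K \<pi>K] l])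
  then obtain s where s: "s \<in> hom_on K \<pi> \<rho>" "\<And>x. x \<in> W \<Longrightarrow> s (l x) = x"
    using hom_on_left_inverse[OF K \<rho>_smooth \<pi>K l(1)] by metis
  have "s \<noteq> 0" using s(2)[OF w(1)] w(2) by (metis zero_fun_apply)
  then show "hom_on K \<pi> \<rho> \<noteq> {0}" using s(1) by blast
qed

end

section \<open>Estimates and large compact open subgroups\<close>

context haar_l_group
begin

lemma integral_norm_le:
  fixes f :: "'g \<Rightarrow> complex"
  assumes f: "cc f" and h: "cc h" and le: "\<And>g. cmod (f g) \<le> e * h g"
  shows "cmod (integral f) \<le> e * integral h"
proof -
  have nf: "cc (\<lambda>g. - cmod (f g))" using cc_comp[OF f, of "\<lambda>x. - cmod x"] by simp
  have eh: "cc (\<lambda>g. e * h g)" using cc_comp[OF h, of "\<lambda>x. e * x"] by simp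
  have "cmod (integral f) \<le> integral (\<lambda>g. cmod (f g))"
    by (rule simple_bochner_integral_norm_bound[OF cc_integrable[OF f]])
  moreover have "0 \<le> integral (\<lambda>g. e * h g + - cmod (f g))"
    by (rule simple_bochner_integral_nonneg) (use le in simp)
  moreover have "integral (\<lambda>g. e * h g + - cmod (f g)) = integral (\<lambda>g. e * h g) + integral (\<lambda>g. - cmod (f g))"
    by (rule integral_add[OF eh nf])
  moreover have "integral (\<lambda>g. e * h g) = e * integral h"
    by (rule simple_bochner_integral_linear) (auto intro: cc_integrable[OF h] linearI simp: algebra_simps)
  moreover have "integral (\<lambda>g. - cmod (f g)) = - integral (\<lambda>g. cmod (f g))"
    by (rule simple_bochner_integral_minus) (use cc_comp[OF f, of cmod] in \<open>auto intro: cc_integrable\<close>)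
  ultimately show ?thesis by simp
qed

text \<open>The compact open subgroups are an open cover of the group, and directedness puts a
  finite subcover inside one of them.\<close>

lemma lc_group_compact_subset:
  assumes lc: "lc_group G T" and C: "compactin T C"
  obtains L where "compact_open_subgroup G T L" "C \<subseteq> L"
proof -
  let ?U = "{L. compact_open_subgroup G T L}"
  have mem: "\<exists>L\<in>?U. x \<in> L" if "x \<in> carrier G" for x using lc that unfolding lc_group_def by blast
  have dir: "\<exists>L\<in>?U. L1 \<subseteq> L \<and> L2 \<subseteq> L" if "L1 \<in> ?U" "L2 \<in> ?U" for L1 L2
    using lc that unfolding lc_group_def by blast
  have "openin T L" if "L \<in> ?U" for L using that by (simp add: compact_open_subgroup_def)
  moreover have "C \<subseteq> \<Union>?U" using compactin_subset_topspace[OF C] mem unfolding top by blast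
  ultimately have "\<exists>F. finite F \<and> F \<subseteq> ?U \<and> C \<subseteq> \<Union>F" by (rule compactinD[OF C])
  then obtain F where F: "finite F" "F \<subseteq> ?U" "C \<subseteq> \<Union>F" by blast
  have "\<exists>L\<in>?U. \<Union>F \<subseteq> L"
    using F(1,2)
  proof (induction F rule: finite_induct)
    case empty
    then show ?case using mem[OF one_closed] by auto
  next
    case (insert L F)
    then obtain L' where L': "L' \<in> ?U" "\<Union>F \<subseteq> L'" by auto
    have "L \<in> ?U" using insert.prems by simp
    from dir[OF this L'(1)] obtain L'' where L'': "L'' \<in> ?U" "L \<subseteq> L''" "L' \<subseteq> L''" by (elim bexE conjE)
    have "\<Union>(insert L F) \<subseteq> L''" using L''(2) L'(2) L''(3) by auto
    then show ?case using L''(1) by (rule bexI)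
  qed
  then obtain L where "L \<in> ?U" "\<Union>F \<subseteq> L" by (elim bexE)
  then show ?thesis using F(3) by (intro that[of L]) (simp, rule order_trans)
qed

end

context hecke_setting
begin

section \<open>The Fell topology and annihilators\<close>

text \<open>The inner average over \<open>K\<close> is absorbed: with h = g k, the vector
  \<sigma>(g) \<sigma>(k) u carries the weight \<xi>(\<rho>(k)^-1 p(g)) = \<xi>(p(h)), and each h
  arises from a coset with the volume of \<open>K\<close>. For an arbitrary vector \<open>u\<close>
  the action of the algebra thus becomes an integral of the orbit of \<open>u\<close> against a
  function that does not involve \<sigma>.\<close>

lemma frob_spread:
  fixes \<sigma> :: "('g, 'v::complex_vector) rep"
  assumes \<sigma>: "smooth_rep G T \<sigma>" and \<xi>: "\<xi> \<in> W'" and u: "u \<in> carrier \<sigma>" and p: "p \<in> carrier cind"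
  shows "frob \<sigma> (spread \<sigma> \<xi> u) p = measure M K *\<^sub>R integral (\<lambda>h. \<xi> (p h) *\<^sub>C act \<sigma> h u)"
    "cc (\<lambda>h. \<xi> (p h) *\<^sub>C act \<sigma> h u)"
proof -
  note R = representationD[OF smooth_repD(1)[OF \<sigma>]]
  let ?f = "\<lambda>h. \<xi> (p h) *\<^sub>C act \<sigma> h u"
  show f: "cc ?f"
  proof (rule cc_bind[where f = "\<lambda>h. \<xi> (p h)" and F = "\<lambda>h c. c *\<^sub>C act \<sigma> h u" and S = UNIV])
    show "cc (\<lambda>h. \<xi> (p h))" by (rule cc_comp[where H = \<xi>, OF cindD(5)[OF p] W'_apply(4)[OF \<xi>]])
    show "locally_constant T (\<lambda>h. c *\<^sub>C act \<sigma> h u)" for c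
      by (rule locally_constant_comp[OF smooth_act_locally_constant[OF topological \<sigma> u]])
  qed simp_all
  \<comment> \<open>The double integrand after the substitution h = g k: for fixed \<open>g\<close>
    it is supported on the coset of \<open>g\<close>, for fixed \<open>h\<close> it is constant on
    the coset of \<open>h\<close> and 0 elsewhere.\<close>
  define F where "F g h = (if inv g \<otimes> h \<in> K \<and> h \<in> carrier G then ?f h else 0)" for g h
  have indK: "locally_constant T (\<lambda>x. x \<in> K)"
    by (rule locally_constant_cong[OF locally_constant_extend[OF locally_constant_const KD(3)
            compactin_imp_closedin[OF hausdorff KD(2)], of True False]]) simp
  have Fg: "cc (F g)" if g: "g \<in> carrier G" for g
  proof -
    have "locally_constant T (\<lambda>h. if inv g \<otimes> h \<in> K then ?f h else 0)"
      using f locally_constant_comp2[OF locally_constant_vimage[OF indK topological_groupD(3)[OF topological inv_closed[OF g]]],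
          of ?f "\<lambda>b y. if b then y else 0"] by (simp add: cc_def)
    moreover obtain C where "compactin T C" "\<forall>h\<in>carrier G - C. ?f h = 0" using f unfolding cc_def by blast
    ultimately have "cc (\<lambda>h. if inv g \<otimes> h \<in> K then ?f h else 0)" unfolding cc_def by auto
    then show ?thesis by (rule cc_cong) (simp add: F_def)
  qed
  \<comment> \<open>As a function into functions, \<open>F\<close> depends only on the coset of
    \<open>g\<close>; this is the local constancy, uniform in \<open>h\<close>, that Fubini
    requires.\<close>
  have FK: "F (g \<otimes> k) = F g" if g: "g \<in> carrier G" and k: "k \<in> K" for g k
  proof
    fix h
    have "inv (g \<otimes> k) \<otimes> h \<in> K \<longleftrightarrow> inv g \<otimes> h \<in> K" if h: "h \<in> carrier G"
    proof -
      have 1: "inv (g \<otimes> k) \<otimes> h = inv k \<otimes> (inv g \<otimes> h)" using g KG[OF k] h by (simp add: inv_mult_group m_assoc)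
      have 2: "inv g \<otimes> h = k \<otimes> (inv (g \<otimes> k) \<otimes> h)" using g KG[OF k] h by (simp add: inv_mult_group m_assoc[symmetric])
      show ?thesis using 1 2 KD(8,9) k by metis
    qed
    then show "F (g \<otimes> k) h = F g h" by (auto simp: F_def)
  qed
  have Fcc: "cc F"
  proof -
    have "locally_constant T F"
      unfolding locally_constant_def
    proof
      fix x assume "x \<in> topspace T"
      then have x: "x \<in> carrier G" by (simp add: top)
      let ?U = "{y \<in> topspace T. inv x \<otimes> y \<in> K}"
      have "openin T ?U"
        by (rule openin_continuous_map_preimage[OF topological_groupD(3)[OF topological inv_closed[OF x]] KD(3)])
      moreover have "x \<in> ?U" using x KD(5) by (simp add: top)
      moreover have "F y = F x" if y: "y \<in> ?U" for y
      proof -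
        have "y \<in> carrier G" "inv x \<otimes> y \<in> K" using y top by auto
        then show ?thesis using FK[OF x, of "inv x \<otimes> y"] x by (simp add: m_assoc[symmetric])
      qed
      ultimately show "\<exists>U. openin T U \<and> x \<in> U \<and> (\<forall>y\<in>U. F y = F x)" by blast
    qed
    moreover obtain C where C: "compactin T C" "\<forall>x\<in>carrier G - C. p x = 0" using cindD(4)[OF p] by blast
    moreover have "F g = 0" if g: "g \<in> carrier G" "p g = 0" for g
    proof
      fix h
      have "p h = 0" if h: "h \<in> carrier G" "inv g \<otimes> h \<in> K"
        using cindD(3)[OF p g(1) h(2)] g h \<rho>D(9) KD(9)[OF h(2)] by (simp add: m_assoc[symmetric])
      then show "F g h = 0 h" by (auto simp: F_def W'_apply(4)[OF \<xi>])
    qed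
    ultimately show ?thesis unfolding cc_def by blast
  qed
  have inner: "act \<sigma> g (spread \<sigma> \<xi> u (p g)) = integral (F g)" if g: "g \<in> carrier G" for g
  proof -
    note pg = cindD(2)[OF p g]
    let ?H = "\<lambda>h. if h \<in> K then act \<sigma> h (\<xi> (act \<rho> (inv h) (p g)) *\<^sub>C u) else 0"
    have Hm: "?H h \<in> carrier \<sigma>" for h
      using R(2)[OF KG] complex_vector.subspace_scale[OF R(1) u] complex_vector.subspace_0[OF R(1)] by simp
    have "act \<sigma> g (spread \<sigma> \<xi> u (p g)) = integral (\<lambda>h. act \<sigma> g (?H h))"
      unfolding spread_apply[OF pg]
      by (rule integral_clinear[OF spread_cc[OF \<sigma> \<xi> u pg] Hm R(1) clinear_on_act[OF smooth_repD(1)[OF \<sigma>] g], symmetric])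
    also have "\<dots> = integral (\<lambda>h. F g (g \<otimes> h))"
    proof (rule integral_cong)
      fix h assume h: "h \<in> carrier G"
      have gh: "inv g \<otimes> (g \<otimes> h) = h" using g h by (simp add: m_assoc[symmetric])
      show "act \<sigma> g (?H h) = F g (g \<otimes> h)"
      proof (cases "h \<in> K")
        case True
        have "act \<sigma> g (act \<sigma> h (c *\<^sub>C u)) = c *\<^sub>C act \<sigma> (g \<otimes> h) u" for c
          using R(4)[OF h u] R(4)[OF g R(2)[OF h u]] R(6)[OF g h u] by simp
        then show ?thesis using True g h gh cindD(3)[OF p g True] by (simp add: F_def)
      qed (use gh representation_act_zero[OF smooth_repD(1)[OF \<sigma>] g] in \<open>simp add: F_def\<close>)
    qed
    also have "\<dots> = integral (F g)" by (rule integral_translate[OF Fg[OF g] g])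
    finally show ?thesis .
  qed
  have "frob \<sigma> (spread \<sigma> \<xi> u) p = integral (\<lambda>g. integral (F g))"
    using p inner by (auto simp: frob_def intro: integral_cong)
  also have "\<dots> = integral (\<lambda>h. integral (\<lambda>g. F g h))" by (rule integral_swap[OF Fcc Fg])
  also have "\<dots> = integral (\<lambda>h. complex_of_real (measure M K) *\<^sub>C ?f h)"
  proof (rule integral_cong)
    fix h assume h: "h \<in> carrier G"
    have "integral (\<lambda>g. F g h) = integral (\<lambda>g. if inv g \<otimes> h \<in> K then ?f h else 0)" by (simp add: F_def h)
    then show "integral (\<lambda>g. F g h) = complex_of_real (measure M K) *\<^sub>C ?f h"
      using integral_coset[OF K h, of "?f h"] by (simp only: scaleR_scaleC)
  qed
  also have "\<dots> = measure M K *\<^sub>R integral ?f" by (simp only: integral_scale[OF f] scaleR_scaleC)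
  finally show "frob \<sigma> (spread \<sigma> \<xi> u) p = measure M K *\<^sub>R integral ?f" .
qed

lemma smooth_dualD:
  assumes "\<xi> \<in> carrier (smooth_dual G T \<pi>)"
  shows "\<xi> \<in> lin_maps (carrier \<pi>) UNIV" "openin T (stabilizer G (dual_rep G \<pi>) \<xi>)"
  using assms by (auto simp: smooth_dual_def dual_rep_def)

text \<open>Expanding the values of \<open>p\<close> in a basis of \<open>W\<close> writes the
  nonzero number \<open>\<xi> (frob \<pi> \<phi> p)\<close> as the integral of finitely many matrix
  coefficients with fixed weights \<open>c j\<close>. If \<open>a\<close> killed
  Hom_K(\<rho>,\<sigma>), the integral of \<open>c j\<close> against the coefficient of
  \<open>w j\<close> and \<open>\<zeta> j\<close> would vanish for every \<open>j\<close>, although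
  the \<open>w j\<close> are unrelated to one another, because \<open>spread\<close> makes a
  \<open>K\<close>-map out of each of them. Closeness of the coefficients where the weights are
  nonzero rules this out.\<close>

lemma annihilator_fell_open:
  fixes \<pi> :: "('g, 'v::complex_vector) rep"
  assumes \<pi>: "smooth_rep G T \<pi>" and \<phi>: "\<phi> \<in> hom_on K \<rho> \<pi>" and a: "a \<in> carrier \<H>" "a \<odot>\<^bsub>\<N> \<pi>\<^esub> \<phi> \<noteq> 0"
  shows "\<exists>(n::nat) v \<xi> C e. (\<forall>j<n. v j \<in> carrier \<pi> \<and> \<xi> j \<in> carrier (smooth_dual G T \<pi>)) \<and> compactin T C \<and> e > 0 \<and>
    (\<forall>\<sigma> :: ('g, 'u::complex_vector) rep. \<forall>w \<zeta>. smooth_rep G T \<sigma> \<longrightarrow>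
       (\<forall>j<n. w j \<in> carrier \<sigma> \<and> \<zeta> j \<in> carrier (smooth_dual G T \<sigma>)) \<longrightarrow>
       (\<forall>j<n. \<forall>g\<in>C. cmod (\<xi> j (act \<pi> g (v j)) - \<zeta> j (act \<sigma> g (w j))) < e) \<longrightarrow>
       (\<exists>\<psi>\<in>hom_on K \<rho> \<sigma>. a \<odot>\<^bsub>\<N> \<sigma>\<^esub> \<psi> \<noteq> 0))"
proof -
  note R = representationD[OF smooth_repD(1)[OF \<pi>]]
  obtain w0 where "frob \<pi> \<phi> (hecke_hom a w0) \<noteq> 0"
    using a(2) unfolding inv_smult[OF \<pi> \<phi> a(1)] by (auto simp: fun_eq_iff)
  moreover define p where "p = hecke_hom a w0"
  ultimately have fp: "frob \<pi> \<phi> p \<noteq> 0" by simp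
  have p: "p \<in> carrier cind" unfolding p_def by (rule hecke_hom_mem[OF a(1)])
  obtain \<xi> where \<xi>: "\<xi> \<in> carrier (smooth_dual G T \<pi>)" "\<xi> (frob \<pi> \<phi> p) \<noteq> 0"
    using smooth_dual_separates[OF K \<pi> intertwiners_mem[OF frob_intertwiner[OF \<pi> \<phi>] p] fp] by metis
  note \<xi>lin = smooth_dualD(1)[OF \<xi>(1)]
  obtain B and coord :: "'w \<Rightarrow> 'w \<Rightarrow> complex" where B: "finite B" "B \<subseteq> W"
    "\<And>b. b \<in> B \<Longrightarrow> coord b \<in> W'" "\<And>v. v \<in> W \<Longrightarrow> (\<Sum>b\<in>B. coord b v *\<^sub>C b) = v"
    by (rule W'_mem_cspan) (rule that)
  obtain b where b: "bij_betw b {..<card B} B"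
    using ex_bij_betw_nat_finite[OF B(1)] by (auto simp: atLeast0LessThan)
  let ?n = "card B"
  define c where "c j g = coord (b j) (p g)" for j g
  have bj: "b j \<in> B" if "j < ?n" for j using b that by (auto simp: bij_betw_def)
  have bW: "b j \<in> W" if "j < ?n" for j using bj[OF that] B(2) by blast
  have ccc: "cc (c j)" if "j < ?n" for j
    unfolding c_def by (rule cc_comp[where H = "coord (b j)", OF cindD(5)[OF p] W'_apply(4)[OF B(3)[OF bj[OF that]]]])
  obtain C where C: "compactin T C" "\<And>x. x \<in> carrier G \<Longrightarrow> x \<notin> C \<Longrightarrow> p x = 0" using cindD(4)[OF p] by blast
  have c0: "c j g = 0" if "j < ?n" "g \<notin> C" for j g
    using C(2)[of g] cindD(1)[OF p, of g] that W'_apply(4)[OF B(3)[OF bj[OF that(1)]]] by (cases "g \<in> carrier G") (auto simp: c_def)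
  have CG: "g \<in> carrier G" if "g \<in> C" for g using compactin_subset_topspace[OF C(1)] that top by blast
  let ?v = "\<lambda>j. \<phi> (b j)"
  have v: "?v j \<in> carrier \<pi>" if "j < ?n" for j by (rule intertwiners_mem[OF \<phi> bW[OF that]])
  have F: "cc (\<lambda>g. c j g * \<xi> (act \<pi> g (?v j)))" if j: "j < ?n" for j
    by (rule cc_bind[OF ccc[OF j], where F = "\<lambda>g y. y * \<xi> (act \<pi> g (?v j))" and S = UNIV])
      (auto intro: locally_constant_comp smooth_act_locally_constant[OF topological \<pi> v[OF j]])
  have "\<xi> (frob \<pi> \<phi> p) = integral (\<lambda>g. \<xi> (act \<pi> g (\<phi> (p g))))"
    using p R(2) intertwiners_mem[OF \<phi>] cindD(2)[OF p]
      integral_clinear[OF frob_cc[OF \<pi> \<phi> p] _ R(1) clinear_on_lin_maps[OF \<xi>lin]] by (simp add: frob_def)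
  also have "\<dots> = integral (\<lambda>g. \<Sum>j<?n. c j g * \<xi> (act \<pi> g (?v j)))"
  proof (rule integral_cong)
    fix g assume g: "g \<in> carrier G"
    have "\<phi> (p g) = \<phi> (\<Sum>x\<in>B. coord x (p g) *\<^sub>C x)" using B(4)[OF cindD(2)[OF p g]] by simp
    also have "(\<Sum>x\<in>B. coord x (p g) *\<^sub>C x) = (\<Sum>j<?n. c j g *\<^sub>C b j)"
      unfolding c_def by (rule sum.reindex_bij_betw[OF b, symmetric])
    also have "\<phi> \<dots> = (\<Sum>j<?n. c j g *\<^sub>C ?v j)"
      using bW by (subst lin_maps_sum[OF \<rho>D(2) intertwinersD(1)[OF \<phi>]])
        (auto simp: lin_mapsD(4)[OF intertwinersD(1)[OF \<phi>]] complex_vector.subspace_scale[OF \<rho>D(2)])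
    also have "act \<pi> g \<dots> = (\<Sum>j<?n. c j g *\<^sub>C act \<pi> g (?v j))"
      using v R(4)[OF g] by (subst clinear_on_sum[OF R(1) clinear_on_act[OF smooth_repD(1)[OF \<pi>] g]])
        (auto simp: complex_vector.subspace_scale[OF R(1)])
    also have "\<xi> \<dots> = (\<Sum>j<?n. c j g * \<xi> (act \<pi> g (?v j)))"
      using v R(2)[OF g] by (subst lin_maps_sum[OF R(1) \<xi>lin])
        (auto simp: complex_vector.subspace_scale[OF R(1)] lin_mapsD(4)[OF \<xi>lin] scaleC_complex_def)
    finally show "\<xi> (act \<pi> g (\<phi> (p g))) = (\<Sum>j<?n. c j g * \<xi> (act \<pi> g (?v j)))" .
  qed
  finally have int: "\<xi> (frob \<pi> \<phi> p) = integral (\<lambda>g. \<Sum>j<?n. c j g * \<xi> (act \<pi> g (?v j)))" .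
  let ?h = "\<lambda>g. \<Sum>j<?n. cmod (c j g)"
  have h: "cc ?h"
  proof (rule cc_sum)
    show "cc (\<lambda>g. cmod (c j g))" if "j \<in> {..<?n}" for j
      by (rule cc_comp[OF ccc]) (use that in auto)
  qed
  have h0: "0 \<le> integral ?h" by (rule simple_bochner_integral_nonneg) (simp add: sum_nonneg)
  \<comment> \<open>Adding 1 keeps the denominator positive and makes \<open>e\<close> times the
    integral of \<open>?h\<close> strictly smaller than the absolute value of the number to be kept
    away from 0.\<close>
  define e where "e = cmod (\<xi> (frob \<pi> \<phi> p)) / (integral ?h + 1)"
  have e: "e > 0" using \<xi>(2) h0 by (simp add: e_def)
  show ?thesis
  proof (intro exI[of _ ?n] exI[of _ ?v] exI[of _ "\<lambda>j. \<xi>"] exI[of _ C] exI[of _ e] conjI allI impI)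
    fix \<sigma> :: "('g, 'u) rep" and w \<zeta>
    assume \<sigma>: "smooth_rep G T \<sigma>" and wz: "\<forall>j<?n. w j \<in> carrier \<sigma> \<and> \<zeta> j \<in> carrier (smooth_dual G T \<sigma>)"
      and close: "\<forall>j<?n. \<forall>g\<in>C. cmod (\<xi> (act \<pi> g (?v j)) - \<zeta> j (act \<sigma> g (w j))) < e"
    note R' = representationD[OF smooth_repD(1)[OF \<sigma>]]
    show "\<exists>\<psi>\<in>hom_on K \<rho> \<sigma>. a \<odot>\<^bsub>\<N> \<sigma>\<^esub> \<psi> \<noteq> 0"
    proof (rule ccontr)
      assume no: "\<not> ?thesis"
      have F': "cc (\<lambda>g. c j g * \<zeta> j (act \<sigma> g (w j)))" "integral (\<lambda>g. c j g * \<zeta> j (act \<sigma> g (w j))) = 0" if j: "j < ?n" for j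
      proof -
        have wj: "w j \<in> carrier \<sigma>" and \<zeta>j: "\<zeta> j \<in> lin_maps (carrier \<sigma>) UNIV" using wz j smooth_dualD(1) by auto
        let ?\<psi> = "spread \<sigma> (coord (b j)) (w j)"
        have \<psi>: "?\<psi> \<in> hom_on K \<rho> \<sigma>" by (rule spread_hom[OF \<sigma> B(3)[OF bj[OF j]] wj])
        have "a \<odot>\<^bsub>\<N> \<sigma>\<^esub> ?\<psi> = 0" using no \<psi> by blast
        then have "frob \<sigma> ?\<psi> p = 0"
          unfolding inv_smult[OF \<sigma> \<psi> a(1)] p_def by (rule fun_cong[where x = w0, THEN trans]) simp
        moreover note fs = frob_spread[OF \<sigma> B(3)[OF bj[OF j]] wj p]
        ultimately have z: "integral (\<lambda>g. c j g *\<^sub>C act \<sigma> g (w j)) = 0" using KD(7) by (simp add: c_def)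
        have cc: "cc (\<lambda>g. c j g *\<^sub>C act \<sigma> g (w j))" using fs(2) by (simp add: c_def)
        have mem: "c j g *\<^sub>C act \<sigma> g (w j) \<in> carrier \<sigma>" if "g \<in> carrier G" for g
          using R'(2)[OF that wj] by (rule complex_vector.subspace_scale[OF R'(1)])
        have eq: "\<zeta> j (c j g *\<^sub>C act \<sigma> g (w j)) = c j g * \<zeta> j (act \<sigma> g (w j))" if "g \<in> carrier G" for g
          using lin_mapsD(4)[OF \<zeta>j R'(2)[OF that wj]] by (simp add: scaleC_complex_def)
        have \<zeta>0: "\<zeta> j 0 = 0" by (rule lin_maps_zero[OF R'(1) \<zeta>j])
        show "cc (\<lambda>g. c j g * \<zeta> j (act \<sigma> g (w j)))" by (rule cc_cong[OF cc_comp[where H = "\<zeta> j", OF cc \<zeta>0] eq])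
        have "integral (\<lambda>g. c j g * \<zeta> j (act \<sigma> g (w j))) = integral (\<lambda>g. \<zeta> j (c j g *\<^sub>C act \<sigma> g (w j)))"
          by (rule integral_cong) (simp add: eq)
        also have "\<dots> = \<zeta> j (integral (\<lambda>g. c j g *\<^sub>C act \<sigma> g (w j)))"
          by (rule integral_clinear[OF cc mem R'(1) clinear_on_lin_maps[OF \<zeta>j]])
        finally show "integral (\<lambda>g. c j g * \<zeta> j (act \<sigma> g (w j))) = 0" using z \<zeta>0 by simp
      qed
      let ?d = "\<lambda>g. \<Sum>j<?n. c j g * (\<xi> (act \<pi> g (?v j)) - \<zeta> j (act \<sigma> g (w j)))"
      let ?A = "\<lambda>g. \<Sum>j<?n. c j g * \<xi> (act \<pi> g (?v j))"
      let ?Z = "\<lambda>g. \<Sum>j<?n. c j g * \<zeta> j (act \<sigma> g (w j))"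
      have A: "cc ?A" and Z: "cc ?Z" using F F'(1) by (auto intro!: cc_sum)
      have Z0: "integral ?Z = 0" using integral_sum[of "{..<?n}" "\<lambda>j g. c j g * \<zeta> j (act \<sigma> g (w j))"] F' by simp
      have nZ: "cc (\<lambda>g. - ?Z g)" by (rule cc_comp[OF Z]) simp
      have deq: "?d = (\<lambda>g. ?A g + - ?Z g)" by (simp add: fun_eq_iff right_diff_distrib sum_subtractf)
      have d: "cc ?d" unfolding deq by (rule cc_add[OF A nZ])
      have "integral ?d = integral ?A + integral (\<lambda>g. - ?Z g)" unfolding deq by (rule integral_add[OF A nZ])
      also have "integral (\<lambda>g. - ?Z g) = 0"
        using simple_bochner_integral_minus[OF cc_integrable[OF Z]] Z0 by simp
      finally have "integral ?d = \<xi> (frob \<pi> \<phi> p)" using int by simp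
      moreover have "cmod (integral ?d) \<le> e * integral ?h"
      proof (rule integral_norm_le[OF d h])
        fix g
        have "cmod (c j g * (\<xi> (act \<pi> g (?v j)) - \<zeta> j (act \<sigma> g (w j)))) \<le> e * cmod (c j g)" if j: "j < ?n" for j
        proof (cases "g \<in> C")
          case True
          then have "cmod (\<xi> (act \<pi> g (?v j)) - \<zeta> j (act \<sigma> g (w j))) \<le> e" using close j by (auto intro: less_imp_le)
          then show ?thesis unfolding norm_mult by (subst mult.commute) (intro mult_right_mono norm_ge_zero)
        qed (simp add: c0[OF j])
        then show "cmod (?d g) \<le> e * ?h g"
          unfolding sum_distrib_left by (intro sum_norm_le) simp
      qed
      moreover have "e * integral ?h < cmod (\<xi> (frob \<pi> \<phi> p))"
      proof -
        have "e * (integral ?h + 1) = cmod (\<xi> (frob \<pi> \<phi> p))" using h0 by (simp add: e_def)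
        then show ?thesis using e by (simp add: distrib_left)
      qed
      ultimately show False by simp
    qed
  qed (use v \<xi>(1) C(1) e in auto)
qed

end

section \<open>Isolating a representation by an algebra element\<close>

lemma csubspace_apply_vimage:
  fixes Q :: "'v::complex_vector set"
  shows "csubspace Q \<Longrightarrow> csubspace {f :: 'x \<Rightarrow> 'v. f x \<in> Q}"
  by (simp add: complex_vector.subspace_def scaleC_fun_def)

context hecke_setting
begin

text \<open>The algebra acts through a subspace of the finite-dimensional endomorphisms of
  Hom_K(\<rho>,\<pi>), so finitely many elements span its image. Quantifying over the subspaces
  \<open>Q\<close> expresses, vector by vector, membership in a span without mentioning
  coefficients.\<close>

lemma finite_spanning_modulo_annihilator:
  fixes \<pi> :: "('g, 'v::complex_vector) rep"
  assumes \<pi>: "admissible_rep G T \<pi>"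
  obtains S where "finite S" "S \<subseteq> carrier \<H>"
    "\<forall>a\<in>carrier \<H>. \<forall>\<phi>\<in>hom_on K \<rho> \<pi>. \<forall>Q. csubspace Q \<longrightarrow> (\<forall>s\<in>S. s \<odot>\<^bsub>\<N> \<pi>\<^esub> \<phi> \<in> Q) \<longrightarrow> a \<odot>\<^bsub>\<N> \<pi>\<^esub> \<phi> \<in> Q"
proof -
  have sm: "smooth_rep G T \<pi>" using \<pi> by (simp add: admissible_rep_def)
  interpret N: left_module \<H> "\<N> \<pi>" by (rule inv_left_module[OF sm])
  note H = hom_csubspace[OF sm] and fd = hom_finite_dim[OF \<pi>]
  define \<Phi> where "\<Phi> a \<phi> = (if \<phi> \<in> hom_on K \<rho> \<pi> then a \<odot>\<^bsub>\<N> \<pi>\<^esub> \<phi> else 0)" for a \<phi>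
  have "\<Phi> ` carrier \<H> \<subseteq> lin_maps (hom_on K \<rho> \<pi>) (hom_on K \<rho> \<pi>)"
  proof (intro image_subsetI lin_mapsI)
    fix a assume a: "a \<in> carrier \<H>"
    show "\<Phi> a x \<in> hom_on K \<rho> \<pi>" if "x \<in> hom_on K \<rho> \<pi>" for x
      using N.smult_closed[OF a, of x] that by (simp add: \<Phi>_def inv_sel)
    show "\<Phi> a (x + y) = \<Phi> a x + \<Phi> a y" if "x \<in> hom_on K \<rho> \<pi>" "y \<in> hom_on K \<rho> \<pi>" for x y
      using N.smult_r_distr[OF a, of x y] that complex_vector.subspace_add[OF H that] by (simp add: \<Phi>_def inv_sel)
    show "\<Phi> a (c *\<^sub>C x) = c *\<^sub>C \<Phi> a x" if "x \<in> hom_on K \<rho> \<pi>" for c x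
      using inv_smult_scale[OF sm that a] that complex_vector.subspace_scale[OF H that] by (simp add: \<Phi>_def)
  qed (simp add: \<Phi>_def)
  then have "finite_dim (\<Phi> ` carrier \<H>)" by (rule finite_dim_mono[OF finite_dim_lin_maps[OF H fd H fd]])
  then obtain S where S: "finite S" "S \<subseteq> carrier \<H>" "\<Phi> ` carrier \<H> \<subseteq> cspan (\<Phi> ` S)"
    by (rule finite_dim_image_spanned)
  show ?thesis
  proof (rule that[OF S(1,2)], intro ballI allI impI)
    fix a \<phi> Q assume a: "a \<in> carrier \<H>" and \<phi>: "\<phi> \<in> hom_on K \<rho> \<pi>" and Q: "csubspace Q"
      and s: "\<forall>s\<in>S. s \<odot>\<^bsub>\<N> \<pi>\<^esub> \<phi> \<in> Q"
    have "csubspace {f. f \<phi> \<in> Q}" by (rule csubspace_apply_vimage[OF Q])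
    then have "cspan (\<Phi> ` S) \<subseteq> {f. f \<phi> \<in> Q}"
      using s \<phi> by (intro complex_vector.span_minimal) (auto simp: \<Phi>_def)
    then have "\<Phi> a \<phi> \<in> Q" using S(3) a by blast
    then show "a \<odot>\<^bsub>\<N> \<pi>\<^esub> \<phi> \<in> Q" using \<phi> by (simp add: \<Phi>_def)
  qed
qed

text \<open>The coefficients agree exactly and not only up to an error: a nonzero
  \<open>L\<close>-map from the irreducible \<open>E\<close> into \<sigma> is injective and has an
  \<open>L\<close>-equivariant retraction \<open>r\<close>. Pushing \<open>v j\<close> forward and
  pulling \<open>\<xi> j\<close> back along \<open>r\<close> preserves the coefficients on
  \<open>L\<close>.\<close>

lemma isolating_hecke_element:
  fixes \<pi> :: "('g, 'v::complex_vector) rep"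
  assumes lc: "lc_group G T" and \<pi>: "smooth_irrep G T \<pi>" and adm: "admissible_rep G T \<pi>" and ne: "hom_on K \<rho> \<pi> \<noteq> {0}"
    and v: "\<And>j. j < n \<Longrightarrow> v j \<in> carrier \<pi>" and \<xi>: "\<And>j. j < n \<Longrightarrow> \<xi> j \<in> carrier (smooth_dual G T \<pi>)" and C: "compactin T C"
  shows "\<exists>a\<in>carrier \<H>. a \<notin> annihilator \<H> (\<N> \<pi>) \<and>
    (\<forall>\<sigma> :: ('g, 'u::complex_vector) rep. smooth_rep G T \<sigma> \<longrightarrow> a \<notin> annihilator \<H> (\<N> \<sigma>) \<longrightarrow>
      (\<exists>w \<zeta>. (\<forall>j<(n::nat). w j \<in> carrier \<sigma> \<and> \<zeta> j \<in> carrier (smooth_dual G T \<sigma>)) \<and>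
        (\<forall>j<n. \<forall>g\<in>C. \<xi> j (act \<pi> g (v j)) = \<zeta> j (act \<sigma> g (w j)))))"
proof -
  note sm = smooth_irrepD(1)[OF \<pi>]
  note R = representationD[OF smooth_repD(1)[OF sm]]
  obtain n0 where n0: "n0 \<in> hom_on K \<rho> \<pi>" "n0 \<noteq> 0" using ne complex_vector.subspace_0[OF hom_csubspace[OF sm]] by blast
  note F0 = frob_intertwiner[OF sm n0(1)]
  have "\<exists>p\<in>carrier cind. v j = frob \<pi> n0 p" if "j < n" for j
    using v[OF that] frob_onto[OF \<pi> n0] by blast
  then obtain p where p: "\<And>j. j < n \<Longrightarrow> p j \<in> carrier cind" "\<And>j. j < n \<Longrightarrow> v j = frob \<pi> n0 (p j)" by metis
  have "\<exists>D. compactin T D \<and> (\<forall>x\<in>carrier G - D. p j x = 0)" if "j < n" for j by (rule cindD(4)[OF p(1)[OF that]])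
  then obtain Dp where Dp: "\<And>j. j < n \<Longrightarrow> compactin T (Dp j)" "\<And>j x. j < n \<Longrightarrow> x \<in> carrier G - Dp j \<Longrightarrow> p j x = 0" by metis
  obtain S where S: "finite S" "S \<subseteq> carrier \<H>"
    "\<forall>a\<in>carrier \<H>. \<forall>\<phi>\<in>hom_on K \<rho> \<pi>. \<forall>Q. csubspace Q \<longrightarrow> (\<forall>s\<in>S. s \<odot>\<^bsub>\<N> \<pi>\<^esub> \<phi> \<in> Q) \<longrightarrow> a \<odot>\<^bsub>\<N> \<pi>\<^esub> \<phi> \<in> Q"
    by (rule finite_spanning_modulo_annihilator[OF adm])
  have "\<exists>D. compactin T D \<and> (\<forall>x\<in>carrier G - D. s x = 0)" if "s \<in> S" for s
    using heckeD(3)[of s] S(2) that by (auto simp: cc_def)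
  then obtain Ds where Ds: "\<And>s. s \<in> S \<Longrightarrow> compactin T (Ds s)" "\<And>s x. s \<in> S \<Longrightarrow> x \<in> carrier G - Ds s \<Longrightarrow> s x = 0" by metis
  \<comment> \<open>\<open>L\<close> has to contain the compact set of the neighbourhood,
    \<open>K\<close> itself, the supports of the functions mapped to the \<open>v j\<close>, so that
    \<open>v j\<close> lies in \<open>E\<close>, and the supports of the elements that span the
    algebra modulo the annihilator.\<close>
  have "compactin T (\<Union>(insert C (insert K (Dp ` {..<n} \<union> Ds ` S))))"
    by (rule compactin_Union) (use C KD(2) Dp(1) Ds(1) S(1) in auto)
  then obtain L where L: "compact_open_subgroup G T L" "\<Union>(insert C (insert K (Dp ` {..<n} \<union> Ds ` S))) \<subseteq> L"
    by (rule lc_group_compact_subset[OF lc])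
  note LD = compact_open_subgroupD[OF L(1)]
  have LC: "C \<subseteq> L" and LK: "K \<subseteq> L" and LDp: "\<And>j. j < n \<Longrightarrow> Dp j \<subseteq> L" and LDs: "\<And>s. s \<in> S \<Longrightarrow> Ds s \<subseteq> L"
    using L(2) by auto
  have LG: "g \<in> carrier G" if "g \<in> L" for g using that LD(4) by blast
  \<comment> \<open>The induction of \<open>\<rho>\<close> from \<open>K\<close> to \<open>L\<close>
    only, realized inside \<open>cind\<close>.\<close>
  define PL where "PL = {q \<in> carrier cind. \<forall>x. x \<notin> L \<longrightarrow> q x = 0}"
  have PLsub: "PL \<subseteq> carrier cind" by (auto simp: PL_def)
  have PL: "csubspace PL"
    using cindR(1) unfolding PL_def complex_vector.subspace_def by (auto simp: scaleC_fun_def)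
  have PLact: "act cind g q \<in> PL" if g: "g \<in> L" and q: "q \<in> PL" for g q
  proof -
    have "act cind g q x = 0" if x: "x \<notin> L" for x
    proof (cases "x \<in> carrier G")
      case True
      have "inv g \<otimes> x \<notin> L"
      proof
        assume "inv g \<otimes> x \<in> L"
        then have "g \<otimes> (inv g \<otimes> x) \<in> L" using LD(8) g by blast
        then show False using x True LG[OF g] by (simp add: m_assoc[symmetric])
      qed
      then show ?thesis using q True by (simp add: act_cind PL_def)
    qed (simp add: act_cind)
    then show ?thesis using q cindR(2)[OF LG[OF g]] by (auto simp: PL_def)
  qed
  have unit_PL: "cind_unit w \<in> PL" for w using cind_unit_mem LK by (auto simp: PL_def cind_unit_def)
  have s_PL: "hecke_hom s w \<in> PL" if s: "s \<in> S" for s w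
  proof -
    have sH: "s \<in> carrier \<H>" using s S(2) by blast
    have "hecke_hom s w x = 0" if x: "x \<notin> L" for x
    proof (cases "w \<in> W \<and> x \<in> carrier G")
      case True
      then have "s x = 0" using Ds(2)[OF s] LDs[OF s] x by blast
      then show ?thesis
        using True hecke_hom_apply[OF sH, of w x] complex_vector.subspace_0[OF \<rho>D(2)] by (intro W_eqI) (auto simp: W'_apply)
    qed (auto simp: hecke_hom_def)
    then show ?thesis using hecke_hom_mem[OF sH] by (auto simp: PL_def)
  qed
  have frob_PL: "frob \<pi> \<phi> q \<in> D"
    if \<phi>: "\<phi> \<in> hom_on K \<rho> \<pi>" and q: "q \<in> PL" and D: "csubspace D" "\<And>g x. g \<in> L \<Longrightarrow> x \<in> D \<Longrightarrow> act \<pi> g x \<in> D" "\<And>w. w \<in> W \<Longrightarrow> \<phi> w \<in> D" for \<phi> q D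
  proof -
    have qc: "q \<in> carrier cind" using q PLsub by blast
    have "act \<pi> g (\<phi> (q g)) \<in> D" if g: "g \<in> carrier G" for g
    proof (cases "g \<in> L")
      case False
      then have "act \<pi> g (\<phi> (q g)) = 0"
        using q g lin_maps_zero[OF \<rho>D(2) intertwinersD(1)[OF \<phi>]] representation_act_zero[OF smooth_repD(1)[OF sm]] by (simp add: PL_def)
      then show ?thesis using complex_vector.subspace_0[OF D(1)] by simp
    qed (use D(2,3) cindD(2)[OF qc g] in blast)
    then show ?thesis using qc by (auto simp: frob_def intro: integral_mem[OF D(1)])
  qed
  define E where "E = frob \<pi> n0 ` PL"
  have Esub: "E \<subseteq> carrier \<pi>" unfolding E_def using PLsub intertwiners_mem[OF F0] by blast
  have E: "csubspace E" unfolding E_def by (rule csubspace_image[OF cindR(1) intertwinersD(1)[OF F0] PL PLsub])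
  have Eact: "act \<pi> g x \<in> E" if g: "g \<in> L" and x: "x \<in> E" for g x
  proof -
    obtain q where q: "q \<in> PL" "x = frob \<pi> n0 q" using x by (auto simp: E_def)
    then have "act \<pi> g x = frob \<pi> n0 (act cind g q)" using intertwinersD(2)[OF F0 LG[OF g]] PLsub by auto
    then show ?thesis using PLact[OF g q(1)] by (simp add: E_def)
  qed
  have n0E: "n0 w \<in> E" if "w \<in> W" for w
    unfolding E_def using frob_unit[OF sm n0(1) that] unit_PL[of w] by (metis imageI)
  have vE: "v j \<in> E" if j: "j < n" for j
  proof -
    have "p j x = 0" if "x \<notin> L" for x
      using Dp(2)[OF j, of x] cindD(1)[OF p(1)[OF j], of x] LDp[OF j] that by blast
    then have "p j \<in> PL" using p(1)[OF j] by (simp add: PL_def)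
    then show ?thesis unfolding E_def p(2)[OF j] by (rule imageI)
  qed
  \<comment> \<open>As \<open>L\<close> contains the supports of elements spanning the algebra modulo the annihilator, every nonzero
    \<open>m\<close> generates \<open>n0\<close> already under \<open>L\<close>; this makes \<open>E\<close> irreducible.\<close>
  have generate: "n0 w \<in> frob \<pi> m ` PL" if m: "m \<in> hom_on K \<rho> \<pi>" "m \<noteq> 0" and w: "w \<in> W" for m w
  proof -
    note Fm = frob_intertwiner[OF sm m(1)]
    have Q: "csubspace (frob \<pi> m ` PL)" by (rule csubspace_image[OF cindR(1) intertwinersD(1)[OF Fm] PL PLsub])
    obtain a where a: "a \<in> carrier \<H>" "a \<odot>\<^bsub>\<N> \<pi>\<^esub> m = n0"
      by (rule simple_module_cyclic[OF inv_simple_module[OF \<pi> ne], of m n0]) (use m n0 in \<open>simp_all add: inv_sel\<close>)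
    have Q': "csubspace {f. f w \<in> frob \<pi> m ` PL}" by (rule csubspace_apply_vimage[OF Q])
    have "a \<odot>\<^bsub>\<N> \<pi>\<^esub> m \<in> {f. f w \<in> frob \<pi> m ` PL}"
    proof (rule S(3)[rule_format, OF a(1) m(1) Q'])
      fix s assume s: "s \<in> S"
      then have "s \<in> carrier \<H>" using S(2) by blast
      then show "s \<odot>\<^bsub>\<N> \<pi>\<^esub> m \<in> {f. f w \<in> frob \<pi> m ` PL}" using s_PL[OF s] by (simp add: inv_smult[OF sm m(1)])
    qed
    then show ?thesis using a(2) by simp
  qed
  let ?E = "\<pi>\<lparr>carrier := E\<rparr>" and ?P = "cind\<lparr>carrier := PL\<rparr>"
  have E_rep: "smooth_on L ?E" by (rule smooth_rep_restrict[OF topological sm LD(1) E Esub Eact])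
  have P_rep: "smooth_on L ?P" by (rule smooth_rep_restrict[OF topological cind_smooth LD(1) PL PLsub PLact])
  \<comment> \<open>Complete reducibility under \<open>L\<close> gives an equivariant projection
    \<open>q\<close> of \<open>E\<close> onto \<open>D\<close>. The composite \<open>m\<close> of
    \<open>q\<close> with \<open>n0\<close> is a nonzero \<open>K\<close>-map, so it generates
    \<open>n0\<close> under \<open>L\<close>. Everything generated by \<open>m\<close> lies in
    \<open>D\<close>, and \<open>n0\<close> generates \<open>E\<close>.\<close>
  have E_irr: "D = E"
    if D: "csubspace D" "D \<subseteq> E" "\<And>g x. g \<in> L \<Longrightarrow> x \<in> D \<Longrightarrow> act \<pi> g x \<in> D" "D \<noteq> {0}" for D
  proof -
    let ?D = "\<pi>\<lparr>carrier := D\<rparr>" and ?i = "\<lambda>x. if x \<in> D then x else 0"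
    have D_rep: "smooth_on L ?D" using D(2) Esub by (intro smooth_rep_restrict[OF topological sm LD(1) D(1) _ D(3)]) auto
    have i: "?i \<in> hom_on L ?D ?E"
      using D(2,3) by (intro intertwinersI lin_mapsI) (auto simp: complex_vector.subspace_add[OF D(1)] complex_vector.subspace_scale[OF D(1)])
    have inj_i: "inj_on ?i (carrier ?D)" by (auto simp: inj_on_def)
    obtain q where q: "q \<in> hom_on L ?E ?D" "\<And>x. x \<in> carrier ?D \<Longrightarrow> q (?i x) = x"
      by (rule hom_on_left_inverse[OF L(1) D_rep E_rep i inj_i]) (rule that)
    have qD: "q x = x" if "x \<in> D" for x using q(2)[of x] that by simp
    have q_lin: "q \<in> lin_maps E D" using intertwinersD(1)[OF q(1)] by simp
    have q_act: "q (act \<pi> g x) = act \<pi> g (q x)" if "g \<in> L" "x \<in> E" for g x using intertwinersD(2)[OF q(1)] that by simp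
    define m where "m w = q (n0 w)" for w
    have m_lin: "m \<in> lin_maps W (carrier \<pi>)"
    proof (rule lin_mapsI)
      show "m w \<in> carrier \<pi>" if "w \<in> W" for w unfolding m_def using lin_mapsD(1)[OF q_lin n0E[OF that]] D(2) Esub by blast
      show "m w = 0" if "w \<notin> W" for w unfolding m_def using hom_outside[OF n0(1) that] lin_maps_zero[OF E q_lin] by simp
      show "m (x + y) = m x + m y" if "x \<in> W" "y \<in> W" for x y
        unfolding m_def using lin_mapsD(3)[OF intertwinersD(1)[OF n0(1)] that] lin_mapsD(3)[OF q_lin n0E n0E] that by simp
      show "m (c *\<^sub>C x) = c *\<^sub>C m x" if "x \<in> W" for c x
        unfolding m_def using lin_mapsD(4)[OF intertwinersD(1)[OF n0(1)] that] lin_mapsD(4)[OF q_lin n0E[OF that]] by simp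
    qed
    have m: "m \<in> hom_on K \<rho> \<pi>"
      using m_lin
    proof (rule intertwinersI)
      fix g x assume g: "g \<in> carrier (G\<lparr>carrier := K\<rparr>)" and x: "x \<in> W"
      then show "m (act \<rho> g x) = act \<pi> g (m x)"
        using intertwinersD(2)[OF n0(1) g x] q_act[OF _ n0E[OF x], of g] LK unfolding m_def by auto
    qed
    have qfrob: "q (frob \<pi> n0 y) = frob \<pi> m y" if y: "y \<in> PL" for y
    proof -
      have yc: "y \<in> carrier cind" using y PLsub by blast
      have out: "y g = 0" if "g \<notin> L" for g using that y by (simp add: PL_def)
      have z: "n0 0 = 0" "m 0 = 0" "q 0 = 0"
        using lin_maps_zero[OF \<rho>D(2) intertwinersD(1)[OF n0(1)]] lin_maps_zero[OF \<rho>D(2) m_lin] lin_maps_zero[OF E q_lin] by auto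
      have mem: "act \<pi> g (n0 (y g)) \<in> E" if g: "g \<in> carrier G" for g
        using Eact n0E[OF cindD(2)[OF yc g]] out[of g] z(1) representation_act_zero[OF smooth_repD(1)[OF sm] g]
          complex_vector.subspace_0[OF E] by (cases "g \<in> L") auto
      have "q (frob \<pi> n0 y) = integral (\<lambda>g. q (act \<pi> g (n0 (y g))))"
        using yc integral_clinear[OF frob_cc[OF sm n0(1) yc] mem E clinear_on_lin_maps[OF q_lin]] by (simp add: frob_def)
      also have "\<dots> = integral (\<lambda>g. act \<pi> g (m (y g)))"
      proof (rule integral_cong)
        fix g assume g: "g \<in> carrier G"
        show "q (act \<pi> g (n0 (y g))) = act \<pi> g (m (y g))"
          using q_act[OF _ n0E[OF cindD(2)[OF yc g]], of g] out[of g] z representation_act_zero[OF smooth_repD(1)[OF sm] g]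
          by (cases "g \<in> L") (auto simp: m_def)
      qed
      finally show ?thesis using yc by (simp add: frob_def)
    qed
    have "m \<noteq> 0"
    proof
      assume m0: "m = 0"
      obtain x where x: "x \<in> D" "x \<noteq> 0" using D(4) complex_vector.subspace_0[OF D(1)] by blast
      then obtain y where y: "y \<in> PL" "x = frob \<pi> n0 y" using D(2) by (auto simp: E_def)
      then have "x = frob \<pi> m y" using qfrob qD[OF x(1)] by simp
      also have "\<dots> = integral (\<lambda>g. 0)"
        using y(1) PLsub representation_act_zero[OF smooth_repD(1)[OF sm]] by (auto simp: frob_def m0 intro!: integral_cong)
      finally show False using x(2) by (simp add: integral_zero)
    qed
    have "n0 w \<in> D" if w: "w \<in> W" for w
    proof -
      obtain y where "y \<in> PL" "n0 w = frob \<pi> m y" using generate[OF m \<open>m \<noteq> 0\<close> w] by blast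
      then have "n0 w = q (frob \<pi> n0 y)" "frob \<pi> n0 y \<in> E" using qfrob by (auto simp: E_def)
      then show ?thesis using lin_mapsD(1)[OF q_lin] by simp
    qed
    then have "E \<subseteq> D" using frob_PL[OF n0(1) _ D(1,3)] by (auto simp: E_def)
    then show ?thesis using D(2) by blast
  qed
  let ?\<theta> = "\<lambda>q. if q \<in> PL then frob \<pi> n0 q else 0"
  have \<theta>: "?\<theta> \<in> hom_on L ?P ?E"
  proof (intro intertwinersI lin_mapsI)
    fix g x assume "g \<in> carrier (G\<lparr>carrier := L\<rparr>)" "x \<in> carrier ?P"
    then show "?\<theta> (act ?P g x) = act ?E g (?\<theta> x)"
      using PLsub PLact intertwinersD(2)[OF F0, of g x] LG by auto
  qed (use lin_mapsD(3)[OF intertwinersD(1)[OF F0] subsetD[OF PLsub] subsetD[OF PLsub]] lin_mapsD(4)[OF intertwinersD(1)[OF F0] subsetD[OF PLsub]]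
        in \<open>auto simp: E_def complex_vector.subspace_add[OF PL] complex_vector.subspace_scale[OF PL]\<close>)
  obtain s where s: "s \<in> hom_on L ?E ?P" "\<And>y. y \<in> carrier ?E \<Longrightarrow> ?\<theta> (s y) = y"
    by (rule hom_on_right_inverse[OF L(1) P_rep E_rep \<theta>]) (auto simp: E_def intro: that)
  have s_lin: "s \<in> lin_maps E PL" using intertwinersD(1)[OF s(1)] by simp
  have s_act: "s (act \<pi> g x) = act cind g (s x)" if "g \<in> L" "x \<in> E" for g x using intertwinersD(2)[OF s(1)] that by simp
  have sE: "s x \<in> PL" "s x \<in> carrier cind" "frob \<pi> n0 (s x) = x" if "x \<in> E" for x
    using lin_mapsD(1)[OF s_lin that] PLsub s(2)[of x] that by auto
  \<comment> \<open>The isolating element is an \<open>L\<close>-equivariant section over \<open>E\<close> of \<open>frob \<pi> n0\<close>, restricted to \<open>\<rho>\<close>.\<close>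
  define \<kappa> where "\<kappa> w = s (n0 w)" for w
  have \<kappa>: "\<kappa> \<in> hom_on K \<rho> cind"
  proof (intro intertwinersI lin_mapsI)
    note lin0 = intertwinersD(1)[OF n0(1)]
    show "\<kappa> w \<in> carrier cind" if "w \<in> W" for w unfolding \<kappa>_def by (rule sE(2)[OF n0E[OF that]])
    show "\<kappa> w = 0" if "w \<notin> W" for w unfolding \<kappa>_def using hom_outside[OF n0(1) that] lin_maps_zero[OF E s_lin] by simp
    show "\<kappa> (x + y) = \<kappa> x + \<kappa> y" if "x \<in> W" "y \<in> W" for x y
      unfolding \<kappa>_def using lin_mapsD(3)[OF lin0 that] lin_mapsD(3)[OF s_lin n0E n0E] that by simp
    show "\<kappa> (c *\<^sub>C x) = c *\<^sub>C \<kappa> x" if "x \<in> W" for c x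
      unfolding \<kappa>_def using lin_mapsD(4)[OF lin0 that] lin_mapsD(4)[OF s_lin n0E[OF that]] by simp
    show "\<kappa> (act \<rho> g x) = act cind g (\<kappa> x)" if g: "g \<in> carrier (G\<lparr>carrier := K\<rparr>)" and x: "x \<in> W" for g x
      using intertwinersD(2)[OF n0(1) g x] s_act[OF _ n0E[OF x], of g] LK g unfolding \<kappa>_def by auto
  qed
  define a where "a = hom_hecke \<kappa>"
  have a: "a \<in> carrier \<H>" unfolding a_def by (rule hom_hecke_mem[OF \<kappa>])
  have ha: "hecke_hom a w = s (n0 w)" for w unfolding a_def hecke_hom_inverse[OF \<kappa>] \<kappa>_def ..
  have n00: "n0 w = 0" if "w \<notin> W" for w by (rule hom_outside[OF n0(1) that])
  have "a \<odot>\<^bsub>\<N> \<pi>\<^esub> n0 = n0"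
  proof
    fix w
    show "(a \<odot>\<^bsub>\<N> \<pi>\<^esub> n0) w = n0 w"
      unfolding inv_smult[OF sm n0(1) a] ha
      using sE(3)[OF n0E] n00 sE(3)[OF complex_vector.subspace_0[OF E]] by (cases "w \<in> W") auto
  qed
  then have notin: "a \<notin> annihilator \<H> (\<N> \<pi>)" using n0 by (auto simp: annihilator_def inv_sel)
  show ?thesis
  proof (intro bexI[OF _ a] conjI notin allI impI)
    fix \<sigma> :: "('g, 'u) rep" assume \<sigma>: "smooth_rep G T \<sigma>" and "a \<notin> annihilator \<H> (\<N> \<sigma>)"
    then obtain \<phi> where \<phi>: "\<phi> \<in> hom_on K \<rho> \<sigma>" "a \<odot>\<^bsub>\<N> \<sigma>\<^esub> \<phi> \<noteq> 0" using a by (auto simp: annihilator_def inv_sel)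
    note R' = representationD[OF smooth_repD(1)[OF \<sigma>]]
    note F\<phi> = frob_intertwiner[OF \<sigma> \<phi>(1)]
    note lin\<phi> = intertwinersD(1)[OF F\<phi>]
    have \<sigma>L: "smooth_on L \<sigma>" by (rule smooth_on_restrict[OF \<sigma> L(1)])
    \<comment> \<open>Composed with \<open>n0\<close>, this is the result of \<open>a\<close> acting
      on \<open>\<phi>\<close>, hence nonzero; so its kernel is an \<open>L\<close>-stable proper
      subspace of \<open>E\<close>, which is 0.\<close>
    define \<psi> where "\<psi> x = (if x \<in> E then frob \<sigma> \<phi> (s x) else 0)" for x
    have \<psi>: "\<psi> \<in> hom_on L ?E \<sigma>"
    proof (intro intertwinersI lin_mapsI)
      fix g x assume "g \<in> carrier (G\<lparr>carrier := L\<rparr>)" "x \<in> carrier ?E"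
      then show "\<psi> (act ?E g x) = act \<sigma> g (\<psi> x)"
        using Eact s_act intertwinersD(2)[OF F\<phi> LG sE(2)] by (simp add: \<psi>_def)
    qed (use lin_mapsD(3,4)[OF s_lin] lin_mapsD(3,4)[OF lin\<phi>] sE(2) intertwiners_mem[OF F\<phi>]
        in \<open>auto simp: \<psi>_def complex_vector.subspace_add[OF E] complex_vector.subspace_scale[OF E]\<close>)
    have \<psi>_lin: "\<psi> \<in> lin_maps E (carrier \<sigma>)" using intertwinersD(1)[OF \<psi>] by simp
    have \<psi>_act: "\<psi> (act \<pi> g x) = act \<sigma> g (\<psi> x)" if "g \<in> L" "x \<in> E" for g x using intertwinersD(2)[OF \<psi>] that by simp
    obtain w1 where w1: "frob \<sigma> \<phi> (s (n0 w1)) \<noteq> 0"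
      using \<phi>(2) unfolding inv_smult[OF \<sigma> \<phi>(1) a] ha by (auto simp: fun_eq_iff)
    have "w1 \<in> W"
      using w1 n00[of w1] lin_maps_zero[OF E s_lin] frob_zero[OF \<sigma> \<phi>(1)] by (metis)
    then have \<psi>w1: "\<psi> (n0 w1) \<noteq> 0" "n0 w1 \<in> E" using w1 n0E by (auto simp: \<psi>_def)
    let ?D = "{x \<in> E. \<psi> x = 0}"
    have "?D = {0}"
    proof (rule ccontr)
      assume "?D \<noteq> {0}"
      then have "?D = E"
        using Eact \<psi>_act representation_act_zero[OF smooth_repD(1)[OF \<sigma>] LG]
        by (intro E_irr[OF csubspace_kernel[OF E \<psi>_lin]]) auto
      then show False using \<psi>w1 by blast
    qed
    have inj: "inj_on \<psi> (carrier ?E)"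
    proof (rule inj_onI)
      fix x y assume "x \<in> carrier ?E" "y \<in> carrier ?E" and eq: "\<psi> x = \<psi> y"
      then have xy: "x \<in> E" "y \<in> E" by auto
      then have "x - y \<in> ?D" using eq by (simp add: complex_vector.subspace_diff[OF E] lin_maps_diff[OF E \<psi>_lin])
      then show "x = y" using \<open>?D = {0}\<close> by simp
    qed
    obtain r where r: "r \<in> hom_on L \<sigma> ?E" "\<And>x. x \<in> carrier ?E \<Longrightarrow> r (\<psi> x) = x"
      by (rule hom_on_left_inverse[OF L(1) E_rep \<sigma>L \<psi> inj]) (rule that)
    have r_lin: "r \<in> lin_maps (carrier \<sigma>) E" using intertwinersD(1)[OF r(1)] by simp
    have r_act: "r (act \<sigma> g x) = act \<pi> g (r x)" if "g \<in> L" "x \<in> carrier \<sigma>" for g x using intertwinersD(2)[OF r(1)] that by simp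
    show "\<exists>w \<zeta>. (\<forall>j<n. w j \<in> carrier \<sigma> \<and> \<zeta> j \<in> carrier (smooth_dual G T \<sigma>)) \<and>
        (\<forall>j<n. \<forall>g\<in>C. \<xi> j (act \<pi> g (v j)) = \<zeta> j (act \<sigma> g (w j)))"
    proof (intro exI[of _ "\<lambda>j. \<psi> (v j)"] exI[of _ "\<lambda>j x. \<xi> j (r x)"] conjI allI impI ballI)
      fix j assume j: "j < n"
      note \<xi>lin = smooth_dualD(1)[OF \<xi>[OF j]]
      show "\<psi> (v j) \<in> carrier \<sigma>" by (rule lin_mapsD(1)[OF \<psi>_lin vE[OF j]])
      have \<xi>E: "(\<lambda>x. \<xi> j (r x)) \<in> lin_maps (carrier \<sigma>) UNIV"
        using lin_mapsD[OF r_lin] Esub lin_mapsD(3)[OF \<xi>lin subsetD[OF Esub] subsetD[OF Esub]] lin_mapsD(4)[OF \<xi>lin subsetD[OF Esub]]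
          lin_maps_zero[OF R(1) \<xi>lin]
        by (intro lin_mapsI) auto
      \<comment> \<open>\<open>r\<close> commutes with \<open>L\<close> only, so smoothness of the
        new functional is read off from the part of the stabilizer of \<open>\<xi> j\<close> inside
        \<open>L\<close>.\<close>
      let ?U = "L \<inter> stabilizer G (dual_rep G \<pi>) (\<xi> j)"
      have U: "openin T ?U" by (rule openin_Int[OF LD(3) smooth_dualD(2)[OF \<xi>[OF j]]])
      have \<xi>dual: "\<xi> j \<in> carrier (dual_rep G \<pi>)" using \<xi>lin by (simp add: dual_rep_def)
      have one: "\<one> \<in> ?U"
        using LD(5) representationD(5)[OF dual_rep_representation[OF smooth_repD(1)[OF sm] is_group] \<xi>dual] by (simp add: stabilizer_def)
      show "(\<lambda>x. \<xi> j (r x)) \<in> carrier (smooth_dual G T \<sigma>)"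
      proof (rule smooth_dualI[OF topological smooth_repD(1)[OF \<sigma>] \<xi>E U one])
        show "?U \<subseteq> carrier G" using LG by blast
        fix g x assume g: "g \<in> ?U" and x: "x \<in> carrier \<sigma>"
        have gL: "inv g \<in> L" using g LD(9) by blast
        have rx: "r x \<in> carrier \<pi>" using lin_mapsD(1)[OF r_lin x] Esub by blast
        have "act (dual_rep G \<pi>) g (\<xi> j) (r x) = \<xi> j (r x)" using g by (simp add: stabilizer_def)
        then show "\<xi> j (r (act \<sigma> (inv g) x)) = \<xi> j (r x)" using rx by (simp add: r_act[OF gL x] dual_rep_def)
      qed
      show "\<xi> j (act \<pi> g (v j)) = \<xi> j (r (act \<sigma> g (\<psi> (v j))))" if g: "g \<in> C" for g
      proof -
        have gL: "g \<in> L" using g LC by blast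
        have "act \<sigma> g (\<psi> (v j)) = \<psi> (act \<pi> g (v j))" by (rule \<psi>_act[OF gL vE[OF j], symmetric])
        then show ?thesis using r(2)[of "act \<pi> g (v j)"] Eact[OF gL vE[OF j]] by simp
      qed
    qed
  qed
qed

end

section \<open>The homeomorphism\<close>

theorem theorem1p10:
  fixes G :: "('g, 'b) monoid_scheme" and T :: "'g topology" and M :: "'g measure"
    and K :: "'g set" and \<rho> :: "('g, 'w::complex_vector) rep"
  assumes "lc_group G T" and "tame G T" and "haar_measure G T M"
    and "compact_open_subgroup G T K"
    and "smooth_irrep (G\<lparr>carrier := K\<rparr>) (subtopology T K) \<rho>"
  shows "homeomorphic_map
    (subtopology (fell_topology G T) (reps_containing G T K \<rho>))
    (jacobson_topology (hecke_algebra G T M K \<rho>))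
    (\<lambda>C. the_elem ((\<lambda>\<pi>. annihilator (hecke_algebra G T M K \<rho>) (rho_invariants G T M K \<rho> \<pi>)) ` C))"
proof -
  interpret hecke_setting G T M K \<rho>
    using assms by unfold_locales (auto simp: lc_group_def)
  let ?V = "reps_containing G T K \<rho>" and ?P = "primitive_ideals \<H>"
  let ?R = "{(\<pi>, \<sigma>) \<in> irreps G T \<times> irreps G T. rep_iso G \<pi> \<sigma>}"
  define f where "f = (\<lambda>C :: ('g, 'g \<Rightarrow> complex) rep set. the_elem ((\<lambda>\<pi>. annihilator \<H> (\<N> \<pi>)) ` C))"
  note eqv = equiv_rep_iso[of G T]
  have irr: "smooth_irrep G T \<pi>" "smooth_rep G T \<pi>" "admissible_rep G T \<pi>" if "\<pi> \<in> irreps G T" for \<pi>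
    using that assms(2) by (auto simp: irreps_def tame_def smooth_irrep_def)
  have class_irreps: "\<pi> \<in> irreps G T" if "C \<in> irrep_classes G T" "\<pi> \<in> C" for C \<pi>
    using that in_quotient_imp_subset[OF eqv] by (auto simp: irrep_classes_def)
  have class_iso: "rep_iso G \<pi> \<sigma>" if "C \<in> irrep_classes G T" "\<pi> \<in> C" "\<sigma> \<in> C" for C \<pi> \<sigma>
    using quotient_eq_iff[OF eqv, of C C \<pi> \<sigma>] that by (auto simp: irrep_classes_def)
  have class_nonempty: "\<exists>\<pi>. \<pi> \<in> C" if "C \<in> irrep_classes G T" for C
    using in_quotient_imp_non_empty[OF eqv] that by (auto simp: irrep_classes_def)
  \<comment> \<open>Isomorphic representations have the same annihilator, so the image of a class is
    a singleton and \<open>the_elem\<close> is meaningful.\<close>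
  have f: "f C = annihilator \<H> (\<N> \<pi>)" if C: "C \<in> irrep_classes G T" "\<pi> \<in> C" for C \<pi>
  proof -
    have "annihilator \<H> (\<N> \<sigma>) = annihilator \<H> (\<N> \<pi>)" if "\<sigma> \<in> C" for \<sigma>
      by (rule rep_iso_annihilator(1)[OF irr(2)[OF class_irreps[OF C(1) that]] irr(2)[OF class_irreps[OF C]] class_iso[OF C(1) that C(2)]])
    then have "(\<lambda>\<pi>. annihilator \<H> (\<N> \<pi>)) ` C = (\<lambda>_. annihilator \<H> (\<N> \<pi>)) ` C" by (rule image_cong[OF refl])
    also have "\<dots> = {annihilator \<H> (\<N> \<pi>)}" using C(2) by (metis empty_iff image_constant)
    finally have "(\<lambda>\<pi>. annihilator \<H> (\<N> \<pi>)) ` C = {annihilator \<H> (\<N> \<pi>)}" .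
    then show ?thesis by (simp add: f_def)
  qed
  have VI: "C \<in> ?V \<longleftrightarrow> hom_on K \<rho> \<pi> \<noteq> {0}" if C: "C \<in> irrep_classes G T" "\<pi> \<in> C" for C \<pi>
  proof -
    have "hom_on K \<sigma> \<rho> \<noteq> {0} \<longleftrightarrow> hom_on K \<rho> \<pi> \<noteq> {0}" if \<sigma>: "\<sigma> \<in> C" for \<sigma>
    proof -
      note s = irr(2)[OF class_irreps[OF C(1) \<sigma>]]
      show ?thesis
        using hom_to_from[OF s] rep_iso_annihilator(2)[OF s irr(2)[OF class_irreps[OF C]] class_iso[OF C(1) \<sigma> C(2)]] by simp
    qed
    then show ?thesis using C by (auto simp: reps_containing_def)
  qed
  have V_class: "C \<in> irrep_classes G T" if "C \<in> ?V" for C using that by (simp add: reps_containing_def)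
  have f_prim: "f C \<in> ?P" if C: "C \<in> ?V" for C
  proof -
    obtain \<pi> where \<pi>: "\<pi> \<in> C" using class_nonempty[OF V_class[OF C]] by blast
    show ?thesis
      unfolding f[OF V_class[OF C] \<pi>]
      using annihilator_primitive[OF inv_simple_module[OF irr(1)[OF class_irreps[OF V_class[OF C] \<pi>]]]]
        VI[OF V_class[OF C] \<pi>] C by simp
  qed
  have f_surj: "I \<in> f ` ?V" if I: "I \<in> ?P" for I
  proof -
    obtain \<pi> :: "('g, 'g \<Rightarrow> 'w) rep" where \<pi>: "smooth_irrep G T \<pi>" "hom_on K \<rho> \<pi> \<noteq> {0}" "annihilator \<H> (\<N> \<pi>) = I"
      by (rule primitive_ideal_irreducible[OF I])
    \<comment> \<open>The representation attached to \<open>I\<close> lives on functions with values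
      in the type of \<open>\<rho>\<close>; an isomorphic copy is needed in the type on which the
      classes are formed.\<close>
    obtain \<sigma> where \<sigma>: "\<sigma> \<in> irreps G T" "rep_iso G \<pi> \<sigma>" using smooth_irrep_universe[OF is_group \<pi>(1)] by blast
    let ?C = "?R `` {\<sigma>}"
    have C: "?C \<in> irrep_classes G T" "\<sigma> \<in> ?C"
      using \<sigma>(1) equiv_class_self[OF eqv] by (auto simp: irrep_classes_def quotient_def)
    note A = rep_iso_annihilator[OF smooth_irrepD(1)[OF \<pi>(1)] irr(2)[OF \<sigma>(1)] \<sigma>(2)]
    have "?C \<in> ?V" using VI[OF C] A(2) \<pi>(2) by simp
    moreover have "f ?C = I" using f[OF C] A(1) \<pi>(3) by simp
    ultimately show ?thesis by blast
  qed
  have f_inj: "inj_on f ?V"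
  proof (rule inj_onI)
    fix C C' assume C: "C \<in> ?V" and C': "C' \<in> ?V" and eq: "f C = f C'"
    obtain \<pi> where \<pi>: "\<pi> \<in> C" using class_nonempty[OF V_class[OF C]] by blast
    obtain \<sigma> where \<sigma>: "\<sigma> \<in> C'" using class_nonempty[OF V_class[OF C']] by blast
    note \<pi>i = class_irreps[OF V_class[OF C] \<pi>] and \<sigma>i = class_irreps[OF V_class[OF C'] \<sigma>]
    have "annihilator \<H> (\<N> \<pi>) = annihilator \<H> (\<N> \<sigma>)" using eq f[OF V_class[OF C] \<pi>] f[OF V_class[OF C'] \<sigma>] by simp
    then have "rep_iso G \<pi> \<sigma>"
      using VI[OF V_class[OF C'] \<sigma>] C' by (intro annihilator_le_iso[OF irr(1)[OF \<pi>i] irr(3)[OF \<pi>i] irr(1)[OF \<sigma>i]]) simp_all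
    then show "C = C'"
      using quotient_eq_iff[OF eqv, of C C' \<pi> \<sigma>] V_class[OF C] V_class[OF C'] \<pi> \<sigma> \<pi>i \<sigma>i by (simp add: irrep_classes_def)
  qed
  have top_V: "topspace (subtopology (fell_topology G T) ?V) = ?V"
    using V_class by (auto simp: topspace_fell)
  have cont: "continuous_map (subtopology (fell_topology G T) ?V) (jacobson_topology \<H>) f"
    unfolding continuous_map_def top_V topspace_jacobson
  proof (intro conjI allI impI)
    show "f \<in> ?V \<rightarrow> ?P" using f_prim by blast
    fix U assume "openin (jacobson_topology \<H>) U"
    then have U: "U \<subseteq> ?P" "hull_kernel \<H> (?P - U) = ?P - U" by (simp_all add: openin_jacobson)
    let ?Z = "{C \<in> ?V. f C \<in> U}"
    have "fell_open G T ?Z"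
      unfolding fell_open_def
    proof (intro conjI ballI)
      show "?Z \<subseteq> irrep_classes G T" using V_class by blast
      fix C \<pi> assume C: "C \<in> ?Z" and \<pi>: "\<pi> \<in> C"
      then have CV: "C \<in> ?V" and CU: "f C \<in> U" by auto
      have "f C \<notin> hull_kernel \<H> (?P - U)" using CU U(2) by blast
      then obtain a where a: "a \<in> carrier \<H>" "\<And>I. I \<in> ?P - U \<Longrightarrow> a \<in> I" "a \<notin> f C"
        using CU U(1) by (auto simp: hull_kernel_def)
      then obtain \<phi> where \<phi>: "\<phi> \<in> hom_on K \<rho> \<pi>" "a \<odot>\<^bsub>\<N> \<pi>\<^esub> \<phi> \<noteq> 0"
        unfolding f[OF V_class[OF CV] \<pi>] by (auto simp: annihilator_def inv_sel)
      obtain n v \<xi> B e where nbhd: "\<forall>j<(n::nat). v j \<in> carrier \<pi> \<and> \<xi> j \<in> carrier (smooth_dual G T \<pi>)" "compactin T B" "(e::real) > 0"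
        "\<forall>\<sigma> :: ('g, 'g \<Rightarrow> complex) rep. \<forall>w \<zeta>. smooth_rep G T \<sigma> \<longrightarrow>
           (\<forall>j<n. w j \<in> carrier \<sigma> \<and> \<zeta> j \<in> carrier (smooth_dual G T \<sigma>)) \<longrightarrow>
           (\<forall>j<n. \<forall>g\<in>B. cmod (\<xi> j (act \<pi> g (v j)) - \<zeta> j (act \<sigma> g (w j))) < e) \<longrightarrow>
           (\<exists>\<psi>\<in>hom_on K \<rho> \<sigma>. a \<odot>\<^bsub>\<N> \<sigma>\<^esub> \<psi> \<noteq> 0)"
        using annihilator_fell_open[OF irr(2)[OF class_irreps[OF V_class[OF CV] \<pi>]] \<phi>(1) a(1) \<phi>(2)] by (elim exE conjE)
      \<comment> \<open>A representation near \<open>\<pi>\<close> is not killed by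
        \<open>a\<close>. This has two effects: it contains \<open>\<rho>\<close>, so its class lies
        in \<open>?V\<close>, and its ideal lies in \<open>U\<close>. Hence \<open>?Z\<close> is
        open even in the whole Fell space.\<close>
      have "fell_nbhd G T \<pi> n v \<xi> B e \<subseteq> ?Z"
      proof
        fix D assume "D \<in> fell_nbhd G T \<pi> n v \<xi> B e"
        then obtain \<sigma> w \<zeta> where D: "D \<in> irrep_classes G T" "\<sigma> \<in> D"
          and wz: "\<forall>j<n. w j \<in> carrier \<sigma> \<and> \<zeta> j \<in> carrier (smooth_dual G T \<sigma>)"
            "\<forall>j<n. \<forall>g\<in>B. cmod (\<xi> j (act \<pi> g (v j)) - \<zeta> j (act \<sigma> g (w j))) < e"
          unfolding fell_nbhd_def by blast
        note s = irr(2)[OF class_irreps[OF D]]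
        obtain \<psi> where \<psi>: "\<psi> \<in> hom_on K \<rho> \<sigma>" "a \<odot>\<^bsub>\<N> \<sigma>\<^esub> \<psi> \<noteq> 0"
          using nbhd(4)[rule_format, OF s, of w \<zeta>] wz by blast
        have "a \<odot>\<^bsub>\<N> \<sigma>\<^esub> 0 = 0" using left_module.smult_zero_right[OF inv_left_module[OF s] a(1)] by (simp add: inv_sel)
        then have "\<psi> \<noteq> 0" using \<psi>(2) by auto
        then have DV: "D \<in> ?V" using VI[OF D] \<psi>(1) by blast
        have "a \<notin> f D" unfolding f[OF D] using \<psi> by (auto simp: annihilator_def inv_sel)
        then have "f D \<in> U" using a(2) f_prim[OF DV] by blast
        then show "D \<in> ?Z" using DV by simp
      qed
      then show "\<exists>n v \<xi> B e. (\<forall>j<n. v j \<in> carrier \<pi> \<and> \<xi> j \<in> carrier (smooth_dual G T \<pi>)) \<and>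
          compactin T B \<and> e > 0 \<and> fell_nbhd G T \<pi> n v \<xi> B e \<subseteq> ?Z"
        using nbhd(1-3) by (intro exI conjI)
    qed
    then show "openin (subtopology (fell_topology G T) ?V) ?Z"
      unfolding openin_subtopology openin_fell by blast
  qed
  have opn: "open_map (subtopology (fell_topology G T) ?V) (jacobson_topology \<H>) f"
    unfolding open_map_def
  proof (intro allI impI)
    fix U0 assume "openin (subtopology (fell_topology G T) ?V) U0"
    then obtain U where U: "fell_open G T U" "U0 = U \<inter> ?V" unfolding openin_subtopology openin_fell by blast
    have sub: "f ` U0 \<subseteq> ?P" using f_prim U(2) by auto
    \<comment> \<open>An ideal of the image cannot lie in the hull of the ideals outside it: the
      isolating element \<open>a\<close> avoids that ideal, while any class in \<open>?V\<close>
      whose ideal does not contain \<open>a\<close> has the prescribed coefficients on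
      \<open>B\<close>, hence lies in \<open>U\<close>. So \<open>a\<close> belongs to all ideals
      outside the image.\<close>
    have "hull_kernel \<H> (?P - f ` U0) \<subseteq> ?P - f ` U0"
    proof
      fix I assume I: "I \<in> hull_kernel \<H> (?P - f ` U0)"
      then have IP: "I \<in> ?P" "carrier \<H> \<inter> \<Inter>(?P - f ` U0) \<subseteq> I" by (auto simp: hull_kernel_def)
      have "I \<notin> f ` U0"
      proof
        assume "I \<in> f ` U0"
        then obtain C where C: "C \<in> U" "C \<in> ?V" "I = f C" using U(2) by blast
        obtain \<pi> where \<pi>: "\<pi> \<in> C" using class_nonempty[OF V_class[OF C(2)]] by blast
        note \<pi>i = class_irreps[OF V_class[OF C(2)] \<pi>]
        obtain n v \<xi> B e where nbhd: "\<forall>j<n. v j \<in> carrier \<pi> \<and> \<xi> j \<in> carrier (smooth_dual G T \<pi>)" "compactin T B" "e > 0"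
          "fell_nbhd G T \<pi> n v \<xi> B e \<subseteq> U"
          by (rule fell_openE[OF U(1) C(1) \<pi>])
        have ne: "hom_on K \<rho> \<pi> \<noteq> {0}" using VI[OF V_class[OF C(2)] \<pi>] C(2) by simp
        obtain a where a: "a \<in> carrier \<H>" "a \<notin> annihilator \<H> (\<N> \<pi>)"
          "\<forall>\<sigma> :: ('g, 'g \<Rightarrow> complex) rep. smooth_rep G T \<sigma> \<longrightarrow> a \<notin> annihilator \<H> (\<N> \<sigma>) \<longrightarrow>
            (\<exists>w \<zeta>. (\<forall>j<n. w j \<in> carrier \<sigma> \<and> \<zeta> j \<in> carrier (smooth_dual G T \<sigma>)) \<and>
              (\<forall>j<n. \<forall>g\<in>B. \<xi> j (act \<pi> g (v j)) = \<zeta> j (act \<sigma> g (w j))))"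
          using isolating_hecke_element[OF assms(1) irr(1)[OF \<pi>i] irr(3)[OF \<pi>i] ne _ _ nbhd(2), of n v \<xi>] nbhd(1) by auto
        have "a \<in> I'" if I': "I' \<in> ?P - f ` U0" for I'
        proof (rule ccontr)
          assume aI: "a \<notin> I'"
          obtain D where D: "D \<in> ?V" "I' = f D" using f_surj I' by blast
          obtain \<sigma> where \<sigma>: "\<sigma> \<in> D" using class_nonempty[OF V_class[OF D(1)]] by blast
          note s = irr(2)[OF class_irreps[OF V_class[OF D(1)] \<sigma>]]
          have "a \<notin> annihilator \<H> (\<N> \<sigma>)" using aI D(2) f[OF V_class[OF D(1)] \<sigma>] by simp
          then obtain w \<zeta> where "\<forall>j<n. w j \<in> carrier \<sigma> \<and> \<zeta> j \<in> carrier (smooth_dual G T \<sigma>)"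
            "\<forall>j<n. \<forall>g\<in>B. \<xi> j (act \<pi> g (v j)) = \<zeta> j (act \<sigma> g (w j))"
            using a(3) s by blast
          then have "D \<in> fell_nbhd G T \<pi> n v \<xi> B e"
            unfolding fell_nbhd_def mem_Collect_eq using V_class[OF D(1)] \<sigma> nbhd(3)
            by (intro conjI bexI[of _ \<sigma>] exI[of _ w] exI[of _ \<zeta>]) simp_all
          then have "D \<in> U0" using nbhd(4) D(1) U(2) by blast
          then show False using I' D(2) by blast
        qed
        then have "a \<in> I" using IP(2) a(1) by blast
        then show False using a(2) C(3) f[OF V_class[OF C(2)] \<pi>] by simp
      qed
      then show "I \<in> ?P - f ` U0" using IP(1) by blast
    qed
    then show "openin (jacobson_topology \<H>) (f ` U0)"
      unfolding openin_jacobson using sub hull_kernel_increasing[of "?P - f ` U0" \<H>] by blast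
  qed
  have "homeomorphic_map (subtopology (fell_topology G T) ?V) (jacobson_topology \<H>) f"
  proof (rule bijective_open_imp_homeomorphic_map[OF cont opn])
    show "f ` topspace (subtopology (fell_topology G T) ?V) = topspace (jacobson_topology \<H>)"
      unfolding top_V topspace_jacobson using f_prim f_surj by blast
    show "inj_on f (topspace (subtopology (fell_topology G T) ?V))" unfolding top_V by (rule f_inj)
  qed
  then show ?thesis unfolding f_def .
qed

end
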